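(* Let $A$ be a separable $C^*$-algebra and $n\ge 1$. There is a constant $l\in\mathbb{R}^+$ such that for every $a\in CB^\infty(\mathbb{R}^{2n},A)$ the pseudodifferential operator $a(x,D)$ (defined on $S^A(\mathbb{R}^n)$) is a bounded operator on $E$ (i.e. it extends to a bounded operator on $E$) and $\|a(x,D)\|\le l\,\pi(a)$, where $$\pi(a)=\sup\{\|\partial_x^\beta\partial_\xi^\gamma a\|_\infty \;:\; \beta,\gamma\in\mathbb{N}^n,\ \beta,\gamma\le \alpha=(1,1,\dots,1)\};$$ the constant $l$ is independent of $a$.
   Context: $A$ is a separable $C^*$-algebra. $S^A(\mathbb{R}^n)$ is the space of smooth rapidly decreasing (Schwartz) functions $\mathbb{R}^n\to A$. On it define the $A$-valued inner product $\langle f,g\rangle=\int f(x)^*g(x)\,dx$ and the norm $\|f\|_2=\|\langle f,f\rangle\|_A^{1/2}$. $E$ is the completion of $S^A(\mathbb{R}^n)$ in this norm; it is a (right) Hilbert $A$-module. $CB^\infty(\mathbb{R}^{m},A)$ is the set of $C^\infty$ functions $\mathbb{R}^m\to A$ that are bounded together with all their partial derivatives; $\|\cdot\|_\infty$ is the sup norm. Inequalities of multi-indices are componentwise. For $a\in CB^\infty(\mathbb{R}^{2n},A)$ and $\varphi\in S^A(\mathbb{R}^n)$, $$a(x,D)\varphi(x)=(2\pi)^{-n}\int\!\!\int e^{i(x-y)\cdot\xi}a(x,\xi)\varphi(y)\,dy\,d\xi=(2\pi)^{-n/2}\int e^{ix\cdot\xi}a(x,\xi)\hat\varphi(\xi)\,d\xi,$$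 where the double integral is an oscillatory (iterated) integral and $\hat\varphi(\xi)=(2\pi)^{-n/2}\int e^{-i\xi\cdot y}\varphi(y)\,dy$. For $\varphi\in S^A(\mathbb{R}^n)$ the function $a(x,D)\varphi$ is square-integrable in the sense $\int\|a(x,D)\varphi(x)\|^2dx<\infty$; such (classes of) functions are regarded as elements of $E$, using $\|f\|_2\le(\int\|f(x)\|^2dx)^{1/2}$. *)

theory Defs
  imports "HOL-Analysis.Analysis"
begin

section \<open>Separable C*-algebras\<close>

text \<open>
  Complex C*-algebras, not assumed to be unital or commutative. The classes
  \<open>real_normed_algebra\<close> and \<open>banach\<close> only provide real scalars, so
  the complex scalar multiplication is added here and tied to \<open>scaleR\<close>.
\<close>

class cstar_algebra = real_normed_algebra + banach +
  fixes scaleC :: "complex \<Rightarrow> 'a \<Rightarrow> 'a"  (infixr \<open>*\<^sub>C\<close> 75)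
    and star :: "'a \<Rightarrow> 'a"
  assumes scaleC_add_right: "c *\<^sub>C (x + y) = c *\<^sub>C x + c *\<^sub>C y"
    and scaleC_add_left: "(c + d) *\<^sub>C x = c *\<^sub>C x + d *\<^sub>C x"
    and scaleC_scaleC: "c *\<^sub>C (d *\<^sub>C x) = (c * d) *\<^sub>C x"
    and scaleC_of_real: "complex_of_real r *\<^sub>C x = r *\<^sub>R x"
    and norm_scaleC: "norm (c *\<^sub>C x) = cmod c * norm x"
    and mult_scaleC_left: "(c *\<^sub>C x) * y = c *\<^sub>C (x * y)"
    and mult_scaleC_right: "x * (c *\<^sub>C y) = c *\<^sub>C (x * y)"
    and star_add: "star (x + y) = star x + star y"
    and star_scaleC: "star (c *\<^sub>C x) = cnj c *\<^sub>C star x"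
    and star_mult: "star (x * y) = star y * star x"
    and star_star: "star (star x) = x"
    and cstar_identity: "norm (star x * x) = (norm x)\<^sup>2"

class separable_cstar_algebra = cstar_algebra +
  assumes countable_dense: "\<exists>D::'a set. countable D \<and> (\<forall>U. open U \<longrightarrow> U \<noteq> {} \<longrightarrow> D \<inter> U \<noteq> {})"

text \<open>
  Bochner integration in HOL-Analysis needs a second countable codomain.
\<close>

instance separable_cstar_algebra \<subseteq> second_countable_topology
proof
  obtain D :: "'a set" where D: "countable D" "\<And>U. open U \<Longrightarrow> U \<noteq> {} \<Longrightarrow> D \<inter> U \<noteq> {}"
    using countable_dense by blast
  define B where "B = (\<lambda>(d, k). ball d (1 / real (Suc k))) ` (D \<times> (UNIV :: nat set))"
  have "countable B"
    unfolding B_def using D(1) by auto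
  moreover have "topological_basis B"
  proof (rule topological_basisI)
    fix U assume "U \<in> B"
    then show "open U" by (auto simp: B_def)
  next
    fix U :: "'a set" and x assume "open U" "x \<in> U"
    then obtain e where e: "e > 0" "ball x e \<subseteq> U"
      by (meson openE)
    obtain k where k: "1 / real (Suc k) < e / 2"
      using e(1) nat_approx_posE[of "e / 2"] by auto
    have "D \<inter> ball x (1 / real (Suc k)) \<noteq> {}"
      by (rule D(2)) auto
    then obtain d where d: "d \<in> D" "dist d x < 1 / real (Suc k)"
      by (auto simp: dist_commute)
    have "ball d (1 / real (Suc k)) \<subseteq> ball x e"
    proof
      fix y assume "y \<in> ball d (1 / real (Suc k))"
      then have "dist d y < 1 / real (Suc k)" by simp
      then show "y \<in> ball x e"
        using d(2) k dist_triangle[of x y d] by (simp add: dist_commute)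
    qed
    then show "\<exists>V\<in>B. x \<in> V \<and> V \<subseteq> U"
      using d e(2) unfolding B_def by (intro bexI[of _ "ball d (1 / real (Suc k))"]) auto
  qed
  ultimately show "\<exists>B::'a set set. countable B \<and> open = generate_topology B"
    using topological_basis_imp_subbasis by blast
qed

instantiation complex :: separable_cstar_algebra
begin

definition scaleC_complex :: "complex \<Rightarrow> complex \<Rightarrow> complex" where
  "scaleC_complex c z = c * z"

definition star_complex :: "complex \<Rightarrow> complex" where
  "star_complex z = cnj z"

instance
proof
  show "\<exists>D::complex set. countable D \<and> (\<forall>U. open U \<longrightarrow> U \<noteq> {} \<longrightarrow> D \<inter> U \<noteq> {})"
    using countable_dense_setE[where 'a = complex] by (metis Int_iff empty_iff)
qed (auto simp: scaleC_complex_def star_complex_def algebra_simps scaleR_conv_of_real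
       norm_mult power2_eq_square)

end

section \<open>Smooth functions and multi-index derivatives\<close>

definition partial_deriv :: "'b::real_normed_vector \<Rightarrow> ('b \<Rightarrow> 'a::real_normed_vector) \<Rightarrow> 'b \<Rightarrow> 'a" where
  "partial_deriv v f x = vector_derivative (\<lambda>t::real. f (x + t *\<^sub>R v)) (at 0)"

fun iter_partial :: "'b::real_normed_vector list \<Rightarrow> ('b \<Rightarrow> 'a::real_normed_vector) \<Rightarrow> 'b \<Rightarrow> 'a" where
  "iter_partial [] f = f"
| "iter_partial (v # vs) f = partial_deriv v (iter_partial vs f)"

text \<open>
  Infinite differentiability: every iterated partial derivative is (Frechet) differentiable,
  and in particular continuous.
\<close>

definition smooth :: "('b::euclidean_space \<Rightarrow> 'a::real_normed_vector) \<Rightarrow> bool" where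
  "smooth f \<longleftrightarrow> (\<forall>vs\<in>lists Basis. iter_partial vs f differentiable_on UNIV)"

text \<open>
  Multi-indices are vectors in \<open>nat ^ 'n\<close>, ordered componentwise. A multi-index says how
  often to differentiate in each direction, but the index type carries no order in which to do
  so; an order is chosen here. For smooth functions the choice is immaterial.
\<close>

definition index_list :: "nat ^ 'n \<Rightarrow> 'n list" where
  "index_list \<alpha> = (SOME is. \<forall>i. count_list is i = \<alpha> $ i)"

lemma count_index_list: "count_list (index_list \<alpha>) i = \<alpha> $ i"
proof -
  have "\<exists>is. \<forall>i. count_list is i = \<alpha> $ i"
  proof -
    obtain "is" where "mset is = (\<Sum>i\<in>UNIV. replicate_mset (\<alpha> $ i) i)"
      using ex_mset by blast
    then have "count_list is i = \<alpha> $ i" for i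
      by (simp flip: count_mset add: count_sum)
    then show ?thesis by blast
  qed
  then show ?thesis
    unfolding index_list_def by (rule someI2_ex) blast
qed

definition multi_deriv ::
  "('n \<Rightarrow> 'b::real_normed_vector) \<Rightarrow> nat ^ 'n \<Rightarrow> ('b \<Rightarrow> 'a::real_normed_vector) \<Rightarrow> 'b \<Rightarrow> 'a" where
  "multi_deriv e \<alpha> f = iter_partial (map e (index_list \<alpha>)) f"

abbreviation deriv_vec ::
  "nat ^ 'n \<Rightarrow> (real ^ 'n \<Rightarrow> 'a::real_normed_vector) \<Rightarrow> real ^ 'n \<Rightarrow> 'a" where
  "deriv_vec \<equiv> multi_deriv (\<lambda>i. axis i 1)"

abbreviation deriv_fst ::
  "nat ^ 'n \<Rightarrow> ((real ^ 'n) \<times> (real ^ 'n) \<Rightarrow> 'a::real_normed_vector) \<Rightarrow> (real ^ 'n) \<times> (real ^ 'n) \<Rightarrow> 'a" where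
  "deriv_fst \<equiv> multi_deriv (\<lambda>i. (axis i 1, 0))"

abbreviation deriv_snd ::
  "nat ^ 'n \<Rightarrow> ((real ^ 'n) \<times> (real ^ 'n) \<Rightarrow> 'a::real_normed_vector) \<Rightarrow> (real ^ 'n) \<times> (real ^ 'n) \<Rightarrow> 'a" where
  "deriv_snd \<equiv> multi_deriv (\<lambda>i. (0, axis i 1))"

section \<open>Function spaces\<close>

definition CB_infty :: "('b::euclidean_space \<Rightarrow> 'a::real_normed_vector) set" where
  "CB_infty = {f. smooth f \<and> (\<forall>vs\<in>lists Basis. bounded (range (iter_partial vs f)))}"

definition sup_norm :: "('b \<Rightarrow> 'a::real_normed_vector) \<Rightarrow> real" where
  "sup_norm f = (SUP x. norm (f x))"

definition symbol_norm ::
  "((real ^ 'n) \<times> (real ^ 'n) \<Rightarrow> 'a::real_normed_vector) \<Rightarrow> real" where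
  "symbol_norm a = Sup {sup_norm (deriv_fst \<beta> (deriv_snd \<gamma> a)) | \<beta> \<gamma>.
     \<beta> \<le> (\<chi> i. 1) \<and> \<gamma> \<le> (\<chi> i. 1)}"

definition schwartz :: "(real ^ 'n \<Rightarrow> 'a::real_normed_vector) set" where
  "schwartz = {f. smooth f \<and>
     (\<forall>\<alpha> \<beta>. bounded (range (\<lambda>x. (\<Prod>i\<in>UNIV. (x $ i) ^ (\<alpha> $ i)) *\<^sub>R deriv_vec \<beta> f x)))}"

section \<open>The completion E of the Schwartz space\<close>

definition ip :: "(real ^ 'n \<Rightarrow> 'a) \<Rightarrow> (real ^ 'n \<Rightarrow> 'a) \<Rightarrow> 'a::separable_cstar_algebra" where
  "ip f g = (\<integral>x. star (f x) * g x \<partial>lborel)"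

definition norm2 :: "(real ^ 'n \<Rightarrow> 'a::separable_cstar_algebra) \<Rightarrow> real" where
  "norm2 f = sqrt (norm (ip f f))"

text \<open>
  The completion is the set of Cauchy sequences of Schwartz functions, modulo sequences
  tending to zero.
\<close>

definition cauchy_seqs :: "(nat \<Rightarrow> real ^ 'n \<Rightarrow> 'a::separable_cstar_algebra) set" where
  "cauchy_seqs = {X. (\<forall>k. X k \<in> schwartz) \<and>
     (\<forall>e>0. \<exists>N. \<forall>j\<ge>N. \<forall>k\<ge>N. norm2 (\<lambda>x. X j x - X k x) < e)}"

definition null_rel ::
  "((nat \<Rightarrow> real ^ 'n \<Rightarrow> 'a::separable_cstar_algebra) \<times> (nat \<Rightarrow> real ^ 'n \<Rightarrow> 'a)) set" where
  "null_rel = {(X, Y). X \<in> cauchy_seqs \<and> Y \<in> cauchy_seqs \<and>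
     (\<lambda>k. norm2 (\<lambda>x. X k x - Y k x)) \<longlonglongrightarrow> 0}"

type_synonym ('a, 'n) seq_class = "(nat \<Rightarrow> real ^ 'n \<Rightarrow> 'a) set"

definition E_space :: "('a::separable_cstar_algebra, 'n::finite) seq_class set" where
  "E_space = cauchy_seqs // null_rel"

definition E_add ::
  "('a::separable_cstar_algebra, 'n::finite) seq_class \<Rightarrow> ('a, 'n) seq_class \<Rightarrow> ('a, 'n) seq_class" where
  "E_add u v = (\<Union>X\<in>u. \<Union>Y\<in>v. null_rel `` {\<lambda>k x. X k x + Y k x})"

definition E_scale ::
  "complex \<Rightarrow> ('a::separable_cstar_algebra, 'n::finite) seq_class \<Rightarrow> ('a, 'n) seq_class" where
  "E_scale c u = (\<Union>X\<in>u. null_rel `` {\<lambda>k x. c *\<^sub>C X k x})"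

definition E_norm :: "('a::separable_cstar_algebra, 'n::finite) seq_class \<Rightarrow> real" where
  "E_norm u = (THE r. \<forall>X\<in>u. (\<lambda>k. norm2 (X k)) \<longlonglongrightarrow> r)"

definition E_embed ::
  "(real ^ 'n \<Rightarrow> 'a::separable_cstar_algebra) \<Rightarrow> ('a, 'n::finite) seq_class" where
  "E_embed \<phi> = null_rel `` {\<lambda>k. \<phi>}"

definition square_integrable :: "(real ^ 'n \<Rightarrow> 'a::separable_cstar_algebra) \<Rightarrow> bool" where
  "square_integrable f \<longleftrightarrow>
     f \<in> borel_measurable lborel \<and> integrable lborel (\<lambda>x. (norm (f x))\<^sup>2)"

text \<open>
  A square-integrable \<open>f\<close> is the limit, in the norm
  \<open>(\<integral> \<parallel>f(x)\<parallel>\<^sup>2 dx)\<^sup>1\<^sup>/\<^sup>2\<close>, of Schwartz functions. This norm dominates \<open>norm2\<close>, so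
  every such approximating sequence is Cauchy for \<open>norm2\<close> and they all have the same class,
  which is the element of E given by \<open>f\<close>. If \<open>f\<close> is not square-integrable, the set below
  is empty and thus not an element of E.
\<close>

definition E_of_fun ::
  "(real ^ 'n \<Rightarrow> 'a::separable_cstar_algebra) \<Rightarrow> ('a, 'n::finite) seq_class" where
  "E_of_fun f = null_rel `` {Y. square_integrable f \<and> (\<forall>k. Y k \<in> schwartz) \<and>
     (\<lambda>k. \<integral>\<^sup>+ x. ennreal ((norm (Y k x - f x))\<^sup>2) \<partial>lborel) \<longlonglongrightarrow> 0}"

definition E_bounded_op ::
  "(('a::separable_cstar_algebra, 'n::finite) seq_class \<Rightarrow> ('a, 'n) seq_class) \<Rightarrow> bool" where
  "E_bounded_op T \<longleftrightarrow>
     T \<in> E_space \<rightarrow> E_space \<and>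
     (\<forall>u\<in>E_space. \<forall>v\<in>E_space. T (E_add u v) = E_add (T u) (T v)) \<and>
     (\<forall>c. \<forall>u\<in>E_space. T (E_scale c u) = E_scale c (T u)) \<and>
     (\<exists>C. \<forall>u\<in>E_space. E_norm (T u) \<le> C * E_norm u)"

definition E_opnorm ::
  "(('a::separable_cstar_algebra, 'n::finite) seq_class \<Rightarrow> ('a, 'n) seq_class) \<Rightarrow> real" where
  "E_opnorm T = Sup {E_norm (T u) | u. u \<in> E_space \<and> E_norm u \<le> 1}"

section \<open>Pseudodifferential operators\<close>

definition fourier :: "(real ^ 'n \<Rightarrow> 'a::separable_cstar_algebra) \<Rightarrow> real ^ 'n \<Rightarrow> 'a" where
  "fourier \<phi> \<xi> = ((2 * pi) powr (- real CARD('n) / 2)) *\<^sub>R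
     (\<integral>y. cis (- (\<xi> \<bullet> y)) *\<^sub>C \<phi> y \<partial>lborel)"

definition pdo ::
  "((real ^ 'n) \<times> (real ^ 'n) \<Rightarrow> 'a) \<Rightarrow> (real ^ 'n \<Rightarrow> 'a::separable_cstar_algebra) \<Rightarrow> real ^ 'n \<Rightarrow> 'a" where
  "pdo a \<phi> x = ((2 * pi) powr (- real CARD('n) / 2)) *\<^sub>R
     (\<integral>\<xi>. cis (x \<bullet> \<xi>) *\<^sub>C (a (x, \<xi>) * fourier \<phi> \<xi>) \<partial>lborel)"

end

theory Submission
  imports Defs "HOL-Probability.Probability" "HOL-Real_Asymp.Real_Asymp"
begin

text \<open>
  The scalar theorem is due to Hwang, and his argument only needs the Cauchy-Schwarz inequality and
  Bessel's inequality in L2, both of which make sense in a Hilbert module. With the window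
  \<open>q(s) = \<Prod>\<^sub>j (1 + i s\<^sub>j)\<^sup>-\<^sup>1\<close> and \<open>W(x, \<xi>) = \<integral> e\<^sup>-\<^sup>i\<^sup>y\<^sup>\<xi> q(x - y) \<phi>(y) dy\<close>, one has
  \<open>\<Prod>\<^sub>j (1 + \<partial>\<xi>\<^sub>j) (e\<^sup>i\<^sup>x\<^sup>\<xi> W) = \<integral> e\<^sup>i\<^sup>(\<^sup>x\<^sup>-\<^sup>y\<^sup>)\<^sup>\<xi> \<phi>(y) dy\<close>, and integration by parts in \<open>\<xi>\<close> replaces the
  symbol by \<open>b = \<Prod>\<^sub>j (1 - \<partial>\<xi>\<^sub>j) a\<close>. In the pairing with \<open>\<psi>\<close>, the factor \<open>H(x) = b(x, \<xi>) W(x, \<xi>)\<close> is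
  written as \<open>\<integral> k(s) (\<Prod>\<^sub>j (1 - \<partial>x\<^sub>j) H)(x + s) ds\<close> with \<open>k(s) = e\<^sup>-\<^sup>s\<^sup>1\<^sup>-\<^sup>.\<^sup>.\<^sup>.\<^sup>-\<^sup>s\<^sup>n\<close> on the positive orthant,
  and k is moved to \<open>\<psi>\<close>. This leaves finitely many integrals \<open>\<integral>\<integral> V* c W' dx d\<xi>\<close> in which c is a
  derivative of the symbol bounded by \<open>\<pi>(a)\<close>, and V, W' are transforms of \<open>\<psi>\<close>, \<open>\<phi>\<close> with
  square-integrable windows; their L2 norms are controlled by Bessel's inequality. As a(x,D) maps
  Schwartz functions to Schwartz functions, one may take \<open>\<psi> = a(x,D) \<phi>\<close>.

  The inequalities in the module rest on the positivity of \<open>b* b\<close>, which is proved along the lines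
  of Kelley, Vaught and Kaplansky with square roots given by the binomial series.
\<close>

section \<open>Elementary C*-algebra\<close>

text \<open>The norm of \<open>L2_ip M f f\<close> can be much smaller than the integral of the
  squared pointwise norms, so pointwise norm estimates would control the wrong norm. The decisive
  estimates are therefore made between algebra-valued integrals, in the order of the algebra, and
  turned into statements about norms only afterwards; for this \<open>cpos\<close> has to survive
  Bochner integration. A second obstacle is convergence. The kernel k jumps at the boundary of the
  orthant, so the transform of \<psi> with that window has no evident integrable majorant in \<xi>.
  A Gaussian weight in \<xi> makes the integrals of squares converge absolutely; the bounds do not
  depend on its width, and dominated convergence removes it. The sources of the constant are
  visible: the operators 1 - \<partial> in \<xi> expand into 2^n derivatives of the symbol, those in
  x cost 3^n because each of them also differentiates the window, and the two Bessel estimates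
  contribute \<open>form_const\<close>.\<close>

lemma scaleC_zero_left [simp]: "0 *\<^sub>C (x::'a::cstar_algebra) = 0"
  using norm_scaleC[of 0 x] by simp

lemma scaleC_zero_right [simp]: "c *\<^sub>C (0::'a::cstar_algebra) = 0"
  using norm_scaleC[of c "0::'a"] by simp

lemma scaleC_one [simp]: "1 *\<^sub>C (x::'a::cstar_algebra) = x"
  using scaleC_of_real[of 1 x] by simp

lemma scaleC_i_i [simp]: "\<i> *\<^sub>C (\<i> *\<^sub>C x) = - (x::'a::cstar_algebra)"
  using scaleC_of_real[of "-1" x] by (simp add: scaleC_scaleC)

lemma scaleC_minus_right: "c *\<^sub>C (- x) = - (c *\<^sub>C (x::'a::cstar_algebra))"
  using scaleC_add_right[of c x "- x"] by (simp add: eq_neg_iff_add_eq_0 add.commute)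

lemma scaleC_minus_left: "(- c) *\<^sub>C x = - (c *\<^sub>C (x::'a::cstar_algebra))"
  using scaleC_add_left[of c "- c" x] by (simp add: eq_neg_iff_add_eq_0 add.commute)

lemma scaleC_diff_right: "c *\<^sub>C (x - y) = c *\<^sub>C x - c *\<^sub>C (y::'a::cstar_algebra)"
  using scaleC_add_right[of c x "- y"] by (simp add: scaleC_minus_right)

lemma scaleC_diff_left: "(c - d) *\<^sub>C x = c *\<^sub>C x - d *\<^sub>C (x::'a::cstar_algebra)"
  using scaleC_add_left[of c "- d" x] by (simp add: scaleC_minus_left)

lemma scaleR_scaleC: "r *\<^sub>R (c *\<^sub>C (x::'a::cstar_algebra)) = c *\<^sub>C (r *\<^sub>R x)"
  by (simp add: scaleC_of_real[symmetric] scaleC_scaleC mult.commute)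

lemma scaleR_scaleC_assoc: "(r *\<^sub>R c) *\<^sub>C (x::'a::cstar_algebra) = r *\<^sub>R (c *\<^sub>C x)"
  by (simp add: scaleR_conv_of_real scaleC_scaleC[symmetric] scaleC_of_real)

text \<open>Product rule, finite sums and the bounded linear maps that are pulled through Bochner
  integrals all enter the proof, for complex multiples, through this interpretation.\<close>

interpretation scaleC: bounded_bilinear "scaleC :: complex \<Rightarrow> 'a::cstar_algebra \<Rightarrow> 'a"
  by (rule bounded_bilinear.intro)
    (auto simp: scaleC_add_left scaleC_add_right scaleR_scaleC scaleR_scaleC_assoc norm_scaleC
      intro!: exI[of _ 1])

lemma star_zero [simp]: "star (0::'a::cstar_algebra) = 0"
  using star_add[of "0::'a" 0] by simp

lemma star_minus: "star (- x) = - star (x::'a::cstar_algebra)"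
  using star_add[of x "- x"] by (simp add: eq_neg_iff_add_eq_0 add.commute)

lemma star_diff: "star (x - y) = star x - star (y::'a::cstar_algebra)"
  using star_add[of x "- y"] by (simp add: star_minus)

lemma star_scaleR: "star (r *\<^sub>R x) = r *\<^sub>R star (x::'a::cstar_algebra)"
  using star_scaleC[of "of_real r" x] by (simp add: scaleC_of_real)

text \<open>The C*-identity and submultiplicativity give \<open>norm y \<le> norm (star y)\<close>
  after one factor is cancelled; the reverse inequality is the same one at
  \<open>star y\<close>.\<close>

lemma norm_star [simp]: "norm (star x) = norm (x::'a::cstar_algebra)"
proof -
  have le: "norm y \<le> norm (star y)" for y :: 'a
  proof (cases "y = 0")
    case False
    have "norm y * norm y \<le> norm (star y) * norm y"
      using norm_mult_ineq[of "star y" y] by (simp add: cstar_identity power2_eq_square)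
    then show ?thesis using False by simp
  qed simp
  from le[of x] le[of "star x"] show ?thesis by (simp add: star_star)
qed

lemma bounded_linear_star: "bounded_linear (star :: 'a::cstar_algebra \<Rightarrow> 'a)"
  by (rule bounded_linear_intro[where K = 1]) (auto simp: star_add star_scaleR)

lemmas star_simps = star_add star_diff star_minus star_mult star_star star_scaleR star_scaleC

lemma norm_mult_star: "norm (x * star x) = (norm (x::'a::cstar_algebra))\<^sup>2"
  using cstar_identity[of "star x"] by (simp add: star_star)

lemma norm_selfadjoint_square:
  assumes "star (h::'a::cstar_algebra) = h" shows "norm (h * h) = (norm h)\<^sup>2"
  using cstar_identity[of h] assms by simp

text \<open>Square roots and positivity need a unit. A general algebra enters this class through its
  unitization.\<close>

class unital_cstar_algebra = cstar_algebra + real_normed_algebra_1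

lemma star_one [simp]: "star (1::'a::unital_cstar_algebra) = 1"
  by (metis mult.right_neutral star_mult star_star mult.left_neutral)

section \<open>Square roots\<close>

text \<open>The Taylor coefficients of \<open>sqrt (1 - x)\<close> at 0.\<close>

definition sqrt_coeff :: "nat \<Rightarrow> real" where
  "sqrt_coeff k = (1/2 gchoose k) * (- 1) ^ k"

lemma sqrt_coeff_0 [simp]: "sqrt_coeff 0 = 1"
  by (simp add: sqrt_coeff_def)

lemma sqrt_coeff_Suc: "sqrt_coeff (Suc k) = sqrt_coeff k * ((real k - 1/2) / real (Suc k))"
  unfolding sqrt_coeff_def
  by (subst gbinomial_Suc_rec) (simp add: field_simps)

text \<open>In the recursion only the first factor, -1/2, is negative. Since all later coefficients
  share one sign, their absolute sum can be read off from the value of the function.\<close>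

lemma sqrt_coeff_nonpos: "sqrt_coeff (Suc k) \<le> 0"
proof (induction k)
  case 0
  show ?case by (simp add: sqrt_coeff_Suc)
next
  case (Suc k)
  then show ?case
    by (subst sqrt_coeff_Suc, intro mult_nonpos_nonneg) simp_all
qed

text \<open>The square of the series for \<open>sqrt (1 - x)\<close> must be \<open>1 - x\<close>;
  on coefficients this is Vandermonde's convolution with 1/2 + 1/2 = 1.\<close>

lemma sqrt_coeff_conv: "(\<Sum>i\<le>k. sqrt_coeff i * sqrt_coeff (k - i)) = (if k = 0 then 1 else if k = 1 then - 1 else 0)"
proof -
  have "(\<Sum>i\<le>k. sqrt_coeff i * sqrt_coeff (k - i)) = (\<Sum>i\<le>k. ((1/2 gchoose i) * (1/2 gchoose (k - i))) * (- 1) ^ k)"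
    by (rule sum.cong) (auto simp: sqrt_coeff_def power_add[symmetric] mult_ac)
  also have "\<dots> = ((1::real) gchoose k) * (- 1) ^ k"
    using gbinomial_Vandermonde[of "1/2::real" "1/2" k] by (simp add: sum_distrib_right[symmetric] atMost_atLeast0)
  also have "(1::real) gchoose k = of_nat (1 choose k)"
    by (simp add: binomial_gbinomial)
  finally show ?thesis
    by (cases k) (auto simp: binomial_eq_0)
qed

text \<open>For \<open>x < 1\<close> the absolute series sums to \<open>1 - sqrt (1 - x)\<close>,
  hence stays below 1; the bound on a finite sum survives the limit
  \<open>x \<rightarrow> 1\<close>.\<close>

lemma sqrt_coeff_partial_sum: "(\<Sum>i\<le>k. \<bar>sqrt_coeff (Suc i)\<bar>) \<le> 1"
proof -
  have *: "(\<Sum>i\<le>k. \<bar>sqrt_coeff (Suc i)\<bar> * x ^ Suc i) \<le> 1" if x: "0 \<le> x" "x < 1" for x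
  proof -
    have s: "(\<lambda>n. (1/2 gchoose n) * (- x) ^ n) sums (1 - x) powr (1/2)"
      using gen_binomial_real[of "- x" "1/2"] x by simp
    then have s': "(\<lambda>n. sqrt_coeff n * x ^ n) sums (1 - x) powr (1/2)"
      by (simp add: sqrt_coeff_def power_minus[of x] mult_ac)
    then have "(\<lambda>n. sqrt_coeff (Suc n) * x ^ Suc n) sums ((1 - x) powr (1/2) - 1)"
      by (subst sums_Suc_iff) simp
    then have s2: "(\<lambda>n. \<bar>sqrt_coeff (Suc n)\<bar> * x ^ Suc n) sums (1 - (1 - x) powr (1/2))"
      using sums_minus sqrt_coeff_nonpos by (fastforce simp: abs_of_nonpos)
    have "(\<Sum>i\<in>{..k}. \<bar>sqrt_coeff (Suc i)\<bar> * x ^ Suc i) \<le> (\<Sum>n. \<bar>sqrt_coeff (Suc n)\<bar> * x ^ Suc n)"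
      using s2 x by (intro sum_le_suminf) (auto simp: sums_iff)
    also have "\<dots> = 1 - (1 - x) powr (1/2)" using s2 by (simp add: sums_iff)
    also have "\<dots> \<le> 1" by simp
    finally show ?thesis .
  qed
  have "((\<lambda>x. \<Sum>i\<le>k. \<bar>sqrt_coeff (Suc i)\<bar> * x ^ Suc i) \<longlongrightarrow> (\<Sum>i\<le>k. \<bar>sqrt_coeff (Suc i)\<bar> * 1 ^ Suc i)) (at_left 1)"
    by (intro tendsto_intros)
  moreover have "eventually (\<lambda>x. (\<Sum>i\<le>k. \<bar>sqrt_coeff (Suc i)\<bar> * x ^ Suc i) \<le> 1) (at_left 1)"
    unfolding eventually_at_left_field using * by (intro exI[of _ 0]) auto
  ultimately show ?thesis
    using tendsto_upperbound[of _ _ "at_left (1::real)" 1] by (force simp: trivial_limit_at_left_real)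
qed

lemma summable_sqrt_coeff: "summable (\<lambda>i. \<bar>sqrt_coeff (Suc i)\<bar>)"
  and suminf_sqrt_coeff: "(\<Sum>i. \<bar>sqrt_coeff (Suc i)\<bar>) \<le> 1"
proof -
  show s: "summable (\<lambda>i. \<bar>sqrt_coeff (Suc i)\<bar>)"
    by (rule bounded_imp_summable[of _ 1]) (use sqrt_coeff_partial_sum in auto)
  show "(\<Sum>i. \<bar>sqrt_coeff (Suc i)\<bar>) \<le> 1"
  proof (rule suminf_le_const[OF s])
    fix n show "(\<Sum>i<n. \<bar>sqrt_coeff (Suc i)\<bar>) \<le> 1"
    proof (cases n)
      case (Suc m)
      then show ?thesis using sqrt_coeff_partial_sum[of m] by (simp add: lessThan_Suc_atMost)
    qed simp
  qed
qed

text \<open>Summable coefficients make the series converge even when \<open>norm x = 1\<close>, and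
  the Cauchy product squares it. The bound on \<open>1 - q\<close> is the certificate that makes
  \<open>q\<close> positive for \<open>upos\<close>; the commutation clause lets roots of commuting
  elements be combined later.\<close>

lemma unital_sqrt_exists:
  fixes x :: "'a::unital_cstar_algebra"
  assumes x: "norm x \<le> 1"
  obtains q where "q * q = 1 - x" "norm (1 - q) \<le> 1" "\<And>z. z * x = x * z \<Longrightarrow> z * q = q * z"
    "star x = x \<Longrightarrow> star q = q"
proof -
  define f where "f k = sqrt_coeff k *\<^sub>R x ^ k" for k
  have bd: "norm (f (Suc k)) \<le> \<bar>sqrt_coeff (Suc k)\<bar>" for k
  proof -
    have "norm (x ^ Suc k) \<le> 1"
      using norm_power_ineq[of x "Suc k"] power_le_one[OF norm_ge_zero x, of "Suc k"] by linarith
    then show ?thesis unfolding f_def by (simp del: power_Suc add: mult_left_le)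
  qed
  have sn1: "summable (\<lambda>k. norm (f (Suc k)))"
    by (rule summable_comparison_test'[OF summable_sqrt_coeff]) (use bd in auto)
  then have sn: "summable (\<lambda>k. norm (f k))" by (subst (asm) summable_Suc_iff)
  then have sf: "summable f" by (rule summable_norm_cancel)
  define q where "q = (\<Sum>k. f k)"
  have "q * q = (\<Sum>k. \<Sum>i\<le>k. f i * f (k - i))"
    unfolding q_def by (rule Cauchy_product[OF sn sn])
  also have "(\<lambda>k. \<Sum>i\<le>k. f i * f (k - i)) = (\<lambda>k. if k \<in> {0, 1} then (if k = 0 then 1 else - x) else 0)"
  proof
    fix k
    have "(\<Sum>i\<le>k. f i * f (k - i)) = (\<Sum>i\<le>k. (sqrt_coeff i * sqrt_coeff (k - i)) *\<^sub>R x ^ k)"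
      by (rule sum.cong) (auto simp: f_def power_add[symmetric])
    also have "\<dots> = (\<Sum>i\<le>k. sqrt_coeff i * sqrt_coeff (k - i)) *\<^sub>R x ^ k"
      by (simp add: scaleR_sum_left)
    also have "\<dots> = (if k \<in> {0, 1} then (if k = 0 then 1 else - x) else 0)"
      unfolding sqrt_coeff_conv by auto
    finally show "(\<Sum>i\<le>k. f i * f (k - i)) = \<dots>" .
  qed
  also have "(\<Sum>k. if k \<in> {0, 1} then (if k = 0 then 1 else - x) else 0) = 1 - x"
    by (subst suminf_finite[of "{0, 1::nat}"]) auto
  finally have 1: "q * q = 1 - x" .
  have "q = f 0 + (\<Sum>k. f (Suc k))"
    unfolding q_def using suminf_split_head[OF sf] by simp
  then have "1 - q = - (\<Sum>k. f (Suc k))" by (simp add: f_def)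
  then have "norm (1 - q) \<le> (\<Sum>k. norm (f (Suc k)))"
    using summable_norm[OF sn1] by simp
  also have "\<dots> \<le> (\<Sum>k. \<bar>sqrt_coeff (Suc k)\<bar>)"
    by (rule suminf_le[OF bd sn1 summable_sqrt_coeff])
  also have "\<dots> \<le> 1" by (rule suminf_sqrt_coeff)
  finally have 2: "norm (1 - q) \<le> 1" .
  have 3: "z * q = q * z" if z: "z * x = x * z" for z
  proof -
    have p: "z * x ^ k = x ^ k * z" for k
      by (induction k) (auto simp: mult.assoc z, metis mult.assoc z)
    have "z * q = (\<Sum>k. z * f k)" unfolding q_def by (rule suminf_mult[OF sf, symmetric])
    also have "\<dots> = (\<Sum>k. f k * z)" by (simp add: f_def p)
    also have "\<dots> = q * z" unfolding q_def by (rule suminf_mult2[OF sf, symmetric])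
    finally show ?thesis .
  qed
  have 4: "star q = q" if s: "star x = x"
  proof -
    have p: "star (x ^ k) = x ^ k" for k
      by (induction k) (auto simp: star_mult s power_commutes)
    have "star q = (\<Sum>k. star (f k))" using bounded_linear.suminf[OF bounded_linear_star sf] by (simp add: q_def)
    also have "(\<lambda>k. star (f k)) = f" by (auto simp: f_def star_scaleR p)
    also have "suminf f = q" by (simp add: q_def)
    finally show ?thesis .
  qed
  show thesis by (rule that[OF 1 2 3 4])
qed

section \<open>Positivity in a unital C*-algebra\<close>

text \<open>
  Positivity is expressed through the norm (the spectrum of a self-adjoint element with
  norm (t - a) \<le> t lies in the nonnegative half-line), so that sums of positive elements are
  positive for trivial reasons.
\<close>

definition upos :: "'a::unital_cstar_algebra \<Rightarrow> bool" where
  "upos a \<longleftrightarrow> star a = a \<and> (\<exists>t\<ge>0. norm (t *\<^sub>R 1 - a) \<le> t)"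

lemma upos_shift:
  assumes "norm (t *\<^sub>R 1 - a) \<le> t" "t \<le> s"
  shows "norm (s *\<^sub>R 1 - (a::'a::unital_cstar_algebra)) \<le> s"
proof -
  have "s *\<^sub>R 1 - a = (s - t) *\<^sub>R 1 + (t *\<^sub>R 1 - a)" by (simp add: scaleR_diff_left)
  then have "norm (s *\<^sub>R 1 - a) \<le> \<bar>s - t\<bar> + norm (t *\<^sub>R 1 - a)"
    by (metis norm_triangle_ineq norm_scaleR norm_one mult.right_neutral)
  then show ?thesis using assms by linarith
qed

lemma upos_add:
  assumes "upos a" "upos (b::'a::unital_cstar_algebra)" shows "upos (a + b)"
proof -
  obtain s t where st: "s \<ge> 0" "t \<ge> 0" "norm (s *\<^sub>R 1 - a) \<le> s" "norm (t *\<^sub>R 1 - b) \<le> t"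
    using assms unfolding upos_def by auto
  have "norm ((s + t) *\<^sub>R 1 - (a + b)) \<le> s + t"
    using norm_triangle_ineq[of "s *\<^sub>R 1 - a" "t *\<^sub>R 1 - b"] st
    by (simp add: scaleR_add_left algebra_simps)
  then show ?thesis using assms st unfolding upos_def
    by (auto simp: star_add intro!: exI[of _ "s + t"])
qed

lemma upos_scaleR:
  assumes "upos a" "r \<ge> 0" shows "upos (r *\<^sub>R (a::'a::unital_cstar_algebra))"
proof -
  obtain s where s: "s \<ge> 0" "norm (s *\<^sub>R 1 - a) \<le> s"
    using assms unfolding upos_def by auto
  have "norm ((r * s) *\<^sub>R 1 - r *\<^sub>R a) = r * norm (s *\<^sub>R 1 - a)"
    using assms(2) by (metis abs_of_nonneg norm_scaleR scaleR_diff_right scaleR_scaleR)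
  also have "\<dots> \<le> r * s" using s assms by (intro mult_left_mono)
  finally show ?thesis using assms s unfolding upos_def
    by (auto simp: star_scaleR intro!: exI[of _ "r * s"])
qed

lemma upos_sqrt:
  fixes a :: "'a::unital_cstar_algebra"
  assumes "upos a"
  obtains q where "q * q = a" "upos q" "\<And>z. z * a = a * z \<Longrightarrow> z * q = q * z"
proof -
  obtain t0 where t0: "t0 \<ge> 0" "norm (t0 *\<^sub>R 1 - a) \<le> t0" and sa: "star a = a"
    using assms unfolding upos_def by auto
  \<comment> \<open>The given bound may be 0; enlarging it by 1 permits division by
    \<open>t\<close>.\<close>
  define t where "t = t0 + 1"
  have t: "t > 0" "norm (t *\<^sub>R 1 - a) \<le> t"
    using t0 upos_shift[of t0 a t] by (auto simp: t_def)
  define x where "x = (1 / t) *\<^sub>R (t *\<^sub>R 1 - a)"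
  have x1: "1 - x = (1 / t) *\<^sub>R a" using t by (simp add: x_def scaleR_diff_right)
  have "norm x \<le> 1" unfolding x_def norm_scaleR using t by (simp add: divide_le_eq)
  then obtain q where q: "q * q = 1 - x" "norm (1 - q) \<le> 1" "\<And>z. z * x = x * z \<Longrightarrow> z * q = q * z"
      "star x = x \<Longrightarrow> star q = q"
    using unital_sqrt_exists by blast
  have sx: "star x = x" unfolding x_def by (simp add: star_scaleR star_diff sa)
  have "upos q" using q(2) q(4)[OF sx] unfolding upos_def by (auto intro!: exI[of _ 1])
  show thesis
  proof (rule that[of "sqrt t *\<^sub>R q"])
    show "sqrt t *\<^sub>R q * sqrt t *\<^sub>R q = a" using t by (simp add: q(1) x1)
    show "upos (sqrt t *\<^sub>R q)" by (rule upos_scaleR) (use \<open>upos q\<close> t in auto)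
    fix z assume "z * a = a * z"
    then have "z * x = x * z" by (simp add: x_def algebra_simps)
    then show "z * sqrt t *\<^sub>R q = sqrt t *\<^sub>R q * z" using q(3) by simp
  qed
qed

text \<open>Repeated use of the C*-identity along powers of two; this substitutes for the spectral
  radius formula.\<close>

lemma selfadjoint_norm_power2:
  assumes "star (h::'a::unital_cstar_algebra) = h" shows "norm (h ^ 2 ^ k) = norm h ^ 2 ^ k"
proof (induction k)
  case (Suc k)
  have s: "star (h ^ n) = h ^ n" for n
    by (induction n) (auto simp: star_mult assms power_commutes)
  have "norm (h ^ 2 ^ Suc k) = norm (h ^ 2 ^ k * h ^ 2 ^ k)"
    by (simp add: power_add[symmetric] mult_2)
  also have "\<dots> = (norm h ^ 2 ^ k)\<^sup>2"
    by (simp add: norm_selfadjoint_square s Suc)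
  finally show ?case by (simp add: power_mult[symmetric] mult.commute)
qed simp

text \<open>The element p + i z is the multiple by sqrt T of an isometry, and p is its real part.\<close>

lemma norm_re_le:
  fixes p z :: "'a::unital_cstar_algebra"
  assumes "star p = p" "star z = z" "p * z = z * p" "p * p + z * z = T *\<^sub>R 1" "T \<ge> 0"
  shows "norm p \<le> sqrt T"
proof -
  define u where "u = p + \<i> *\<^sub>C z"
  have "star u * u = p * p + z * z"
    unfolding u_def using assms(1-3)
    by (simp add: star_simps scaleC_minus_left scaleC_diff_right scaleC_add_right algebra_simps mult_scaleC_left mult_scaleC_right)
  then have "(norm u)\<^sup>2 = T" using cstar_identity[of u] assms by simp
  then have u: "norm u = sqrt T" by (metis norm_ge_zero real_sqrt_abs abs_of_nonneg)
  have "u + star u = 2 *\<^sub>R p" unfolding u_def using assms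
    by (simp add: star_simps scaleC_minus_left scaleR_2)
  then have "2 * norm p \<le> norm u + norm (star u)"
    using norm_triangle_ineq[of u "star u"] by simp
  then show ?thesis using u by simp
qed

text \<open>With \<open>T\<close> the square of \<open>norm h\<close>, the element
  \<open>T - h * h\<close> is positive because its distance from \<open>T\<close> is
  \<open>norm (h * h)\<close>. Its root \<open>z\<close> commutes with \<open>h\<close>, and
  \<open>h * h + z * z = T\<close>, so \<open>norm_re_le\<close>, with the root in the role of the
  real part, bounds \<open>z\<close>.\<close>

lemma square_bound:
  fixes h :: "'a::unital_cstar_algebra"
  assumes "star h = h"
  shows "norm ((norm h)\<^sup>2 *\<^sub>R 1 - h * h) \<le> (norm h)\<^sup>2"
proof -
  define T where "T = (norm h)\<^sup>2"
  have sa: "star (T *\<^sub>R 1 - h * h) = T *\<^sub>R 1 - h * h" by (simp add: star_simps assms)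
  have "upos (T *\<^sub>R 1 - h * h)"
    unfolding upos_def using sa norm_selfadjoint_square[OF assms]
    by (auto intro!: exI[of _ T] simp: T_def)
  then obtain z where z: "z * z = T *\<^sub>R 1 - h * h" "upos z"
      "\<And>y. y * (T *\<^sub>R 1 - h * h) = (T *\<^sub>R 1 - h * h) * y \<Longrightarrow> y * z = z * y"
    using upos_sqrt by metis
  have sz: "star z = z" using z(2) by (simp add: upos_def)
  have c: "h * z = z * h" by (rule z(3)) (simp add: algebra_simps)
  have "norm z \<le> sqrt T"
    by (rule norm_re_le[of z h]) (use c sz assms z(1) in \<open>auto simp: T_def\<close>)
  then have "(norm z)\<^sup>2 \<le> T" by (metis T_def norm_ge_zero real_le_rsqrt real_sqrt_abs abs_norm_cancel power_mono real_sqrt_pow2 zero_le_power2)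
  then show ?thesis using z(1) norm_selfadjoint_square[OF sz] by (simp add: T_def)
qed

lemma upos_square: "star (h::'a::unital_cstar_algebra) = h \<Longrightarrow> upos (h * h)"
  unfolding upos_def using square_bound[of h]
  by (auto simp: star_mult intro!: exI[of _ "(norm h)\<^sup>2"])

text \<open>Every positive element is the square of a self-adjoint one, to which
  \<open>square_bound\<close> applies. This replaces the unspecified bound in \<open>upos\<close> by
  one that depends on \<open>a\<close> alone, as integration will require.\<close>

lemma upos_norm_bound:
  assumes "upos (a::'a::unital_cstar_algebra)" shows "norm (norm a *\<^sub>R 1 - a) \<le> norm a"
proof -
  obtain q where q: "q * q = a" "upos q" using upos_sqrt[OF assms] by metis
  have sq: "star q = q" using q by (simp add: upos_def)
  show ?thesis using square_bound[OF sq] norm_selfadjoint_square[OF sq] q by simp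
qed

text \<open>The roots of \<open>P\<close> and \<open>- P\<close> commute and their squares add up to
  0, so \<open>norm_re_le\<close> with \<open>T = 0\<close> annihilates the first.\<close>

lemma upos_antisym:
  assumes "upos P" "upos (- (P::'a::unital_cstar_algebra))" shows "P = 0"
proof -
  obtain p where p: "p * p = P" "upos p" "\<And>z. z * P = P * z \<Longrightarrow> z * p = p * z"
    using upos_sqrt[OF assms(1)] by metis
  obtain z where z: "z * z = - P" "upos z"
    using upos_sqrt[OF assms(2)] by metis
  have "P = - (z * z)" using z(1) by simp
  then have "z * P = P * z" by (simp add: mult.assoc)
  then have c: "p * z = z * p" using p(3) by simp
  have "norm p \<le> sqrt 0"
    by (rule norm_re_le[of p z]) (use p(1,2) z(1,2) c in \<open>auto simp: upos_def\<close>)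
  then show ?thesis using p by simp
qed

text \<open>The roots of \<open>a\<close> and of \<open>norm b - a\<close> commute and their squares
  add up to \<open>norm b\<close>; \<open>norm_re_le\<close> bounds the former.\<close>

lemma upos_norm_mono:
  assumes "upos a" "upos (b - (a::'a::unital_cstar_algebra))" shows "norm a \<le> norm b"
proof -
  have sb: "star b = b" using assms by (simp add: upos_def star_diff)
  have "upos (norm b *\<^sub>R 1 - b)"
    unfolding upos_def by (auto simp: star_simps sb intro!: exI[of _ "norm b"])
  from upos_add[OF this assms(2)] have "upos (norm b *\<^sub>R 1 - a)" by simp
  then obtain z where z: "z * z = norm b *\<^sub>R 1 - a" "upos z"
      "\<And>y. y * (norm b *\<^sub>R 1 - a) = (norm b *\<^sub>R 1 - a) * y \<Longrightarrow> y * z = z * y"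
    using upos_sqrt by metis
  obtain p where p: "p * p = a" "upos p" using upos_sqrt[OF assms(1)] by metis
  have "p * a = a * p" by (simp add: p(1)[symmetric] mult.assoc)
  then have c: "p * z = z * p" by (intro z(3)) (simp add: algebra_simps)
  have sp: "star p = p" using p by (simp add: upos_def)
  have "norm p \<le> sqrt (norm b)"
    by (rule norm_re_le[of p z]) (use p(1,2) z(1,2) c in \<open>auto simp: upos_def\<close>)
  then have "(norm p)\<^sup>2 \<le> norm b" by (metis norm_ge_zero power_mono real_sqrt_pow2)
  then show ?thesis using norm_selfadjoint_square[OF sp] p(1) by simp
qed

text \<open>
  Since c intertwines t - c * star c, of norm at most t, with t + P, the norm of the n-th power of
  t + P is at most t ^ n * (1 + n). For self-adjoint elements this forces the norm of t + P itself
  to be at most t, so that - P is positive as well.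
\<close>

lemma star_mult_eq_minus_upos:
  fixes c :: "'a::unital_cstar_algebra"
  assumes P: "upos P" and c: "star c * c = - P"
  shows "P = 0"
proof -
  \<comment> \<open>Up to real factors, \<open>p\<close> and \<open>q\<close> are the real and
    imaginary parts of \<open>c\<close>. Half the sum of their squares is
    \<open>c * star c + star c * c\<close>, and \<open>star c * c = - P\<close>, so
    \<open>c * star c\<close> is a sum of positive elements.\<close>
  define p where "p = c + star c"
  define q where "q = \<i> *\<^sub>C (c - star c)"
  have sp: "star p = p" by (simp add: p_def star_simps add.commute)
  have sq: "star q = q" by (simp add: q_def star_simps scaleC_minus_left scaleC_diff_right)
  have "p * p + q * q = 2 *\<^sub>R (c * star c + star c * c)"
    unfolding p_def q_def
    by (simp add: algebra_simps mult_scaleC_left mult_scaleC_right scaleR_2 scaleC_diff_right)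
  then have "c * star c = (1/2) *\<^sub>R (p * p + q * q) + P" using c by simp
  then have "upos (c * star c)"
    by (metis upos_add upos_scaleR upos_square sp sq P divide_nonneg_nonneg zero_le_one zero_le_numeral)
  then obtain t0 where t0: "t0 \<ge> 0" "norm (t0 *\<^sub>R 1 - c * star c) \<le> t0" unfolding upos_def by auto
  \<comment> \<open>The three terms serve division by \<open>t\<close>, the norm bound on
    \<open>m\<close>, and the estimate of the square of \<open>norm c\<close> in
    \<open>bd\<close>.\<close>
  define t where "t = max 1 (max t0 ((norm c)\<^sup>2))"
  have t: "t \<ge> 1" "norm (t *\<^sub>R 1 - c * star c) \<le> t" "(norm c)\<^sup>2 \<le> t"
    using upos_shift[OF t0(2), of t] by (auto simp: t_def)
  define m where "m = t *\<^sub>R 1 - c * star c"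
  define Q where "Q = t *\<^sub>R 1 + P"
  have int: "m * c = c * Q" unfolding m_def Q_def using c by (simp add: algebra_simps)
  have intn: "m ^ n * c = c * Q ^ n" for n
    by (induction n) (auto simp: mult.assoc int, metis int mult.assoc)
  have bd: "norm (P * Q ^ n) \<le> t ^ n * t" for n
  proof -
    have "P * Q ^ n = - (star c * (m ^ n * c))" unfolding intn using c by (simp add: mult.assoc[symmetric])
    then have "norm (P * Q ^ n) \<le> norm c * norm (m ^ n * c)"
      using norm_mult_ineq[of "star c" "m ^ n * c"] by simp
    also have "\<dots> \<le> norm c * (norm (m ^ n) * norm c)"
      by (intro mult_left_mono norm_mult_ineq norm_ge_zero)
    also have "\<dots> = norm (m ^ n) * (norm c)\<^sup>2" by (simp add: power2_eq_square)
    also have "\<dots> \<le> t ^ n * t"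
      using t norm_power_ineq[of m n] power_mono[of "norm m" t n]
      by (intro mult_mono) (auto simp: m_def)
    finally show ?thesis .
  qed
  have grow: "norm (Q ^ n) \<le> t ^ n * (1 + real n)" for n
  proof (induction n)
    case (Suc n)
    have "Q ^ Suc n = t *\<^sub>R Q ^ n + P * Q ^ n" by (simp add: Q_def algebra_simps)
    then have "norm (Q ^ Suc n) \<le> t * norm (Q ^ n) + norm (P * Q ^ n)"
      using norm_triangle_ineq[of "t *\<^sub>R Q ^ n" "P * Q ^ n"] t by simp
    also have "\<dots> \<le> t * (t ^ n * (1 + real n)) + t ^ n * t"
      using Suc bd[of n] t by (intro add_mono mult_left_mono) auto
    finally show ?case by (simp add: algebra_simps)
  qed simp
  have sQ: "star Q = Q" using P by (simp add: Q_def star_simps upos_def)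
  have "norm Q \<le> t"
  proof (rule ccontr)
    assume "\<not> norm Q \<le> t"
    define r where "r = norm Q / t"
    have r: "r > 1" using \<open>\<not> norm Q \<le> t\<close> t by (simp add: r_def)
    have le: "r ^ 2 ^ k \<le> 1 + real (2 ^ k)" for k
    proof -
      have "norm Q ^ 2 ^ k \<le> t ^ 2 ^ k * (1 + real (2 ^ k))"
        using grow[of "2 ^ k"] selfadjoint_norm_power2[OF sQ, of k] by simp
      then show ?thesis using t unfolding r_def power_divide by (simp add: divide_le_eq mult.commute)
    qed
    have "filterlim (\<lambda>k. r ^ k / (1 + real k)) at_top sequentially"
      using r by real_asymp
    then have "filterlim (\<lambda>k. r ^ 2 ^ k / (1 + real (2 ^ k))) at_top sequentially"
      by (rule filterlim_compose[where g = "\<lambda>k. r ^ k / (1 + real k)"])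
        (use filterlim_subseq[of "\<lambda>k. 2 ^ k :: nat"] in \<open>auto simp: strict_mono_def\<close>)
    then have "eventually (\<lambda>k. r ^ 2 ^ k / (1 + real (2 ^ k)) > 1) sequentially"
      unfolding filterlim_at_top_dense by blast
    then obtain k where "r ^ 2 ^ k / (1 + real (2 ^ k)) > 1"
      using eventually_happens sequentially_bot by blast
    moreover have "r ^ 2 ^ k / (1 + real (2 ^ k)) \<le> 1"
      using le[of k] by (subst divide_le_eq_1_pos) (auto intro: add_pos_pos)
    ultimately show False by simp
  qed
  then have "norm (t *\<^sub>R 1 - (- P)) \<le> t" by (simp add: Q_def)
  moreover have "star (- P) = - P" using P by (simp add: upos_def star_minus)
  ultimately have "upos (- P)" unfolding upos_def using t(1) by (metis order_trans zero_le_one)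
  then show ?thesis using upos_antisym[OF P] by simp
qed

text \<open>
  With h = star b * b and r the square root of the absolute value of h, the element
  c = b * (abs h - h) * r satisfies star c * c = - s * s for the self-adjoint s below.
\<close>

lemma upos_star_mult: "upos (star b * (b::'a::unital_cstar_algebra))"
proof -
  define h where "h = star b * b"
  have sh: "star h = h" by (simp add: h_def star_simps)
  obtain g where g: "g * g = h * h" "upos g" "\<And>z. z * (h * h) = h * h * z \<Longrightarrow> z * g = g * z"
    using upos_sqrt[OF upos_square[OF sh]] by metis
  obtain r where r: "r * r = g" "upos r" "\<And>z. z * g = g * z \<Longrightarrow> z * r = r * z"
    using upos_sqrt[OF g(2)] by metis
  have sg: "star g = g" "star r = r" using g(2) r(2) by (auto simp: upos_def)
  have hg: "h * g = g * h" by (rule g(3)) (simp add: mult.assoc)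
  have hr: "h * r = r * h" by (rule r(3)[OF hg])
  have gr: "g * r = r * g" by (rule r(3)) simp
  define d where "d = g - h"
  have sd: "star d = d" by (simp add: d_def star_simps sg sh)
  have dr: "d * r = r * d" and dh: "d * h = h * d" and dg: "d * g = g * d"
    by (simp_all add: d_def algebra_simps hr gr hg)
  \<comment> \<open>Both identities come from \<open>g * g = h * h\<close>.\<close>
  have dd: "d * d = - 2 *\<^sub>R (h * d)" and dg2: "d * g = (1/2) *\<^sub>R (d * d)"
    unfolding d_def by (simp_all add: algebra_simps g(1) hg scaleR_2 flip: scaleR_add_left)
  define c where "c = b * (d * r)"
  have "star c * c = (r * d) * h * (d * r)"
    by (simp add: c_def h_def star_simps sd sg mult.assoc)
  also have "\<dots> = h * d * (d * g)"
    by (metis dr dh hr gr r(1) mult.assoc)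
  also have "h * d = - (1/2) *\<^sub>R (d * d)" unfolding dd by simp
  finally have cc: "star c * c = - (((1/2) *\<^sub>R (d * d)) * ((1/2) *\<^sub>R (d * d)))"
    unfolding dg2 by simp
  define s where "s = (1/2) *\<^sub>R (d * d)"
  have ss: "star s = s" by (simp add: s_def star_simps sd)
  have "s * s = 0" by (rule star_mult_eq_minus_upos[OF upos_square[OF ss]]) (use cc in \<open>simp add: s_def\<close>)
  then have "norm s = 0" using norm_selfadjoint_square[OF ss] by simp
  then have "d * d = 0" by (simp add: s_def)
  then have "norm d = 0" using norm_selfadjoint_square[OF sd] by simp
  then have "h = g" by (simp add: d_def)
  then show ?thesis using g(2) by (simp add: h_def)
qed

section \<open>Unitization\<close>

datatype 'a unitization = Unitz (upart: 'a) (uscal: complex)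

text \<open>An element of the unitization acts on the original algebra by left multiplication; the
  C*-norm is built from the operator norm of this action.\<close>

definition uact :: "'a::cstar_algebra unitization \<Rightarrow> 'a \<Rightarrow> 'a" where
  "uact x c = upart x * c + uscal x *\<^sub>C c"

lemma bounded_linear_uact: "bounded_linear (uact x)"
  unfolding uact_def
  by (intro bounded_linear_add bounded_linear_mult_right scaleC.bounded_linear_right)

instantiation unitization :: (cstar_algebra) real_normed_algebra_1
begin

definition zero_unitization :: "'a unitization" where "zero_unitization = Unitz 0 0"
definition one_unitization :: "'a unitization" where "one_unitization = Unitz 0 1"
definition plus_unitization :: "'a unitization \<Rightarrow> 'a unitization \<Rightarrow> 'a unitization" where
  "plus_unitization x y = Unitz (upart x + upart y) (uscal x + uscal y)"
definition uminus_unitization :: "'a unitization \<Rightarrow> 'a unitization" where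
  "uminus_unitization x = Unitz (- upart x) (- uscal x)"
definition minus_unitization :: "'a unitization \<Rightarrow> 'a unitization \<Rightarrow> 'a unitization" where
  "minus_unitization x y = Unitz (upart x - upart y) (uscal x - uscal y)"
definition times_unitization :: "'a unitization \<Rightarrow> 'a unitization \<Rightarrow> 'a unitization" where
  "times_unitization x y =
    Unitz (upart x * upart y + uscal y *\<^sub>C upart x + uscal x *\<^sub>C upart y) (uscal x * uscal y)"
definition scaleR_unitization :: "real \<Rightarrow> 'a unitization \<Rightarrow> 'a unitization" where
  "scaleR_unitization r x = Unitz (r *\<^sub>R upart x) (r *\<^sub>R uscal x)"
text \<open>The scalar part enters the norm because the action alone is not faithful if the algebra is unital.\<close>
definition norm_unitization :: "'a unitization \<Rightarrow> real" where
  "norm_unitization x = max (cmod (uscal x)) (onorm (uact x))"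
definition dist_unitization :: "'a unitization \<Rightarrow> 'a unitization \<Rightarrow> real" where
  "dist_unitization x y = norm (x - y)"
definition sgn_unitization :: "'a unitization \<Rightarrow> 'a unitization" where
  "sgn_unitization x = inverse (norm x) *\<^sub>R x"
definition uniformity_unitization :: "('a unitization \<times> 'a unitization) filter" where
  "uniformity_unitization = (INF e\<in>{0<..}. principal {(x, y). dist x y < e})"
definition open_unitization :: "'a unitization set \<Rightarrow> bool" where
  "open_unitization U \<longleftrightarrow> (\<forall>x\<in>U. eventually (\<lambda>(x', y). x' = x \<longrightarrow> y \<in> U) uniformity)"

lemmas unitz_defs = zero_unitization_def one_unitization_def plus_unitization_def
  uminus_unitization_def minus_unitization_def times_unitization_def scaleR_unitization_def

lemma uact_simps:
  "uact 0 c = 0" "uact 1 c = c" "uact (x + y) c = uact x c + uact y c" "uact (- x) c = - uact x c"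
  "uact (x * y) c = uact x (uact y c)" "uact (r *\<^sub>R x) c = r *\<^sub>R uact x c"
  by (simp_all add: uact_def unitz_defs algebra_simps scaleC_add_left scaleC_add_right
      scaleC_scaleC mult_scaleC_left mult_scaleC_right scaleC_minus_left scaleR_scaleC_assoc[symmetric])

lemma norm_uact_le: "norm (uact x c) \<le> norm x * norm c"
proof -
  have "norm (uact x c) \<le> onorm (uact x) * norm c"
    by (rule onorm[OF bounded_linear_uact])
  also have "\<dots> \<le> norm x * norm c" by (intro mult_right_mono) (auto simp: norm_unitization_def)
  finally show ?thesis .
qed

lemma norm_unitz_leI:
  assumes "cmod (uscal x) \<le> b" "\<And>c. norm (uact x c) \<le> b * norm c"
  shows "norm x \<le> b"
proof -
  have "b \<ge> 0" using assms(1) norm_ge_zero order_trans by blast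
  then show ?thesis using assms by (auto simp: norm_unitization_def intro!: onorm_bound)
qed

lemma norm_uscal_le: "cmod (uscal x) \<le> norm x"
  by (simp add: norm_unitization_def)

lemma norm_unitz_nonneg: "0 \<le> norm (x :: 'a unitization)"
  using norm_uscal_le[of x] norm_ge_zero order_trans by blast

text \<open>Let \<open>a\<close> be the algebra part. Acting on \<open>star a\<close> produces
  \<open>a * star a\<close> up to a scalar multiple of \<open>star a\<close>; both the action and
  the scalar are controlled by \<open>norm x\<close>, and one factor \<open>norm a\<close> cancels.
  Definiteness of the norm and completeness depend on this.\<close>

lemma norm_upart_le: "norm (upart x) \<le> 2 * norm x"
proof (cases "upart x = 0")
  case True
  then show ?thesis using norm_unitz_nonneg[of x] by simp
next
  case False
  let ?a = "upart x"
  have "?a * star ?a = uact x (star ?a) - uscal x *\<^sub>C star ?a"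
    by (simp add: uact_def)
  then have "norm (?a * star ?a) \<le> norm (uact x (star ?a)) + norm (uscal x *\<^sub>C star ?a)"
    using norm_triangle_ineq4 by metis
  also have "\<dots> \<le> norm x * norm ?a + norm x * norm ?a"
    using norm_uact_le[of x "star ?a"] norm_uscal_le[of x]
    by (intro add_mono) (auto simp: norm_scaleC intro!: mult_right_mono)
  finally have "norm ?a * norm ?a \<le> (2 * norm x) * norm ?a"
    by (simp add: norm_mult_star power2_eq_square)
  then show ?thesis using False by simp
qed

lemma norm_unitz_le: "norm x \<le> norm (upart x) + cmod (uscal x)"
proof (rule norm_unitz_leI)
  fix c
  have "norm (uact x c) \<le> norm (upart x * c) + norm (uscal x *\<^sub>C c)"
    unfolding uact_def by (rule norm_triangle_ineq)
  also have "\<dots> \<le> (norm (upart x) + cmod (uscal x)) * norm c"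
    using norm_mult_ineq[of "upart x" c] by (simp add: norm_scaleC distrib_right)
  finally show "norm (uact x c) \<le> (norm (upart x) + cmod (uscal x)) * norm c" .
qed simp

lemma norm_unitz_mult: "norm (x * y) \<le> norm x * norm (y :: 'a unitization)"
proof (rule norm_unitz_leI)
  show "cmod (uscal (x * y)) \<le> norm x * norm y"
    by (auto simp: unitz_defs norm_mult intro!: mult_mono norm_uscal_le norm_unitz_nonneg)
  fix c
  show "norm (uact (x * y) c) \<le> norm x * norm y * norm c"
    using norm_uact_le[of x "uact y c"] mult_left_mono[OF norm_uact_le[of y c] norm_unitz_nonneg[of x]]
    by (simp add: uact_simps mult.assoc)
qed

instance
proof
  fix x y z :: "'a unitization" and r s :: real and c d :: complex
  show "x + y + z = x + (y + z)" "x + y = y + x" "0 + x = x" "- x + x = 0" "x - y = x + - y"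
    "r *\<^sub>R (x + y) = r *\<^sub>R x + r *\<^sub>R y" "(r + s) *\<^sub>R x = r *\<^sub>R x + s *\<^sub>R x"
    "r *\<^sub>R s *\<^sub>R x = (r * s) *\<^sub>R x" "1 *\<^sub>R x = x"
    by (simp_all add: unitz_defs algebra_simps)
  show "x * y * z = x * (y * z)" "(x + y) * z = x * z + y * z" "x * (y + z) = x * y + x * z"
    "r *\<^sub>R x * y = r *\<^sub>R (x * y)" "x * r *\<^sub>R y = r *\<^sub>R (x * y)" "1 * x = x" "x * 1 = x"
    by (simp_all add: unitz_defs algebra_simps scaleC_add_left scaleC_add_right scaleC_scaleC
        mult_scaleC_left mult_scaleC_right scaleR_scaleC scaleR_scaleC_assoc)
  show "(0::'a unitization) \<noteq> 1" by (simp add: unitz_defs)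
  show "dist x y = norm (x - y)" by (rule dist_unitization_def)
  show "sgn x = inverse (norm x) *\<^sub>R x" by (rule sgn_unitization_def)
  show "uniformity = (INF e\<in>{0<..}. principal {(x, y::'a unitization). dist x y < e})"
    by (rule uniformity_unitization_def)
  show "open U \<longleftrightarrow> (\<forall>x\<in>U. eventually (\<lambda>(x', y). x' = x \<longrightarrow> y \<in> U) uniformity)" for U :: "'a unitization set"
    by (rule open_unitization_def)
  show "norm x = 0 \<longleftrightarrow> x = 0"
  proof
    assume "norm x = 0"
    then show "x = 0" using norm_upart_le[of x] norm_uscal_le[of x]
      by (cases x) (simp add: unitz_defs)
  next
    assume "x = 0"
    then show "norm x = 0" using norm_unitz_le[of x] norm_unitz_nonneg[of x] by (simp add: unitz_defs)
  qed
  show "norm (x + y) \<le> norm x + norm y"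
  proof (rule norm_unitz_leI)
    show "cmod (uscal (x + y)) \<le> norm x + norm y"
      using norm_triangle_ineq[of "uscal x" "uscal y"] norm_uscal_le[of x] norm_uscal_le[of y]
      by (simp add: unitz_defs)
    fix c show "norm (uact (x + y) c) \<le> (norm x + norm y) * norm c"
      using norm_triangle_ineq[of "uact x c" "uact y c"] norm_uact_le[of x c] norm_uact_le[of y c]
      by (simp add: uact_simps distrib_right)
  qed
  have sc: "norm (r *\<^sub>R x) \<le> \<bar>r\<bar> * norm x" for r and x :: "'a unitization"
  proof (rule norm_unitz_leI)
    show "cmod (uscal (r *\<^sub>R x)) \<le> \<bar>r\<bar> * norm x"
      by (simp add: unitz_defs mult_left_mono norm_uscal_le)
    fix y show "norm (uact (r *\<^sub>R x) y) \<le> \<bar>r\<bar> * norm x * norm y"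
      by (simp add: uact_simps mult.assoc mult_left_mono norm_uact_le)
  qed
  show "norm (r *\<^sub>R x) = \<bar>r\<bar> * norm x"
  proof (cases "r = 0")
    case True
    then show ?thesis using sc[of r x] norm_unitz_nonneg[of "r *\<^sub>R x"] by simp
  next
    case False
    have "inverse r *\<^sub>R (r *\<^sub>R x) = x" using False by (cases x) (simp add: unitz_defs)
    then have "\<bar>r\<bar> * norm x \<le> \<bar>r\<bar> * (\<bar>inverse r\<bar> * norm (r *\<^sub>R x))"
      using sc[of "inverse r" "r *\<^sub>R x"] by (simp add: mult_left_mono)
    also have "\<dots> = norm (r *\<^sub>R x)" using False by simp
    finally show ?thesis using sc[of r x] by simp
  qed
  show "norm (x * y) \<le> norm x * norm y" by (rule norm_unitz_mult)
  show "norm (1::'a unitization) = 1"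
    using norm_uscal_le[of "1::'a unitization"] norm_unitz_le[of "1::'a unitization"] by (simp add: unitz_defs)
qed

end

text \<open>The norm is equivalent to the sum of the norms of the two components
  (\<open>norm_upart_le\<close>, \<open>norm_uscal_le\<close>, \<open>norm_unitz_le\<close>), so
  limits are taken componentwise.\<close>

instance unitization :: (cstar_algebra) banach
proof
  fix X :: "nat \<Rightarrow> 'a unitization"
  assume C: "Cauchy X"
  have d1: "dist (upart x) (upart y) \<le> 2 * dist x y" for x y :: "'a unitization"
    using norm_upart_le[of "x - y"] by (simp add: dist_unitization_def dist_norm unitz_defs)
  have d2: "dist (uscal x) (uscal y) \<le> dist x y" for x y :: "'a unitization"
    using norm_uscal_le[of "x - y"] by (simp add: dist_unitization_def dist_norm unitz_defs)
  have "Cauchy (\<lambda>n. upart (X n))"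
  proof (rule metric_CauchyI)
    fix e :: real assume "e > 0"
    then obtain M where M: "\<And>m n. m \<ge> M \<Longrightarrow> n \<ge> M \<Longrightarrow> dist (X m) (X n) < e / 2"
      using metric_CauchyD[OF C, of "e / 2"] by auto
    show "\<exists>M. \<forall>m\<ge>M. \<forall>n\<ge>M. dist (upart (X m)) (upart (X n)) < e"
      using M d1 by (intro exI[of _ M]) (smt (verit, best) field_sum_of_halves)
  qed
  then obtain a where a: "(\<lambda>n. upart (X n)) \<longlonglongrightarrow> a" using Cauchy_convergent convergent_def by blast
  have "Cauchy (\<lambda>n. uscal (X n))"
  proof (rule metric_CauchyI)
    fix e :: real assume "e > 0"
    then obtain M where M: "\<And>m n. m \<ge> M \<Longrightarrow> n \<ge> M \<Longrightarrow> dist (X m) (X n) < e"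
      using metric_CauchyD[OF C, of e] by auto
    show "\<exists>M. \<forall>m\<ge>M. \<forall>n\<ge>M. dist (uscal (X m)) (uscal (X n)) < e"
      using M d2 by (intro exI[of _ M]) (smt (verit, best))
  qed
  then obtain z where z: "(\<lambda>n. uscal (X n)) \<longlonglongrightarrow> z" using Cauchy_convergent convergent_def by blast
  have "X \<longlonglongrightarrow> Unitz a z"
  proof (rule metric_LIMSEQ_I)
    fix e :: real assume "e > 0"
    have "(\<lambda>n. norm (upart (X n) - a) + cmod (uscal (X n) - z)) \<longlonglongrightarrow> 0"
      using tendsto_add[OF tendsto_norm[OF LIM_zero[OF a]] tendsto_norm[OF LIM_zero[OF z]]] by simp
    then obtain M where M: "\<And>n. n \<ge> M \<Longrightarrow> norm (upart (X n) - a) + cmod (uscal (X n) - z) < e"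
      using \<open>e > 0\<close> unfolding lim_sequentially dist_norm by fastforce
    have "dist (X n) (Unitz a z) \<le> norm (upart (X n) - a) + cmod (uscal (X n) - z)" for n
      using norm_unitz_le[of "X n - Unitz a z"] by (simp add: dist_unitization_def unitz_defs)
    then show "\<exists>M. \<forall>n\<ge>M. dist (X n) (Unitz a z) < e"
      using M by (intro exI[of _ M]) (meson order_le_less_trans)
  qed
  then show "convergent X" by (auto simp: convergent_def)
qed

instantiation unitization :: (cstar_algebra) unital_cstar_algebra
begin

definition scaleC_unitization :: "complex \<Rightarrow> 'a unitization \<Rightarrow> 'a unitization" where
  "scaleC_unitization c x = Unitz (c *\<^sub>C upart x) (c * uscal x)"
definition star_unitization :: "'a unitization \<Rightarrow> 'a unitization" where
  "star_unitization x = Unitz (star (upart x)) (cnj (uscal x))"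

lemmas unitz_star_defs = unitz_defs scaleC_unitization_def star_unitization_def

lemma uact_scaleC: "uact (z *\<^sub>C x) c = z *\<^sub>C uact x c"
  by (simp add: uact_def unitz_star_defs scaleC_add_right scaleC_scaleC mult_scaleC_left)

text \<open>For \<open>c\<close> in the algebra, the square of \<open>norm (uact x c)\<close> is the
  norm of \<open>star c\<close> times the action of \<open>star x * x\<close> on \<open>c\<close>;
  this bounds the operator norm, and the scalar component is treated apart. The resulting inequality
  forces \<open>norm (star x) = norm x\<close>, and with it the opposite inequality.\<close>

lemma norm_unitz_star_mult: "norm (star x * x) = (norm (x :: 'a unitization))\<^sup>2"
proof -
  have le: "(norm x)\<^sup>2 \<le> norm (star x * x)" for x :: "'a unitization"
  proof -
    have "norm x \<le> sqrt (norm (star x * x))"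
    proof (rule norm_unitz_leI)
      have "(cmod (uscal x))\<^sup>2 = cmod (uscal (star x * x))"
        by (simp add: unitz_star_defs norm_mult power2_eq_square)
      also have "\<dots> \<le> norm (star x * x)" by (rule norm_uscal_le)
      finally show "cmod (uscal x) \<le> sqrt (norm (star x * x))" by (rule real_le_rsqrt)
      fix c
      have "(norm (uact x c))\<^sup>2 = norm (star (uact x c) * uact x c)" by (simp add: cstar_identity)
      also have "star (uact x c) * uact x c = star c * uact (star x * x) c"
        by (simp add: uact_def unitz_star_defs star_simps algebra_simps mult_scaleC_left mult_scaleC_right
            scaleC_add_right scaleC_add_left scaleC_scaleC mult.commute)
      also have "norm \<dots> \<le> norm c * (norm (star x * x) * norm c)"
        by (rule order_trans[OF norm_mult_ineq]) (auto intro!: mult_left_mono norm_uact_le)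
      also have "\<dots> = (sqrt (norm (star x * x)) * norm c)\<^sup>2"
        by (simp add: power_mult_distrib norm_unitz_nonneg power2_eq_square[of "norm c"])
      finally show "norm (uact x c) \<le> sqrt (norm (star x * x)) * norm c"
        by (rule power2_le_imp_le) (simp add: norm_unitz_nonneg)
    qed
    then show ?thesis by (metis norm_unitz_nonneg power_mono real_sqrt_pow2)
  qed
  have ss: "star (star x) = x" for x :: "'a unitization"
    by (simp add: unitz_star_defs star_star)
  have sle: "norm x \<le> norm (star x)" for x :: "'a unitization"
  proof (cases "norm x = 0")
    case False
    have "norm x * norm x \<le> norm (star x) * norm x"
      using le[of x] norm_mult_ineq[of "star x" x] by (simp add: power2_eq_square)
    then show ?thesis using False norm_ge_zero[of x] by simp
  qed (simp add: norm_unitz_nonneg)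
  have "norm (star x) = norm x" using sle[of x] sle[of "star x"] by (simp add: ss)
  then show "norm (star x * x) = (norm x)\<^sup>2"
    using le[of x] norm_mult_ineq[of "star x" x] by (simp add: power2_eq_square)
qed

instance
proof
  fix x y z :: "'a unitization" and r s :: real and c d :: complex
  have scC: "norm (c *\<^sub>C x) \<le> cmod c * norm x" for c and x :: "'a unitization"
  proof (rule norm_unitz_leI)
    show "cmod (uscal (c *\<^sub>C x)) \<le> cmod c * norm x"
      by (simp add: unitz_star_defs norm_mult mult_left_mono norm_uscal_le)
    fix y show "norm (uact (c *\<^sub>C x) y) \<le> cmod c * norm x * norm y"
      by (simp add: uact_scaleC norm_scaleC mult.assoc mult_left_mono norm_uact_le)
  qed
  show nC: "norm (c *\<^sub>C x) = cmod c * norm x" for c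
  proof (cases "c = 0")
    case True
    then show ?thesis using scC[of c x] norm_ge_zero[of "c *\<^sub>C x"] by simp
  next
    case False
    have "inverse c *\<^sub>C (c *\<^sub>C x) = x" using False by (cases x) (simp add: unitz_star_defs scaleC_scaleC)
    then have "cmod c * norm x \<le> cmod c * (cmod (inverse c) * norm (c *\<^sub>C x))"
      using scC[of "inverse c" "c *\<^sub>C x"] by (simp add: mult_left_mono)
    also have "\<dots> = norm (c *\<^sub>C x)" using False by (simp add: norm_inverse)
    finally show ?thesis using scC[of c x] by simp
  qed
  show "complex_of_real r *\<^sub>C x = r *\<^sub>R x"
    by (simp add: unitz_star_defs scaleC_of_real scaleR_conv_of_real)
  show "c *\<^sub>C (x + y) = c *\<^sub>C x + c *\<^sub>C y" "(c + d) *\<^sub>C x = c *\<^sub>C x + d *\<^sub>C x"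
    "c *\<^sub>C d *\<^sub>C x = (c * d) *\<^sub>C x" "c *\<^sub>C x * y = c *\<^sub>C (x * y)" "x * c *\<^sub>C y = c *\<^sub>C (x * y)"
    by (simp_all add: unitz_star_defs algebra_simps scaleC_add_left scaleC_add_right scaleC_scaleC
        mult_scaleC_left mult_scaleC_right)
  show "star (x + y) = star x + star y" "star (c *\<^sub>C x) = cnj c *\<^sub>C star x"
    "star (x * y) = star y * star x" "star (star x) = x"
    by (simp_all add: unitz_star_defs star_simps algebra_simps)
  show "norm (star x * x) = (norm x)\<^sup>2" by (rule norm_unitz_star_mult)
qed

end

section \<open>Positive elements\<close>

definition cpos :: "'a::cstar_algebra \<Rightarrow> bool" where
  "cpos a \<longleftrightarrow> upos (Unitz a 0)"

lemma Unitz_norm [simp]: "norm (Unitz a 0) = norm (a::'a::cstar_algebra)"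
proof (rule antisym)
  show "norm (Unitz a 0) \<le> norm a" using norm_unitz_le[of "Unitz a 0"] by simp
  show "norm a \<le> norm (Unitz a 0)"
  proof (cases "a = 0")
    case False
    have "norm a * norm a = norm (uact (Unitz a 0) (star a))"
      by (simp add: uact_def norm_mult_star power2_eq_square)
    also have "\<dots> \<le> norm (Unitz a 0) * norm a" using norm_uact_le[of "Unitz a 0" "star a"] by simp
    finally show ?thesis using False by simp
  qed (simp add: norm_unitz_nonneg)
qed

text \<open>The operator norm of the left action by \<open>t - a\<close> is spelled out on vectors
  \<open>c\<close>, and the scalar component of \<open>t - a\<close> is \<open>t\<close> itself. In
  this form, free of the unit, the condition can be integrated.\<close>

lemma cpos_iff:
  "cpos a \<longleftrightarrow> star a = a \<and> (\<exists>t\<ge>0. \<forall>c. norm (t *\<^sub>R c - a * c) \<le> t * norm (c::'a::cstar_algebra))"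
proof -
  have "norm (t *\<^sub>R 1 - Unitz a 0) \<le> t \<longleftrightarrow> (\<forall>c. norm (t *\<^sub>R c - a * c) \<le> t * norm c)" if t: "t \<ge> 0" for t
  proof -
    have u: "uact (t *\<^sub>R 1 - Unitz a 0) c = t *\<^sub>R c - a * c" for c
      by (simp add: uact_def unitz_star_defs scaleR_scaleC_assoc)
    show ?thesis
    proof safe
      fix c assume *: "norm (t *\<^sub>R 1 - Unitz a 0) \<le> t"
      show "norm (t *\<^sub>R c - a * c) \<le> t * norm c"
        using norm_uact_le[of "t *\<^sub>R 1 - Unitz a 0" c] mult_right_mono[OF *, of "norm c"] by (simp add: u)
    next
      assume *: "\<forall>c. norm (t *\<^sub>R c - a * c) \<le> t * norm c"
      show "norm (t *\<^sub>R 1 - Unitz a 0) \<le> t"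
        by (rule norm_unitz_leI) (use t * in \<open>auto simp: u\<close>, simp add: unitz_star_defs)
    qed
  qed
  then show ?thesis unfolding cpos_def upos_def by (auto simp: unitz_star_defs)
qed

text \<open>By \<open>upos_norm_bound\<close> the witness may be \<open>norm a\<close>; as a
  function of the point it can be integrated in \<open>cpos_integral\<close>.\<close>

lemma cpos_norm_bound:
  assumes "cpos a" shows "norm (norm a *\<^sub>R c - a * c) \<le> norm a * norm (c::'a::cstar_algebra)"
proof -
  have "norm (uact (norm a *\<^sub>R 1 - Unitz a 0) c) \<le> norm a * norm c"
    using norm_uact_le[of "norm a *\<^sub>R 1 - Unitz a 0" c] upos_norm_bound[of "Unitz a 0"] assms
      mult_right_mono[of "norm (norm a *\<^sub>R 1 - Unitz a 0)" "norm a" "norm c"]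
    by (simp add: cpos_def)
  moreover have "uact (norm a *\<^sub>R 1 - Unitz a 0) c = norm a *\<^sub>R c - a * c"
    by (simp add: uact_def unitz_star_defs scaleR_scaleC_assoc)
  ultimately show ?thesis by simp
qed

lemma cpos_selfadjoint: "cpos a \<Longrightarrow> star a = a"
  by (simp add: cpos_iff)

lemma cpos_add: "cpos a \<Longrightarrow> cpos b \<Longrightarrow> cpos (a + b)"
  using upos_add[of "Unitz a 0" "Unitz b 0"] by (simp add: cpos_def unitz_star_defs)

lemma cpos_scaleR: "cpos a \<Longrightarrow> r \<ge> 0 \<Longrightarrow> cpos (r *\<^sub>R a)"
  using upos_scaleR[of "Unitz a 0" r] by (simp add: cpos_def unitz_star_defs)

lemma cpos_star_mult: "cpos (star b * b)"
  using upos_star_mult[of "Unitz b 0"] by (simp add: cpos_def unitz_star_defs)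

lemma cpos_norm_mono: "cpos a \<Longrightarrow> cpos (b - a) \<Longrightarrow> norm a \<le> norm b"
  using upos_norm_mono[of "Unitz a 0" "Unitz b 0"] by (simp add: cpos_def unitz_star_defs)

text \<open>The root \<open>q\<close> of \<open>norm p - p\<close> exists only in the unitization,
  but \<open>q * y\<close> lies in the algebra again, and the element in question is
  \<open>star (q * y) * (q * y)\<close>.\<close>

lemma cpos_conj:
  assumes "cpos p"
  shows "cpos (norm p *\<^sub>R (star y * y) - star y * p * y)"
proof -
  have "upos (norm p *\<^sub>R 1 - Unitz p 0)"
    using assms unfolding upos_def cpos_def
    by (auto simp: star_simps intro!: exI[of _ "norm p"])
  then obtain q where q: "q * q = norm p *\<^sub>R 1 - Unitz p 0" "upos q"
    using upos_sqrt by metis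
  have "star (q * Unitz y 0) * (q * Unitz y 0) = star (Unitz y 0) * (q * q) * Unitz y 0"
    using q(2) by (simp add: star_mult upos_def mult.assoc)
  also have "\<dots> = Unitz (norm p *\<^sub>R (star y * y) - star y * p * y) 0"
    unfolding q(1) by (simp add: unitz_star_defs algebra_simps scaleR_scaleC_assoc)
  finally show ?thesis using upos_star_mult[of "q * Unitz y 0"] by (simp add: cpos_def)
qed

lemma cpos_conj_star:
  "cpos ((norm c)\<^sup>2 *\<^sub>R (star y * y) - star (c * y) * (c * y))"
  using cpos_conj[OF cpos_star_mult, of c y] by (simp add: cstar_identity star_mult mult.assoc)

text \<open>The bounds with witness \<open>norm (f x)\<close> integrate to a bound for the integral
  whose witness is the integral of the norms, so no duality or closed-cone argument enters.\<close>

lemma cpos_integral: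
  fixes f :: "'b \<Rightarrow> 'a::{cstar_algebra, second_countable_topology}"
  assumes "\<And>x. cpos (f x)"
  shows "cpos (\<integral>x. f x \<partial>M)"
proof (cases "integrable M f")
  case True
  have "star (\<integral>x. f x \<partial>M) = (\<integral>x. f x \<partial>M)"
    using integral_bounded_linear[OF bounded_linear_star True, symmetric]
    by (simp only: cpos_selfadjoint[OF assms])
  moreover have "norm ((\<integral>x. norm (f x) \<partial>M) *\<^sub>R c - (\<integral>x. f x \<partial>M) * c) \<le> (\<integral>x. norm (f x) \<partial>M) * norm c" for c
  proof -
    have "(\<integral>x. norm (f x) \<partial>M) *\<^sub>R c - (\<integral>x. f x \<partial>M) * c = (\<integral>x. norm (f x) *\<^sub>R c - f x * c \<partial>M)"
      using True by simp
    also have "norm \<dots> \<le> (\<integral>x. norm (norm (f x) *\<^sub>R c - f x * c) \<partial>M)"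
      by (rule integral_norm_bound)
    also have "\<dots> \<le> (\<integral>x. norm (f x) * norm c \<partial>M)"
      using True by (intro integral_mono cpos_norm_bound assms) auto
    finally show ?thesis using True by simp
  qed
  ultimately show ?thesis unfolding cpos_iff
    by (intro conjI exI[of _ "\<integral>x. norm (f x) \<partial>M"]) auto
next
  case False
  \<comment> \<open>The Bochner integral is 0 by convention here, and 0 is positive.\<close>
  then show ?thesis using cpos_star_mult[of "0::'a"] by (simp add: not_integrable_integral_eq)
qed

section \<open>The Cauchy-Schwarz inequality\<close>

text \<open>Square integrability of the pointwise norm is stronger than what the module norm
  measures; it guarantees that the algebra-valued inner products exist as Bochner integrals.\<close>

definition L2 :: "'b measure \<Rightarrow> ('b \<Rightarrow> 'a::separable_cstar_algebra) \<Rightarrow> bool" where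
  "L2 M f \<longleftrightarrow> f \<in> borel_measurable M \<and> integrable M (\<lambda>x. (norm (f x))\<^sup>2)"

definition L2_ip :: "'b measure \<Rightarrow> ('b \<Rightarrow> 'a) \<Rightarrow> ('b \<Rightarrow> 'a) \<Rightarrow> 'a::separable_cstar_algebra" where
  "L2_ip M f g = (\<integral>x. star (f x) * g x \<partial>M)"

lemma borel_measurable_star [measurable]:
  "f \<in> borel_measurable M \<Longrightarrow> (\<lambda>x. star (f x :: 'a::cstar_algebra)) \<in> borel_measurable M"
  by (rule measurable_compose[OF _ borel_measurable_continuous_onI])
    (auto intro: linear_continuous_on bounded_linear_star)

lemma borel_measurable_mult_algebra [measurable (raw)]:
  fixes f g :: "'b \<Rightarrow> 'a::{real_normed_algebra, second_countable_topology}"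
  assumes "f \<in> borel_measurable M" "g \<in> borel_measurable M"
  shows "(\<lambda>x. f x * g x) \<in> borel_measurable M"
  by (rule borel_measurable_continuous_Pair[OF assms]) (intro continuous_intros)

lemma borel_measurable_scaleC [measurable (raw)]:
  fixes g :: "'b \<Rightarrow> 'a::separable_cstar_algebra"
  assumes "f \<in> borel_measurable M" "g \<in> borel_measurable M"
  shows "(\<lambda>x. f x *\<^sub>C g x) \<in> borel_measurable M"
  by (rule borel_measurable_continuous_Pair[OF assms])
    (intro scaleC.continuous_on continuous_intros)

lemma L2_measurable [measurable_dest]: "L2 M f \<Longrightarrow> f \<in> borel_measurable M"
  by (simp add: L2_def)

lemma norm_star_mult_le:
  fixes u v :: "'a::cstar_algebra"
  shows "norm (star u * v) \<le> (norm u)\<^sup>2 + (norm v)\<^sup>2"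
proof -
  have "2 * (norm u * norm v) \<le> (norm u)\<^sup>2 + (norm v)\<^sup>2"
    using sum_squares_bound[of "norm u" "norm v"] by simp
  moreover have "norm (star u * v) \<le> norm u * norm v"
    using norm_mult_ineq[of "star u" v] by simp
  ultimately show ?thesis by (smt (verit) mult_nonneg_nonneg norm_ge_zero)
qed

lemma integrable_star_mult:
  assumes "L2 M f" "L2 M g"
  shows "integrable M (\<lambda>x. star (f x) * g x)"
proof (rule Bochner_Integration.integrable_bound)
  show "integrable M (\<lambda>x. (norm (f x))\<^sup>2 + (norm (g x))\<^sup>2)" using assms by (simp add: L2_def)
  show "(\<lambda>x. star (f x) * g x) \<in> borel_measurable M" using assms by (auto simp: L2_def)
  show "AE x in M. norm (star (f x) * g x) \<le> norm ((norm (f x))\<^sup>2 + (norm (g x))\<^sup>2)"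
    using norm_star_mult_le by (intro AE_I2) simp
qed

lemma L2_bound:
  assumes "L2 M f" "g \<in> borel_measurable M" "\<And>x. norm (g x) \<le> B * norm (f x)"
  shows "L2 M g"
  unfolding L2_def
proof
  show "integrable M (\<lambda>x. (norm (g x))\<^sup>2)"
  proof (rule Bochner_Integration.integrable_bound)
    show "integrable M (\<lambda>x. B\<^sup>2 * (norm (f x))\<^sup>2)" using assms by (simp add: L2_def)
    have "(norm (g x))\<^sup>2 \<le> (B * norm (f x))\<^sup>2" for x
      by (intro power_mono assms) simp
    then show "AE x in M. norm ((norm (g x))\<^sup>2) \<le> norm (B\<^sup>2 * (norm (f x))\<^sup>2)"
      by (simp add: power_mult_distrib)
  qed (use assms(2) in measurable)
qed fact

lemma L2_mult_right: "L2 M f \<Longrightarrow> L2 M (\<lambda>x. f x * y)"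
  by (rule L2_bound[of M f _ "norm y"])
    (auto simp: L2_def mult.commute[of "norm y"] intro: norm_mult_ineq)

lemma cpos_L2_ip: "cpos (L2_ip M f f)"
  unfolding L2_ip_def by (rule cpos_integral) (rule cpos_star_mult)

lemma star_L2_ip: "L2 M f \<Longrightarrow> L2 M g \<Longrightarrow> star (L2_ip M f g) = L2_ip M g f"
  unfolding L2_ip_def
  using integral_bounded_linear[OF bounded_linear_star integrable_star_mult[of M f g], symmetric]
  by (simp add: star_simps)

text \<open>Positivity of the inner product of f - g y with itself, with y a multiple of L2_ip M g f.\<close>

lemma L2_ip_Cauchy_Schwarz:
  assumes f: "L2 M f" and g: "L2 M g"
  shows "(norm (L2_ip M f g))\<^sup>2 \<le> norm (L2_ip M f f) * norm (L2_ip M g g)"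
proof -
  define u where "u = L2_ip M g f"
  have su: "star u = L2_ip M f g" unfolding u_def by (rule star_L2_ip[OF g f])
  \<comment> \<open>A number \<open>N\<close> strictly above the norm of \<open>L2_ip M g g\<close>
    avoids division by zero; the limit towards that norm is taken at the end.\<close>
  have key: "(norm u)\<^sup>2 \<le> N * norm (L2_ip M f f)" if N: "N > norm (L2_ip M g g)" for N
  proof -
    have N0: "N > 0" using N norm_ge_zero[of "L2_ip M g g"] by linarith
    define y where "y = (1 / N) *\<^sub>R u"
    have gy: "L2 M (\<lambda>x. g x * y)" by (rule L2_mult_right[OF g])
    have i1: "L2_ip M f (\<lambda>x. g x * y) = star u * y"
      unfolding su L2_ip_def using integrable_star_mult[OF f g]
      by (simp add: mult.assoc[symmetric])
    have i2: "L2_ip M (\<lambda>x. g x * y) f = star y * u"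
      unfolding u_def L2_ip_def using integrable_star_mult[OF g f]
      by (simp add: mult.assoc star_mult)
    have i3: "L2_ip M (\<lambda>x. g x * y) (\<lambda>x. g x * y) = star y * L2_ip M g g * y"
    proof -
      have "L2_ip M (\<lambda>x. g x * y) (\<lambda>x. g x * y) = (\<integral>x. star y * (star (g x) * g x) * y \<partial>M)"
        unfolding L2_ip_def by (simp add: mult.assoc star_mult)
      also have "\<dots> = star y * L2_ip M g g * y"
        unfolding L2_ip_def using integrable_star_mult[OF g g] by simp
      finally show ?thesis .
    qed
    let ?d = "\<lambda>x. f x - g x * y"
    have "L2_ip M ?d ?d = (\<integral>x. (star (f x) * f x - star (f x) * (g x * y)) -
        (star (g x * y) * f x - star (g x * y) * (g x * y)) \<partial>M)"
      unfolding L2_ip_def by (simp add: star_diff algebra_simps)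
    also have "\<dots> = (L2_ip M f f - L2_ip M f (\<lambda>x. g x * y)) - (L2_ip M (\<lambda>x. g x * y) f - L2_ip M (\<lambda>x. g x * y) (\<lambda>x. g x * y))"
      unfolding L2_ip_def
      using integrable_star_mult[OF f f] integrable_star_mult[OF f gy]
        integrable_star_mult[OF gy f] integrable_star_mult[OF gy gy]
      by simp
    finally have d: "L2_ip M ?d ?d = L2_ip M f f - star u * y - star y * u + star y * L2_ip M g g * y"
      using i1 i2 i3 by simp
    have "cpos (norm (L2_ip M g g) *\<^sub>R (star y * y) - star y * L2_ip M g g * y)"
      by (rule cpos_conj[OF cpos_L2_ip])
    moreover have "cpos ((N - norm (L2_ip M g g)) *\<^sub>R (star y * y))"
      using N by (intro cpos_scaleR cpos_star_mult) simp
    \<comment> \<open>The two added positive terms replace \<open>star y * L2_ip M g g * y\<close>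
      by \<open>N *\<^sub>R (star y * y)\<close>; since \<open>y\<close> is \<open>u\<close> divided
      by \<open>N\<close>, all terms in \<open>y\<close> then combine into one multiple of
      \<open>star u * u\<close>.\<close>
    ultimately have "cpos (L2_ip M ?d ?d + ((norm (L2_ip M g g) *\<^sub>R (star y * y) - star y * L2_ip M g g * y)
        + (N - norm (L2_ip M g g)) *\<^sub>R (star y * y)))"
      by (intro cpos_add cpos_L2_ip)
    also have "L2_ip M ?d ?d + ((norm (L2_ip M g g) *\<^sub>R (star y * y) - star y * L2_ip M g g * y)
        + (N - norm (L2_ip M g g)) *\<^sub>R (star y * y)) =
        L2_ip M f f - star u * y - star y * u + N *\<^sub>R (star y * y)"
      unfolding d by (simp add: scaleR_left_diff_distrib)
    also have "star u * y = (1/N) *\<^sub>R (star u * u)" by (simp add: y_def)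
    also have "star y * u = (1/N) *\<^sub>R (star u * u)" by (simp add: y_def star_scaleR)
    also have "N *\<^sub>R (star y * y) = (1/N) *\<^sub>R (star u * u)" using N0 by (simp add: y_def star_scaleR)
    finally have "cpos (L2_ip M f f - (1/N) *\<^sub>R (star u * u))" by simp
    moreover have "cpos ((1/N) *\<^sub>R (star u * u))" using N0 by (intro cpos_scaleR cpos_star_mult) simp
    ultimately have "norm ((1/N) *\<^sub>R (star u * u)) \<le> norm (L2_ip M f f)" using cpos_norm_mono by blast
    then show ?thesis using N0 by (simp add: cstar_identity field_simps)
  qed
  have "(norm u)\<^sup>2 \<le> norm (L2_ip M g g) * norm (L2_ip M f f)"
  proof (rule tendsto_lowerbound)
    show "((\<lambda>N. N * norm (L2_ip M f f)) \<longlongrightarrow> norm (L2_ip M g g) * norm (L2_ip M f f)) (at_right (norm (L2_ip M g g)))"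
      by (intro tendsto_intros)
    show "\<forall>\<^sub>F N in at_right (norm (L2_ip M g g)). (norm u)\<^sup>2 \<le> N * norm (L2_ip M f f)"
      using key by (auto simp: eventually_at_right_field intro: exI[of _ "norm (L2_ip M g g) + 1"])
  qed simp
  then show ?thesis using su by (metis mult.commute norm_star)
qed

definition L2_norm :: "'b measure \<Rightarrow> ('b \<Rightarrow> 'a::separable_cstar_algebra) \<Rightarrow> real" where
  "L2_norm M f = sqrt (norm (L2_ip M f f))"

lemma L2_norm_nonneg [simp]: "L2_norm M f \<ge> 0"
  by (simp add: L2_norm_def)

lemma L2_norm_power2: "(L2_norm M f)\<^sup>2 = norm (L2_ip M f f)"
  by (simp add: L2_norm_def)

lemma norm_L2_ip_le: "L2 M f \<Longrightarrow> L2 M g \<Longrightarrow> norm (L2_ip M f g) \<le> L2_norm M f * L2_norm M g"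
  by (rule power2_le_imp_le) (use L2_ip_Cauchy_Schwarz[of M f g] in \<open>auto simp: power_mult_distrib L2_norm_power2\<close>)

lemma L2_norm_triangle:
  assumes f: "L2 M f" and g: "L2 M g" shows "L2_norm M (\<lambda>x. f x + g x) \<le> L2_norm M f + L2_norm M g"
proof (rule power2_le_imp_le)
  have "L2_ip M (\<lambda>x. f x + g x) (\<lambda>x. f x + g x) = (\<integral>x. (star (f x) * f x + star (f x) * g x) +
      (star (g x) * f x + star (g x) * g x) \<partial>M)"
    unfolding L2_ip_def by (simp add: star_add algebra_simps)
  also have "\<dots> = (L2_ip M f f + L2_ip M f g) + (L2_ip M g f + L2_ip M g g)"
    unfolding L2_ip_def using integrable_star_mult[OF f f] integrable_star_mult[OF f g]
        integrable_star_mult[OF g f] integrable_star_mult[OF g g] by simp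
  finally have "(L2_norm M (\<lambda>x. f x + g x))\<^sup>2 \<le> norm (L2_ip M f f) + norm (L2_ip M f g) + (norm (L2_ip M g f) + norm (L2_ip M g g))"
    unfolding L2_norm_power2 by (simp only:) (intro order_trans[OF norm_triangle_ineq] add_mono norm_triangle_ineq)
  also have "\<dots> \<le> (L2_norm M f)\<^sup>2 + L2_norm M f * L2_norm M g + (L2_norm M g * L2_norm M f + (L2_norm M g)\<^sup>2)"
    using norm_L2_ip_le[OF f g] norm_L2_ip_le[OF g f] unfolding L2_norm_power2 by linarith
  also have "\<dots> = (L2_norm M f + L2_norm M g)\<^sup>2" by (simp add: power2_sum)
  finally show "(L2_norm M (\<lambda>x. f x + g x))\<^sup>2 \<le> (L2_norm M f + L2_norm M g)\<^sup>2" .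
qed simp

lemma L2_norm_scaleC: "L2_norm M (\<lambda>x. c *\<^sub>C f x) = cmod c * L2_norm M f"
proof -
  have "star (c *\<^sub>C x) * (c *\<^sub>C x) = (cmod c)\<^sup>2 *\<^sub>R (star x * x)" for x :: 'b
    by (simp add: star_scaleC mult_scaleC_left mult_scaleC_right scaleC_scaleC
        complex_norm_square[symmetric] mult.commute[of "cnj c"] flip: scaleC_of_real)
  then have "L2_ip M (\<lambda>x. c *\<^sub>C f x) (\<lambda>x. c *\<^sub>C f x) = (cmod c)\<^sup>2 *\<^sub>R L2_ip M f f"
    unfolding L2_ip_def by simp
  then show ?thesis by (simp add: L2_norm_def real_sqrt_mult)
qed

lemma L2_norm_zero [simp]: "L2_norm M (\<lambda>x. 0) = 0"
  by (simp add: L2_norm_def L2_ip_def)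

lemma L2_norm_minus_commute: "L2_norm M (\<lambda>x. f x - g x) = L2_norm M (\<lambda>x. g x - f x)"
proof -
  have "star (f x - g x) * (f x - g x) = star (g x - f x) * (g x - f x)" for x
    by (simp add: star_diff algebra_simps)
  then show ?thesis by (simp add: L2_norm_def L2_ip_def)
qed

text \<open>\<open>cpos_conj_star\<close> compares \<open>star (c x * u x) * (c x * u x)\<close>
  with a multiple of \<open>star (u x) * u x\<close> at each point, and this order inequality is
  integrated. Pointwise norms would only give a bound by the integral of the squared norms of
  \<open>u\<close>.\<close>

lemma L2_norm_mult_le:
  assumes u: "L2 M u" and c: "c \<in> borel_measurable M" "\<And>x. norm (c x) \<le> B"
  shows "L2 M (\<lambda>x. c x * u x)" "L2_norm M (\<lambda>x. c x * u x) \<le> B * L2_norm M u"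
proof -
  show L: "L2 M (\<lambda>x. c x * u x)"
    by (rule L2_bound[OF u, of _ B])
      (use c u in \<open>auto simp: L2_def intro!: order_trans[OF norm_mult_ineq] mult_right_mono\<close>)
  have B: "B \<ge> 0" using c(2)[of undefined] norm_ge_zero order_trans by blast
  have "cpos (B\<^sup>2 *\<^sub>R (star (u x) * u x) - star (c x * u x) * (c x * u x))" for x
  proof -
    have "(norm (c x))\<^sup>2 \<le> B\<^sup>2" using c(2) by (intro power_mono) auto
    then have "cpos ((B\<^sup>2 - (norm (c x))\<^sup>2) *\<^sub>R (star (u x) * u x))"
      by (intro cpos_scaleR cpos_star_mult) simp
    from cpos_add[OF this cpos_conj_star[of "c x" "u x"]] show ?thesis
      by (simp add: scaleR_left_diff_distrib)
  qed
  then have "cpos (\<integral>x. B\<^sup>2 *\<^sub>R (star (u x) * u x) - star (c x * u x) * (c x * u x) \<partial>M)"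
    by (rule cpos_integral)
  also have "\<dots> = B\<^sup>2 *\<^sub>R L2_ip M u u - L2_ip M (\<lambda>x. c x * u x) (\<lambda>x. c x * u x)"
    unfolding L2_ip_def using integrable_star_mult[OF u u] integrable_star_mult[OF L L] by simp
  finally have "norm (L2_ip M (\<lambda>x. c x * u x) (\<lambda>x. c x * u x)) \<le> norm (B\<^sup>2 *\<^sub>R L2_ip M u u)"
    by (intro cpos_norm_mono cpos_L2_ip)
  then have "(L2_norm M (\<lambda>x. c x * u x))\<^sup>2 \<le> (B * L2_norm M u)\<^sup>2" by (simp add: L2_norm_power2 power_mult_distrib)
  then show "L2_norm M (\<lambda>x. c x * u x) \<le> B * L2_norm M u" by (rule power2_le_imp_le) (simp add: B)
qed

lemma ip_eq: "ip = L2_ip lborel"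
  by (intro ext) (simp add: ip_def L2_ip_def)

lemma norm2_eq: "norm2 = L2_norm lborel"
  by (intro ext) (simp add: norm2_def L2_norm_def ip_eq)

section \<open>Iterated partial derivatives\<close>

lemma has_vector_derivative_line:
  assumes "(f has_derivative D) (at (x + t *\<^sub>R v))"
  shows "((\<lambda>t. f (x + t *\<^sub>R v)) has_vector_derivative D v) (at t)"
proof -
  have "((\<lambda>t. x + t *\<^sub>R v) has_derivative (\<lambda>s. s *\<^sub>R v)) (at t)"
    by (auto intro!: derivative_eq_intros)
  then have "((\<lambda>t. f (x + t *\<^sub>R v)) has_derivative (\<lambda>s. D (s *\<^sub>R v))) (at t)"
    using has_derivative_compose assms by blast
  moreover have "D (s *\<^sub>R v) = s *\<^sub>R D v" for s
    using assms has_derivative_linear linear_scale by blast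
  ultimately show ?thesis by (simp add: has_vector_derivative_def)
qed

lemma partial_deriv_eq:
  assumes "(f has_derivative D) (at x)" shows "partial_deriv v f x = D v"
  unfolding partial_deriv_def
  by (rule vector_derivative_at) (use has_vector_derivative_line[of f D x 0 v] assms in simp)

lemma has_vector_derivative_partial:
  assumes "f differentiable (at (x + t *\<^sub>R v))"
  shows "((\<lambda>t. f (x + t *\<^sub>R v)) has_vector_derivative partial_deriv v f (x + t *\<^sub>R v)) (at t)"
proof -
  obtain D where D: "(f has_derivative D) (at (x + t *\<^sub>R v))" using assms differentiable_def by blast
  show ?thesis using has_vector_derivative_line[OF D] partial_deriv_eq[OF D, of v] by simp
qed

lemma vector_mvt:
  fixes \<phi> :: "real \<Rightarrow> 'a::real_normed_vector"
  assumes "\<And>t. 0 \<le> t \<Longrightarrow> t \<le> h \<Longrightarrow> (\<phi> has_vector_derivative \<phi>' t) (at t)"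
    and "\<And>t. 0 \<le> t \<Longrightarrow> t \<le> h \<Longrightarrow> norm (\<phi>' t) \<le> B" and "0 \<le> h"
  shows "norm (\<phi> h - \<phi> 0) \<le> B * h"
proof -
  have "norm (\<phi> h - \<phi> 0) \<le> B * norm (h - 0)"
  proof (rule differentiable_bound[where S = "{0..h}" and f' = "\<lambda>t s. s *\<^sub>R \<phi>' t"])
    show "(\<phi> has_derivative (\<lambda>s. s *\<^sub>R \<phi>' t)) (at t within {0..h})" if "t \<in> {0..h}" for t
      using assms(1)[of t] that
      by (auto simp: has_vector_derivative_def intro: has_derivative_at_withinI)
    show "onorm (\<lambda>s. s *\<^sub>R \<phi>' t) \<le> B" if "t \<in> {0..h}" for t
      using assms(2)[of t] that by (simp add: onorm_scaleR_left[OF bounded_linear_ident] onorm_id)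
  qed (use assms(3) in auto)
  then show ?thesis using assms(3) by simp
qed

text \<open>Two applications of the mean value inequality: along \<open>v\<close> to
  \<open>partial_deriv u f\<close>, then along \<open>u\<close> to the difference of the translates
  of \<open>f\<close> by \<open>h *\<^sub>R v\<close> and by 0.\<close>

lemma second_difference_bound:
  fixes f :: "'b::real_normed_vector \<Rightarrow> 'a::real_normed_vector"
  assumes f: "\<And>y. f differentiable (at y)" and fu: "\<And>y. partial_deriv u f differentiable (at y)"
    and c: "isCont (partial_deriv v (partial_deriv u f)) x" and e: "e > 0"
  shows "\<exists>d>0. \<forall>h. 0 < h \<and> h < d \<longrightarrow>
    norm (f (x + h *\<^sub>R u + h *\<^sub>R v) - f (x + h *\<^sub>R u) - f (x + h *\<^sub>R v) + f x
      - (h * h) *\<^sub>R partial_deriv v (partial_deriv u f) x) \<le> e * (h * h)"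
proof -
  let ?g = "partial_deriv v (partial_deriv u f)"
  obtain s where s: "s > 0" "\<And>y. dist y x < s \<Longrightarrow> dist (?g y) (?g x) < e"
    using c e unfolding continuous_at_eps_delta by metis
  \<comment> \<open>Every point reached from \<open>x\<close> by multiples at most
    \<open>h < d\<close> of \<open>u\<close> and \<open>v\<close> stays within \<open>s\<close> of
    \<open>x\<close>; the added 1 covers \<open>u = v = 0\<close>.\<close>
  define d where "d = s / (norm u + norm v + 1)"
  have np: "norm u + norm v + 1 > 0" by (simp add: add_nonneg_pos)
  have "norm (f (x + h *\<^sub>R u + h *\<^sub>R v) - f (x + h *\<^sub>R u) - f (x + h *\<^sub>R v) + f x
      - (h * h) *\<^sub>R ?g x) \<le> e * (h * h)" if h: "0 < h" "h < d" for h
  proof -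
    have near: "norm (?g (x + r *\<^sub>R u + t *\<^sub>R v) - ?g x) \<le> e" if "0 \<le> r" "r \<le> h" "0 \<le> t" "t \<le> h" for r t
    proof -
      have "dist (x + r *\<^sub>R u + t *\<^sub>R v) x \<le> norm (r *\<^sub>R u) + norm (t *\<^sub>R v)"
        by (simp add: dist_norm add.assoc norm_triangle_ineq del: norm_scaleR)
      also have "\<dots> \<le> h * norm u + h * norm v"
        using that by (intro add_mono) (auto intro: mult_right_mono)
      also have "\<dots> \<le> h * (norm u + norm v + 1)" using h by (simp add: algebra_simps)
      also have "\<dots> < s" using h np by (simp add: d_def pos_less_divide_eq)
      finally show ?thesis using s(2) by (metis dist_norm less_imp_le)
    qed
    have inner: "norm (partial_deriv u f (x + r *\<^sub>R u + h *\<^sub>R v) - partial_deriv u f (x + r *\<^sub>R u) - h *\<^sub>R ?g x) \<le> e * h"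
      if r: "0 \<le> r" "r \<le> h" for r
    proof -
      have "norm ((partial_deriv u f (x + r *\<^sub>R u + h *\<^sub>R v) - h *\<^sub>R ?g x) -
          (partial_deriv u f (x + r *\<^sub>R u + 0 *\<^sub>R v) - 0 *\<^sub>R ?g x)) \<le> e * h"
      proof (rule vector_mvt[where \<phi>' = "\<lambda>t. ?g (x + r *\<^sub>R u + t *\<^sub>R v) - ?g x"])
        fix t assume t: "0 \<le> t" "t \<le> h"
        show "((\<lambda>t. partial_deriv u f (x + r *\<^sub>R u + t *\<^sub>R v) - t *\<^sub>R ?g x) has_vector_derivative
            ?g (x + r *\<^sub>R u + t *\<^sub>R v) - ?g x) (at t)"
          by (intro has_vector_derivative_diff has_vector_derivative_partial fu)
            (auto intro!: derivative_eq_intros simp: has_vector_derivative_def)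
        show "norm (?g (x + r *\<^sub>R u + t *\<^sub>R v) - ?g x) \<le> e" using near r t by blast
      qed (use h in auto)
      then show ?thesis by (simp add: algebra_simps)
    qed
    have "norm ((f (x + h *\<^sub>R v + h *\<^sub>R u) - f (x + h *\<^sub>R u) - h *\<^sub>R (h *\<^sub>R ?g x)) -
        (f (x + h *\<^sub>R v + 0 *\<^sub>R u) - f (x + 0 *\<^sub>R u) - 0 *\<^sub>R (h *\<^sub>R ?g x))) \<le> (e * h) * h"
    proof (rule vector_mvt[where \<phi>' = "\<lambda>t. partial_deriv u f (x + h *\<^sub>R v + t *\<^sub>R u) - partial_deriv u f (x + t *\<^sub>R u) - h *\<^sub>R ?g x"])
      fix t assume t: "0 \<le> t" "t \<le> h"
      show "((\<lambda>t. f (x + h *\<^sub>R v + t *\<^sub>R u) - f (x + t *\<^sub>R u) - t *\<^sub>R (h *\<^sub>R ?g x)) has_vector_derivative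
          partial_deriv u f (x + h *\<^sub>R v + t *\<^sub>R u) - partial_deriv u f (x + t *\<^sub>R u) - h *\<^sub>R ?g x) (at t)"
        by (intro has_vector_derivative_diff has_vector_derivative_partial f)
          (auto intro!: derivative_eq_intros simp: has_vector_derivative_def)
      show "norm (partial_deriv u f (x + h *\<^sub>R v + t *\<^sub>R u) - partial_deriv u f (x + t *\<^sub>R u) - h *\<^sub>R ?g x) \<le> e * h"
        using inner[OF t] by (simp add: add_ac)
    qed (use h in auto)
    then show ?thesis by (simp add: algebra_simps)
  qed
  moreover have "d > 0" using s np by (simp add: d_def)
  ultimately show ?thesis by blast
qed

text \<open>The second difference is symmetric in \<open>u\<close> and \<open>v\<close>, and
  \<open>second_difference_bound\<close> compares it with either mixed derivative.\<close>

lemma partial_deriv_commute: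
  fixes f :: "'b::real_normed_vector \<Rightarrow> 'a::real_normed_vector"
  assumes f: "\<And>y. f differentiable (at y)" and fu: "\<And>y. partial_deriv u f differentiable (at y)"
    and fv: "\<And>y. partial_deriv v f differentiable (at y)"
    and cu: "isCont (partial_deriv v (partial_deriv u f)) x"
    and cv: "isCont (partial_deriv u (partial_deriv v f)) x"
  shows "partial_deriv v (partial_deriv u f) x = partial_deriv u (partial_deriv v f) x" (is "?a = ?b")
proof -
  have "norm (?a - ?b) \<le> 0 + e" if e: "e > 0" for e
  proof -
    let ?D = "\<lambda>h. f (x + h *\<^sub>R u + h *\<^sub>R v) - f (x + h *\<^sub>R u) - f (x + h *\<^sub>R v) + f x"
    obtain d1 where d1: "d1 > 0" "\<And>h. 0 < h \<Longrightarrow> h < d1 \<Longrightarrow> norm (?D h - (h * h) *\<^sub>R ?a) \<le> e/2 * (h * h)"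
      using second_difference_bound[OF f fu cu, of "e/2"] e by auto
    obtain d2 where d2: "d2 > 0" "\<And>h. 0 < h \<Longrightarrow> h < d2 \<Longrightarrow>
        norm (f (x + h *\<^sub>R v + h *\<^sub>R u) - f (x + h *\<^sub>R v) - f (x + h *\<^sub>R u) + f x - (h * h) *\<^sub>R ?b) \<le> e/2 * (h * h)"
      using second_difference_bound[OF f fv cv, of "e/2"] e by auto
    define h where "h = min d1 d2 / 2"
    have h: "0 < h" "h < d1" "h < d2" using d1 d2 by (auto simp: h_def)
    have "(h * h) *\<^sub>R (?a - ?b) = (?D h - (h * h) *\<^sub>R ?b) - (?D h - (h * h) *\<^sub>R ?a)"
      by (simp add: algebra_simps)
    moreover have "norm (?D h - (h * h) *\<^sub>R ?b) \<le> e/2 * (h * h)"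
      using d2(2)[OF h(1,3)] by (simp add: algebra_simps)
    ultimately have "norm ((h * h) *\<^sub>R (?a - ?b)) \<le> e/2 * (h * h) + e/2 * (h * h)"
      using d1(2)[OF h(1,2)] norm_triangle_ineq4 by (smt (verit))
    then have "(h * h) * norm (?a - ?b) \<le> (h * h) * e" unfolding norm_scaleR by (simp add: mult.commute)
    then show ?thesis using h by simp
  qed
  then have "norm (?a - ?b) \<le> 0" by (rule field_le_epsilon)
  then show ?thesis by simp
qed

lemma iter_partial_append: "iter_partial (vs @ ws) f = iter_partial vs (iter_partial ws f)"
  by (induction vs) auto

lemma smooth_differentiable: "smooth f \<Longrightarrow> f differentiable (at x)"
  unfolding smooth_def using differentiable_on_eq_differentiable_at[of UNIV f]
  by (metis iter_partial.simps(1) lists.Nil UNIV_I open_UNIV)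

lemma smooth_iter_partial: "smooth f \<Longrightarrow> vs \<in> lists Basis \<Longrightarrow> smooth (iter_partial vs f)"
  unfolding smooth_def by (metis append_in_lists_conv iter_partial_append)

lemma smooth_partial_deriv: "smooth f \<Longrightarrow> b \<in> Basis \<Longrightarrow> smooth (partial_deriv b f)"
  using smooth_iter_partial[of f "[b]"] by simp

lemma iter_partial_swap:
  assumes "smooth f" "u \<in> Basis" "v \<in> Basis"
  shows "partial_deriv v (partial_deriv u f) = partial_deriv u (partial_deriv v f)"
  by (intro ext partial_deriv_commute smooth_differentiable differentiable_imp_continuous_within
      smooth_partial_deriv assms)

lemma iter_partial_move:
  assumes "smooth f" "xs \<in> lists Basis" "ys \<in> lists Basis" "y \<in> Basis"
  shows "iter_partial (xs @ y # ys) f = iter_partial (y # xs @ ys) f"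
  using assms(2)
proof (induction xs)
  case (Cons x xs)
  have "iter_partial ((x # xs) @ y # ys) f = partial_deriv x (partial_deriv y (iter_partial (xs @ ys) f))"
    using Cons by simp
  also have "\<dots> = partial_deriv y (partial_deriv x (iter_partial (xs @ ys) f))"
    using Cons assms by (intro iter_partial_swap smooth_iter_partial) auto
  finally show ?case by simp
qed simp

text \<open>Makes the order chosen by \<open>index_list\<close> immaterial, so that multi-index
  derivatives can be handled as lists in any convenient order.\<close>

lemma iter_partial_perm:
  assumes "smooth f" "vs \<in> lists Basis" "mset vs = mset ws"
  shows "iter_partial vs f = iter_partial ws f"
  using assms(2,3)
proof (induction vs arbitrary: ws)
  case (Cons v vs)
  from Cons.prems have "v \<in> set ws" by (metis list.set_intros(1) set_mset_mset)
  then obtain a b where ws: "ws = a @ v # b" by (meson split_list)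
  have "set (v # vs) = set ws" using Cons.prems mset_eq_setD by blast
  moreover have "set (v # vs) \<subseteq> Basis" using Cons.hyps by auto
  ultimately have ab: "a \<in> lists Basis" "b \<in> lists Basis" "v \<in> Basis" by (auto simp: ws)
  have "iter_partial vs f = iter_partial (a @ b) f"
    using Cons.prems ws by (intro Cons.IH) auto
  then show ?case using iter_partial_move[OF assms(1) ab] ws by simp
qed simp

text \<open>Coinduction for smoothness: a family of differentiable functions closed under basis
  derivatives replaces explicit formulas for iterated derivatives. The second conclusion carries
  further properties of the family over to all derivatives.\<close>

lemma smooth_coinduct:
  assumes "f \<in> F" "\<And>g. g \<in> F \<Longrightarrow> g differentiable_on UNIV"
    "\<And>g b. g \<in> F \<Longrightarrow> b \<in> Basis \<Longrightarrow> partial_deriv b g \<in> F"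
  shows "smooth f" "vs \<in> lists Basis \<Longrightarrow> iter_partial vs f \<in> F"
proof -
  have *: "iter_partial vs f \<in> F" if "vs \<in> lists Basis" for vs
    using that by induction (auto simp: assms)
  then show "vs \<in> lists Basis \<Longrightarrow> iter_partial vs f \<in> F" .
  show "smooth f" unfolding smooth_def using * assms(2) by blast
qed

lemma partial_deriv_add:
  assumes "f differentiable (at x)" "g differentiable (at x)"
  shows "partial_deriv v (\<lambda>x. f x + g x) x = partial_deriv v f x + partial_deriv v g x"
proof -
  obtain D D' where "(f has_derivative D) (at x)" "(g has_derivative D') (at x)"
    using assms by (auto simp: differentiable_def)
  then show ?thesis
    using partial_deriv_eq[of f D x v] partial_deriv_eq[of g D' x v]
      partial_deriv_eq[OF has_derivative_add, of f D x g D' v] by simp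
qed

lemma partial_deriv_linear:
  assumes "bounded_linear h" "f differentiable (at x)"
  shows "partial_deriv v (\<lambda>x. h (f x)) x = h (partial_deriv v f x)"
proof -
  obtain D where "(f has_derivative D) (at x)"
    using assms by (auto simp: differentiable_def)
  then show ?thesis
    using partial_deriv_eq[of f D x v]
      partial_deriv_eq[OF bounded_linear.has_derivative[OF assms(1)], of f D x v] by simp
qed

lemma differentiable_linear:
  "bounded_linear h \<Longrightarrow> f differentiable F \<Longrightarrow> (\<lambda>x. h (f x)) differentiable F"
  unfolding differentiable_def using bounded_linear.has_derivative by blast

section \<open>Bounded smooth functions\<close>

lemma CB_smooth: "f \<in> CB_infty \<Longrightarrow> smooth f"
  by (simp add: CB_infty_def)

lemma CB_bounded:
  assumes "f \<in> CB_infty" obtains B where "B > 0" "\<And>x. norm (f x) \<le> B"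
proof -
  have "bounded (range (iter_partial [] f))" using assms unfolding CB_infty_def by blast
  then show ?thesis using that unfolding bounded_pos by auto
qed

lemma CB_partial_deriv:
  assumes "f \<in> CB_infty" "b \<in> Basis" shows "partial_deriv b f \<in> CB_infty"
proof -
  have "bounded (range (iter_partial vs (partial_deriv b f)))" if "vs \<in> lists Basis" for vs
  proof -
    have "vs @ [b] \<in> lists Basis" using that assms(2) by simp
    then have "bounded (range (iter_partial (vs @ [b]) f))" using assms(1) unfolding CB_infty_def by blast
    then show ?thesis by (simp add: iter_partial_append)
  qed
  then show ?thesis using assms smooth_partial_deriv unfolding CB_infty_def by blast
qed

lemma CB_iter_partial: "f \<in> CB_infty \<Longrightarrow> vs \<in> lists Basis \<Longrightarrow> iter_partial vs f \<in> CB_infty"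
  by (induction vs) (simp_all add: CB_partial_deriv)

lemma smooth_add_iter:
  assumes "smooth f" "smooth g" "vs \<in> lists Basis"
  shows "iter_partial vs (\<lambda>x. f x + g x) = (\<lambda>x. iter_partial vs f x + iter_partial vs g x)"
  using assms(3)
proof (induction vs)
  case (Cons v vs)
  then show ?case
    by (auto intro!: partial_deriv_add smooth_differentiable smooth_iter_partial assms)
qed simp

lemma smooth_linear_iter:
  assumes "bounded_linear h" "smooth f" "vs \<in> lists Basis"
  shows "iter_partial vs (\<lambda>x. h (f x)) = (\<lambda>x. h (iter_partial vs f x))"
  using assms(3)
proof (induction vs)
  case (Cons v vs)
  then show ?case
    by (auto intro!: partial_deriv_linear smooth_differentiable smooth_iter_partial assms)
qed simp

lemma smooth_add:
  assumes f: "smooth f" and g: "smooth g" shows "smooth (\<lambda>x. f x + g x)"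
  unfolding smooth_def
proof
  fix vs :: "'a list" assume vs: "vs \<in> lists Basis"
  show "iter_partial vs (\<lambda>x. f x + g x) differentiable_on UNIV"
    unfolding smooth_add_iter[OF f g vs]
    using f g vs by (intro differentiable_on_add) (auto simp: smooth_def)
qed

lemma smooth_linear:
  fixes f :: "'b::euclidean_space \<Rightarrow> _"
  assumes h: "bounded_linear h" and f: "smooth f" shows "smooth (\<lambda>x. h (f x))"
  unfolding smooth_def
proof
  fix vs :: "'b list" assume vs: "vs \<in> lists Basis"
  show "iter_partial vs (\<lambda>x. h (f x)) differentiable_on UNIV"
    unfolding smooth_linear_iter[OF h f vs]
    using f vs by (auto simp: smooth_def differentiable_on_def intro!: differentiable_linear[OF h])
qed

lemma CB_add:
  assumes "f \<in> CB_infty" "g \<in> CB_infty" shows "(\<lambda>x. f x + g x) \<in> CB_infty"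
proof -
  have "bounded (range (iter_partial vs (\<lambda>x. f x + g x)))" if vs: "vs \<in> lists Basis" for vs
    unfolding smooth_add_iter[OF CB_smooth CB_smooth vs, OF assms]
  proof -
    obtain B where B: "\<And>x. norm (iter_partial vs f x) \<le> B"
      using CB_bounded[OF CB_iter_partial[OF assms(1) vs]] by metis
    obtain C where C: "\<And>x. norm (iter_partial vs g x) \<le> C"
      using CB_bounded[OF CB_iter_partial[OF assms(2) vs]] by metis
    show "bounded (range (\<lambda>x. iter_partial vs f x + iter_partial vs g x))"
      unfolding bounded_iff using B C by (intro exI[of _ "B + C"]) (auto intro: norm_triangle_mono)
  qed
  then show ?thesis using assms smooth_add unfolding CB_infty_def by blast
qed

lemma CB_linear:
  assumes h: "bounded_linear h" and f: "f \<in> CB_infty" shows "(\<lambda>x. h (f x)) \<in> CB_infty"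
proof -
  have "bounded (range (iter_partial vs (\<lambda>x. h (f x))))" if vs: "vs \<in> lists Basis" for vs
    unfolding smooth_linear_iter[OF h CB_smooth[OF f] vs]
    using f vs bounded_linear_image[OF _ h, of "range (iter_partial vs f)"]
    by (auto simp: CB_infty_def image_image)
  then show ?thesis using f smooth_linear[OF h] unfolding CB_infty_def by blast
qed

lemma CB_diff:
  assumes "f \<in> CB_infty" "g \<in> CB_infty" shows "(\<lambda>x. f x - g x) \<in> CB_infty"
  using CB_add[OF assms(1) CB_linear[OF bounded_linear_minus[OF bounded_linear_ident] assms(2)]] by simp

section \<open>Schwartz functions\<close>

lemma axis_Basis [simp]: "axis i (1::real) \<in> Basis"
  by (auto simp: Basis_vec_def)

lemma Basis_vec_eq: "Basis = range (\<lambda>i. axis i (1::real))"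
  by (auto simp: Basis_vec_def)

definition monomial :: "('n::finite \<Rightarrow> nat) \<Rightarrow> real ^ 'n \<Rightarrow> real" where
  "monomial \<alpha> x = (\<Prod>i\<in>UNIV. (x $ i) ^ \<alpha> i)"

lemma monomial_mult: "monomial (\<alpha>(j := Suc (\<alpha> j))) x = x $ j * monomial \<alpha> x"
  by (simp add: monomial_def prod.remove[of UNIV j] mult.assoc)

text \<open>The same coinductive principle for \<open>schwartz\<close>: boundedness, derivatives and
  coordinate factors are checked once on the family \<open>F\<close>, and no iterated derivative of
  a concrete function has to be computed.\<close>

lemma schwartzI:
  fixes F :: "(real ^ 'n \<Rightarrow> 'a::real_normed_vector) set"
  assumes "f \<in> F" and d: "\<And>g x. g \<in> F \<Longrightarrow> g differentiable (at x)"
    and b: "\<And>g. g \<in> F \<Longrightarrow> bounded (range g)"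
    and p: "\<And>g j. g \<in> F \<Longrightarrow> partial_deriv (axis j 1) g \<in> F"
    and m: "\<And>g j. g \<in> F \<Longrightarrow> (\<lambda>x. x $ j *\<^sub>R g x) \<in> F"
  shows "f \<in> schwartz"
proof -
  have sm: "smooth f" and it: "iter_partial vs f \<in> F" if "vs \<in> lists Basis" for vs
    by (rule smooth_coinduct[OF assms(1)]; use d p that in \<open>auto simp: Basis_vec_eq differentiable_on_eq_differentiable_at\<close>)+
  have pw: "(\<lambda>x. (x $ j) ^ k *\<^sub>R g x) \<in> F" if "g \<in> F" for g j k
  proof (induction k)
    case (Suc k)
    then show ?case using m[OF Suc, of j] by simp
  qed (use that in simp)
  have mono: "(\<lambda>x. (\<Prod>i\<in>I. (x $ i) ^ \<alpha> i) *\<^sub>R g x) \<in> F" if "g \<in> F" "finite I" for g I and \<alpha> :: "'n \<Rightarrow> nat"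
    using that(2)
  proof induction
    case (insert j I)
    then show ?case using pw[OF insert.IH, of j "\<alpha> j"] by simp
  qed (use that in simp)
  have "deriv_vec \<beta> f \<in> F" for \<beta>
    unfolding multi_deriv_def by (rule it) (auto simp: lists_eq_set)
  then show ?thesis unfolding schwartz_def using sm[of "[]"] mono[of _ UNIV] b by auto
qed

text \<open>In \<open>schwartz\<close> monomials stand only in front of derivatives. This closure is
  stable under both operations in any order, so that \<open>schwartzI\<close> applies to it and
  every member is seen to be Schwartz.\<close>

inductive_set sgen :: "(real ^ 'n \<Rightarrow> 'a) \<Rightarrow> (real ^ 'n \<Rightarrow> 'a::real_normed_vector) set" for f where
  base: "vs \<in> lists Basis \<Longrightarrow> iter_partial vs f \<in> sgen f"
| mul: "g \<in> sgen f \<Longrightarrow> (\<lambda>x. x $ j *\<^sub>R g x) \<in> sgen f"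
| add: "g \<in> sgen f \<Longrightarrow> h \<in> sgen f \<Longrightarrow> (\<lambda>x. g x + h x) \<in> sgen f"
| zero: "(\<lambda>x. 0) \<in> sgen f"

lemma partial_deriv_const [simp]: "partial_deriv v (\<lambda>x. c) = (\<lambda>x. 0)"
  using partial_deriv_eq[OF has_derivative_const] by auto

lemma has_derivative_coord_mult:
  assumes "(g has_derivative D) (at x)"
  shows "((\<lambda>x. x $ j *\<^sub>R g x) has_derivative (\<lambda>h. x $ j *\<^sub>R D h + h $ j *\<^sub>R g x)) (at x)"
  by (intro has_derivative_scaleR assms bounded_linear_imp_has_derivative bounded_linear_vec_nth)

lemma partial_deriv_coord_mult:
  assumes "g differentiable (at x)"
  shows "partial_deriv v (\<lambda>x. x $ j *\<^sub>R g x) x = x $ j *\<^sub>R partial_deriv v g x + v $ j *\<^sub>R g x"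
proof -
  obtain D where "(g has_derivative D) (at x)" using assms by (auto simp: differentiable_def)
  then show ?thesis using partial_deriv_eq[of g D x v] partial_deriv_eq[OF has_derivative_coord_mult, of g D x v j] by simp
qed

lemma sgen_differentiable: "g \<in> sgen f \<Longrightarrow> smooth f \<Longrightarrow> g differentiable (at x)"
proof (induction rule: sgen.induct)
  case (mul g j)
  then show ?case using has_derivative_coord_mult unfolding differentiable_def by blast
next
  case (base vs)
  then show ?case by (intro smooth_differentiable smooth_iter_partial)
qed auto

lemma sgen_partial_deriv:
  assumes "g \<in> sgen f" "smooth f" shows "partial_deriv (axis i 1) g \<in> sgen f"
  using assms(1)
proof (induction rule: sgen.induct)
  case (base vs)
  then show ?case using sgen.base[of "axis i 1 # vs" f] by simp
next
  case (mul g j)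
  have "partial_deriv (axis i 1) (\<lambda>x. x $ j *\<^sub>R g x) =
      (\<lambda>x. x $ j *\<^sub>R partial_deriv (axis i 1) g x + axis i 1 $ j *\<^sub>R g x)"
    using sgen_differentiable[OF mul.hyps assms(2)] partial_deriv_coord_mult by blast
  also have "\<dots> \<in> sgen f"
  proof (cases "i = j")
    case True
    then show ?thesis using sgen.add[OF sgen.mul[OF mul.IH] mul.hyps] by simp
  next
    case False
    then show ?thesis using sgen.mul[OF mul.IH] by (simp add: axis_def)
  qed
  finally show ?case .
next
  case (add g h)
  have "partial_deriv (axis i 1) (\<lambda>x. g x + h x) = (\<lambda>x. partial_deriv (axis i 1) g x + partial_deriv (axis i 1) h x)"
    using sgen_differentiable[OF add.hyps(1) assms(2)] sgen_differentiable[OF add.hyps(2) assms(2)]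
    by (intro ext partial_deriv_add) auto
  then show ?case using sgen.add[OF add.IH] by simp
next
  case zero
  then show ?case using sgen.zero by simp
qed

lemma schwartz_smooth: "f \<in> schwartz \<Longrightarrow> smooth f"
  by (simp add: schwartz_def)

text \<open>Counting the entries of the list produces the multi-index; the order does not matter by
  \<open>iter_partial_perm\<close>.\<close>

lemma schwartz_bounded_monomial:
  fixes f :: "real ^ 'n \<Rightarrow> 'a::real_normed_vector"
  assumes f: "f \<in> schwartz" and vs: "vs \<in> lists Basis"
  shows "bounded (range (\<lambda>x. monomial \<alpha> x *\<^sub>R iter_partial vs f x))"
proof -
  have "\<exists>ks. vs = map (\<lambda>i. axis i (1::real)) ks"
    using vs by (induction vs) (auto simp: Basis_vec_eq, metis list.simps(9))
  then obtain ks where ks: "vs = map (\<lambda>i. axis i (1::real)) ks" by blast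
  define \<beta> :: "nat ^ 'n" where "\<beta> = (\<chi> i. count_list ks i)"
  have "mset (index_list \<beta>) = mset ks"
    by (rule multiset_eqI) (simp add: count_mset count_index_list \<beta>_def)
  then have "mset (map (\<lambda>i. axis i (1::real)) (index_list \<beta>)) = mset vs" by (simp add: ks)
  then have "iter_partial vs f = deriv_vec \<beta> f"
    unfolding multi_deriv_def by (intro iter_partial_perm[OF schwartz_smooth[OF f] vs]) simp
  moreover have "bounded (range (\<lambda>x. (\<Prod>i\<in>UNIV. (x $ i) ^ ((\<chi> i. \<alpha> i) $ i)) *\<^sub>R deriv_vec \<beta> f x))"
    using f unfolding schwartz_def by blast
  ultimately show ?thesis by (simp add: monomial_def)
qed

text \<open>The exponent stays arbitrary in the induction, because a coordinate factor is absorbed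
  by raising one of its entries.\<close>

lemma sgen_bounded_monomial:
  assumes "g \<in> sgen f" "f \<in> schwartz"
  shows "bounded (range (\<lambda>x. monomial \<alpha> x *\<^sub>R g x))"
  using assms(1)
proof (induction arbitrary: \<alpha> rule: sgen.induct)
  case (base vs)
  then show ?case using schwartz_bounded_monomial assms(2) by blast
next
  case (mul g j)
  show ?case using mul.IH[of "\<alpha>(j := Suc (\<alpha> j))"]
    unfolding monomial_mult by (simp add: mult.commute)
next
  case (add g h)
  show ?case using bounded_plus_comp[OF add.IH(1)[of \<alpha>] add.IH(2)[of \<alpha>]]
    by (simp add: scaleR_add_right)
qed simp

lemma sgen_schwartz:
  assumes g: "g \<in> sgen f" and f: "f \<in> schwartz"
  shows "g \<in> schwartz"
proof (rule schwartzI[of g "sgen f"])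
  fix h assume h: "h \<in> sgen f"
  show "bounded (range h)" using sgen_bounded_monomial[OF h f, of "\<lambda>_. 0"] by (simp add: monomial_def)
  show "h differentiable (at x)" for x by (rule sgen_differentiable[OF h schwartz_smooth[OF f]])
  show "partial_deriv (axis j 1) h \<in> sgen f" for j by (rule sgen_partial_deriv[OF h schwartz_smooth[OF f]])
  show "(\<lambda>x. x $ j *\<^sub>R h x) \<in> sgen f" for j by (rule sgen.mul[OF h])
qed (rule g)

lemma sgen_self: "f \<in> sgen f"
  using sgen.base[of "[]" f] by simp

lemma schwartz_partial_deriv: "f \<in> schwartz \<Longrightarrow> partial_deriv (axis j 1) f \<in> schwartz"
  by (rule sgen_schwartz[OF sgen_partial_deriv[OF sgen_self schwartz_smooth]])

lemma schwartz_coord_mult: "f \<in> schwartz \<Longrightarrow> (\<lambda>x. x $ j *\<^sub>R f x) \<in> schwartz"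
  by (rule sgen_schwartz[OF sgen.mul[OF sgen_self]])

lemma schwartz_bounded:
  assumes "f \<in> schwartz" obtains B where "B > 0" "\<And>x. norm (f x) \<le> B"
  using sgen_bounded_monomial[OF sgen_self assms, of "\<lambda>_. 0"] that
  unfolding bounded_pos by (auto simp: monomial_def)

lemma schwartz_differentiable: "f \<in> schwartz \<Longrightarrow> f differentiable (at x)"
  by (simp add: schwartz_smooth smooth_differentiable)

lemma schwartz_linear:
  fixes h :: "'a::real_normed_vector \<Rightarrow> 'c::real_normed_vector"
  assumes h: "bounded_linear h" and f: "f \<in> schwartz" shows "(\<lambda>x. h (f x)) \<in> schwartz"
proof (rule schwartzI[of _ "{\<lambda>x. h (g x) | g. g \<in> schwartz}"])
  fix k assume "k \<in> {\<lambda>x. h (g x) | g. g \<in> schwartz}"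
  then obtain g where g: "k = (\<lambda>x. h (g x))" "g \<in> schwartz" by blast
  show "k differentiable (at x)" for x
    unfolding g by (intro differentiable_linear[OF h] schwartz_differentiable g)
  obtain B where B: "\<And>x. norm (g x) \<le> B" using schwartz_bounded[OF g(2)] by metis
  have "bounded (range g)" using B by (auto simp: bounded_iff)
  then show "bounded (range k)" unfolding g using bounded_linear_image[OF _ h, of "range g"] by (simp add: image_image)
  show "partial_deriv (axis j 1) k \<in> {\<lambda>x. h (g x) | g. g \<in> schwartz}" for j
    unfolding g using schwartz_partial_deriv[OF g(2), of j] partial_deriv_linear[OF h schwartz_differentiable[OF g(2)]]
    by auto
  show "(\<lambda>x. x $ j *\<^sub>R k x) \<in> {\<lambda>x. h (g x) | g. g \<in> schwartz}" for j
    unfolding g using schwartz_coord_mult[OF g(2), of j] linear_scale[OF bounded_linear.linear[OF h]]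
    by (auto simp: o_def intro!: exI[of _ "\<lambda>x. x $ j *\<^sub>R g x"])
qed (intro CollectI exI[of _ f] conjI refl f)

lemma schwartz_add:
  fixes f g :: "real ^ 'n \<Rightarrow> 'a::real_normed_vector"
  assumes "f \<in> schwartz" "g \<in> schwartz" shows "(\<lambda>x. f x + g x) \<in> schwartz"
proof (rule schwartzI[of _ "{\<lambda>x. f x + g x | f g. f \<in> schwartz \<and> g \<in> schwartz}"])
  fix k :: "real ^ 'n \<Rightarrow> 'a" assume "k \<in> {\<lambda>x. f x + g x | f g. f \<in> schwartz \<and> g \<in> schwartz}"
  then obtain f g where g: "k = (\<lambda>x. f x + g x)" "f \<in> schwartz" "g \<in> schwartz" by blast
  show "k differentiable (at x)" for x
    unfolding g by (intro differentiable_add schwartz_differentiable g)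
  obtain B where B: "\<And>x. norm (f x) \<le> B" using schwartz_bounded[OF g(2)] by metis
  obtain C where C: "\<And>x. norm (g x) \<le> C" using schwartz_bounded[OF g(3)] by metis
  show "bounded (range k)" unfolding g bounded_iff using B C
    by (intro exI[of _ "B + C"]) (auto intro: norm_triangle_mono)
  show "partial_deriv (axis j 1) k \<in> {\<lambda>x. f x + g x | f g. f \<in> schwartz \<and> g \<in> schwartz}" for j
    unfolding g
    using schwartz_partial_deriv[OF g(2), of j] schwartz_partial_deriv[OF g(3), of j]
      partial_deriv_add[OF schwartz_differentiable[OF g(2)] schwartz_differentiable[OF g(3)]]
    by blast
  show "(\<lambda>x. x $ j *\<^sub>R k x) \<in> {\<lambda>x. f x + g x | f g. f \<in> schwartz \<and> g \<in> schwartz}" for j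
    unfolding g scaleR_add_right
    using schwartz_coord_mult[OF g(2), of j] schwartz_coord_mult[OF g(3), of j]
    by (intro CollectI exI[of _ "\<lambda>x. x $ j *\<^sub>R f x"] exI[of _ "\<lambda>x. x $ j *\<^sub>R g x"]) auto
qed (intro CollectI exI[of _ f] exI[of _ g] conjI refl assms)

lemma schwartz_scaleC: "f \<in> schwartz \<Longrightarrow> (\<lambda>x. c *\<^sub>C (f x :: 'a::cstar_algebra)) \<in> schwartz"
  by (rule schwartz_linear[OF scaleC.bounded_linear_right])

lemma schwartz_diff: "f \<in> schwartz \<Longrightarrow> g \<in> schwartz \<Longrightarrow> (\<lambda>x. f x - g x) \<in> schwartz"
  using schwartz_add[of f "\<lambda>x. - g x"] schwartz_linear[OF bounded_linear_minus[OF bounded_linear_ident], of g] by simp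

lemma schwartz_zero: "(\<lambda>x. 0) \<in> schwartz"
  by (rule schwartzI[of _ "{\<lambda>x. 0}"]) auto

text \<open>A product of one-variable integrable functions, used as the common integrable majorant.
  It is also the squared modulus of \<open>rat_window\<close> with all exponents equal to 1.\<close>

definition decay :: "real ^ 'n \<Rightarrow> real" where
  "decay x = (\<Prod>i\<in>UNIV. 1 / (1 + (x $ i)\<^sup>2))"

lemma one_plus_square_pos: "1 + (t::real)\<^sup>2 > 0"
  by (simp add: add_pos_nonneg)

lemma decay_pos: "decay x > 0"
  unfolding decay_def by (intro prod_pos) (simp add: one_plus_square_pos)

text \<open>
  The closure properties alone give rapid decay, also for functions of \<open>x\<close> with parameters.
\<close>

lemma decay_bound:
  fixes g :: "'p \<Rightarrow> 'a::real_normed_vector" and X :: "'p \<Rightarrow> real ^ 'n"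
  assumes g: "g \<in> F" and b: "\<And>g. g \<in> F \<Longrightarrow> bounded (range g)"
    and m: "\<And>g j. g \<in> F \<Longrightarrow> (\<lambda>p. X p $ j *\<^sub>R g p) \<in> F" and a: "\<And>g h. g \<in> F \<Longrightarrow> h \<in> F \<Longrightarrow> (\<lambda>p. g p + h p) \<in> F"
  obtains C where "C > 0" "\<And>p. norm (g p) \<le> C * decay (X p)"
proof -
  have "(\<lambda>p. (\<Prod>i\<in>I. 1 + (X p $ i)\<^sup>2) *\<^sub>R g p) \<in> F" if "finite I" for I
    using that
  proof induction
    case (insert j I)
    have "(\<lambda>p. (\<Prod>i\<in>I. 1 + (X p $ i)\<^sup>2) *\<^sub>R g p + X p $ j *\<^sub>R X p $ j *\<^sub>R (\<Prod>i\<in>I. 1 + (X p $ i)\<^sup>2) *\<^sub>R g p) \<in> F"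
      by (intro a m insert.IH)
    moreover have "(\<lambda>p. (\<Prod>i\<in>I. 1 + (X p $ i)\<^sup>2) *\<^sub>R g p + X p $ j *\<^sub>R X p $ j *\<^sub>R (\<Prod>i\<in>I. 1 + (X p $ i)\<^sup>2) *\<^sub>R g p) =
        (\<lambda>p. (\<Prod>i\<in>insert j I. 1 + (X p $ i)\<^sup>2) *\<^sub>R g p)"
      using insert by (auto simp: scaleR_left_distrib power2_eq_square distrib_right mult.assoc)
    ultimately show ?case by simp
  qed (use g in simp)
  from b[OF this[of UNIV]] obtain C where C: "C > 0" "\<And>p. norm ((\<Prod>i\<in>UNIV. 1 + (X p $ i)\<^sup>2) *\<^sub>R g p) \<le> C"
    unfolding bounded_pos by auto
  have "norm (g p) \<le> C * decay (X p)" for p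
  proof -
    have pp: "(\<Prod>i\<in>UNIV. 1 + (X p $ i)\<^sup>2) > 0" by (intro prod_pos) (simp add: one_plus_square_pos)
    have "decay (X p) = 1 / (\<Prod>i\<in>UNIV. 1 + (X p $ i)\<^sup>2)" by (simp add: decay_def prod_dividef)
    moreover have "(\<Prod>i\<in>UNIV. 1 + (X p $ i)\<^sup>2) * norm (g p) \<le> C" using C(2)[of p] pp by simp
    ultimately show ?thesis using pp by (simp add: pos_le_divide_eq mult.commute)
  qed
  then show thesis using that C(1) by blast
qed

lemma schwartz_decay:
  fixes f :: "real ^ 'n \<Rightarrow> 'a::real_normed_vector"
  assumes "f \<in> schwartz"
  obtains C where "C > 0" "\<And>x. norm (f x) \<le> C * decay x"
proof (rule decay_bound[of f schwartz "\<lambda>x. x"])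
  fix g h :: "real ^ 'n \<Rightarrow> 'a" and j assume g: "g \<in> schwartz"
  then show "bounded (range g)" using schwartz_bounded[of g] by (metis bounded_iff rangeE)
  show "(\<lambda>x. x $ j *\<^sub>R g x) \<in> schwartz" by (rule schwartz_coord_mult[OF g])
  show "(\<lambda>x. g x + h x) \<in> schwartz" if "h \<in> schwartz" by (rule schwartz_add[OF g that])
next
  show "f \<in> schwartz" by (rule assms)
next
  fix C assume "0 < C" "\<And>x. norm (f x) \<le> C * decay x"
  then show thesis by (rule that)
qed

section \<open>The symbol norm\<close>

lemma fst_axis_Basis [simp]: "(axis i (1::real), 0) \<in> Basis" and snd_axis_Basis [simp]: "(0, axis i (1::real)) \<in> Basis"
  by (auto simp: Basis_prod_def)

text \<open>Distinct lists correspond to multi-indices with entries at most 1. There are finitely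
  many of these, so the supremum in \<open>symbol_norm\<close> is over a bounded set and
  \<open>Sup\<close> has its intended meaning.\<close>

lemma symbol_norm_bound:
  fixes a :: "(real ^ 'n) \<times> (real ^ 'n) \<Rightarrow> 'a::real_normed_vector"
  assumes a: "a \<in> CB_infty" and d: "distinct ks" "distinct js"
  shows "norm (iter_partial (map (\<lambda>i. (axis i 1, 0)) ks @ map (\<lambda>i. (0, axis i 1)) js) a z) \<le> symbol_norm a"
proof -
  let ?S = "{sup_norm (deriv_fst \<beta> (deriv_snd \<gamma> a)) | \<beta> \<gamma>. \<beta> \<le> (\<chi> i. 1) \<and> \<gamma> \<le> (\<chi> i. 1)}"
  have fin1: "finite {\<beta> :: nat ^ 'n. \<beta> \<le> (\<chi> i. 1)}"
  proof (rule finite_subset)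
    show "{\<beta> :: nat ^ 'n. \<beta> \<le> (\<chi> i. 1)} \<subseteq> vec_lambda ` (UNIV \<rightarrow> {0, 1})"
    proof
      fix \<beta> :: "nat ^ 'n" assume "\<beta> \<in> {\<beta>. \<beta> \<le> (\<chi> i. 1)}"
      then have "\<beta> $ i = 0 \<or> \<beta> $ i = 1" for i
        using le_Suc_eq by (fastforce simp: less_eq_vec_def)
      then show "\<beta> \<in> vec_lambda ` (UNIV \<rightarrow> {0, 1})"
        by (intro image_eqI[of _ _ "vec_nth \<beta>"]) (auto simp: vec_nth_inverse)
    qed
    have "finite (UNIV \<rightarrow>\<^sub>E {0, 1::nat} :: ('n \<Rightarrow> nat) set)" by (intro finite_PiE) auto
    then show "finite (vec_lambda ` (UNIV \<rightarrow> {0, 1::nat}) :: (nat ^ 'n) set)" by (simp add: PiE_def)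
  qed
  have "?S \<subseteq> (\<lambda>(\<beta>, \<gamma>). sup_norm (deriv_fst \<beta> (deriv_snd \<gamma> a))) ` ({\<beta>. \<beta> \<le> (\<chi> i. 1)} \<times> {\<beta>. \<beta> \<le> (\<chi> i. 1)})"
    by auto
  then have "finite ?S" using fin1 by (meson finite_SigmaI finite_imageI finite_subset)
  then have bdd: "bdd_above ?S" by (rule bdd_above_finite)
  define \<beta> :: "nat ^ 'n" where "\<beta> = (\<chi> i. count_list ks i)"
  define \<gamma> :: "nat ^ 'n" where "\<gamma> = (\<chi> i. count_list js i)"
  have le: "\<beta> \<le> (\<chi> i. 1)" "\<gamma> \<le> (\<chi> i. 1)"
    using d by (auto simp: \<beta>_def \<gamma>_def less_eq_vec_def distinct_count_atmost_1 simp flip: count_mset)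
  have "mset (index_list \<beta>) = mset ks" "mset (index_list \<gamma>) = mset js"
    by (rule multiset_eqI; simp add: count_mset count_index_list \<beta>_def \<gamma>_def)+
  then have "mset (map (\<lambda>i. (axis i (1::real), 0::real^'n)) (index_list \<beta>) @ map (\<lambda>i. (0::real^'n, axis i (1::real))) (index_list \<gamma>))
     = mset (map (\<lambda>i. (axis i 1, 0)) ks @ map (\<lambda>i. (0, axis i 1)) js)"
    by simp
  moreover have Bl: "map (\<lambda>i. (axis i (1::real), 0::real^'n)) (index_list \<beta>) @ map (\<lambda>i. (0::real^'n, axis i (1::real))) (index_list \<gamma>) \<in> lists Basis"
    by (auto simp: lists_eq_set)
  ultimately have eq: "deriv_fst \<beta> (deriv_snd \<gamma> a) = iter_partial (map (\<lambda>i. (axis i 1, 0)) ks @ map (\<lambda>i. (0, axis i 1)) js) a"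
    unfolding multi_deriv_def iter_partial_append[symmetric]
    by (intro iter_partial_perm[OF CB_smooth[OF a] Bl])
  obtain B where B: "\<And>x. norm (deriv_fst \<beta> (deriv_snd \<gamma> a) x) \<le> B"
    using CB_bounded[OF CB_iter_partial[OF a Bl]] unfolding multi_deriv_def iter_partial_append by metis
  have "norm (deriv_fst \<beta> (deriv_snd \<gamma> a) z) \<le> sup_norm (deriv_fst \<beta> (deriv_snd \<gamma> a))"
    unfolding sup_norm_def by (rule cSUP_upper[OF _ bdd_aboveI2[OF B]]) simp
  also have "\<dots> \<le> symbol_norm a"
    unfolding symbol_norm_def by (rule cSup_upper) (use le bdd in auto)
  finally show ?thesis by (simp add: eq)
qed

lemma symbol_norm_nonneg: "a \<in> CB_infty \<Longrightarrow> symbol_norm a \<ge> 0"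
  using order_trans[OF norm_ge_zero symbol_norm_bound[of a "[]" "[]"]] by simp

section \<open>Integration over Euclidean space\<close>

lemma lborel_integral_translate:
  fixes f :: "'b::euclidean_space \<Rightarrow> 'a::{banach, second_countable_topology}"
  assumes [measurable]: "f \<in> borel_measurable borel"
  shows "(\<integral>x. f (c + x) \<partial>lborel) = (\<integral>x. f x \<partial>lborel)"
    and "integrable lborel (\<lambda>x. f (c + x)) \<longleftrightarrow> integrable lborel f"
proof -
  show "(\<integral>x. f (c + x) \<partial>lborel) = (\<integral>x. f x \<partial>lborel)"
    by (subst (2) lborel_distr_plus[of c, symmetric]) (simp add: integral_distr)
  show "integrable lborel (\<lambda>x. f (c + x)) \<longleftrightarrow> integrable lborel f"
    by (subst (2) lborel_distr_plus[of c, symmetric]) (simp add: integrable_distr_eq)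
qed

lemma lborel_distr_reflect: "distr lborel borel (\<lambda>x. c - x) = (lborel :: 'b::euclidean_space measure)"
  using lborel_affine[of "-1::real" c] by (simp add: density_1)

lemma lborel_integral_reflect:
  fixes f :: "'b::euclidean_space \<Rightarrow> 'a::{banach, second_countable_topology}"
  assumes [measurable]: "f \<in> borel_measurable borel"
  shows "(\<integral>x. f (c - x) \<partial>lborel) = (\<integral>x. f x \<partial>lborel)"
    and "integrable lborel (\<lambda>x. f (c - x)) \<longleftrightarrow> integrable lborel f"
proof -
  show "(\<integral>x. f (c - x) \<partial>lborel) = (\<integral>x. f x \<partial>lborel)"
    by (subst (2) lborel_distr_reflect[of c, symmetric]) (simp add: integral_distr)
  show "integrable lborel (\<lambda>x. f (c - x)) \<longleftrightarrow> integrable lborel f"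
    by (subst (2) lborel_distr_reflect[of c, symmetric]) (simp add: integrable_distr_eq)
qed

interpretation lborel_product: product_sigma_finite "\<lambda>_. lborel :: real measure" ..

text \<open>Lebesgue measure is the image of the product measure under the coordinate
  representation, so the one-dimensional integrals multiply.\<close>

lemma lborel_Basis_prod:
  fixes f :: "'b::euclidean_space \<Rightarrow> real \<Rightarrow> 'a::{real_normed_field, banach, second_countable_topology}"
  assumes f: "\<And>b. b \<in> Basis \<Longrightarrow> integrable lborel (f b)"
  shows "integrable lborel (\<lambda>x. \<Prod>b\<in>Basis. f b (x \<bullet> b))"
    and "(\<integral>x. (\<Prod>b\<in>Basis. f b (x \<bullet> b)) \<partial>lborel) = (\<Prod>b\<in>Basis. \<integral>t. f b t \<partial>lborel)"
proof -
  have [measurable]: "(\<lambda>x. \<Prod>b\<in>Basis. f b (x \<bullet> b)) \<in> borel_measurable borel"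
  proof (rule borel_measurable_prod)
    fix b :: 'b assume "b \<in> Basis"
    then have [measurable]: "f b \<in> borel_measurable borel"
      using f[of b] borel_measurable_integrable by auto
    show "(\<lambda>x. f b (x \<bullet> b)) \<in> borel_measurable borel" by measurable
  qed
  have eq: "(\<Prod>b\<in>Basis. f b ((\<Sum>b'\<in>Basis. s b' *\<^sub>R b') \<bullet> b)) = (\<Prod>b\<in>Basis. f b (s b))" for s
    by (rule prod.cong) (auto simp: inner_sum_left_Basis)
  show "integrable lborel (\<lambda>x. \<Prod>b\<in>Basis. f b (x \<bullet> b))"
    by (subst lborel_eq, subst integrable_distr_eq)
      (auto simp: eq intro!: lborel_product.product_integrable_prod f)
  show "(\<integral>x. (\<Prod>b\<in>Basis. f b (x \<bullet> b)) \<partial>lborel) = (\<Prod>b\<in>Basis. \<integral>t. f b t \<partial>lborel)"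
    by (subst lborel_eq, subst integral_distr)
      (auto simp: eq intro!: lborel_product.product_integral_prod f)
qed

lemma prod_vec_Basis: "(\<Prod>b\<in>(Basis::(real^'n) set). g b) = (\<Prod>i\<in>UNIV. g (axis i 1))"
  unfolding Basis_vec_eq by (subst prod.reindex) (auto simp: inj_on_def axis_eq_axis)

lemma lborel_vec_prod:
  fixes f :: "real \<Rightarrow> 'a::{real_normed_field, banach, second_countable_topology}"
  assumes f: "integrable lborel f"
  shows "integrable lborel (\<lambda>x::real^'n. \<Prod>i\<in>UNIV. f (x $ i))"
    and "(\<integral>x. (\<Prod>i\<in>UNIV. f ((x::real^'n) $ i)) \<partial>lborel) = (\<integral>t. f t \<partial>lborel) ^ CARD('n)"
  using lborel_Basis_prod[of "\<lambda>b::real^'n. f", OF f] by (simp_all add: prod_vec_Basis inner_axis)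

lemma integrable_inverse_square: "integrable lborel (\<lambda>t::real. 1 / (1 + t\<^sup>2))"
  using integrable_inverse_1_plus_square by (simp add: set_integrable_def einterval_def inverse_eq_divide)

lemma integrable_decay: "integrable lborel (decay :: real ^ 'n \<Rightarrow> real)"
  using lborel_vec_prod(1)[OF integrable_inverse_square] by (simp add: decay_def[abs_def])

lemma decay_measurable [measurable]: "decay \<in> borel_measurable borel"
  using integrable_decay borel_measurable_integrable by force

text \<open>From \<open>t^2 \<le> 2 (t + s)^2 + 2 s^2\<close>, where \<open>s\<close> is at most 1
  in modulus. It provides one majorant for all difference quotients with step at most 1.\<close>

lemma decay_shift:
  assumes "\<bar>s\<bar> \<le> 1" shows "decay (x + s *\<^sub>R axis j 1) \<le> 3 * decay x"
proof -
  let ?t = "x $ j"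
  have "?t\<^sup>2 \<le> 2 * (?t + s)\<^sup>2 + 2 * s\<^sup>2"
    using zero_le_power2[of "?t + 2 * s"] by (simp add: power2_eq_square algebra_simps)
  moreover have "s\<^sup>2 \<le> 1" using assms by (simp add: abs_square_le_1)
  ultimately have "1 + ?t\<^sup>2 \<le> 3 * (1 + (?t + s)\<^sup>2)" by (smt (verit) zero_le_power2)
  then have 1: "1 / (1 + (?t + s)\<^sup>2) \<le> 3 * (1 / (1 + ?t\<^sup>2))"
    by (simp add: divide_le_eq le_divide_eq one_plus_square_pos mult.commute)
  have "decay (x + s *\<^sub>R axis j 1) = 1 / (1 + (?t + s)\<^sup>2) * (\<Prod>i\<in>UNIV - {j}. 1 / (1 + (x $ i)\<^sup>2))"
    unfolding decay_def by (subst prod.remove[of UNIV j]) (auto simp: axis_def intro!: prod.cong)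
  also have "\<dots> \<le> 3 * (1 / (1 + ?t\<^sup>2)) * (\<Prod>i\<in>UNIV - {j}. 1 / (1 + (x $ i)\<^sup>2))"
    using 1 by (intro mult_right_mono prod_nonneg) (auto simp: one_plus_square_pos less_imp_le)
  also have "\<dots> = 3 * decay x"
    using prod.remove[of UNIV j "\<lambda>i. 1 / (1 + (x $ i)\<^sup>2)"] by (simp add: decay_def)
  finally show ?thesis .
qed

section \<open>Integrals of derivatives and derivatives of integrals\<close>

lemma continuous_differentiable:
  "(\<And>x. f differentiable (at x)) \<Longrightarrow> continuous_on UNIV f"
  by (meson differentiable_imp_continuous_on differentiable_on_def differentiable_at_withinI)

lemma differentiable_measurable:
  fixes f :: "'b::real_normed_vector \<Rightarrow> 'a::real_normed_vector"
  shows "(\<And>x. f differentiable (at x)) \<Longrightarrow> f \<in> borel_measurable borel"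
  by (intro borel_measurable_continuous_onI continuous_differentiable)

lemma integrable_decay_bound:
  fixes F :: "real ^ 'n \<Rightarrow> 'a::{banach, second_countable_topology}"
  assumes "F \<in> borel_measurable borel" "\<And>x. norm (F x) \<le> C * decay x"
  shows "integrable lborel F"
proof (rule Bochner_Integration.integrable_bound[of lborel "\<lambda>x. C * decay x"])
  show "integrable lborel (\<lambda>x::real^'n. C * decay x)" by (simp add: integrable_decay)
  show "AE x in lborel. norm (F x) \<le> norm (C * decay x)"
    using assms(2) by (intro AE_I2) (metis abs_ge_self order_trans real_norm_def)
qed (use assms in simp)

lemma difference_quotient_tendsto:
  assumes "(\<phi> has_vector_derivative d) (at (t::real))"
  shows "(\<lambda>n. (1 / inverse (real (Suc n))) *\<^sub>R (\<phi> (t + inverse (real (Suc n))) - \<phi> t)) \<longlonglongrightarrow> d"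
proof -
  have "((\<lambda>h. (1 / h) *\<^sub>R (\<phi> (t + h) - \<phi> t)) \<longlongrightarrow> d) (at 0)"
  proof -
    have "((\<lambda>h. norm ((1 / h) *\<^sub>R (\<phi> (t + h) - \<phi> t) - d)) \<longlongrightarrow> 0) (at 0)"
    proof (rule Lim_transform_eventually)
      show "((\<lambda>h. norm (\<phi> (t + h) - \<phi> t - h *\<^sub>R d) / norm h) \<longlongrightarrow> 0) (at 0)"
        using assms by (simp add: has_vector_derivative_def has_derivative_at)
      have "norm (\<phi> (t + h) - \<phi> t - h *\<^sub>R d) / norm h = norm ((1 / h) *\<^sub>R (\<phi> (t + h) - \<phi> t) - d)"
        if "h \<noteq> 0" for h
      proof -
        have "(1 / h) *\<^sub>R (\<phi> (t + h) - \<phi> t) - d = (1 / h) *\<^sub>R (\<phi> (t + h) - \<phi> t - h *\<^sub>R d)"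
          using that by (simp add: scaleR_diff_right)
        then show ?thesis by simp
      qed
      then show "\<forall>\<^sub>F h in at 0. norm (\<phi> (t + h) - \<phi> t - h *\<^sub>R d) / norm h =
          norm ((1 / h) *\<^sub>R (\<phi> (t + h) - \<phi> t) - d)"
        by (simp add: eventually_at_filter)
    qed
    then show ?thesis by (rule LIM_zero_cancel[OF tendsto_norm_zero_cancel])
  qed
  then show ?thesis
    by (rule filterlim_compose) (use LIMSEQ_inverse_real_of_nat in \<open>auto simp: filterlim_at\<close>)
qed

text \<open>The derivative is the dominated limit of difference quotients, each of which has
  integral 0 by translation invariance. The integrations by parts in \<open>wft_xi_mult\<close> and
  \<open>wpdo_coord_mult\<close> rest on this.\<close>

lemma integral_partial_deriv_zero:
  fixes F :: "real ^ 'n \<Rightarrow> 'a::{banach, second_countable_topology}"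
  assumes d: "\<And>x. F differentiable (at x)" and i: "integrable lborel F"
    and b: "\<And>x. norm (partial_deriv (axis j 1) F x) \<le> C * decay x"
  shows "integrable lborel (partial_deriv (axis j 1) F)" "(\<integral>x. partial_deriv (axis j 1) F x \<partial>lborel) = 0"
proof -
  define h where "h n = inverse (real (Suc n))" for n
  define Q where "Q n x = (1 / h n) *\<^sub>R (F (h n *\<^sub>R axis j 1 + x) - F x)" for n x
  have h: "0 < h n" "h n \<le> 1" for n by (auto simp: h_def inverse_le_1_iff)
  have [measurable]: "F \<in> borel_measurable borel" by (rule differentiable_measurable[OF d])
  have Qm: "Q n \<in> borel_measurable lborel" for n unfolding Q_def by measurable
  have lim: "(\<lambda>n. Q n x) \<longlonglongrightarrow> partial_deriv (axis j 1) F x" for x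
    using difference_quotient_tendsto[OF has_vector_derivative_partial[of F x 0 "axis j 1"]] d
    by (simp add: Q_def h_def add.commute)
  have C: "C \<ge> 0"
    using order_trans[OF norm_ge_zero b[of 0]] decay_pos[of "0::real^'n"] by (simp add: zero_le_mult_iff)
  have bd: "norm (Q n x) \<le> 3 * C * decay x" for n x
  proof -
    have "norm (F (x + h n *\<^sub>R axis j 1) - F (x + 0 *\<^sub>R axis j 1)) \<le> (C * (3 * decay x)) * h n"
    proof (rule vector_mvt[where \<phi> = "\<lambda>t. F (x + t *\<^sub>R axis j 1)" and \<phi>' = "\<lambda>t. partial_deriv (axis j 1) F (x + t *\<^sub>R axis j 1)"])
      fix t assume t: "0 \<le> t" "t \<le> h n"
      show "((\<lambda>t. F (x + t *\<^sub>R axis j 1)) has_vector_derivative partial_deriv (axis j 1) F (x + t *\<^sub>R axis j 1)) (at t)"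
        by (rule has_vector_derivative_partial[OF d])
      have "\<bar>t\<bar> \<le> 1" using t h(2)[of n] by simp
      from decay_shift[OF this, of x j]
      show "norm (partial_deriv (axis j 1) F (x + t *\<^sub>R axis j 1)) \<le> C * (3 * decay x)"
        using C by (intro order_trans[OF b] mult_left_mono)
    qed (use h in \<open>auto intro: less_imp_le\<close>)
    then show ?thesis using h(1)[of n] by (simp add: Q_def add.commute divide_le_eq mult_ac)
  qed
  have w: "integrable lborel (\<lambda>x::real^'n. 3 * C * decay x)" by (simp add: integrable_decay)
  have m: "partial_deriv (axis j 1) F \<in> borel_measurable lborel"
    by (rule borel_measurable_LIMSEQ_metric[OF Qm lim])
  show "integrable lborel (partial_deriv (axis j 1) F)"
    by (rule integrable_dominated_convergence[where s = Q and w = "\<lambda>x. 3 * C * decay x"])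
      (use m Qm w lim bd in auto)
  have "(\<lambda>n. \<integral>x. Q n x \<partial>lborel) \<longlonglongrightarrow> (\<integral>x. partial_deriv (axis j 1) F x \<partial>lborel)"
    by (rule integral_dominated_convergence[where w = "\<lambda>x. 3 * C * decay x"])
      (use m Qm w lim bd in auto)
  moreover have "(\<integral>x. Q n x \<partial>lborel) = 0" for n
    using i by (simp add: Q_def lborel_integral_translate)
  ultimately show "(\<integral>x. partial_deriv (axis j 1) F x \<partial>lborel) = 0"
    by (simp add: LIMSEQ_const_iff)
qed

text \<open>The mean value inequality bounds the remainder of the linear approximation by
  \<open>2 * G \<xi> * norm h\<close>, so dominated convergence applies to it along every sequence
  tending to 0.\<close>

lemma has_derivative_integral:
  fixes f :: "'e::real_normed_vector \<Rightarrow> 'b \<Rightarrow> 'a::{banach, second_countable_topology}"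
  assumes r: "r > 0"
    and d: "\<And>z \<xi>. z \<in> ball x r \<Longrightarrow> ((\<lambda>z. f z \<xi>) has_derivative f' z \<xi>) (at z)"
    and b: "\<And>z \<xi> h. z \<in> ball x r \<Longrightarrow> norm (f' z \<xi> h) \<le> G \<xi> * norm h"
    and i: "\<And>z. z \<in> ball x r \<Longrightarrow> integrable M (f z)"
    and G: "integrable M G" and G0: "\<And>\<xi>. 0 \<le> G \<xi>"
    and m: "\<And>h. (\<lambda>\<xi>. f' x \<xi> h) \<in> borel_measurable M"
  shows "((\<lambda>z. \<integral>\<xi>. f z \<xi> \<partial>M) has_derivative (\<lambda>h. \<integral>\<xi>. f' x \<xi> h \<partial>M)) (at x)"
proof -
  have x: "x \<in> ball x r" using r by simp
  have lin: "linear (f' x \<xi>)" for \<xi> using d[OF x] has_derivative_linear by blast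
  have i': "integrable M (\<lambda>\<xi>. f' x \<xi> h)" for h
  proof (rule Bochner_Integration.integrable_bound[of M "\<lambda>\<xi>. G \<xi> * norm h"])
    show "AE \<xi> in M. norm (f' x \<xi> h) \<le> norm (G \<xi> * norm h)"
      using b[OF x, of _ h] by (intro AE_I2) (metis abs_ge_self order_trans real_norm_def)
  qed (use G m in auto)
  have bl: "bounded_linear (\<lambda>h. \<integral>\<xi>. f' x \<xi> h \<partial>M)"
  proof (rule bounded_linear_intro[where K = "\<integral>\<xi>. G \<xi> \<partial>M"])
    show "(\<integral>\<xi>. f' x \<xi> (h + k) \<partial>M) = (\<integral>\<xi>. f' x \<xi> h \<partial>M) + (\<integral>\<xi>. f' x \<xi> k \<partial>M)" for h k
      using i' by (simp add: linear_add[OF lin])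
    show "(\<integral>\<xi>. f' x \<xi> (c *\<^sub>R h) \<partial>M) = c *\<^sub>R (\<integral>\<xi>. f' x \<xi> h \<partial>M)" for c h
      using i' by (simp add: linear_scale[OF lin])
    show "norm (\<integral>\<xi>. f' x \<xi> h \<partial>M) \<le> norm h * (\<integral>\<xi>. G \<xi> \<partial>M)" for h
    proof -
      have "norm (\<integral>\<xi>. f' x \<xi> h \<partial>M) \<le> (\<integral>\<xi>. norm (f' x \<xi> h) \<partial>M)" by (rule integral_norm_bound)
      also have "\<dots> \<le> (\<integral>\<xi>. G \<xi> * norm h \<partial>M)"
        using i' G b[OF x] by (intro integral_mono) auto
      finally show ?thesis using G by (simp add: mult.commute)
    qed
  qed
  define R where "R h \<xi> = f (x + h) \<xi> - f x \<xi> - f' x \<xi> h" for h \<xi>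
  have Rb: "norm (R h \<xi>) \<le> (2 * G \<xi>) * norm h" if h: "norm h < r" for h \<xi>
  proof -
    have "norm (f (x + h) \<xi> - f x \<xi>) \<le> G \<xi> * norm (x + h - x)"
    proof (rule differentiable_bound[where S = "ball x r" and f = "\<lambda>z. f z \<xi>" and f' = "\<lambda>z. f' z \<xi>"])
      show "((\<lambda>z. f z \<xi>) has_derivative f' z \<xi>) (at z within ball x r)" if "z \<in> ball x r" for z
        using d[OF that] has_derivative_at_withinI by blast
      show "onorm (f' z \<xi>) \<le> G \<xi>" if "z \<in> ball x r" for z
        by (intro onorm_bound b[OF that] G0)
    qed (use h r in \<open>auto simp: dist_norm\<close>)
    moreover have "norm (R h \<xi>) \<le> norm (f (x + h) \<xi> - f x \<xi>) + norm (f' x \<xi> h)"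
      unfolding R_def by (rule norm_triangle_ineq4)
    ultimately show ?thesis using b[OF x, of \<xi> h] by (simp add: algebra_simps)
  qed
  have Ri: "integrable M (R h)" if h: "norm h < r" for h
  proof -
    have "x + h \<in> ball x r" using h by (simp add: dist_norm)
    then show ?thesis unfolding R_def[abs_def] using i i' x by simp
  qed
  have "((\<lambda>h. norm ((\<integral>\<xi>. f (x + h) \<xi> \<partial>M) - (\<integral>\<xi>. f x \<xi> \<partial>M) - (\<integral>\<xi>. f' x \<xi> h \<partial>M)) / norm h) \<longlongrightarrow> 0) (at 0)"
    unfolding tendsto_at_iff_sequentially comp_def
  proof (intro allI impI)
    fix X :: "nat \<Rightarrow> 'e" assume X0: "\<forall>i. X i \<in> UNIV - {0}" and X: "X \<longlonglongrightarrow> 0"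
    \<comment> \<open>Outside the ball no bound on the remainder is available, so \<open>s\<close>
      is set to 0 there; this affects finitely many \<open>n\<close> only.\<close>
    define s where "s n \<xi> = (if norm (X n) < r then norm (R (X n) \<xi>) / norm (X n) else 0)" for n \<xi>
    have ev: "eventually (\<lambda>n. norm (X n) < r) sequentially"
      using tendstoD[OF X r] by (simp add: dist_norm)
    have sm: "s n \<in> borel_measurable M" for n
      using borel_measurable_integrable[OF Ri[of "X n"]] by (cases "norm (X n) < r") (auto simp: s_def[abs_def])
    have sb: "norm (s n \<xi>) \<le> 2 * \<bar>G \<xi>\<bar>" for n \<xi>
    proof (cases "norm (X n) < r")
      case True
      have "norm (R (X n) \<xi>) \<le> (2 * \<bar>G \<xi>\<bar>) * norm (X n)"
        by (rule order_trans[OF Rb[OF True]]) (intro mult_right_mono, auto)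
      then show ?thesis using X0 True by (auto simp: s_def divide_le_eq)
    qed (simp add: s_def)
    have sl: "(\<lambda>n. s n \<xi>) \<longlonglongrightarrow> 0" for \<xi>
    proof -
      have "((\<lambda>h. norm (R h \<xi>) / norm h) \<longlongrightarrow> 0) (at 0)"
        using d[OF x, of \<xi>] unfolding has_derivative_at R_def by auto
      then have "(\<lambda>n. norm (R (X n) \<xi>) / norm (X n)) \<longlonglongrightarrow> 0"
        using X X0 unfolding tendsto_at_iff_sequentially comp_def by blast
      then show ?thesis
        by (rule Lim_transform_eventually) (use ev in \<open>auto elim!: eventually_mono simp: s_def\<close>)
    qed
    have "(\<lambda>n. \<integral>\<xi>. s n \<xi> \<partial>M) \<longlonglongrightarrow> (\<integral>\<xi>. 0 \<partial>M)"
      by (rule integral_dominated_convergence[where w = "\<lambda>\<xi>. 2 * \<bar>G \<xi>\<bar>"]) (use sm sb sl G in auto)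
    then have lim: "(\<lambda>n. \<integral>\<xi>. s n \<xi> \<partial>M) \<longlonglongrightarrow> 0" by simp
    show "(\<lambda>n. norm ((\<integral>\<xi>. f (x + X n) \<xi> \<partial>M) - (\<integral>\<xi>. f x \<xi> \<partial>M) - (\<integral>\<xi>. f' x \<xi> (X n) \<partial>M)) / norm (X n)) \<longlonglongrightarrow> 0"
    proof (rule tendsto_sandwich[OF _ _ tendsto_const lim])
      show "\<forall>\<^sub>F n in sequentially. norm ((\<integral>\<xi>. f (x + X n) \<xi> \<partial>M) - (\<integral>\<xi>. f x \<xi> \<partial>M) - (\<integral>\<xi>. f' x \<xi> (X n) \<partial>M)) / norm (X n)
          \<le> (\<integral>\<xi>. s n \<xi> \<partial>M)"
        using ev
      proof eventually_elim
        case (elim n)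
        have "x + X n \<in> ball x r" using elim by (simp add: dist_norm)
        then have "(\<integral>\<xi>. f (x + X n) \<xi> \<partial>M) - (\<integral>\<xi>. f x \<xi> \<partial>M) - (\<integral>\<xi>. f' x \<xi> (X n) \<partial>M) = (\<integral>\<xi>. R (X n) \<xi> \<partial>M)"
          unfolding R_def using i i' x by simp
        also have "norm \<dots> \<le> (\<integral>\<xi>. norm (R (X n) \<xi>) \<partial>M)" by (rule integral_norm_bound)
        finally show ?case using elim by (simp add: s_def divide_right_mono)
      qed
    qed simp
  qed
  then show ?thesis using bl by (simp add: has_derivative_at)
qed

section \<open>The exponential kernel\<close>

text \<open>\<open>kern1\<close> is the fundamental solution of \<open>1 + d/dr\<close>; averaging
  against it therefore inverts the transposed operator \<open>1 - d/dr\<close>.\<close>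

definition kern1 :: "real \<Rightarrow> real" where
  "kern1 r = (if r < 0 then 0 else exp (- r))"

definition kern :: "'b::euclidean_space \<Rightarrow> real" where
  "kern x = (\<Prod>b\<in>Basis. kern1 (x \<bullet> b))"

lemma kern1_measurable [measurable]: "kern1 \<in> borel_measurable borel"
  unfolding kern1_def[abs_def] by measurable

lemma kern1_bounds: "0 \<le> kern1 r" "kern1 r \<le> 1"
  by (auto simp: kern1_def)

lemma integrable_kern1: "integrable lborel kern1"
proof -
  interpret prob_space "density lborel (exponential_density 1)"
    by (rule prob_space_exponential_density) simp
  have eq: "exponential_density 1 = kern1" by (auto simp: exponential_density_def kern1_def)
  have "(\<integral>\<^sup>+x. ennreal (kern1 x) \<partial>lborel) = 1"
    using emeasure_space_1 by (simp add: emeasure_density eq)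
  then show ?thesis by (intro integrableI_nonneg) (auto simp: kern1_bounds)
qed

lemma kern_measurable [measurable]: "kern \<in> borel_measurable borel"
  unfolding kern_def[abs_def] by measurable

lemma kern_bounds: "0 \<le> kern x" "kern x \<le> 1"
  unfolding kern_def by (auto intro!: prod_nonneg prod_le_1 simp: kern1_bounds)

lemma integrable_kern: "integrable lborel kern"
  unfolding kern_def[abs_def] by (rule lborel_Basis_prod) (rule integrable_kern1)

text \<open>On the half-line the integrand is minus the derivative of
  \<open>exp (- r) *\<^sub>R H (x + r *\<^sub>R v)\<close>, so only the value at
  \<open>r = 0\<close> remains. The fundamental theorem of calculus is carried out with difference
  quotients and dominated convergence.\<close>

lemma kern1_representation:
  fixes H :: "'b::euclidean_space \<Rightarrow> 'a::{banach, second_countable_topology}"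
  assumes d: "\<And>x. H differentiable (at x)" and b: "\<And>x. norm (H x) \<le> B"
    and b': "\<And>x. norm (partial_deriv v H x) \<le> B'"
  shows "(\<integral>r. kern1 r *\<^sub>R (H (x + r *\<^sub>R v) - partial_deriv v H (x + r *\<^sub>R v)) \<partial>lborel) = H x"
proof -
  have [measurable]: "H \<in> borel_measurable borel" by (rule differentiable_measurable[OF d])
  have B: "B \<ge> 0" "B' \<ge> 0" using order_trans[OF norm_ge_zero b[of 0]] order_trans[OF norm_ge_zero b'[of 0]] by auto
  define G where "G r = exp (- r) *\<^sub>R H (x + r *\<^sub>R v)" for r
  define G' where "G' r = exp (- r) *\<^sub>R (partial_deriv v H (x + r *\<^sub>R v) - H (x + r *\<^sub>R v))" for r
  have Gd: "(G has_vector_derivative G' r) (at r)" for r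
  proof -
    have e: "((\<lambda>r. exp (- r)) has_real_derivative - exp (- r)) (at r)"
      by (auto intro!: derivative_eq_intros)
    have "((\<lambda>r. exp (- r) *\<^sub>R H (x + r *\<^sub>R v)) has_vector_derivative
        exp (- r) *\<^sub>R partial_deriv v H (x + r *\<^sub>R v) + (- exp (- r)) *\<^sub>R H (x + r *\<^sub>R v)) (at r)"
      by (rule has_vector_derivative_scaleR[OF e has_vector_derivative_partial[OF d]])
    then show ?thesis by (simp add: G_def[abs_def] G'_def scaleR_diff_right)
  qed
  have Gm [measurable]: "G \<in> borel_measurable borel" unfolding G_def by measurable
  have Gb: "norm (G r) \<le> exp (- r) * B" for r by (simp add: G_def b mult_left_mono)
  have G'b: "norm (G' r) \<le> exp (- r) * (B + B')" for r
    unfolding G'_def using norm_triangle_ineq4[of "partial_deriv v H (x + r *\<^sub>R v)" "H (x + r *\<^sub>R v)"] b b'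
    by (auto intro!: mult_left_mono) (smt (verit, best))
  define h where "h n = inverse (real (Suc n))" for n
  have h: "0 < h n" "h n \<le> 1" for n by (auto simp: h_def inverse_le_1_iff)
  have h0: "h \<longlonglongrightarrow> 0" unfolding h_def by (rule LIMSEQ_inverse_real_of_nat)
  define ind where "ind r = (if r < 0 then 0 else 1 :: real)" for r :: real
  have [measurable]: "ind \<in> borel_measurable borel" unfolding ind_def[abs_def] by measurable
  define Q where "Q n r = ind r *\<^sub>R ((1 / h n) *\<^sub>R (G (r + h n) - G r))" for n r
  have lim: "(\<lambda>n. Q n r) \<longlonglongrightarrow> ind r *\<^sub>R G' r" for r
    unfolding Q_def h_def by (intro tendsto_scaleR tendsto_const difference_quotient_tendsto[OF Gd])
  have Qm: "Q n \<in> borel_measurable lborel" for n unfolding Q_def by measurable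
  have Qb: "norm (Q n r) \<le> (B + B') * kern1 r" for n r
  proof (cases "r < 0")
    case False
    have "norm (G (r + h n) - G (r + 0)) \<le> (exp (- r) * (B + B')) * h n"
    proof (rule vector_mvt[where \<phi> = "\<lambda>t. G (r + t)" and \<phi>' = "\<lambda>t. G' (r + t)"])
      fix t :: real assume t: "0 \<le> t"
      show "((\<lambda>t. G (r + t)) has_vector_derivative G' (r + t)) (at t)"
        using has_vector_derivative_line[of G "\<lambda>s. s *\<^sub>R G' (r + t)" r t 1] Gd[of "r + t"]
        by (simp add: has_vector_derivative_def)
      show "norm (G' (r + t)) \<le> exp (- r) * (B + B')"
        by (rule order_trans[OF G'b]) (use t B in \<open>auto intro!: mult_right_mono\<close>)
    qed (use h in \<open>auto intro: less_imp_le\<close>)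
    then show ?thesis using h(1)[of n] False by (simp add: Q_def ind_def kern1_def divide_le_eq mult_ac)
  qed (simp add: Q_def ind_def kern1_def)
  have w: "integrable lborel (\<lambda>r. (B + B') * kern1 r)" by (simp add: integrable_kern1)
  have m: "(\<lambda>r. ind r *\<^sub>R G' r) \<in> borel_measurable lborel"
    by (rule borel_measurable_LIMSEQ_metric[OF Qm lim])
  have L: "(\<lambda>n. \<integral>r. Q n r \<partial>lborel) \<longlonglongrightarrow> (\<integral>r. ind r *\<^sub>R G' r \<partial>lborel)"
    by (rule integral_dominated_convergence[where w = "\<lambda>r. (B + B') * kern1 r"])
      (use m Qm w lim Qb in auto)
  have iG: "integrable lborel (\<lambda>r. ind r *\<^sub>R G r)"
  proof (rule Bochner_Integration.integrable_bound[of lborel "\<lambda>r. B * kern1 r"])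
    show "AE r in lborel. norm (ind r *\<^sub>R G r) \<le> norm (B * kern1 r)"
      using Gb B by (intro AE_I2) (auto simp: ind_def kern1_def mult.commute)
  qed (auto simp: integrable_kern1)
  \<comment> \<open>Shifting the variable leaves minus the average of \<open>G\<close> over the
    interval from 0 to \<open>h n\<close>; \<open>U\<close> is its integrand rescaled to the unit
    interval, where the limit \<open>G 0 = H x\<close> can be taken by dominated
    convergence.\<close>
  define U where "U n u = (if 0 \<le> u \<and> u < 1 then G (h n * u) else 0)" for n u
  have Q_int: "(\<integral>r. Q n r \<partial>lborel) = - (\<integral>u. U n u \<partial>lborel)" for n
  proof -
    define K where "K r = ind (r - h n) *\<^sub>R G r" for r
    have [measurable]: "K \<in> borel_measurable borel" unfolding K_def by measurable
    have iK: "integrable lborel K"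
    proof (rule Bochner_Integration.integrable_bound[OF iG])
      show "AE r in lborel. norm (K r) \<le> norm (ind r *\<^sub>R G r)"
        using h(1)[of n] by (intro AE_I2) (auto simp: K_def ind_def)
    qed simp
    have e1: "(\<integral>r. ind r *\<^sub>R G (r + h n) \<partial>lborel) = (\<integral>r. K r \<partial>lborel)"
      using lborel_integral_translate(1)[of K "h n"] by (simp add: K_def add.commute)
    have i1: "integrable lborel (\<lambda>r. ind r *\<^sub>R G (r + h n))"
      using lborel_integral_translate(2)[of K "h n"] iK by (simp add: K_def add.commute)
    have "(\<integral>r. Q n r \<partial>lborel) = (1 / h n) *\<^sub>R (\<integral>r. ind r *\<^sub>R G (r + h n) - ind r *\<^sub>R G r \<partial>lborel)"
      unfolding Q_def by (simp add: scaleR_diff_right scaleR_left_commute[of "ind _"] flip: integral_scaleR_right)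
    also have "\<dots> = - ((1 / h n) *\<^sub>R (\<integral>r. ind r *\<^sub>R G r - K r \<partial>lborel))"
      using i1 iG iK by (simp add: e1 flip: scaleR_minus_right)
    also have "(\<integral>r. ind r *\<^sub>R G r - K r \<partial>lborel) = (\<integral>r. (if 0 \<le> r \<and> r < h n then G r else 0) \<partial>lborel)"
      using h(1)[of n] by (intro Bochner_Integration.integral_cong) (auto simp: K_def ind_def)
    also have "\<dots> = h n *\<^sub>R (\<integral>u. U n u \<partial>lborel)"
      using lborel_integral_real_affine[of "h n" "\<lambda>r. if 0 \<le> r \<and> r < h n then G r else 0" 0] h(1)[of n]
      by (simp add: U_def zero_le_mult_iff cong: if_cong)
    finally show ?thesis using h(1)[of n] by simp
  qed
  have "(\<lambda>n. \<integral>u. U n u \<partial>lborel) \<longlonglongrightarrow> (\<integral>u. (if 0 \<le> u \<and> u < (1::real) then H x else 0) \<partial>lborel)"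
  proof (rule integral_dominated_convergence[where w = "\<lambda>u::real. B * indicator {0..<1} u"])
    show "integrable lborel (\<lambda>u::real. B * indicator {0..<1} u)" by simp
    show "AE u in lborel. (\<lambda>n. U n u) \<longlonglongrightarrow> (if 0 \<le> u \<and> u < 1 then H x else 0)"
    proof (intro AE_I2)
      fix u :: real
      have "isCont G 0" using Gd has_vector_derivative_continuous by blast
      moreover have "(\<lambda>n. h n * u) \<longlonglongrightarrow> 0" using tendsto_mult_left_zero[OF h0] by simp
      ultimately have "(\<lambda>n. G (h n * u)) \<longlonglongrightarrow> G 0" by (rule isCont_tendsto_compose)
      then have lim: "(\<lambda>n. G (h n * u)) \<longlonglongrightarrow> H x" by (simp add: G_def)
      show "(\<lambda>n. U n u) \<longlonglongrightarrow> (if 0 \<le> u \<and> u < 1 then H x else 0)"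
      proof (cases "0 \<le> u \<and> u < 1")
        case True
        then show ?thesis using lim by (simp add: U_def)
      next
        case False
        then have "U n u = 0" for n by (auto simp: U_def)
        then show ?thesis using False by auto
      qed
    qed
    show "AE u in lborel. norm (U n u) \<le> B * indicator {0..<1} u" for n
    proof (intro AE_I2)
      fix u :: real
      have "norm (G (h n * u)) \<le> B" if "0 \<le> u"
      proof -
        have "exp (- (h n * u)) * B \<le> 1 * B" using that h(1)[of n] B by (intro mult_right_mono) auto
        then show ?thesis using Gb[of "h n * u"] by simp
      qed
      then show "norm (U n u) \<le> B * indicator {0..<1} u" by (simp add: U_def)
    qed
    show "U n \<in> borel_measurable lborel" for n unfolding U_def[abs_def] by measurable
  qed measurable
  moreover have "(\<integral>u. (if 0 \<le> u \<and> u < (1::real) then H x else 0) \<partial>lborel) = H x"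
  proof -
    have "(\<lambda>u. if 0 \<le> u \<and> u < (1::real) then H x else 0) = (\<lambda>u. indicator {0..<1} u *\<^sub>R H x)"
      by (auto simp: indicator_def)
    then show ?thesis by simp
  qed
  ultimately have "(\<lambda>n. \<integral>r. Q n r \<partial>lborel) \<longlonglongrightarrow> - H x" unfolding Q_int by (simp add: tendsto_minus)
  then have "(\<integral>r. ind r *\<^sub>R G' r \<partial>lborel) = - H x" using L LIMSEQ_unique by blast
  moreover have "kern1 r *\<^sub>R (H (x + r *\<^sub>R v) - partial_deriv v H (x + r *\<^sub>R v)) = - (ind r *\<^sub>R G' r)" for r
    by (simp add: kern1_def ind_def G'_def algebra_simps)
  ultimately show ?thesis by simp
qed

fun one_minus_derivs :: "'b::real_normed_vector list \<Rightarrow> ('b \<Rightarrow> 'a::real_normed_vector) \<Rightarrow> 'b \<Rightarrow> 'a" where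
  "one_minus_derivs [] H = H"
| "one_minus_derivs (b # bs) H = (\<lambda>x. one_minus_derivs bs H x - partial_deriv b (one_minus_derivs bs H) x)"

text \<open>
  The one-dimensional formula applied to one coordinate after the other. The derivatives are taken
  at most once in each coordinate, which is what makes \<open>\<pi>(a)\<close> suffice.
\<close>

lemma kern_representation:
  fixes F :: "('b::euclidean_space \<Rightarrow> 'a::{banach, second_countable_topology}) set"
  assumes d: "\<And>H x. H \<in> F \<Longrightarrow> H differentiable (at x)" and b: "\<And>H. H \<in> F \<Longrightarrow> bounded (range H)"
    and p: "\<And>H v. H \<in> F \<Longrightarrow> v \<in> Basis \<Longrightarrow> bounded (range (partial_deriv v H))"
    and c: "\<And>H v. H \<in> F \<Longrightarrow> v \<in> Basis \<Longrightarrow> (\<lambda>x. H x - partial_deriv v H x) \<in> F"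
    and H: "H \<in> F" and bs: "distinct bs" "set bs = Basis"
  shows "one_minus_derivs bs H \<in> F"
    and "(\<integral>s. kern s *\<^sub>R one_minus_derivs bs H (x + s) \<partial>lborel) = H x"
proof -
  \<comment> \<open>Generalised to sublists of the basis, with the product measure over the
    coordinates already treated; for the whole basis its image is Lebesgue measure.\<close>
  have *: "one_minus_derivs bs H \<in> F \<and>
      (\<integral>s. (\<Prod>b\<in>set bs. kern1 (s b)) *\<^sub>R one_minus_derivs bs H (x + (\<Sum>b\<in>set bs. s b *\<^sub>R b)) \<partial>Pi\<^sub>M (set bs) (\<lambda>_. lborel)) = H x"
    if "distinct bs" "set bs \<subseteq> Basis" for bs x
    using that
  proof (induction bs arbitrary: x)
    case Nil
    interpret finite_measure "Pi\<^sub>M {} (\<lambda>_::'b. lborel :: real measure)"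
      by rule (simp add: space_PiM)
    show ?case using H by (simp add: space_PiM measure_def)
  next
    case (Cons v bs)
    let ?K = "one_minus_derivs bs H"
    let ?K' = "one_minus_derivs (v # bs) H"
    have v: "v \<in> Basis" "v \<notin> set bs" using Cons.prems by auto
    have IH: "?K \<in> F" "\<And>x. (\<integral>s. (\<Prod>b\<in>set bs. kern1 (s b)) *\<^sub>R ?K (x + (\<Sum>b\<in>set bs. s b *\<^sub>R b)) \<partial>Pi\<^sub>M (set bs) (\<lambda>_. lborel)) = H x"
      using Cons by auto
    have K': "?K' \<in> F" using c[OF IH(1) v(1)] by simp
    have [measurable]: "?K' \<in> borel_measurable borel" by (rule differentiable_measurable[OF d[OF K']])
    obtain B where B: "\<And>x. norm (?K' x) \<le> B" using b[OF K'] unfolding bounded_iff by auto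
    obtain C where C: "\<And>x. norm (?K x) \<le> C" using b[OF IH(1)] unfolding bounded_iff by auto
    obtain C' where C': "\<And>x. norm (partial_deriv v ?K x) \<le> C'" using p[OF IH(1) v(1)] unfolding bounded_iff by auto
    let ?f = "\<lambda>s. (\<Prod>b\<in>set (v # bs). kern1 (s b)) *\<^sub>R ?K' (x + (\<Sum>b\<in>set (v # bs). s b *\<^sub>R b))"
    have m: "?f \<in> borel_measurable (Pi\<^sub>M (insert v (set bs)) (\<lambda>_. lborel))"
      by (simp del: one_minus_derivs.simps)
    have int: "integrable (Pi\<^sub>M (insert v (set bs)) (\<lambda>_. lborel)) ?f"
    proof (rule Bochner_Integration.integrable_bound)
      show "integrable (Pi\<^sub>M (insert v (set bs)) (\<lambda>_. lborel)) (\<lambda>s. (\<Prod>b\<in>insert v (set bs). kern1 (s b)) * B)"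
        by (intro integrable_mult_left lborel_product.product_integrable_prod integrable_kern1) simp
      have B0: "B \<ge> 0" using order_trans[OF norm_ge_zero B[of 0]] .
      show "AE s in Pi\<^sub>M (insert v (set bs)) (\<lambda>_. lborel). norm (?f s) \<le> norm ((\<Prod>b\<in>insert v (set bs). kern1 (s b)) * B)"
        using B B0 by (intro AE_I2) (auto simp: abs_mult intro!: mult_left_mono)
    qed (rule m)
    have "(\<integral>s. ?f s \<partial>Pi\<^sub>M (set (v # bs)) (\<lambda>_. lborel)) = (\<integral>s. (\<integral>r. ?f (s(v := r)) \<partial>lborel) \<partial>Pi\<^sub>M (set bs) (\<lambda>_. lborel))"
      using lborel_product.product_integral_insert[OF _ v(2) int] by simp
    also have "\<dots> = (\<integral>s. (\<Prod>b\<in>set bs. kern1 (s b)) *\<^sub>R ?K (x + (\<Sum>b\<in>set bs. s b *\<^sub>R b)) \<partial>Pi\<^sub>M (set bs) (\<lambda>_. lborel))"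
    proof (rule Bochner_Integration.integral_cong[OF refl])
      fix s :: "'b \<Rightarrow> real"
      have "?f (s(v := r)) = (\<Prod>b\<in>set bs. kern1 (s b)) *\<^sub>R (kern1 r *\<^sub>R
          (?K (x + (\<Sum>b\<in>set bs. s b *\<^sub>R b) + r *\<^sub>R v) - partial_deriv v ?K (x + (\<Sum>b\<in>set bs. s b *\<^sub>R b) + r *\<^sub>R v)))" for r
      proof -
        have "(\<Prod>b\<in>set bs. kern1 ((s(v := r)) b)) = (\<Prod>b\<in>set bs. kern1 (s b))"
          "(\<Sum>b\<in>set bs. (s(v := r)) b *\<^sub>R b) = (\<Sum>b\<in>set bs. s b *\<^sub>R b)"
          using v(2) by (auto intro!: prod.cong sum.cong)
        then show ?thesis using v(2) by (simp add: add_ac mult.commute)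
      qed
      then show "(\<integral>r. ?f (s(v := r)) \<partial>lborel) = (\<Prod>b\<in>set bs. kern1 (s b)) *\<^sub>R ?K (x + (\<Sum>b\<in>set bs. s b *\<^sub>R b))"
        by (simp only: integral_scaleR_right kern1_representation[OF d[OF IH(1)] C C'])
    qed
    also have "\<dots> = H x" by (rule IH(2))
    finally show ?case using K' by blast
  qed
  show "one_minus_derivs bs H \<in> F" using * bs by simp
  have [measurable]: "one_minus_derivs bs H \<in> borel_measurable borel"
    by (rule differentiable_measurable) (use * bs d in simp)
  have k: "kern (\<Sum>b\<in>Basis. s b *\<^sub>R b) = (\<Prod>b\<in>Basis. kern1 (s b))" for s :: "'b \<Rightarrow> real"
    unfolding kern_def by (rule prod.cong) (auto simp: inner_sum_left_Basis)
  show "(\<integral>s. kern s *\<^sub>R one_minus_derivs bs H (x + s) \<partial>lborel) = H x"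
    using *[OF bs(1), of x] bs(2) by (subst lborel_eq, subst integral_distr) (auto simp: k)
qed

section \<open>The Gaussian weight\<close>

definition gauss_wt :: "real \<Rightarrow> real ^ 'n \<Rightarrow> real" where
  "gauss_wt \<epsilon> \<xi> = (\<Prod>i\<in>UNIV. exp (- (\<epsilon> * \<xi> $ i)\<^sup>2 / 2))"

text \<open>The Fourier transform of \<open>gauss_wt\<close> (see
  \<open>integral_gauss_wt_cis\<close>). The Bessel inequality uses that it is nonnegative and even,
  with total mass \<open>(2 * pi) ^ CARD('n)\<close> for every positive
  \<open>\<epsilon>\<close>.\<close>

definition gauss_hat :: "real \<Rightarrow> real ^ 'n \<Rightarrow> real" where
  "gauss_hat \<epsilon> s = (\<Prod>i\<in>UNIV. sqrt (2 * pi) / \<epsilon> * exp (- (s $ i / \<epsilon>)\<^sup>2 / 2))"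

text \<open>Everything is read off from the standard normal distribution, the last value from its
  characteristic function.\<close>

lemma integral_gauss: "integrable lborel (\<lambda>x::real. exp (- x\<^sup>2 / 2))"
    "(\<integral>x. exp (- x\<^sup>2 / 2) \<partial>lborel) = sqrt (2 * pi)"
  and integral_gauss_cis: "(\<integral>x. complex_of_real (exp (- x\<^sup>2 / 2)) * cis (t * x) \<partial>lborel) = sqrt (2 * pi) * exp (- t\<^sup>2 / 2)"
proof -
  have dens: "std_normal_density = (\<lambda>x. 1 / sqrt (2 * pi) * exp (- x\<^sup>2 / 2))"
    by (auto simp: std_normal_density_def)
  have "integrable lborel std_normal_density" "(\<integral>x. std_normal_density x \<partial>lborel) = 1" by auto
  then have i: "integrable lborel (\<lambda>x. 1 / sqrt (2 * pi) * exp (- x\<^sup>2 / 2))"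
    "(\<integral>x. 1 / sqrt (2 * pi) * exp (- x\<^sup>2 / 2) \<partial>lborel) = 1"
    unfolding dens .
  show "integrable lborel (\<lambda>x::real. exp (- x\<^sup>2 / 2))"
    using integrable_mult_right[OF i(1), of "sqrt (2 * pi)"] by (simp add: mult.assoc[symmetric])
  have c: "1 / c * I = 1 \<Longrightarrow> c \<noteq> 0 \<Longrightarrow> I = c" for c I :: real by (simp add: field_simps)
  show "(\<integral>x. exp (- x\<^sup>2 / 2) \<partial>lborel) = sqrt (2 * pi)"
  proof (rule c)
    show "1 / sqrt (2 * pi) * (\<integral>x. exp (- x\<^sup>2 / 2) \<partial>lborel) = 1"
      using i(2) by (simp only: integral_mult_right_zero)
  qed simp
  have "complex_of_real (exp (- (t\<^sup>2) / 2)) = char std_normal_distribution t"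
    by (simp add: char_std_normal_distribution)
  also have "\<dots> = (\<integral>x. std_normal_density x *\<^sub>R iexp (t * x) \<partial>lborel)"
    unfolding char_def by (subst integral_density) auto
  also have "\<dots> = (\<integral>x. complex_of_real (1 / sqrt (2 * pi)) * (complex_of_real (exp (- x\<^sup>2 / 2)) * cis (t * x)) \<partial>lborel)"
    unfolding dens by (rule Bochner_Integration.integral_cong) (auto simp: scaleR_conv_of_real cis_conv_exp)
  also have "\<dots> = complex_of_real (1 / sqrt (2 * pi)) * (\<integral>x. complex_of_real (exp (- x\<^sup>2 / 2)) * cis (t * x) \<partial>lborel)"
    by simp
  finally show "(\<integral>x. complex_of_real (exp (- x\<^sup>2 / 2)) * cis (t * x) \<partial>lborel) = sqrt (2 * pi) * exp (- t\<^sup>2 / 2)"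
    by (simp add: field_simps)
qed

lemma cis_measurable [measurable]: "cis \<in> borel_measurable borel"
  by (intro borel_measurable_continuous_onI continuous_intros)

lemma cis_sum: "finite I \<Longrightarrow> cis (\<Sum>i\<in>I. f i) = (\<Prod>i\<in>I. cis (f i))"
  by (induction I rule: finite_induct) (auto simp: cis_mult[symmetric])

lemma integral_gauss_scaled:
  assumes "\<epsilon> > 0"
  shows "integrable lborel (\<lambda>x::real. exp (- (\<epsilon> * x)\<^sup>2 / 2))"
    and "(\<integral>x. complex_of_real (exp (- (\<epsilon> * x)\<^sup>2 / 2)) * cis (x * s) \<partial>lborel) = sqrt (2 * pi) / \<epsilon> * exp (- (s / \<epsilon>)\<^sup>2 / 2)"
    and "(\<integral>x. exp (- (\<epsilon> * x)\<^sup>2 / 2) \<partial>lborel) = sqrt (2 * pi) / \<epsilon>"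
proof -
  show "integrable lborel (\<lambda>x::real. exp (- (\<epsilon> * x)\<^sup>2 / 2))"
    using lborel_integrable_real_affine[OF integral_gauss(1), of \<epsilon> 0] assms by simp
  show "(\<integral>x. exp (- (\<epsilon> * x)\<^sup>2 / 2) \<partial>lborel) = sqrt (2 * pi) / \<epsilon>"
  proof -
    have "sqrt (2 * pi) = \<epsilon> * (\<integral>x. exp (- (\<epsilon> * x)\<^sup>2 / 2) \<partial>lborel)"
      using lborel_integral_real_affine[of \<epsilon> "\<lambda>x. exp (- x\<^sup>2 / 2)" 0] assms
      unfolding integral_gauss(2) by simp
    then show ?thesis using assms by (simp add: eq_divide_eq mult.commute[of _ \<epsilon>])
  qed
  define I where "I = (\<integral>x. complex_of_real (exp (- (\<epsilon> * x)\<^sup>2 / 2)) * cis (x * s) \<partial>lborel)"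
  have "complex_of_real (sqrt (2 * pi) * exp (- (s / \<epsilon>)\<^sup>2 / 2)) = \<epsilon> * I"
    using lborel_integral_real_affine[of \<epsilon> "\<lambda>x. complex_of_real (exp (- x\<^sup>2 / 2)) * cis (s / \<epsilon> * x)" 0] assms
    unfolding integral_gauss_cis I_def by (simp add: mult.commute[of _ s] scaleR_conv_of_real)
  then have "complex_of_real (sqrt (2 * pi) * exp (- (s / \<epsilon>)\<^sup>2 / 2)) / \<epsilon> = I"
    using assms by simp
  then show "I = sqrt (2 * pi) / \<epsilon> * exp (- (s / \<epsilon>)\<^sup>2 / 2)" by simp
qed

lemma gauss_wt_bounds: "0 < gauss_wt \<epsilon> \<xi>" "gauss_wt \<epsilon> \<xi> \<le> 1"
  unfolding gauss_wt_def by (auto intro!: prod_pos prod_le_1)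

lemma gauss_wt_measurable [measurable]: "gauss_wt \<epsilon> \<in> borel_measurable borel"
  unfolding gauss_wt_def[abs_def] by measurable

lemma gauss_hat_measurable [measurable]: "gauss_hat \<epsilon> \<in> borel_measurable borel"
  unfolding gauss_hat_def[abs_def] by measurable

lemma gauss_hat_nonneg: "\<epsilon> > 0 \<Longrightarrow> 0 \<le> gauss_hat \<epsilon> s"
  unfolding gauss_hat_def by (auto intro!: prod_nonneg)

lemma gauss_hat_minus: "gauss_hat \<epsilon> (- s) = gauss_hat \<epsilon> s"
  unfolding gauss_hat_def by simp

lemma integrable_gauss_wt: "\<epsilon> > 0 \<Longrightarrow> integrable lborel (gauss_wt \<epsilon> :: real^'n \<Rightarrow> real)"
  using lborel_vec_prod(1)[OF integral_gauss_scaled(1), of \<epsilon>] by (simp add: gauss_wt_def[abs_def])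

lemma integral_gauss_wt_cis:
  fixes s :: "real ^ 'n"
  assumes e: "\<epsilon> > 0"
  shows "(\<integral>\<xi>. gauss_wt \<epsilon> \<xi> *\<^sub>R cis (\<xi> \<bullet> s) \<partial>lborel) = complex_of_real (gauss_hat \<epsilon> s)"
proof -
  have "(\<integral>\<xi>. gauss_wt \<epsilon> \<xi> *\<^sub>R cis (\<xi> \<bullet> s) \<partial>lborel) =
      (\<integral>\<xi>. (\<Prod>b\<in>Basis. complex_of_real (exp (- (\<epsilon> * (\<xi> \<bullet> b))\<^sup>2 / 2)) * cis ((\<xi> \<bullet> b) * (s \<bullet> b))) \<partial>lborel)"
    by (rule Bochner_Integration.integral_cong)
      (auto simp: gauss_wt_def scaleR_conv_of_real prod_vec_Basis inner_axis prod.distrib inner_vec_def[of _ s] cis_sum)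
  also have "\<dots> = (\<Prod>b\<in>Basis. \<integral>t. complex_of_real (exp (- (\<epsilon> * t)\<^sup>2 / 2)) * cis (t * (s \<bullet> b)) \<partial>lborel)"
  proof (rule lborel_Basis_prod(2))
    fix b :: "real ^ 'n"
    show "integrable lborel (\<lambda>t. complex_of_real (exp (- (\<epsilon> * t)\<^sup>2 / 2)) * cis (t * (s \<bullet> b)))"
      by (rule Bochner_Integration.integrable_bound[OF integral_gauss_scaled(1)[OF e]]) (auto simp: norm_mult)
  qed
  also have "\<dots> = complex_of_real (gauss_hat \<epsilon> s)"
    unfolding integral_gauss_scaled(2)[OF e] gauss_hat_def by (simp add: prod_vec_Basis inner_axis)
  finally show ?thesis .
qed

lemma integral_gauss_hat:
  assumes e: "\<epsilon> > 0"
  shows "integrable lborel (gauss_hat \<epsilon> :: real^'n \<Rightarrow> real)"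
    and "(\<integral>s. gauss_hat \<epsilon> (s::real^'n) \<partial>lborel) = (2 * pi) ^ CARD('n)"
proof -
  have i: "integrable lborel (\<lambda>x::real. sqrt (2 * pi) / \<epsilon> * exp (- (x / \<epsilon>)\<^sup>2 / 2))"
    using integral_gauss_scaled(1)[of "1 / \<epsilon>"] e by simp
  show "integrable lborel (gauss_hat \<epsilon> :: real^'n \<Rightarrow> real)"
    unfolding gauss_hat_def[abs_def] by (rule lborel_vec_prod(1)[OF i])
  have "(\<integral>x. sqrt (2 * pi) / \<epsilon> * exp (- (x / \<epsilon>)\<^sup>2 / 2) \<partial>lborel) = 2 * pi"
    using integral_gauss_scaled(3)[of "1 / \<epsilon>"] e by simp
  then show "(\<integral>s. gauss_hat \<epsilon> (s::real^'n) \<partial>lborel) = (2 * pi) ^ CARD('n)"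
    unfolding gauss_hat_def using lborel_vec_prod(2)[OF i] by simp
qed

lemma gauss_wt_tendsto: "(\<lambda>n. gauss_wt (inverse (real (Suc n))) \<xi>) \<longlonglongrightarrow> 1"
proof -
  have "(\<lambda>n. gauss_wt (inverse (real (Suc n))) \<xi>) \<longlonglongrightarrow> (\<Prod>i\<in>(UNIV::'a set). exp (- (0 * \<xi> $ i)\<^sup>2 / 2))"
    unfolding gauss_wt_def by (intro tendsto_intros LIMSEQ_inverse_real_of_nat) auto
  then show ?thesis by simp
qed

section \<open>Windowed Fourier transforms\<close>

lemma has_derivative_cis_mult:
  assumes "(g has_derivative g') (at x within s)"
  shows "((\<lambda>x. cis (g x)) has_derivative (\<lambda>h. complex_of_real (g' h) * (\<i> * cis (g x)))) (at x within s)"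
  using has_derivative_cis[OF assms] by (simp add: scaleR_conv_of_real)

text \<open>A Fourier transform with a window centred at \<open>x\<close>. For the window 1 it is
  the ordinary transform without its normalising constant and does not depend on
  \<open>x\<close>.\<close>

definition wft :: "(real ^ 'n \<Rightarrow> complex) \<Rightarrow> (real ^ 'n \<Rightarrow> 'a) \<Rightarrow> real ^ 'n \<Rightarrow> real ^ 'n \<Rightarrow> 'a::separable_cstar_algebra" where
  "wft p \<phi> x \<xi> = (\<integral>y. (cis (- (y \<bullet> \<xi>)) * p (x - y)) *\<^sub>C \<phi> y \<partial>lborel)"

text \<open>The exponents are a parameter because each derivative of the window raises one of them:
  up to scalars the family is closed under differentiation.\<close>

definition rat_window :: "('n \<Rightarrow> nat) \<Rightarrow> real ^ 'n \<Rightarrow> complex" where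
  "rat_window m s = (\<Prod>j\<in>UNIV. inverse (1 + \<i> * complex_of_real (s $ j)) ^ m j)"

lemma one_plus_i_nz [simp]: "1 + \<i> * complex_of_real t \<noteq> 0"
  by (simp add: complex_eq_iff)

lemma cmod_one_plus_i: "1 \<le> cmod (1 + \<i> * complex_of_real t)"
  by (simp add: cmod_def)

lemma cmod_rat_window_le: "cmod (rat_window m s) \<le> 1"
  unfolding rat_window_def
  by (auto simp: prod_norm[symmetric] norm_power norm_inverse inverse_le_1_iff cmod_one_plus_i intro!: prod_le_1 power_le_one)

lemma rat_window_measurable [measurable]: "rat_window m \<in> borel_measurable borel"
  unfolding rat_window_def[abs_def] by measurable

lemma rat_window_Suc: "rat_window m s = (1 + \<i> * complex_of_real (s $ j)) * rat_window (m(j := Suc (m j))) s"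
  unfolding rat_window_def by (simp add: prod.remove[of UNIV j] mult.assoc[symmetric])

lemma has_derivative_rat_window:
  "(rat_window m has_derivative (\<lambda>h. \<Sum>j\<in>UNIV. complex_of_real (h $ j) * (- \<i> * of_nat (m j) * rat_window (m(j := Suc (m j))) s))) (at s)"
proof -
  let ?z = "\<lambda>s j. 1 + \<i> * complex_of_real (s $ j)"
  have d: "((\<lambda>s. inverse (?z s j) ^ m j) has_derivative
      (\<lambda>h. complex_of_real (h $ j) * (- \<i> * of_nat (m j) * inverse (?z s j) ^ Suc (m j)))) (at s)" for j
  proof -
    have c: "((\<lambda>s. s $ j) has_derivative (\<lambda>h. h $ j)) (at s)"
      by (rule bounded_linear_imp_has_derivative[OF bounded_linear_vec_nth])
    have z: "((\<lambda>s. ?z s j) has_derivative (\<lambda>h. \<i> * complex_of_real (h $ j))) (at s)"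
      by (auto intro!: derivative_eq_intros has_derivative_of_real c)
    have "((\<lambda>s. inverse (?z s j)) has_derivative (\<lambda>h. - (inverse (?z s j) * (\<i> * complex_of_real (h $ j)) * inverse (?z s j)))) (at s)"
      by (rule Deriv.has_derivative_inverse[OF _ z]) simp
    from has_derivative_power[OF this, of "m j"] show ?thesis
      by (rule has_derivative_eq_rhs) (cases "m j"; auto simp: mult_ac)
  qed
  have "((\<lambda>s. \<Prod>j\<in>UNIV. inverse (?z s j) ^ m j) has_derivative
      (\<lambda>h. \<Sum>j\<in>UNIV. complex_of_real (h $ j) * (- \<i> * of_nat (m j) * inverse (?z s j) ^ Suc (m j)) *
        (\<Prod>i\<in>UNIV - {j}. inverse (?z s i) ^ m i))) (at s)"
    by (rule has_derivative_prod) (rule d)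
  moreover have "rat_window (m(j := Suc (m j))) s = inverse (?z s j) ^ Suc (m j) * (\<Prod>i\<in>UNIV - {j}. inverse (?z s i) ^ m i)" for j
    unfolding rat_window_def by (subst prod.remove[of UNIV j]) (auto intro!: arg_cong2[where f = "(*)"] prod.cong)
  moreover have "rat_window m = (\<lambda>s. \<Prod>j\<in>UNIV. inverse (?z s j) ^ m j)" by (simp add: rat_window_def[abs_def])
  ultimately show ?thesis by (simp only: mult.assoc)
qed

lemma schwartz_measurable [measurable_dest]: "\<phi> \<in> schwartz \<Longrightarrow> \<phi> \<in> borel_measurable borel"
  by (rule differentiable_measurable) (rule schwartz_differentiable)

lemma schwartz_integrable:
  fixes \<phi> :: "real ^ 'n \<Rightarrow> 'a::{banach, second_countable_topology}"
  assumes "\<phi> \<in> schwartz" shows "integrable lborel \<phi>"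
proof -
  obtain C where "\<And>x. norm (\<phi> x) \<le> C * decay x" using schwartz_decay[OF assms] by metis
  then show ?thesis by (rule integrable_decay_bound[OF schwartz_measurable[OF assms]])
qed

lemma schwartz_L2:
  fixes \<phi> :: "real ^ 'n \<Rightarrow> 'a::separable_cstar_algebra"
  assumes "\<phi> \<in> schwartz" shows "L2 lborel \<phi>"
  unfolding L2_def
proof
  show "\<phi> \<in> borel_measurable lborel" using schwartz_measurable[OF assms] by simp
  obtain B where B: "B > 0" "\<And>x. norm (\<phi> x) \<le> B" using schwartz_bounded[OF assms] by metis
  show "integrable lborel (\<lambda>x. (norm (\<phi> x))\<^sup>2)"
  proof (rule Bochner_Integration.integrable_bound[of lborel "\<lambda>x. B * norm (\<phi> x)"])
    show "AE x in lborel. norm ((norm (\<phi> x))\<^sup>2) \<le> norm (B * norm (\<phi> x))"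
      using B by (intro AE_I2) (auto simp: power2_eq_square intro: mult_right_mono)
  qed (use schwartz_integrable[OF assms] schwartz_measurable[OF assms] in auto)
qed

lemma wft_integrable:
  fixes \<phi> :: "real ^ 'n \<Rightarrow> 'a::separable_cstar_algebra"
  assumes "\<phi> \<in> schwartz" "p \<in> borel_measurable borel" "\<And>s. cmod (p s) \<le> 1"
  shows "integrable lborel (\<lambda>y. (cis (- (y \<bullet> \<xi>)) * p (x - y)) *\<^sub>C \<phi> y)"
proof (rule Bochner_Integration.integrable_bound[OF schwartz_integrable[OF assms(1)]])
  have [measurable]: "(\<lambda>y. p (x - y)) \<in> borel_measurable borel"
    by (rule measurable_compose[OF _ assms(2)]) simp
  have [measurable]: "(\<lambda>y. cis (- (y \<bullet> \<xi>))) \<in> borel_measurable borel"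
    by (rule measurable_compose[OF _ cis_measurable]) simp
  show "(\<lambda>y. (cis (- (y \<bullet> \<xi>)) * p (x - y)) *\<^sub>C \<phi> y) \<in> borel_measurable lborel"
    using schwartz_measurable[OF assms(1)] by (simp add: borel_measurable_scaleC)
  show "AE y in lborel. norm ((cis (- (y \<bullet> \<xi>)) * p (x - y)) *\<^sub>C \<phi> y) \<le> norm (\<phi> y)"
    using assms(3) by (intro AE_I2) (simp add: norm_scaleC norm_mult mult_left_le_one_le)
qed

lemma norm_wft_le:
  assumes "\<phi> \<in> schwartz" "p \<in> borel_measurable borel" "\<And>s. cmod (p s) \<le> 1"
  shows "norm (wft p \<phi> x \<xi>) \<le> (\<integral>y. cmod (p (x - y)) * norm (\<phi> y) \<partial>lborel)"
    and "norm (wft p \<phi> x \<xi>) \<le> (\<integral>y. norm (\<phi> y) \<partial>lborel)"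
proof -
  note i = wft_integrable[OF assms, of \<xi> x]
  have "norm (wft p \<phi> x \<xi>) \<le> (\<integral>y. norm ((cis (- (y \<bullet> \<xi>)) * p (x - y)) *\<^sub>C \<phi> y) \<partial>lborel)"
    unfolding wft_def by (rule integral_norm_bound)
  then show 1: "norm (wft p \<phi> x \<xi>) \<le> (\<integral>y. cmod (p (x - y)) * norm (\<phi> y) \<partial>lborel)"
    by (simp add: norm_scaleC norm_mult)
  also have "\<dots> \<le> (\<integral>y. norm (\<phi> y) \<partial>lborel)"
    using integrable_norm[OF i] schwartz_integrable[OF assms(1)] assms(3)
    by (intro integral_mono) (auto simp: norm_scaleC norm_mult mult_left_le_one_le)
  finally show "norm (wft p \<phi> x \<xi>) \<le> (\<integral>y. norm (\<phi> y) \<partial>lborel)" .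
qed

lemma wft_measurable:
  assumes "\<phi> \<in> schwartz" "p \<in> borel_measurable borel"
  shows "(\<lambda>z. wft p \<phi> (fst z) (snd z)) \<in> borel_measurable (borel \<Otimes>\<^sub>M borel)"
proof -
  note [measurable] = schwartz_measurable[OF assms(1)] assms(2)
  show ?thesis unfolding wft_def by measurable
qed

text \<open>Multiplication by \<open>\<i>\<close> isolates the first term. It is applied to the
  relations that come from a vanishing integral of a derivative.\<close>

lemma scaleC_solve:
  fixes a b c :: "'a::cstar_algebra"
  assumes "0 = (- \<i> * complex_of_real r) *\<^sub>C a + (\<i> * complex_of_real s) *\<^sub>C b + c"
  shows "r *\<^sub>R a = s *\<^sub>R b - \<i> *\<^sub>C c"
proof -
  have "\<i> *\<^sub>C ((- \<i> * complex_of_real r) *\<^sub>C a) = r *\<^sub>R a"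
    by (simp add: scaleC_scaleC scaleC_of_real[symmetric])
  moreover have "\<i> *\<^sub>C ((\<i> * complex_of_real s) *\<^sub>C b) = - (s *\<^sub>R b)"
    by (simp add: scaleC_scaleC scaleC_of_real[symmetric] scaleC_minus_left)
  moreover have "0 = \<i> *\<^sub>C ((- \<i> * complex_of_real r) *\<^sub>C a) + \<i> *\<^sub>C ((\<i> * complex_of_real s) *\<^sub>C b) + \<i> *\<^sub>C c"
    using assms by (metis scaleC_add_right scaleC_zero_right)
  ultimately have "0 = r *\<^sub>R a - s *\<^sub>R b + \<i> *\<^sub>C c" by simp
  then show ?thesis by (metis add_diff_cancel_right' diff_0 diff_eq_eq minus_diff_eq uminus_add_conv_diff)
qed

text \<open>Integration by parts in the integration variable.\<close>

lemma wft_xi_mult: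
  fixes \<phi> :: "real ^ 'n \<Rightarrow> 'a::separable_cstar_algebra"
  assumes \<phi>: "\<phi> \<in> schwartz"
  shows "\<xi> $ j *\<^sub>R wft (rat_window m) \<phi> x \<xi> =
    real (m j) *\<^sub>R wft (rat_window (m(j := Suc (m j)))) \<phi> x \<xi> - \<i> *\<^sub>C wft (rat_window m) (partial_deriv (axis j 1) \<phi>) x \<xi>"
proof -
  let ?m' = "m(j := Suc (m j))"
  define \<phi>' where "\<phi>' = partial_deriv (axis j 1) \<phi>"
  have \<phi>': "\<phi>' \<in> schwartz" unfolding \<phi>'_def by (rule schwartz_partial_deriv[OF \<phi>])
  define F where "F y = (cis (- (y \<bullet> \<xi>)) * rat_window m (x - y)) *\<^sub>C \<phi> y" for y
  have D: "\<exists>D. (F has_derivative D) (at y) \<and> D (axis j 1) =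
      (- \<i> * \<xi> $ j) *\<^sub>C F y + (\<i> * m j) *\<^sub>C ((cis (- (y \<bullet> \<xi>)) * rat_window ?m' (x - y)) *\<^sub>C \<phi> y) +
        (cis (- (y \<bullet> \<xi>)) * rat_window m (x - y)) *\<^sub>C \<phi>' y" for y
  proof -
    obtain D\<phi> where D\<phi>: "(\<phi> has_derivative D\<phi>) (at y)"
      using schwartz_differentiable[OF \<phi>] differentiable_def by blast
    have 1: "((\<lambda>y. cis (- (y \<bullet> \<xi>))) has_derivative (\<lambda>h. complex_of_real (- (h \<bullet> \<xi>)) * (\<i> * cis (- (y \<bullet> \<xi>))))) (at y)"
      by (intro has_derivative_cis_mult derivative_intros)
    have 2: "((\<lambda>y. rat_window m (x - y)) has_derivative
      (\<lambda>h. \<Sum>j\<in>UNIV. complex_of_real ((- h) $ j) * (- \<i> * of_nat (m j) * rat_window (m(j := Suc (m j))) (x - y)))) (at y)"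
      by (rule has_derivative_compose[OF _ has_derivative_rat_window]) (auto intro!: derivative_eq_intros)
    note d = scaleC.FDERIV[OF has_derivative_mult[OF 1 2] D\<phi>]
    have s: "(\<Sum>i\<in>UNIV. complex_of_real ((- axis j 1) $ i) * (- \<i> * of_nat (m i) * rat_window (m(i := Suc (m i))) (x - y))) =
        \<i> * of_nat (m j) * rat_window ?m' (x - y)"
      by (subst sum.remove[of UNIV j]) (auto simp: axis_def intro!: sum.neutral)
    have ax: "D\<phi> (axis j 1) = \<phi>' y" unfolding \<phi>'_def by (rule partial_deriv_eq[OF D\<phi>, symmetric])
    show ?thesis
      unfolding F_def[abs_def]
      by (rule exI, rule conjI, rule d)
        (simp only: s ax, simp add: scaleC_add_left scaleC_diff_left scaleC_minus_left scaleC_scaleC inner_commute[of "axis j 1"] inner_axis algebra_simps)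
  qed
  have pd: "partial_deriv (axis j 1) F y = (- \<i> * \<xi> $ j) *\<^sub>C F y +
      (\<i> * m j) *\<^sub>C ((cis (- (y \<bullet> \<xi>)) * rat_window ?m' (x - y)) *\<^sub>C \<phi> y) + (cis (- (y \<bullet> \<xi>)) * rat_window m (x - y)) *\<^sub>C \<phi>' y" for y
    using D[of y] partial_deriv_eq by metis
  have Fd: "F differentiable (at y)" for y using D[of y] differentiable_def by blast
  obtain C where C: "C > 0" "\<And>x. norm (\<phi> x) \<le> C * decay x" using schwartz_decay[OF \<phi>] by metis
  obtain C' where C': "C' > 0" "\<And>x. norm (\<phi>' x) \<le> C' * decay x" using schwartz_decay[OF \<phi>'] by metis
  have Fi: "integrable lborel F" unfolding F_def
    by (rule wft_integrable[OF \<phi> rat_window_measurable cmod_rat_window_le])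
  have wF: "wft (rat_window m) \<phi> x \<xi> = integral\<^sup>L lborel F" by (simp add: wft_def F_def[abs_def])
  have Fi2: "integrable lborel (\<lambda>y. (cis (- (y \<bullet> \<xi>)) * rat_window ?m' (x - y)) *\<^sub>C \<phi> y)"
    by (rule wft_integrable[OF \<phi> rat_window_measurable cmod_rat_window_le])
  have Fi3: "integrable lborel (\<lambda>y. (cis (- (y \<bullet> \<xi>)) * rat_window m (x - y)) *\<^sub>C \<phi>' y)"
    by (rule wft_integrable[OF \<phi>' rat_window_measurable cmod_rat_window_le])
  have nb: "norm ((cis (- (y \<bullet> \<xi>)) * rat_window k (x - y)) *\<^sub>C v) \<le> norm v" for k y and v :: 'a
    by (simp add: norm_scaleC norm_mult mult_left_le_one_le cmod_rat_window_le)
  have "norm (partial_deriv (axis j 1) F y) \<le> (\<bar>\<xi> $ j\<bar> * C + real (m j) * C + C') * decay y" for y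
  proof -
    have "norm (partial_deriv (axis j 1) F y) \<le> \<bar>\<xi> $ j\<bar> * norm (F y) +
      real (m j) * norm ((cis (- (y \<bullet> \<xi>)) * rat_window ?m' (x - y)) *\<^sub>C \<phi> y) + norm ((cis (- (y \<bullet> \<xi>)) * rat_window m (x - y)) *\<^sub>C \<phi>' y)"
      unfolding pd
      by (rule order_trans[OF norm_triangle_ineq] add_mono order_trans[OF norm_triangle_ineq] order_refl)+
        (simp_all add: norm_scaleC norm_mult)
    also have "\<dots> \<le> \<bar>\<xi> $ j\<bar> * (C * decay y) + real (m j) * (C * decay y) + C' * decay y"
      using order_trans[OF nb C(2)] order_trans[OF nb C'(2)]
      by (intro add_mono mult_left_mono) (auto simp: F_def)
    finally show ?thesis by (simp add: algebra_simps)
  qed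
  from integral_partial_deriv_zero(2)[OF Fd Fi this]
  have "0 = (\<integral>y. (- \<i> * \<xi> $ j) *\<^sub>C F y + (\<i> * m j) *\<^sub>C ((cis (- (y \<bullet> \<xi>)) * rat_window ?m' (x - y)) *\<^sub>C \<phi> y) +
      (cis (- (y \<bullet> \<xi>)) * rat_window m (x - y)) *\<^sub>C \<phi>' y \<partial>lborel)"
    unfolding pd by simp
  also have "\<dots> = (- \<i> * \<xi> $ j) *\<^sub>C wft (rat_window m) \<phi> x \<xi> + (\<i> * m j) *\<^sub>C wft (rat_window ?m') \<phi> x \<xi> + wft (rat_window m) \<phi>' x \<xi>"
    unfolding wF unfolding wft_def using Fi Fi2 Fi3
    by (simp add: integrable_bounded_linear[OF scaleC.bounded_linear_right]
        integral_bounded_linear[OF scaleC.bounded_linear_right])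
  finally have "0 = (- \<i> * \<xi> $ j) *\<^sub>C wft (rat_window m) \<phi> x \<xi> + (\<i> * complex_of_real (real (m j))) *\<^sub>C wft (rat_window ?m') \<phi> x \<xi> + wft (rat_window m) \<phi>' x \<xi>"
    by simp
  then show ?thesis unfolding \<phi>'_def by (rule scaleC_solve)
qed

text \<open>The two windows differ by the factor \<open>1 + \<i> * (x $ j - y $ j)\<close>; its part
  in \<open>x\<close> leaves the integral and its part in \<open>y\<close> is absorbed into the
  Schwartz function.\<close>

lemma wft_rat_window_Suc:
  fixes \<phi> :: "real ^ 'n \<Rightarrow> 'a::separable_cstar_algebra"
  assumes \<phi>: "\<phi> \<in> schwartz"
  shows "wft (rat_window m) \<phi> x \<xi> = (1 + \<i> * x $ j) *\<^sub>C wft (rat_window (m(j := Suc (m j)))) \<phi> x \<xi>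
    - \<i> *\<^sub>C wft (rat_window (m(j := Suc (m j)))) (\<lambda>y. y $ j *\<^sub>R \<phi> y) x \<xi>"
proof -
  let ?m' = "m(j := Suc (m j))"
  have "(cis (- (y \<bullet> \<xi>)) * rat_window m (x - y)) *\<^sub>C \<phi> y =
      (1 + \<i> * x $ j) *\<^sub>C ((cis (- (y \<bullet> \<xi>)) * rat_window ?m' (x - y)) *\<^sub>C \<phi> y)
      - \<i> *\<^sub>C ((cis (- (y \<bullet> \<xi>)) * rat_window ?m' (x - y)) *\<^sub>C (y $ j *\<^sub>R \<phi> y))" for y
    by (subst rat_window_Suc[of m _ j])
      (simp add: scaleC_scaleC scaleC_of_real[symmetric] algebra_simps flip: scaleC_diff_left)
  then show ?thesis
    unfolding wft_def
    using wft_integrable[OF \<phi> rat_window_measurable cmod_rat_window_le, of \<xi> ?m' x]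
      wft_integrable[OF schwartz_coord_mult[OF \<phi>] rat_window_measurable cmod_rat_window_le, of \<xi> ?m' x j]
    by (simp add: integrable_bounded_linear[OF scaleC.bounded_linear_right]
        integral_bounded_linear[OF scaleC.bounded_linear_right])
qed

text \<open>Only the window depends on \<open>x\<close>, and each component of its derivative is a
  window with one exponent raised.\<close>

lemma wft_has_derivative_x:
  fixes \<phi> :: "real ^ 'n \<Rightarrow> 'a::separable_cstar_algebra"
  assumes \<phi>: "\<phi> \<in> schwartz"
  shows "((\<lambda>x. wft (rat_window m) \<phi> x \<xi>) has_derivative
    (\<lambda>h. \<Sum>j\<in>UNIV. h $ j *\<^sub>R ((- \<i> * m j) *\<^sub>C wft (rat_window (m(j := Suc (m j)))) \<phi> x \<xi>))) (at x)"
proof -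
  let ?q = "\<lambda>j. rat_window (m(j := Suc (m j)))"
  define f' where "f' z y h = (\<Sum>j\<in>UNIV. h $ j *\<^sub>R ((- \<i> * m j) *\<^sub>C ((cis (- (y \<bullet> \<xi>)) * ?q j (z - y)) *\<^sub>C \<phi> y)))" for z y h
  have meas [measurable]: "\<phi> \<in> borel_measurable borel" by (rule schwartz_measurable[OF \<phi>])
  have "((\<lambda>z. wft (rat_window m) \<phi> z \<xi>) has_derivative (\<lambda>h. \<integral>y. f' x y h \<partial>lborel)) (at x)"
    unfolding wft_def
  proof (rule has_derivative_integral[where r = 1 and G = "\<lambda>y. (\<Sum>j\<in>UNIV. real (m j)) * norm (\<phi> y)"])
    fix z y :: "real ^ 'n"
    have "((\<lambda>z. rat_window m (z - y)) has_derivative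
      (\<lambda>h. \<Sum>j\<in>UNIV. complex_of_real (h $ j) * (- \<i> * of_nat (m j) * ?q j (z - y)))) (at z)"
      by (rule has_derivative_compose[OF _ has_derivative_rat_window]) (auto intro!: derivative_eq_intros)
    from scaleC.FDERIV[OF has_derivative_mult[OF has_derivative_const this] has_derivative_const, of "cis (- (y \<bullet> \<xi>))" "\<phi> y"]
    show "((\<lambda>z. (cis (- (y \<bullet> \<xi>)) * rat_window m (z - y)) *\<^sub>C \<phi> y) has_derivative f' z y) (at z)"
      by (rule has_derivative_eq_rhs)
        (auto simp: f'_def sum_distrib_left scaleC.sum_left scaleC_scaleC scaleC_of_real[symmetric] mult_ac)
    fix h :: "real ^ 'n"
    have "norm (f' z y h) \<le> (\<Sum>j\<in>UNIV. norm h * (real (m j) * norm (\<phi> y)))"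
      unfolding f'_def
      by (rule sum_norm_le) (auto simp: norm_scaleC norm_mult cmod_rat_window_le intro!: mult_mono mult_left_le_one_le component_le_norm_cart)
    also have "\<dots> = (\<Sum>j\<in>UNIV. real (m j)) * norm (\<phi> y) * norm h"
      by (simp add: sum_distrib_left sum_distrib_right mult_ac)
    finally show "norm (f' z y h) \<le> (\<Sum>j\<in>UNIV. real (m j)) * norm (\<phi> y) * norm h" .
  next
    show "integrable lborel (\<lambda>y. (cis (- (y \<bullet> \<xi>)) * rat_window m (z - y)) *\<^sub>C \<phi> y)" for z
      by (rule wft_integrable[OF \<phi> rat_window_measurable cmod_rat_window_le])
    show "integrable lborel (\<lambda>y. (\<Sum>j\<in>UNIV. real (m j)) * norm (\<phi> y))"
      using schwartz_integrable[OF \<phi>] by simp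
    show "(\<lambda>y. f' x y h) \<in> borel_measurable lborel" for h
      unfolding f'_def by measurable
  qed (auto intro!: sum_nonneg mult_nonneg_nonneg)
  moreover have "(\<integral>y. f' x y h \<partial>lborel) = (\<Sum>j\<in>UNIV. h $ j *\<^sub>R ((- \<i> * m j) *\<^sub>C wft (?q j) \<phi> x \<xi>))" for h
    unfolding f'_def wft_def using wft_integrable[OF \<phi> rat_window_measurable cmod_rat_window_le]
    by (simp add: integrable_bounded_linear[OF scaleC.bounded_linear_right]
        integral_bounded_linear[OF scaleC.bounded_linear_right])
  ultimately show ?thesis by simp
qed

text \<open>Only the phase depends on \<open>\<xi>\<close>; its derivative brings down
  \<open>- \<i> * y $ j\<close>, and the Schwartz function absorbs the coordinate.\<close>

lemma wft_has_derivative_xi: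
  fixes \<phi> :: "real ^ 'n \<Rightarrow> 'a::separable_cstar_algebra"
  assumes \<phi>: "\<phi> \<in> schwartz"
  shows "((\<lambda>\<xi>. wft (rat_window m) \<phi> x \<xi>) has_derivative
    (\<lambda>h. \<Sum>j\<in>UNIV. h $ j *\<^sub>R ((- \<i>) *\<^sub>C wft (rat_window m) (\<lambda>y. y $ j *\<^sub>R \<phi> y) x \<xi>))) (at \<xi>)"
proof -
  define f' where "f' \<zeta> y h = (\<Sum>j\<in>UNIV. h $ j *\<^sub>R ((- \<i>) *\<^sub>C ((cis (- (y \<bullet> \<zeta>)) * rat_window m (x - y)) *\<^sub>C (y $ j *\<^sub>R \<phi> y))))" for \<zeta> y h
  have meas [measurable]: "\<phi> \<in> borel_measurable borel" by (rule schwartz_measurable[OF \<phi>])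
  have "((\<lambda>\<zeta>. wft (rat_window m) \<phi> x \<zeta>) has_derivative (\<lambda>h. \<integral>y. f' \<xi> y h \<partial>lborel)) (at \<xi>)"
    unfolding wft_def
  proof (rule has_derivative_integral[where r = 1 and G = "\<lambda>y. \<Sum>j\<in>UNIV. norm (y $ j *\<^sub>R \<phi> y)"])
    fix \<zeta> y :: "real ^ 'n"
    have "((\<lambda>\<zeta>. cis (- (y \<bullet> \<zeta>))) has_derivative (\<lambda>h. complex_of_real (- (y \<bullet> h)) * (\<i> * cis (- (y \<bullet> \<zeta>))))) (at \<zeta>)"
      by (intro has_derivative_cis_mult derivative_intros)
    from scaleC.FDERIV[OF has_derivative_mult[OF this has_derivative_const] has_derivative_const, of "rat_window m (x - y)" "\<phi> y"]
    show "((\<lambda>\<zeta>. (cis (- (y \<bullet> \<zeta>)) * rat_window m (x - y)) *\<^sub>C \<phi> y) has_derivative f' \<zeta> y) (at \<zeta>)"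
    proof (rule has_derivative_eq_rhs)
      show "(\<lambda>h. (cis (- (y \<bullet> \<zeta>)) * rat_window m (x - y)) *\<^sub>C 0 + (cis (- (y \<bullet> \<zeta>)) * 0 +
          complex_of_real (- (y \<bullet> h)) * (\<i> * cis (- (y \<bullet> \<zeta>))) * rat_window m (x - y)) *\<^sub>C \<phi> y) = f' \<zeta> y"
      proof
        fix h
        have "f' \<zeta> y h = (\<Sum>j\<in>UNIV. complex_of_real (y $ j * h $ j)) *\<^sub>C ((- \<i> * cis (- (y \<bullet> \<zeta>)) * rat_window m (x - y)) *\<^sub>C \<phi> y)"
          unfolding f'_def scaleC.sum_left by (auto simp: scaleC_of_real[symmetric] scaleC_scaleC mult_ac)
        moreover have "(\<Sum>j\<in>UNIV. complex_of_real (y $ j * h $ j)) = complex_of_real (y \<bullet> h)"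
          by (simp add: inner_vec_def)
        ultimately show "(cis (- (y \<bullet> \<zeta>)) * rat_window m (x - y)) *\<^sub>C 0 + (cis (- (y \<bullet> \<zeta>)) * 0 +
          complex_of_real (- (y \<bullet> h)) * (\<i> * cis (- (y \<bullet> \<zeta>))) * rat_window m (x - y)) *\<^sub>C \<phi> y = f' \<zeta> y h"
          by (simp add: scaleC_scaleC mult_ac)
      qed
    qed
    fix h :: "real ^ 'n"
    have "norm (f' \<zeta> y h) \<le> (\<Sum>j\<in>UNIV. norm h * norm (y $ j *\<^sub>R \<phi> y))"
      unfolding f'_def
      by (rule sum_norm_le) (auto simp: norm_scaleC norm_mult cmod_rat_window_le intro!: mult_mono mult_left_le_one_le component_le_norm_cart)
    then show "norm (f' \<zeta> y h) \<le> (\<Sum>j\<in>UNIV. norm (y $ j *\<^sub>R \<phi> y)) * norm h"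
      by (simp add: sum_distrib_left sum_distrib_right mult_ac)
  next
    show "integrable lborel (\<lambda>y. (cis (- (y \<bullet> \<zeta>)) * rat_window m (x - y)) *\<^sub>C \<phi> y)" for \<zeta>
      by (rule wft_integrable[OF \<phi> rat_window_measurable cmod_rat_window_le])
    show "integrable lborel (\<lambda>y. \<Sum>j\<in>UNIV. norm (y $ j *\<^sub>R \<phi> y))"
      by (intro Bochner_Integration.integrable_sum integrable_norm schwartz_integrable schwartz_coord_mult \<phi>)
    show "(\<lambda>y. f' \<xi> y h) \<in> borel_measurable lborel" for h
      unfolding f'_def by measurable
  qed (auto intro!: sum_nonneg mult_nonneg_nonneg)
  moreover have "(\<integral>y. f' \<xi> y h \<partial>lborel) = (\<Sum>j\<in>UNIV. h $ j *\<^sub>R ((- \<i>) *\<^sub>C wft (rat_window m) (\<lambda>y. y $ j *\<^sub>R \<phi> y) x \<xi>))" for h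
    unfolding f'_def wft_def using wft_integrable[OF schwartz_coord_mult[OF \<phi>] rat_window_measurable cmod_rat_window_le]
    by (simp add: integrable_bounded_linear[OF scaleC.bounded_linear_right]
        integral_bounded_linear[OF scaleC.bounded_linear_right])
  ultimately show ?thesis by simp
qed

text \<open>By \<open>wft_xi_mult\<close> this span is closed under multiplication by each
  coordinate of \<open>\<xi>\<close>, so \<open>decay_bound\<close> yields decay in
  \<open>\<xi>\<close> that is uniform in \<open>x\<close>.\<close>

inductive_set wft_span :: "((real ^ 'n) \<times> (real ^ 'n) \<Rightarrow> 'a::separable_cstar_algebra) set" where
  base: "\<phi> \<in> schwartz \<Longrightarrow> (\<lambda>z. wft (rat_window m) \<phi> (fst z) (snd z)) \<in> wft_span"
| add: "f \<in> wft_span \<Longrightarrow> g \<in> wft_span \<Longrightarrow> (\<lambda>z. f z + g z) \<in> wft_span"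
| scale: "f \<in> wft_span \<Longrightarrow> (\<lambda>z. c *\<^sub>C f z) \<in> wft_span"

lemma wft_span_mult: "f \<in> wft_span \<Longrightarrow> (\<lambda>z. snd z $ j *\<^sub>R f z) \<in> wft_span"
proof (induction rule: wft_span.induct)
  case (base \<phi> m)
  have "(\<lambda>z. snd z $ j *\<^sub>R wft (rat_window m) \<phi> (fst z) (snd z)) =
      (\<lambda>z. complex_of_real (m j) *\<^sub>C wft (rat_window (m(j := Suc (m j)))) \<phi> (fst z) (snd z) +
        (- \<i>) *\<^sub>C wft (rat_window m) (partial_deriv (axis j 1) \<phi>) (fst z) (snd z))"
    by (simp add: wft_xi_mult[OF base] scaleC_minus_left scaleC_of_real del: of_real_of_nat_eq)
  then show ?case
    using wft_span.add[OF wft_span.scale[OF wft_span.base[OF base]] wft_span.scale[OF wft_span.base[OF schwartz_partial_deriv[OF base]]]]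
    by simp
next
  case (add f g)
  show ?case using wft_span.add[OF add.IH] by (simp add: scaleR_add_right)
next
  case (scale f c)
  show ?case using wft_span.scale[OF scale.IH] by (simp add: scaleR_scaleC)
qed

lemma wft_span_bounded: "f \<in> wft_span \<Longrightarrow> bounded (range f)"
proof (induction rule: wft_span.induct)
  case (base \<phi> m)
  then show ?case
    unfolding bounded_iff using norm_wft_le(2)[OF base rat_window_measurable cmod_rat_window_le] by blast
next
  case (add f g)
  then show ?case by (intro bounded_plus_comp)
next
  case (scale f c)
  then show ?case using bounded_linear_image[OF scale.IH scaleC.bounded_linear_right, of c]
    by (simp add: image_image)
qed

lemma wft_decay:
  fixes \<phi> :: "real ^ 'n \<Rightarrow> 'a::separable_cstar_algebra"
  assumes \<phi>: "\<phi> \<in> schwartz"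
  obtains C where "C > 0" "\<And>x \<xi>. norm (wft (rat_window m) \<phi> x \<xi>) \<le> C * decay \<xi>"
proof -
  obtain C where "C > 0" "\<And>z. norm (wft (rat_window m) \<phi> (fst z) (snd z)) \<le> C * decay (snd z)"
    using decay_bound[of "\<lambda>z. wft (rat_window m) \<phi> (fst z) (snd z)" wft_span snd,
        OF wft_span.base[OF \<phi>] wft_span_bounded wft_span_mult wft_span.add] by metis
  then show thesis using that by (metis fst_conv snd_conv)
qed

section \<open>A weighted Bessel inequality\<close>

lemma pair_integrableI:
  fixes F :: "'b::euclidean_space \<times> 'c::euclidean_space \<Rightarrow> 'a::{banach, second_countable_topology}"
  assumes m: "F \<in> borel_measurable (lborel \<Otimes>\<^sub>M lborel)"
    and i: "\<And>x. integrable lborel (\<lambda>y. F (x, y))"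
    and o: "integrable lborel (\<lambda>x. \<integral>y. norm (F (x, y)) \<partial>lborel)"
  shows "integrable (lborel \<Otimes>\<^sub>M lborel) F"
  by (rule lborel_pair.Fubini_integrable) (use m i o in auto)

lemma pair_integrable_mult:
  fixes f :: "'b::euclidean_space \<Rightarrow> real" and g :: "'c::euclidean_space \<Rightarrow> real"
  assumes f: "integrable lborel f" and g: "integrable lborel g"
  shows "integrable (lborel \<Otimes>\<^sub>M lborel) (\<lambda>(x, y). f x * g y)"
proof (rule pair_integrableI)
  note [measurable] = borel_measurable_integrable[OF f] borel_measurable_integrable[OF g]
  show "(\<lambda>(x, y). f x * g y) \<in> borel_measurable (lborel \<Otimes>\<^sub>M lborel)" by measurable
qed (use f g in \<open>auto simp: abs_mult\<close>)

lemma pair_integrable_conv: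
  fixes f g :: "'b::euclidean_space \<Rightarrow> real"
  assumes f: "integrable lborel f" and g: "integrable lborel g"
  shows "integrable (lborel \<Otimes>\<^sub>M lborel) (\<lambda>(x, y). f x * g (y - x))"
proof (rule pair_integrableI)
  have [measurable]: "f \<in> borel_measurable borel" "g \<in> borel_measurable borel"
    using f g borel_measurable_integrable by auto
  show "(\<lambda>(x, y). f x * g (y - x)) \<in> borel_measurable (lborel \<Otimes>\<^sub>M lborel)" by measurable
  have i: "integrable lborel (\<lambda>y. g (y - x))" for x
    using lborel_integral_translate(2)[of g "- x"] g by simp
  then show "integrable lborel (\<lambda>y. case (x, y) of (x, y) \<Rightarrow> f x * g (y - x))" for x by simp
  have "(\<integral>y. \<bar>g (y - x)\<bar> \<partial>lborel) = (\<integral>y. \<bar>g y\<bar> \<partial>lborel)" for x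
    using lborel_integral_translate(1)[of "\<lambda>y. \<bar>g y\<bar>" "- x"] by simp
  then show "integrable lborel (\<lambda>x. \<integral>y. norm (case (x, y) of (x, y) \<Rightarrow> f x * g (y - x)) \<partial>lborel)"
    using f by (simp add: abs_mult)
qed

lemma pair_integrable_swap:
  fixes F :: "'b::euclidean_space \<times> 'c::euclidean_space \<Rightarrow> 'a::{banach, second_countable_topology}"
  shows "integrable (lborel \<Otimes>\<^sub>M lborel) F \<Longrightarrow> integrable (lborel \<Otimes>\<^sub>M lborel) (\<lambda>(x, y). F (y, x))"
  by (rule lborel_pair.integrable_product_swap)

lemma pair_integral_swap:
  fixes F :: "'b::euclidean_space \<times> 'c::euclidean_space \<Rightarrow> 'a::{banach, second_countable_topology}"
  assumes "F \<in> borel_measurable (lborel \<Otimes>\<^sub>M lborel)"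
  shows "(\<integral>z. F (snd z, fst z) \<partial>(lborel \<Otimes>\<^sub>M lborel)) = (\<integral>z. F z \<partial>(lborel \<Otimes>\<^sub>M lborel))"
  using lborel_pair.integral_product_swap[OF assms] by (simp add: case_prod_unfold)

lemma pair_integrable_bound:
  fixes F :: "'b::euclidean_space \<times> 'c::euclidean_space \<Rightarrow> 'a::{banach, second_countable_topology}"
  assumes "integrable (lborel \<Otimes>\<^sub>M lborel) G" "F \<in> borel_measurable (lborel \<Otimes>\<^sub>M lborel)"
    "\<And>x y. norm (F (x, y)) \<le> G (x, y)"
  shows "integrable (lborel \<Otimes>\<^sub>M lborel) F"
  by (rule Bochner_Integration.integrable_bound[OF assms(1,2)])
    (use assms(3) in \<open>auto intro!: AE_I2 order_trans[OF assms(3)]\<close>)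

text \<open>
  The transform of the weight is a nonnegative kernel \<open>K\<close>, and
  \<open>K (y - z) (f y - f z)* (f y - f z)\<close> is positive.
\<close>

lemma bessel_weighted:
  fixes f :: "real ^ 'n \<Rightarrow> 'a::separable_cstar_algebra"
  assumes f: "integrable lborel f" and f2: "L2 lborel f" and e: "\<epsilon> > 0"
  defines "fh \<equiv> \<lambda>\<xi>. \<integral>y. cis (- (y \<bullet> \<xi>)) *\<^sub>C f y \<partial>lborel"
  shows "cpos ((2 * pi) ^ CARD('n) *\<^sub>R L2_ip lborel f f - (\<integral>\<xi>. gauss_wt \<epsilon> \<xi> *\<^sub>R (star (fh \<xi>) * fh \<xi>) \<partial>lborel))"
proof -
  let ?M = "lborel \<Otimes>\<^sub>M lborel :: ((real^'n) \<times> (real^'n)) measure"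
  let ?K = "gauss_hat \<epsilon> :: real ^ 'n \<Rightarrow> real"
  have [measurable]: "f \<in> borel_measurable borel" using f borel_measurable_integrable by auto
  have nf: "integrable lborel (\<lambda>y. norm (f y))" using f by simp
  have nf2: "integrable lborel (\<lambda>y. (norm (f y))\<^sup>2)" using f2 by (simp add: L2_def)
  have ff: "integrable ?M (\<lambda>(y, z). norm (f y) * norm (f z))" by (rule pair_integrable_mult[OF nf nf])
  have cf: "integrable lborel (\<lambda>y. cis (- (y \<bullet> \<xi>)) *\<^sub>C f y)" for \<xi>
    by (rule Bochner_Integration.integrable_bound[OF f]) (auto simp: norm_scaleC)
  have i2: "integrable ?M (\<lambda>w. cis (\<xi> \<bullet> (fst w - snd w)) *\<^sub>C (star (f (fst w)) * f (snd w)))" for \<xi>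
    by (rule pair_integrable_bound[OF ff])
      (auto simp: norm_scaleC intro!: order_trans[OF norm_mult_ineq])
  have sq: "star (fh \<xi>) * fh \<xi> = (\<integral>w. cis (\<xi> \<bullet> (fst w - snd w)) *\<^sub>C (star (f (fst w)) * f (snd w)) \<partial>?M)" for \<xi>
  proof -
    have "star (fh \<xi>) = (\<integral>y. star (cis (- (y \<bullet> \<xi>)) *\<^sub>C f y) \<partial>lborel)"
      unfolding fh_def by (rule integral_bounded_linear[OF bounded_linear_star cf, symmetric])
    also have "\<dots> = (\<integral>y. cis (y \<bullet> \<xi>) *\<^sub>C star (f y) \<partial>lborel)"
      by (simp add: star_scaleC cis_cnj)
    finally have "star (fh \<xi>) * fh \<xi> = (\<integral>y. cis (y \<bullet> \<xi>) *\<^sub>C star (f y) \<partial>lborel) * fh \<xi>" by simp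
    also have "\<dots> = (\<integral>y. (cis (y \<bullet> \<xi>) *\<^sub>C star (f y)) * fh \<xi> \<partial>lborel)"
    proof -
      have "integrable lborel (\<lambda>y. cis (y \<bullet> \<xi>) *\<^sub>C star (f y))"
        using integrable_bounded_linear[OF bounded_linear_star cf[of \<xi>]] by (simp add: star_scaleC cis_cnj)
      then show ?thesis by simp
    qed
    also have "\<dots> = (\<integral>y. (\<integral>z. (cis (y \<bullet> \<xi>) *\<^sub>C star (f y)) * (cis (- (z \<bullet> \<xi>)) *\<^sub>C f z) \<partial>lborel) \<partial>lborel)"
      unfolding fh_def using cf by simp
    also have "\<dots> = (\<integral>y. (\<integral>z. cis (\<xi> \<bullet> (fst (y, z) - snd (y, z))) *\<^sub>C (star (f (fst (y, z))) * f (snd (y, z))) \<partial>lborel) \<partial>lborel)"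
      by (simp add: mult_scaleC_left mult_scaleC_right scaleC_scaleC cis_mult inner_diff_right inner_commute[of \<xi>])
    also have "\<dots> = (\<integral>w. cis (\<xi> \<bullet> (fst w - snd w)) *\<^sub>C (star (f (fst w)) * f (snd w)) \<partial>?M)"
      by (rule lborel_pair.integral_fst'[OF i2])
    finally show ?thesis .
  qed
  define C where "C = (\<integral>w. ?K (fst w - snd w) *\<^sub>R (star (f (fst w)) * f (snd w)) \<partial>?M)"
  have eq1: "(\<integral>\<xi>. gauss_wt \<epsilon> \<xi> *\<^sub>R (star (fh \<xi>) * fh \<xi>) \<partial>lborel) = C"
  proof -
    \<comment> \<open>The integrable weight is what permits the \<open>\<xi>\<close> integral to be
      taken first; it then produces \<open>gauss_hat\<close> at the difference of the two
      points.\<close>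
    let ?F = "\<lambda>(\<xi>, w). gauss_wt \<epsilon> \<xi> *\<^sub>R (cis (\<xi> \<bullet> (fst w - snd w)) *\<^sub>C (star (f (fst w)) * f (snd w)))"
    have "integrable lborel (\<lambda>w. norm (f (fst w)) * norm (f (snd w)))"
      using ff by (simp add: case_prod_unfold lborel_prod)
    from pair_integrable_mult[OF integrable_gauss_wt[OF e, where 'n = 'n] this]
    have iF: "integrable (lborel \<Otimes>\<^sub>M lborel) ?F"
    proof (rule pair_integrable_bound)
      have [measurable]: "fst \<in> borel_measurable (borel :: ((real^'n) \<times> (real^'n)) measure)"
        "snd \<in> borel_measurable (borel :: ((real^'n) \<times> (real^'n)) measure)"
        by (intro borel_measurable_continuous_onI continuous_intros)+
      have [measurable]: "(\<lambda>w. star (f (fst w)) * f (snd w)) \<in> borel_measurable borel"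
        "(\<lambda>w. fst w - snd w :: real ^ 'n) \<in> borel_measurable borel"
        by measurable
      let ?N = "lborel \<Otimes>\<^sub>M lborel :: ((real^'n) \<times> ((real^'n) \<times> (real^'n))) measure"
      have [measurable]: "(\<lambda>z. fst (snd z) - snd (snd z)) \<in> borel_measurable ?N"
        by (rule measurable_compose[OF measurable_snd, of "\<lambda>w. fst w - snd w"]) simp
      have [measurable]: "(\<lambda>z. star (f (fst (snd z))) * f (snd (snd z))) \<in> borel_measurable ?N"
        by (rule measurable_compose[OF measurable_snd, of "\<lambda>w. star (f (fst w)) * f (snd w)"]) simp
      have [measurable]: "(\<lambda>z. cis (fst z \<bullet> (fst (snd z) - snd (snd z)))) \<in> borel_measurable ?N"
        by (rule measurable_compose[OF borel_measurable_inner cis_measurable]) simp_all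
      have [measurable]: "(\<lambda>z. gauss_wt \<epsilon> (fst z)) \<in> borel_measurable ?N"
        by (rule measurable_compose[OF measurable_fst]) simp
      show "?F \<in> borel_measurable (lborel \<Otimes>\<^sub>M lborel)" unfolding case_prod_unfold by measurable
      fix \<xi> :: "real ^ 'n" and w :: "(real ^ 'n) \<times> (real ^ 'n)"
      have "norm (star (f (fst w)) * f (snd w)) \<le> norm (f (fst w)) * norm (f (snd w))"
        using norm_mult_ineq[of "star (f (fst w))" "f (snd w)"] by simp
      then show "norm (?F (\<xi>, w)) \<le> (case (\<xi>, w) of (\<xi>, w) \<Rightarrow> gauss_wt \<epsilon> \<xi> * (norm (f (fst w)) * norm (f (snd w))))"
        using gauss_wt_bounds(1)[of \<epsilon> \<xi>] by (simp add: norm_scaleC mult_left_mono)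
    qed
    have "(\<integral>\<xi>. gauss_wt \<epsilon> \<xi> *\<^sub>R (star (fh \<xi>) * fh \<xi>) \<partial>lborel) = (\<integral>\<xi>. (\<integral>w. ?F (\<xi>, w) \<partial>lborel) \<partial>lborel)"
      unfolding sq by (simp add: lborel_prod)
    also have "\<dots> = (\<integral>w. (\<integral>\<xi>. ?F (\<xi>, w) \<partial>lborel) \<partial>lborel)"
      using lborel_pair.Fubini_integral[of "\<lambda>\<xi> w. ?F (\<xi>, w)"] iF by (simp add: case_prod_unfold)
    also have "\<dots> = (\<integral>w. ?K (fst w - snd w) *\<^sub>R (star (f (fst w)) * f (snd w)) \<partial>lborel)"
    proof (rule Bochner_Integration.integral_cong[OF refl])
      fix w
      let ?v = "star (f (fst w)) * f (snd w)"
      have g: "integrable lborel (\<lambda>\<xi>. gauss_wt \<epsilon> \<xi> *\<^sub>R cis (\<xi> \<bullet> (fst w - snd w)))"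
        by (rule Bochner_Integration.integrable_bound[OF integrable_gauss_wt[OF e]]) auto
      have "(\<integral>\<xi>. ?F (\<xi>, w) \<partial>lborel) = (\<integral>\<xi>. (gauss_wt \<epsilon> \<xi> *\<^sub>R cis (\<xi> \<bullet> (fst w - snd w))) *\<^sub>C ?v \<partial>lborel)"
        by (simp add: scaleR_scaleC_assoc)
      also have "\<dots> = (\<integral>\<xi>. gauss_wt \<epsilon> \<xi> *\<^sub>R cis (\<xi> \<bullet> (fst w - snd w)) \<partial>lborel) *\<^sub>C ?v"
        by (rule integral_bounded_linear[OF scaleC.bounded_linear_left g])
      finally show "(\<integral>\<xi>. ?F (\<xi>, w) \<partial>lborel) = ?K (fst w - snd w) *\<^sub>R ?v"
        by (simp add: integral_gauss_wt_cis[OF e] scaleC_of_real)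
    qed
    finally show ?thesis by (simp add: C_def lborel_prod)
  qed
  have K: "integrable lborel ?K" "(\<integral>s. ?K s \<partial>lborel) = (2 * pi) ^ CARD('n)"
    using integral_gauss_hat[OF e] by auto
  have K0: "0 \<le> ?K s" for s by (rule gauss_hat_nonneg[OF e])
  have Ks: "?K (y - z) = ?K (z - y)" for y z using gauss_hat_minus[of \<epsilon> "z - y"] by simp
  have k1: "integrable ?M (\<lambda>w. ?K (fst w - snd w) * (norm (f (fst w)))\<^sup>2)"
    using pair_integrable_conv[OF nf2 K(1)] by (simp add: case_prod_unfold Ks mult.commute)
  have k2: "integrable ?M (\<lambda>w. ?K (fst w - snd w) * (norm (f (snd w)))\<^sup>2)"
    using pair_integrable_swap[OF k1] by (simp add: case_prod_unfold Ks[of "fst _"])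
  have k12: "integrable ?M (\<lambda>w. ?K (fst w - snd w) * ((norm (f (fst w)))\<^sup>2 + (norm (f (snd w)))\<^sup>2))"
    using Bochner_Integration.integrable_add[OF k1 k2] by (simp add: distrib_left)
  have j1: "integrable ?M (\<lambda>w. ?K (fst w - snd w) *\<^sub>R (star (f (fst w)) * f (fst w)))"
    by (rule pair_integrable_bound[OF k1]) (auto simp: cstar_identity abs_of_nonneg K0)
  have j2: "integrable ?M (\<lambda>w. ?K (fst w - snd w) *\<^sub>R (star (f (snd w)) * f (snd w)))"
    by (rule pair_integrable_bound[OF k2]) (auto simp: cstar_identity abs_of_nonneg K0)
  have j3: "integrable ?M (\<lambda>w. ?K (fst w - snd w) *\<^sub>R (star (f (fst w)) * f (snd w)))"
    by (rule pair_integrable_bound[OF k12]) (auto simp: abs_of_nonneg K0 intro!: mult_left_mono norm_star_mult_le)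
  have j4: "integrable ?M (\<lambda>w. ?K (fst w - snd w) *\<^sub>R (star (f (snd w)) * f (fst w)))"
    using pair_integrable_swap[OF j3] by (simp add: case_prod_unfold Ks[of "fst _"])
  have e4: "(\<integral>w. ?K (fst w - snd w) *\<^sub>R (star (f (snd w)) * f (fst w)) \<partial>?M) = C"
    using pair_integral_swap[OF borel_measurable_integrable[OF j3]] by (simp add: C_def Ks[of "fst _"])
  have e1: "(\<integral>w. ?K (fst w - snd w) *\<^sub>R (star (f (fst w)) * f (fst w)) \<partial>?M) = (2 * pi) ^ CARD('n) *\<^sub>R L2_ip lborel f f"
  proof -
    have "(\<integral>w. ?K (fst w - snd w) *\<^sub>R (star (f (fst w)) * f (fst w)) \<partial>?M) =
        (\<integral>y. (\<integral>z. ?K (y - z) *\<^sub>R (star (f y) * f y) \<partial>lborel) \<partial>lborel)"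
      using lborel_pair.integral_fst'[OF j1] by simp
    also have "\<dots> = (\<integral>y. (2 * pi) ^ CARD('n) *\<^sub>R (star (f y) * f y) \<partial>lborel)"
    proof (rule Bochner_Integration.integral_cong[OF refl])
      fix y
      have "integrable lborel (\<lambda>z. ?K (y - z))" "(\<integral>z. ?K (y - z) \<partial>lborel) = (2 * pi) ^ CARD('n)"
        using lborel_integral_reflect[of ?K y] K by auto
      then show "(\<integral>z. ?K (y - z) *\<^sub>R (star (f y) * f y) \<partial>lborel) = (2 * pi) ^ CARD('n) *\<^sub>R (star (f y) * f y)"
        by simp
    qed
    finally show ?thesis by (simp add: L2_ip_def)
  qed
  have e2: "(\<integral>w. ?K (fst w - snd w) *\<^sub>R (star (f (snd w)) * f (snd w)) \<partial>?M) = (2 * pi) ^ CARD('n) *\<^sub>R L2_ip lborel f f"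
    using pair_integral_swap[OF borel_measurable_integrable[OF j1]] e1 by (simp add: Ks[of "fst _"])
  \<comment> \<open>Expanded, the two diagonal terms have integral
    \<open>(2 * pi) ^ CARD('n) *\<^sub>R L2_ip lborel f f\<close> each and the two mixed terms have
    integral \<open>C\<close> each, so this positivity is twice the claim.\<close>
  have "cpos (\<integral>w. ?K (fst w - snd w) *\<^sub>R (star (f (fst w) - f (snd w)) * (f (fst w) - f (snd w))) \<partial>?M)"
    by (rule cpos_integral) (intro cpos_scaleR cpos_star_mult K0)
  also have "(\<integral>w. ?K (fst w - snd w) *\<^sub>R (star (f (fst w) - f (snd w)) * (f (fst w) - f (snd w))) \<partial>?M) =
      (\<integral>w. (?K (fst w - snd w) *\<^sub>R (star (f (fst w)) * f (fst w)) + ?K (fst w - snd w) *\<^sub>R (star (f (snd w)) * f (snd w)))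
        - (?K (fst w - snd w) *\<^sub>R (star (f (fst w)) * f (snd w)) + ?K (fst w - snd w) *\<^sub>R (star (f (snd w)) * f (fst w))) \<partial>?M)"
    by (rule Bochner_Integration.integral_cong) (auto simp: star_diff algebra_simps)
  also have "\<dots> = 2 *\<^sub>R ((2 * pi) ^ CARD('n) *\<^sub>R L2_ip lborel f f - C)"
    using j1 j2 j3 j4 by (simp add: e1 e2 e4 C_def[symmetric] scaleR_2)
  finally have "cpos ((1/2) *\<^sub>R (2 *\<^sub>R ((2 * pi) ^ CARD('n) *\<^sub>R L2_ip lborel f f - C)))"
    by (rule cpos_scaleR) simp
  then show ?thesis unfolding eq1 by simp
qed

text \<open>For fixed \<open>x\<close> the transform is that of
  \<open>p (x - y) *\<^sub>C \<phi> y\<close>, to which \<open>bessel_weighted\<close> applies;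
  integration over \<open>x\<close> turns the window into the constant factor, its squared L2 norm.
  The weight enters by its square root since \<open>form_bound\<close> distributes it over two
  factors.\<close>

lemma wft_weighted_L2:
  fixes \<phi> :: "real ^ 'n \<Rightarrow> 'a::separable_cstar_algebra" and p :: "real ^ 'n \<Rightarrow> complex"
  assumes \<phi>: "\<phi> \<in> schwartz" and e: "\<epsilon> > 0"
    and p: "p \<in> borel_measurable borel" "\<And>s. cmod (p s) \<le> 1" "integrable lborel (\<lambda>s. (cmod (p s))\<^sup>2)"
  defines "u \<equiv> \<lambda>z. sqrt (gauss_wt \<epsilon> (snd z)) *\<^sub>R wft p \<phi> (fst z) (snd z)"
  shows "L2 (lborel \<Otimes>\<^sub>M lborel) u"
    and "(L2_norm (lborel \<Otimes>\<^sub>M lborel) u)\<^sup>2 \<le> (2 * pi) ^ CARD('n) * (\<integral>s. (cmod (p s))\<^sup>2 \<partial>lborel) * (L2_norm lborel \<phi>)\<^sup>2"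
proof -
  let ?M = "lborel \<Otimes>\<^sub>M lborel :: ((real^'n) \<times> (real^'n)) measure"
  have [measurable]: "\<phi> \<in> borel_measurable borel" by (rule schwartz_measurable[OF \<phi>])
  note [measurable] = p(1)
  have wm: "(\<lambda>z. wft p \<phi> (fst z) (snd z)) \<in> borel_measurable ?M"
    using wft_measurable[OF \<phi> p(1)] by (simp add: borel_prod lborel_prod)
  have um: "u \<in> borel_measurable ?M"
    unfolding u_def by (intro borel_measurable_scaleR borel_measurable_sqrt wm measurable_compose[OF measurable_snd]) simp
  have nphi: "integrable lborel (\<lambda>y. norm (\<phi> y))" using schwartz_integrable[OF \<phi>] by simp
  define N where "N = (\<integral>y. norm (\<phi> y) \<partial>lborel)"
  have conv: "integrable ?M (\<lambda>(y, x). norm (\<phi> y) * (cmod (p (x - y)))\<^sup>2)"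
    by (rule pair_integrable_conv[OF nphi p(3)])
  define v where "v x = (\<integral>y. norm (\<phi> y) * (cmod (p (x - y)))\<^sup>2 \<partial>lborel)" for x
  have vi: "integrable lborel v"
    using lborel_pair.integrable_snd[OF conv] by (simp add: v_def[abs_def])
  text \<open>The scalar Cauchy-Schwarz inequality for the measure with density \<open>norm (\<phi> y)\<close>.\<close>
  have wb: "(norm (wft p \<phi> x \<xi>))\<^sup>2 \<le> N * v x" for x \<xi>
  proof -
    have i1: "integrable lborel (\<lambda>y. norm (\<phi> y) * (cmod (p (x - y)))\<^sup>2)"
      by (rule Bochner_Integration.integrable_bound[OF nphi])
        (use p(2) in \<open>auto simp: abs_mult power_le_one intro!: mult_left_le\<close>)
    have i2: "integrable lborel (\<lambda>y. cmod (p (x - y)) * norm (\<phi> y))"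
      by (rule Bochner_Integration.integrable_bound[OF nphi])
        (use p(2) in \<open>auto simp: abs_mult intro!: mult_left_le_one_le\<close>)
    define A where "A = (\<integral>y. cmod (p (x - y)) * norm (\<phi> y) \<partial>lborel)"
    have quad: "0 \<le> t\<^sup>2 * N - 2 * t * A + v x" for t
    proof -
      have "0 \<le> (\<integral>y. norm (\<phi> y) * (t - cmod (p (x - y)))\<^sup>2 \<partial>lborel)"
        by (rule integral_nonneg_AE) auto
      also have "\<dots> = (\<integral>y. t\<^sup>2 * norm (\<phi> y) - 2 * t * (cmod (p (x - y)) * norm (\<phi> y)) + norm (\<phi> y) * (cmod (p (x - y)))\<^sup>2 \<partial>lborel)"
        by (rule Bochner_Integration.integral_cong) (auto simp: power2_diff algebra_simps)
      also have "\<dots> = t\<^sup>2 * N - 2 * t * A + v x"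
        using nphi i1 i2 by (simp add: N_def A_def v_def)
      finally show ?thesis .
    qed
    have "A\<^sup>2 \<le> N * v x"
    proof (cases "N = 0")
      case True
      have "A \<le> N" unfolding A_def N_def using nphi i2 p(2)
        by (intro integral_mono) (auto intro!: mult_left_le_one_le)
      moreover have "0 \<le> A" unfolding A_def by (rule integral_nonneg_AE) auto
      ultimately show ?thesis using True by simp
    next
      case False
      have "N \<ge> 0" unfolding N_def by (rule integral_nonneg_AE) auto
      then have "N > 0" using False by simp
      \<comment> \<open>\<open>A / N\<close> is the minimum point of the quadratic in
        \<open>t\<close>.\<close>
      then show ?thesis using quad[of "A / N"]
        by (simp add: power2_eq_square field_simps)
    qed
    moreover have "(norm (wft p \<phi> x \<xi>))\<^sup>2 \<le> A\<^sup>2"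
      unfolding A_def by (intro power_mono norm_wft_le(1) \<phi> p) auto
    ultimately show ?thesis by simp
  qed
  show L: "L2 ?M u"
    unfolding L2_def
  proof
    \<comment> \<open>The majorant factorises: it is integrable in \<open>x\<close> by convolution
      and in \<open>\<xi>\<close> by the weight.\<close>
    have "integrable ?M (\<lambda>(x, \<xi>). (N * v x) * gauss_wt \<epsilon> \<xi>)"
      by (rule pair_integrable_mult) (use vi integrable_gauss_wt[OF e] in auto)
    then show "integrable ?M (\<lambda>z. (norm (u z))\<^sup>2)"
    proof (rule pair_integrable_bound)
      show "(\<lambda>z. (norm (u z))\<^sup>2) \<in> borel_measurable ?M" using um by measurable
      fix x \<xi>
      show "norm ((norm (u (x, \<xi>)))\<^sup>2) \<le> (case (x, \<xi>) of (x, \<xi>) \<Rightarrow> (N * v x) * gauss_wt \<epsilon> \<xi>)"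
        using wb[of x \<xi>] gauss_wt_bounds(1)[of \<epsilon> \<xi>]
        by (simp add: u_def power_mult_distrib mult.commute mult_right_mono less_imp_le)
    qed
  qed (rule um)
  define P where "P = (\<integral>s. (cmod (p s))\<^sup>2 \<partial>lborel)"
  have uu: "star (u z) * u z = gauss_wt \<epsilon> (snd z) *\<^sub>R (star (wft p \<phi> (fst z) (snd z)) * wft p \<phi> (fst z) (snd z))" for z
    using gauss_wt_bounds(1)[of \<epsilon> "snd z"] by (simp add: u_def star_scaleR less_imp_le)
  have fx: "cpos ((2 * pi) ^ CARD('n) *\<^sub>R (\<integral>y. (cmod (p (x - y)))\<^sup>2 *\<^sub>R (star (\<phi> y) * \<phi> y) \<partial>lborel) - (\<integral>\<xi>. star (u (x, \<xi>)) * u (x, \<xi>) \<partial>lborel))" for x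
  proof -
    let ?f = "\<lambda>y. p (x - y) *\<^sub>C \<phi> y"
    have fi: "integrable lborel ?f" using wft_integrable[OF \<phi> p(1,2), of 0 x] by simp
    have fL: "L2 lborel ?f"
      by (rule L2_bound[OF schwartz_L2[OF \<phi>], of _ 1])
        (use borel_measurable_integrable[OF fi] p(2) in \<open>auto simp: norm_scaleC mult_left_le_one_le\<close>)
    have "star (?f y) * ?f y = (cmod (p (x - y)))\<^sup>2 *\<^sub>R (star (\<phi> y) * \<phi> y)" for y
      by (simp add: star_scaleC mult_scaleC_left mult_scaleC_right scaleC_scaleC
          complex_norm_square[symmetric] mult.commute[of "cnj _"] flip: scaleC_of_real)
    then have 1: "L2_ip lborel ?f ?f = (\<integral>y. (cmod (p (x - y)))\<^sup>2 *\<^sub>R (star (\<phi> y) * \<phi> y) \<partial>lborel)"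
      by (simp add: L2_ip_def)
    have 2: "(\<integral>y. cis (- (y \<bullet> \<xi>)) *\<^sub>C ?f y \<partial>lborel) = wft p \<phi> x \<xi>" for \<xi>
      by (simp add: wft_def scaleC_scaleC)
    show ?thesis using bessel_weighted[OF fi fL e] unfolding 1 2 by (simp add: uu)
  qed
  have ssi: "integrable lborel (\<lambda>y. star (\<phi> y) * \<phi> y)"
    using integrable_star_mult[OF schwartz_L2[OF \<phi>] schwartz_L2[OF \<phi>]] .
  have pi: "integrable ?M (\<lambda>(y, x). (cmod (p (x - y)))\<^sup>2 *\<^sub>R (star (\<phi> y) * \<phi> y))"
  proof (rule pair_integrable_bound)
    show "integrable ?M (\<lambda>(y, x). (norm (\<phi> y))\<^sup>2 * (cmod (p (x - y)))\<^sup>2)"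
      using schwartz_L2[OF \<phi>] p(3) by (intro pair_integrable_conv) (auto simp: L2_def)
  qed (auto simp: cstar_identity mult.commute)
  have i1: "integrable lborel (\<lambda>x. \<integral>y. (cmod (p (x - y)))\<^sup>2 *\<^sub>R (star (\<phi> y) * \<phi> y) \<partial>lborel)"
    using lborel_pair.integrable_snd[OF pi] by simp
  have "(\<integral>x. \<integral>y. (cmod (p (x - y)))\<^sup>2 *\<^sub>R (star (\<phi> y) * \<phi> y) \<partial>lborel \<partial>lborel) =
      (\<integral>y. \<integral>x. (cmod (p (x - y)))\<^sup>2 *\<^sub>R (star (\<phi> y) * \<phi> y) \<partial>lborel \<partial>lborel)"
    using lborel_pair.Fubini_integral[OF pi] by simp
  also have "\<dots> = (\<integral>y. P *\<^sub>R (star (\<phi> y) * \<phi> y) \<partial>lborel)"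
  proof (rule Bochner_Integration.integral_cong[OF refl])
    fix y
    have "integrable lborel (\<lambda>x. (cmod (p (x - y)))\<^sup>2)" "(\<integral>x. (cmod (p (x - y)))\<^sup>2 \<partial>lborel) = P"
      using lborel_integral_translate[of "\<lambda>s. (cmod (p s))\<^sup>2" "- y"] p(3) by (simp_all add: P_def)
    then show "(\<integral>x. (cmod (p (x - y)))\<^sup>2 *\<^sub>R (star (\<phi> y) * \<phi> y) \<partial>lborel) = P *\<^sub>R (star (\<phi> y) * \<phi> y)" by simp
  qed
  also have "\<dots> = P *\<^sub>R L2_ip lborel \<phi> \<phi>" using ssi by (simp add: L2_ip_def)
  finally have e1: "(\<integral>x. \<integral>y. (cmod (p (x - y)))\<^sup>2 *\<^sub>R (star (\<phi> y) * \<phi> y) \<partial>lborel \<partial>lborel) = P *\<^sub>R L2_ip lborel \<phi> \<phi>" .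
  have ui: "integrable ?M (\<lambda>z. star (u z) * u z)" by (rule integrable_star_mult[OF L L])
  have i2: "integrable lborel (\<lambda>x. \<integral>\<xi>. star (u (x, \<xi>)) * u (x, \<xi>) \<partial>lborel)"
    by (rule lborel_pair.integrable_fst'[OF ui])
  have e2: "(\<integral>x. \<integral>\<xi>. star (u (x, \<xi>)) * u (x, \<xi>) \<partial>lborel \<partial>lborel) = L2_ip ?M u u"
    unfolding L2_ip_def by (rule lborel_pair.integral_fst'[OF ui])
  have "cpos (\<integral>x. (2 * pi) ^ CARD('n) *\<^sub>R (\<integral>y. (cmod (p (x - y)))\<^sup>2 *\<^sub>R (star (\<phi> y) * \<phi> y) \<partial>lborel) - (\<integral>\<xi>. star (u (x, \<xi>)) * u (x, \<xi>) \<partial>lborel) \<partial>lborel)"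
    by (rule cpos_integral) (rule fx)
  also have "\<dots> = (2 * pi) ^ CARD('n) *\<^sub>R (P *\<^sub>R L2_ip lborel \<phi> \<phi>) - L2_ip ?M u u"
    using i1 i2 by (simp add: e1 e2)
  finally have "norm (L2_ip ?M u u) \<le> norm ((2 * pi) ^ CARD('n) *\<^sub>R (P *\<^sub>R L2_ip lborel \<phi> \<phi>))"
    by (rule cpos_norm_mono[OF cpos_L2_ip])
  moreover have "P \<ge> 0" unfolding P_def by (rule integral_nonneg_AE) auto
  ultimately show "(L2_norm ?M u)\<^sup>2 \<le> (2 * pi) ^ CARD('n) * (\<integral>s. (cmod (p s))\<^sup>2 \<partial>lborel) * (L2_norm lborel \<phi>)\<^sup>2"
    by (simp add: L2_norm_power2 P_def abs_of_nonneg)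
qed

section \<open>Square-integrable windows and the bilinear form\<close>

lemma integrable_rat_window_square:
  fixes m :: "'n::finite \<Rightarrow> nat"
  assumes m: "\<And>j. m j \<ge> 1"
  shows "integrable lborel (\<lambda>s. (cmod (rat_window m s))\<^sup>2)"
    and "(\<integral>s. (cmod (rat_window m s))\<^sup>2 \<partial>lborel) \<le> (\<integral>s. decay (s :: real ^ 'n) \<partial>lborel)"
proof -
  \<comment> \<open>Since \<open>1 + \<i> * t\<close> has squared modulus \<open>1 + t^2\<close>,
    exponent 1 gives \<open>decay\<close> itself, and higher exponents only make the window
    smaller.\<close>
  have le: "(cmod (rat_window m s))\<^sup>2 \<le> decay s" for s
  proof -
    have "(cmod (rat_window m s))\<^sup>2 = (\<Prod>j\<in>UNIV. (1 / (1 + (s $ j)\<^sup>2)) ^ m j)"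
    proof -
      have "(cmod (1 + \<i> * complex_of_real t))\<^sup>2 = 1 + t\<^sup>2" for t by (simp add: cmod_power2)
      then have "inverse ((cmod (1 + \<i> * complex_of_real t))\<^sup>2) = 1 / (1 + t\<^sup>2)" for t
        by (simp add: inverse_eq_divide)
      then have "(cmod (inverse (1 + \<i> * complex_of_real t)))\<^sup>2 = 1 / (1 + t\<^sup>2)" for t
        by (simp only: norm_inverse power_inverse)
      then show ?thesis
        by (simp add: rat_window_def prod_norm[symmetric] norm_power prod_power_distrib power_commutes flip: power_mult)
          (simp add: mult.commute[of _ 2] power_mult)
    qed
    also have "\<dots> \<le> (\<Prod>j\<in>UNIV. 1 / (1 + (s $ j)\<^sup>2))"
    proof (rule prod_mono, safe)
      fix j
      have "0 \<le> 1 / (1 + (s $ j)\<^sup>2)" "1 / (1 + (s $ j)\<^sup>2) \<le> 1" by (auto simp: one_plus_square_pos less_imp_le)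
      then show "0 \<le> (1 / (1 + (s $ j)\<^sup>2)) ^ m j" "(1 / (1 + (s $ j)\<^sup>2)) ^ m j \<le> 1 / (1 + (s $ j)\<^sup>2)"
        using power_decreasing[of 1 "m j" "1 / (1 + (s $ j)\<^sup>2)"] m[of j] by auto
    qed
    finally show ?thesis by (simp add: decay_def)
  qed
  show i: "integrable lborel (\<lambda>s. (cmod (rat_window m s))\<^sup>2)"
    by (rule Bochner_Integration.integrable_bound[OF integrable_decay]) (use le in \<open>auto intro!: order_trans[OF le]\<close>)
  show "(\<integral>s. (cmod (rat_window m s))\<^sup>2 \<partial>lborel) \<le> (\<integral>s. decay (s :: real ^ 'n) \<partial>lborel)"
    by (rule integral_mono[OF i integrable_decay]) (rule le)
qed

lemma kern_square: 
  shows "integrable lborel (\<lambda>s::real^'n. (cmod (complex_of_real (kern s)))\<^sup>2)"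
    and "(\<integral>s. (cmod (complex_of_real (kern (s::real^'n))))\<^sup>2 \<partial>lborel) \<le> (\<integral>s. kern (s::real^'n) \<partial>lborel)"
proof -
  have le: "(cmod (complex_of_real (kern s)))\<^sup>2 \<le> kern s" for s :: "real ^ 'n"
    using kern_bounds[of s] by (simp add: power2_eq_square mult_left_le_one_le)
  show i: "integrable lborel (\<lambda>s::real^'n. (cmod (complex_of_real (kern s)))\<^sup>2)"
  proof (rule Bochner_Integration.integrable_bound[OF integrable_kern])
    show "AE s::real^'n in lborel. norm ((cmod (complex_of_real (kern s)))\<^sup>2) \<le> norm (kern s)"
      using le by (intro AE_I2) (simp add: abs_of_nonneg kern_bounds(1))
  qed simp
  show "(\<integral>s. (cmod (complex_of_real (kern (s::real^'n))))\<^sup>2 \<partial>lborel) \<le> (\<integral>s. kern (s::real^'n) \<partial>lborel)"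
    by (rule integral_mono[OF i integrable_kern]) (rule le)
qed

abbreviation wftk :: "(real ^ 'n \<Rightarrow> 'a) \<Rightarrow> real ^ 'n \<Rightarrow> real ^ 'n \<Rightarrow> 'a::separable_cstar_algebra" where
  "wftk \<equiv> wft (\<lambda>s. complex_of_real (kern s))"

text \<open>The geometric mean of the two Bessel constants. Each is
  \<open>(2 * pi) ^ CARD('n)\<close> times a bound for the squared L2 norm of the window: the
  integral of \<open>kern\<close> for the window of \<open>\<psi>\<close>, that of
  \<open>decay\<close> for the window of \<open>\<phi>\<close>.\<close>

definition form_const :: "'n::finite itself \<Rightarrow> real" where
  "form_const _ = (2 * pi) ^ CARD('n) * sqrt ((\<integral>s. kern (s::real^'n) \<partial>lborel) * (\<integral>s. decay (s :: real ^ 'n) \<partial>lborel))"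

lemma form_const_nonneg: "form_const TYPE('n::finite) \<ge> 0"
  unfolding form_const_def
  by (auto intro!: mult_nonneg_nonneg integral_nonneg_AE simp: kern_bounds decay_pos less_imp_le)

lemma kern_cmod_le: "cmod (complex_of_real (kern s)) \<le> 1"
  using kern_bounds[of s] by simp

lemma kern_complex_measurable: "(\<lambda>s. complex_of_real (kern s)) \<in> borel_measurable borel"
  by measurable

text \<open>\<open>F\<close> is integrable because the first factor has an integrable majorant in
  \<open>x\<close> and the last one in \<open>\<xi>\<close>. For the bound by module norms a
  Gaussian weight is split into two square roots, Cauchy-Schwarz on the product space is followed by
  \<open>wft_weighted_L2\<close>, and the weight is removed by dominated convergence.\<close>

lemma form_bound:
  fixes \<phi> \<psi> :: "real ^ 'n \<Rightarrow> 'a::separable_cstar_algebra"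
  assumes \<phi>: "\<phi> \<in> schwartz" and \<psi>: "\<psi> \<in> schwartz" and m: "\<And>j. m j \<ge> 1"
    and c: "c \<in> borel_measurable borel" "\<And>z. norm (c z) \<le> B"
  defines "F \<equiv> \<lambda>z. star (wftk \<psi> (fst z) (snd z)) * (c z * wft (rat_window m) \<phi> (fst z) (snd z))"
  shows "integrable (lborel \<Otimes>\<^sub>M lborel) F"
    and "norm (\<integral>z. F z \<partial>(lborel \<Otimes>\<^sub>M lborel)) \<le> form_const TYPE('n) * B * L2_norm lborel \<psi> * L2_norm lborel \<phi>"
proof -
  let ?M = "lborel \<Otimes>\<^sub>M lborel :: ((real^'n) \<times> (real^'n)) measure"
  have B: "B \<ge> 0" using order_trans[OF norm_ge_zero c(2)] .
  have cm [measurable]: "c \<in> borel_measurable ?M" using c(1) by (simp add: lborel_prod)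
  have vm [measurable]: "(\<lambda>z. wftk \<psi> (fst z) (snd z)) \<in> borel_measurable ?M"
    using wft_measurable[OF \<psi> kern_complex_measurable] by (simp add: borel_prod lborel_prod)
  have wm [measurable]: "(\<lambda>z. wft (rat_window m) \<phi> (fst z) (snd z)) \<in> borel_measurable ?M"
    using wft_measurable[OF \<phi> rat_window_measurable] by (simp add: borel_prod lborel_prod)
  obtain C where C: "C > 0" "\<And>x \<xi>. norm (wft (rat_window m) \<phi> x \<xi>) \<le> C * decay \<xi>" using wft_decay[OF \<phi>] by metis
  have npsi: "integrable lborel (\<lambda>y. norm (\<psi> y))" using schwartz_integrable[OF \<psi>] by simp
  define v where "v x = (\<integral>y. norm (\<psi> y) * kern (x - y) \<partial>lborel)" for x
  have vi: "integrable lborel v"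
    using lborel_pair.integrable_snd[OF pair_integrable_conv[OF npsi integrable_kern]] by (simp add: v_def[abs_def])
  have vb: "norm (wftk \<psi> x \<xi>) \<le> v x" for x \<xi>
    using norm_wft_le(1)[OF \<psi> kern_complex_measurable kern_cmod_le, of x \<xi>]
    by (simp add: v_def mult.commute abs_of_nonneg[OF kern_bounds(1)])
  have Fm [measurable]: "F \<in> borel_measurable ?M" unfolding F_def by measurable
  have "integrable ?M (\<lambda>(x, \<xi>). v x * (B * C * decay \<xi>))"
    by (rule pair_integrable_mult[OF vi]) (simp add: integrable_decay)
  then show Fi: "integrable ?M F"
  proof (rule pair_integrable_bound)
    fix x \<xi> :: "real ^ 'n"
    have "norm (F (x, \<xi>)) \<le> norm (wftk \<psi> x \<xi>) * (norm (c (x, \<xi>)) * norm (wft (rat_window m) \<phi> x \<xi>))"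
      unfolding F_def using norm_mult_ineq[of "star (wftk \<psi> x \<xi>)" "c (x, \<xi>) * wft (rat_window m) \<phi> x \<xi>"]
        mult_left_mono[OF norm_mult_ineq[of "c (x, \<xi>)" "wft (rat_window m) \<phi> x \<xi>"], of "norm (wftk \<psi> x \<xi>)"]
      by simp
    also have "\<dots> \<le> v x * (B * (C * decay \<xi>))"
      using vb[of x \<xi>] c(2) C(2) B order_trans[OF norm_ge_zero vb] by (intro mult_mono) auto
    finally show "norm (F (x, \<xi>)) \<le> (case (x, \<xi>) of (x, \<xi>) \<Rightarrow> v x * (B * C * decay \<xi>))" by (simp add: mult.assoc)
  qed (rule Fm)
  define R where "R = form_const TYPE('n) * B * L2_norm lborel \<psi> * L2_norm lborel \<phi>"
  have step: "norm (\<integral>z. gauss_wt \<epsilon> (snd z) *\<^sub>R F z \<partial>?M) \<le> R" if e: "\<epsilon> > 0" for \<epsilon>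
  proof -
    define U where "U z = sqrt (gauss_wt \<epsilon> (snd z)) *\<^sub>R wftk \<psi> (fst z) (snd z)" for z
    define W where "W z = sqrt (gauss_wt \<epsilon> (snd z)) *\<^sub>R wft (rat_window m) \<phi> (fst z) (snd z)" for z
    have U: "L2 ?M U" "(L2_norm ?M U)\<^sup>2 \<le> (2 * pi) ^ CARD('n) * (\<integral>s. (cmod (complex_of_real (kern (s::real^'n))))\<^sup>2 \<partial>lborel) * (L2_norm lborel \<psi>)\<^sup>2"
      unfolding U_def[abs_def] by (rule wft_weighted_L2[OF \<psi> e kern_complex_measurable kern_cmod_le kern_square(1)])+
    have W: "L2 ?M W" "(L2_norm ?M W)\<^sup>2 \<le> (2 * pi) ^ CARD('n) * (\<integral>s. (cmod (rat_window m s))\<^sup>2 \<partial>lborel) * (L2_norm lborel \<phi>)\<^sup>2"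
      unfolding W_def[abs_def] by (rule wft_weighted_L2[OF \<phi> e rat_window_measurable cmod_rat_window_le integrable_rat_window_square(1)[OF m]])+
    define k where "k = (\<integral>s. kern (s::real^'n) \<partial>lborel)"
    define d where "d = (\<integral>s. decay (s::real^'n) \<partial>lborel)"
    have kd: "k \<ge> 0" "d \<ge> 0" unfolding k_def d_def
      by (auto intro!: integral_nonneg_AE simp: kern_bounds decay_pos less_imp_le)
    have U2: "(L2_norm ?M U)\<^sup>2 \<le> (2 * pi) ^ CARD('n) * k * (L2_norm lborel \<psi>)\<^sup>2"
      using kern_square(2) by (intro order_trans[OF U(2)] mult_right_mono mult_left_mono) (auto simp: k_def)
    have W2: "(L2_norm ?M W)\<^sup>2 \<le> (2 * pi) ^ CARD('n) * d * (L2_norm lborel \<phi>)\<^sup>2"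
      using integrable_rat_window_square(2)[OF m] by (intro order_trans[OF W(2)] mult_right_mono mult_left_mono) (auto simp: d_def)
    have "gauss_wt \<epsilon> (snd z) *\<^sub>R F z = star (U z) * (c z * W z)" for z
      using gauss_wt_bounds(1)[of \<epsilon> "snd z"] by (simp add: F_def U_def W_def star_scaleR less_imp_le)
    then have "(\<integral>z. gauss_wt \<epsilon> (snd z) *\<^sub>R F z \<partial>?M) = L2_ip ?M U (\<lambda>z. c z * W z)"
      by (simp add: L2_ip_def)
    also have "norm \<dots> \<le> L2_norm ?M U * L2_norm ?M (\<lambda>z. c z * W z)"
      by (intro norm_L2_ip_le U L2_norm_mult_le(1)[OF W(1) cm c(2)])
    also have "\<dots> \<le> L2_norm ?M U * (B * L2_norm ?M W)"
      by (intro mult_left_mono L2_norm_mult_le(2)[OF W(1) cm c(2)]) simp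
    also have "\<dots> = B * (L2_norm ?M U * L2_norm ?M W)" by simp
    also have "\<dots> \<le> B * (form_const TYPE('n) * L2_norm lborel \<psi> * L2_norm lborel \<phi>)"
    proof (rule mult_left_mono[OF _ B], rule power2_le_imp_le)
      have "(L2_norm ?M U * L2_norm ?M W)\<^sup>2 \<le> ((2 * pi) ^ CARD('n) * k * (L2_norm lborel \<psi>)\<^sup>2) * ((2 * pi) ^ CARD('n) * d * (L2_norm lborel \<phi>)\<^sup>2)"
        unfolding power_mult_distrib[of "L2_norm ?M U"] using kd by (intro mult_mono U2 W2) auto
      also have "\<dots> = (form_const TYPE('n) * L2_norm lborel \<psi> * L2_norm lborel \<phi>)\<^sup>2"
        unfolding form_const_def power_mult_distrib k_def[symmetric] d_def[symmetric]
        using kd by (simp add: power2_eq_square mult_ac)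
      finally show "(L2_norm ?M U * L2_norm ?M W)\<^sup>2 \<le> (form_const TYPE('n) * L2_norm lborel \<psi> * L2_norm lborel \<phi>)\<^sup>2" .
    qed (simp add: form_const_nonneg)
    finally show ?thesis by (simp add: R_def mult_ac)
  qed
  have "(\<lambda>n. \<integral>z. gauss_wt (inverse (real (Suc n))) (snd z) *\<^sub>R F z \<partial>?M) \<longlonglongrightarrow> (\<integral>z. F z \<partial>?M)"
  proof (rule integral_dominated_convergence[where w = "\<lambda>z. norm (F z)"])
    show "(\<lambda>z. gauss_wt (inverse (real (Suc n))) (snd z) *\<^sub>R F z) \<in> borel_measurable ?M" for n
      by (intro borel_measurable_scaleR Fm measurable_compose[OF measurable_snd]) simp
    have "(\<lambda>n. gauss_wt (inverse (real (Suc n))) (snd z) *\<^sub>R F z) \<longlonglongrightarrow> 1 *\<^sub>R F z" for z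
      by (intro tendsto_scaleR gauss_wt_tendsto tendsto_const)
    then show "AE z in ?M. (\<lambda>n. gauss_wt (inverse (real (Suc n))) (snd z) *\<^sub>R F z) \<longlonglongrightarrow> F z" by simp
    show "AE z in ?M. norm (gauss_wt (inverse (real (Suc n))) (snd z) *\<^sub>R F z) \<le> norm (F z)" for n
      by (intro AE_I2)
        (simp add: abs_of_pos[OF gauss_wt_bounds(1)] mult_left_le_one_le gauss_wt_bounds(2) less_imp_le[OF gauss_wt_bounds(1)])
  qed (use Fi Fm in auto)
  from tendsto_norm[OF this] show "norm (\<integral>z. F z \<partial>?M) \<le> form_const TYPE('n) * B * L2_norm lborel \<psi> * L2_norm lborel \<phi>"
    unfolding R_def[symmetric] by (rule Lim_bounded) (use step in auto)
qed

section \<open>Pseudodifferential operators with windows\<close>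

abbreviation dx :: "'n \<Rightarrow> ((real ^ 'n) \<times> (real ^ 'n) \<Rightarrow> 'a::real_normed_vector) \<Rightarrow> (real ^ 'n) \<times> (real ^ 'n) \<Rightarrow> 'a" where
  "dx j \<equiv> partial_deriv (axis j 1, 0)"

abbreviation dxi :: "'n \<Rightarrow> ((real ^ 'n) \<times> (real ^ 'n) \<Rightarrow> 'a::real_normed_vector) \<Rightarrow> (real ^ 'n) \<times> (real ^ 'n) \<Rightarrow> 'a" where
  "dxi j \<equiv> partial_deriv (0, axis j 1)"

lemma sum_axis_scaleR: "(\<Sum>i\<in>UNIV. axis j (1::real) $ i *\<^sub>R v i) = (v j :: 'a::real_vector)"
  by (subst sum.remove[of UNIV j]) (auto simp: axis_def intro!: sum.neutral)

lemma vec_sum_axis: "(\<Sum>j\<in>UNIV. h $ j *\<^sub>R axis j 1) = (h :: real ^ 'n)"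
  by (simp add: vec_eq_iff axis_def if_distrib cong: if_cong)

lemma CB_has_derivative_x:
  assumes a: "a \<in> CB_infty"
  shows "((\<lambda>x. a (x, \<xi>)) has_derivative (\<lambda>h. \<Sum>j\<in>UNIV. h $ j *\<^sub>R dx j a (x, \<xi>))) (at x)"
proof -
  obtain D where D: "(a has_derivative D) (at (x, \<xi>))"
    using smooth_differentiable[OF CB_smooth[OF a]] differentiable_def by blast
  have "((\<lambda>x. (x, \<xi>)) has_derivative (\<lambda>h. (h, 0))) (at x)"
    by (auto intro!: derivative_eq_intros)
  from has_derivative_compose[OF this D] have 1: "((\<lambda>x. a (x, \<xi>)) has_derivative (\<lambda>h. D (h, 0))) (at x)" .
  have lin: "linear D" using D has_derivative_linear by blast
  have "D (h, 0) = (\<Sum>j\<in>UNIV. h $ j *\<^sub>R dx j a (x, \<xi>))" for h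
  proof -
    have "(h, 0) = (\<Sum>j\<in>UNIV. h $ j *\<^sub>R (axis j 1, 0::real^'a))"
      by (simp add: sum_prod vec_sum_axis)
    then show ?thesis
      by (simp only: linear_sum[OF lin] linear_scale[OF lin] partial_deriv_eq[OF D])
  qed
  then show ?thesis using 1 by simp
qed

lemma CB_has_derivative_xi:
  assumes a: "a \<in> CB_infty"
  shows "((\<lambda>\<xi>. a (x, \<xi>)) has_derivative (\<lambda>h. \<Sum>j\<in>UNIV. h $ j *\<^sub>R dxi j a (x, \<xi>))) (at \<xi>)"
proof -
  obtain D where D: "(a has_derivative D) (at (x, \<xi>))"
    using smooth_differentiable[OF CB_smooth[OF a]] differentiable_def by blast
  have "((\<lambda>\<xi>. (x, \<xi>)) has_derivative (\<lambda>h. (0, h))) (at \<xi>)"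
    by (auto intro!: derivative_eq_intros)
  from has_derivative_compose[OF this D] have 1: "((\<lambda>\<xi>. a (x, \<xi>)) has_derivative (\<lambda>h. D (0, h))) (at \<xi>)" .
  have lin: "linear D" using D has_derivative_linear by blast
  have "D (0, h) = (\<Sum>j\<in>UNIV. h $ j *\<^sub>R dxi j a (x, \<xi>))" for h
  proof -
    have "(0, h) = (\<Sum>j\<in>UNIV. h $ j *\<^sub>R (0::real^'a, axis j 1))"
      by (simp add: sum_prod vec_sum_axis)
    then show ?thesis
      by (simp only: linear_sum[OF lin] linear_scale[OF lin] partial_deriv_eq[OF D])
  qed
  then show ?thesis using 1 by simp
qed

lemma CB_measurable: "a \<in> CB_infty \<Longrightarrow> a \<in> borel_measurable borel"
  by (rule differentiable_measurable) (rule smooth_differentiable[OF CB_smooth])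

lemma CB_measurable_section:
  fixes a :: "(real ^ 'n) \<times> (real ^ 'n) \<Rightarrow> 'a::real_normed_vector"
  assumes "a \<in> CB_infty"
  shows "(\<lambda>\<xi>. a (x, \<xi>)) \<in> borel_measurable borel" "(\<lambda>x. a (x, \<xi>)) \<in> borel_measurable borel"
  by (rule differentiable_measurable, rule differentiableI, rule CB_has_derivative_xi[OF assms])
    (rule differentiable_measurable, rule differentiableI, rule CB_has_derivative_x[OF assms])

lemma wft_measurable_section:
  assumes "\<phi> \<in> schwartz"
  shows "(\<lambda>\<xi>. wft (rat_window m) \<phi> x \<xi>) \<in> borel_measurable borel"
  by (rule differentiable_measurable, use wft_has_derivative_xi[OF assms] in \<open>auto simp: differentiable_def\<close>)

text \<open>Phase and symbol of \<open>pdo\<close> with a windowed transform, normalising constants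
  left out. The trivial window recovers \<open>pdo\<close>; the others appear when integration by
  parts moves derivatives onto the symbol.\<close>

definition wpdo :: "('n \<Rightarrow> nat) \<Rightarrow> ((real ^ 'n) \<times> (real ^ 'n) \<Rightarrow> 'a) \<Rightarrow> (real ^ 'n \<Rightarrow> 'a::separable_cstar_algebra) \<Rightarrow> real ^ 'n \<Rightarrow> 'a" where
  "wpdo m a \<phi> x = (\<integral>\<xi>. cis (x \<bullet> \<xi>) *\<^sub>C (a (x, \<xi>) * wft (rat_window m) \<phi> x \<xi>) \<partial>lborel)"

lemma rat_window_zero [simp]: "rat_window (\<lambda>_. 0) s = 1"
  by (simp add: rat_window_def)

text \<open>The constant is squared because \<open>fourier\<close> and \<open>pdo\<close> each carry
  one copy of it.\<close>

lemma pdo_eq_wpdo: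
  "pdo a \<phi> x = (((2 * pi) powr (- real CARD('n) / 2))\<^sup>2) *\<^sub>R wpdo (\<lambda>_. 0) a \<phi> (x :: real ^ 'n)"
proof -
  have "fourier \<phi> \<xi> = ((2 * pi) powr (- real CARD('n) / 2)) *\<^sub>R wft (rat_window (\<lambda>_. 0)) \<phi> x \<xi>" for \<xi>
    by (simp add: fourier_def wft_def inner_commute)
  then have "(\<integral>\<xi>. cis (x \<bullet> \<xi>) *\<^sub>C (a (x, \<xi>) * fourier \<phi> \<xi>) \<partial>lborel) =
      (\<integral>\<xi>. ((2 * pi) powr (- real CARD('n) / 2)) *\<^sub>R (cis (x \<bullet> \<xi>) *\<^sub>C (a (x, \<xi>) * wft (rat_window (\<lambda>_. 0)) \<phi> x \<xi>)) \<partial>lborel)"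
    by (simp add: scaleR_scaleC)
  then show ?thesis by (simp add: pdo_def wpdo_def power2_eq_square)
qed

lemma wpdo_integrand_bound:
  fixes a :: "(real ^ 'n) \<times> (real ^ 'n) \<Rightarrow> 'a::separable_cstar_algebra"
  assumes a: "a \<in> CB_infty" and \<phi>: "\<phi> \<in> schwartz"
  obtains C where "C > 0" "\<And>x \<xi>. norm (cis (x \<bullet> \<xi>) *\<^sub>C (a (x, \<xi>) * wft (rat_window m) \<phi> x \<xi>)) \<le> C * decay \<xi>"
    "\<And>x \<xi>. norm (a (x, \<xi>) * wft (rat_window m) \<phi> x \<xi>) \<le> C * decay \<xi>"
proof -
  obtain B where B: "B > 0" "\<And>z. norm (a z) \<le> B" using CB_bounded[OF a] by metis
  obtain C where C: "C > 0" "\<And>x \<xi>. norm (wft (rat_window m) \<phi> x \<xi>) \<le> C * decay \<xi>" using wft_decay[OF \<phi>] by metis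
  have 1: "norm (a (x, \<xi>) * wft (rat_window m) \<phi> x \<xi>) \<le> (B * C) * decay \<xi>" for x \<xi>
  proof -
    have "norm (a (x, \<xi>) * wft (rat_window m) \<phi> x \<xi>) \<le> norm (a (x, \<xi>)) * norm (wft (rat_window m) \<phi> x \<xi>)" by (rule norm_mult_ineq)
    also have "\<dots> \<le> B * (C * decay \<xi>)" using B C by (intro mult_mono) (auto simp: less_imp_le)
    finally show ?thesis by (simp add: mult.assoc)
  qed
  show thesis by (rule that[of "B * C"]) (use B C 1 in \<open>auto simp: norm_scaleC\<close>)
qed

lemma wpdo_measurable:
  assumes a: "a \<in> CB_infty" and \<phi>: "\<phi> \<in> schwartz"
  shows "(\<lambda>\<xi>. cis (x \<bullet> \<xi>) *\<^sub>C (a (x, \<xi>) * wft (rat_window m) \<phi> x \<xi>)) \<in> borel_measurable borel"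
proof -
  note [measurable] = CB_measurable_section[OF a] wft_measurable_section[OF \<phi>]
  have [measurable]: "(\<lambda>\<xi>. cis (x \<bullet> \<xi>)) \<in> borel_measurable borel"
    by (rule measurable_compose[OF _ cis_measurable]) simp
  show ?thesis by measurable
qed

lemma wpdo_integrable:
  assumes a: "a \<in> CB_infty" and \<phi>: "\<phi> \<in> schwartz"
  shows "integrable lborel (\<lambda>\<xi>. cis (x \<bullet> \<xi>) *\<^sub>C (a (x, \<xi>) * wft (rat_window m) \<phi> x \<xi>))"
proof -
  obtain C where "\<And>x \<xi>. norm (cis (x \<bullet> \<xi>) *\<^sub>C (a (x, \<xi>) * wft (rat_window m) \<phi> x \<xi>)) \<le> C * decay \<xi>"
    using wpdo_integrand_bound[OF a \<phi>] by metis
  then show ?thesis by (rule integrable_decay_bound[OF wpdo_measurable[OF a \<phi>]])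
qed

lemma wpdo_bounded:
  fixes a :: "(real ^ 'n) \<times> (real ^ 'n) \<Rightarrow> 'a::separable_cstar_algebra"
  assumes a: "a \<in> CB_infty" and \<phi>: "\<phi> \<in> schwartz"
  shows "bounded (range (wpdo m a \<phi>))"
proof -
  obtain C where C: "C > 0" "\<And>x \<xi>. norm (cis (x \<bullet> \<xi>) *\<^sub>C (a (x, \<xi>) * wft (rat_window m) \<phi> x \<xi>)) \<le> C * decay \<xi>"
    using wpdo_integrand_bound[OF a \<phi>] by metis
  have "norm (wpdo m a \<phi> x) \<le> (\<integral>\<xi>. C * decay (\<xi> :: real ^ 'n) \<partial>lborel)" for x
  proof -
    have "norm (wpdo m a \<phi> x) \<le> (\<integral>\<xi>. norm (cis (x \<bullet> \<xi>) *\<^sub>C (a (x, \<xi>) * wft (rat_window m) \<phi> x \<xi>)) \<partial>lborel)"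
      unfolding wpdo_def by (rule integral_norm_bound)
    also have "\<dots> \<le> (\<integral>\<xi>. C * decay (\<xi> :: real ^ 'n) \<partial>lborel)"
      by (intro integral_mono integrable_norm wpdo_integrable[OF a \<phi>] C(2)) (simp add: integrable_decay)
    finally show ?thesis .
  qed
  then show ?thesis by (auto simp: bounded_iff)
qed

text \<open>
  Only the factor with trivial window is independent of \<open>x\<close>, so that differentiation does not
  produce further windows.
\<close>

lemma wpdo_has_derivative:
  fixes a :: "(real ^ 'n) \<times> (real ^ 'n) \<Rightarrow> 'a::separable_cstar_algebra"
  assumes a: "a \<in> CB_infty" and \<phi>: "\<phi> \<in> schwartz"
  shows "(wpdo (\<lambda>_. 0) a \<phi> has_derivative
    (\<lambda>h. \<Sum>j\<in>UNIV. h $ j *\<^sub>R (wpdo (\<lambda>_. 0) (dx j a) \<phi> x + wpdo (\<lambda>_. 0) a (partial_deriv (axis j 1) \<phi>) x))) (at x)"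
proof -
  let ?w = "wft (rat_window (\<lambda>_. 0))"
  let ?d = "\<lambda>j. partial_deriv (axis j 1) \<phi>"
  have aj: "dx j a \<in> CB_infty" for j by (rule CB_partial_deriv[OF a]) simp
  have \<phi>j: "?d j \<in> schwartz" for j by (rule schwartz_partial_deriv[OF \<phi>])
  define g where "g j z \<xi> = cis (z \<bullet> \<xi>) *\<^sub>C (dx j a (z, \<xi>) * ?w \<phi> z \<xi>) + cis (z \<bullet> \<xi>) *\<^sub>C (a (z, \<xi>) * ?w (?d j) z \<xi>)" for j z \<xi>
  define f' where "f' z \<xi> h = (\<Sum>j\<in>UNIV. h $ j *\<^sub>R g j z \<xi>)" for z \<xi> h
  have gi: "integrable lborel (g j z)" for j z
    unfolding g_def[abs_def] by (intro Bochner_Integration.integrable_add wpdo_integrable a aj \<phi> \<phi>j)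
  have gb: "\<exists>C. \<forall>z \<xi>. norm (g j z \<xi>) \<le> C * decay \<xi>" for j
  proof -
    obtain C1 where C1: "\<And>x \<xi>. norm (cis (x \<bullet> \<xi>) *\<^sub>C (dx j a (x, \<xi>) * ?w \<phi> x \<xi>)) \<le> C1 * decay \<xi>"
      using wpdo_integrand_bound[OF aj \<phi>] by metis
    obtain C2 where C2: "\<And>x \<xi>. norm (cis (x \<bullet> \<xi>) *\<^sub>C (a (x, \<xi>) * ?w (?d j) x \<xi>)) \<le> C2 * decay \<xi>"
      using wpdo_integrand_bound[OF a \<phi>j] by metis
    show ?thesis unfolding g_def
      by (intro exI[of _ "C1 + C2"] allI order_trans[OF norm_triangle_ineq])
        (use C1 C2 in \<open>auto simp: distrib_right intro: add_mono\<close>)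
  qed
  then obtain C where C: "\<And>j z \<xi>. norm (g j z \<xi>) \<le> C j * decay \<xi>" by metis
  have "((\<lambda>z. \<integral>\<xi>. cis (z \<bullet> \<xi>) *\<^sub>C (a (z, \<xi>) * ?w \<phi> z \<xi>) \<partial>lborel) has_derivative (\<lambda>h. \<integral>\<xi>. f' x \<xi> h \<partial>lborel)) (at x)"
  proof (rule has_derivative_integral[where r = 1 and G = "\<lambda>\<xi>. (\<Sum>j\<in>UNIV. \<bar>C j\<bar>) * decay \<xi>"])
    fix z \<xi> :: "real ^ 'n"
    have 1: "((\<lambda>z. cis (z \<bullet> \<xi>)) has_derivative (\<lambda>h. complex_of_real (h \<bullet> \<xi>) * (\<i> * cis (z \<bullet> \<xi>)))) (at z)"
      by (intro has_derivative_cis_mult derivative_intros)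
    have 2: "((\<lambda>z. ?w \<phi> z \<xi>) has_derivative (\<lambda>h. 0)) (at z)"
      using wft_has_derivative_x[OF \<phi>, of "\<lambda>_. 0" \<xi> z] by simp
    note d = scaleC.FDERIV[OF 1 bounded_bilinear.FDERIV[OF bounded_bilinear_mult CB_has_derivative_x[OF a, of \<xi> z] 2]]
    \<comment> \<open>With all exponents 0 the window term of \<open>wft_xi_mult\<close> vanishes:
      multiplication by \<open>\<i> * \<xi> $ j\<close> amounts to differentiation of
      \<open>\<phi>\<close>.\<close>
    have iw: "\<i> *\<^sub>C (\<xi> $ j *\<^sub>R ?w \<phi> z \<xi>) = ?w (?d j) z \<xi>" for j
      using wft_xi_mult[OF \<phi>, of \<xi> j "\<lambda>_. 0" z] by (simp add: scaleC_minus_right)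
    show "((\<lambda>z. cis (z \<bullet> \<xi>) *\<^sub>C (a (z, \<xi>) * ?w \<phi> z \<xi>)) has_derivative f' z \<xi>) (at z)"
    proof (rule has_derivative_eq_rhs[OF d], rule ext)
      fix h :: "real ^ 'n"
      have "complex_of_real (h \<bullet> \<xi>) * (\<i> * cis (z \<bullet> \<xi>)) = (\<Sum>j\<in>UNIV. complex_of_real (h $ j) * (cis (z \<bullet> \<xi>) * (\<i> * complex_of_real (\<xi> $ j))))"
        by (simp add: inner_vec_def sum_distrib_left sum_distrib_right mult_ac)
      then have "(complex_of_real (h \<bullet> \<xi>) * (\<i> * cis (z \<bullet> \<xi>))) *\<^sub>C (a (z, \<xi>) * ?w \<phi> z \<xi>) =
          (\<Sum>j\<in>UNIV. complex_of_real (h $ j) *\<^sub>C (cis (z \<bullet> \<xi>) *\<^sub>C (a (z, \<xi>) * (\<i> *\<^sub>C (complex_of_real (\<xi> $ j) *\<^sub>C ?w \<phi> z \<xi>)))))"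
        by (simp add: scaleC.sum_left scaleC_scaleC mult_scaleC_right)
      also have "\<dots> = (\<Sum>j\<in>UNIV. h $ j *\<^sub>R (cis (z \<bullet> \<xi>) *\<^sub>C (a (z, \<xi>) * ?w (?d j) z \<xi>)))"
        by (simp add: scaleC_of_real iw)
      finally show "cis (z \<bullet> \<xi>) *\<^sub>C (a (z, \<xi>) * 0 + (\<Sum>j\<in>UNIV. h $ j *\<^sub>R dx j a (z, \<xi>)) * ?w \<phi> z \<xi>) +
          (complex_of_real (h \<bullet> \<xi>) * (\<i> * cis (z \<bullet> \<xi>))) *\<^sub>C (a (z, \<xi>) * ?w \<phi> z \<xi>) = f' z \<xi> h"
        by (simp add: f'_def g_def scaleR_add_right sum.distrib sum_distrib_right scaleC.sum_right scaleR_scaleC)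
    qed
    fix h :: "real ^ 'n"
    have "norm (f' z \<xi> h) \<le> (\<Sum>j\<in>UNIV. norm h * (\<bar>C j\<bar> * decay \<xi>))"
      unfolding f'_def
    proof (rule sum_norm_le)
      fix j
      have "norm (g j z \<xi>) \<le> \<bar>C j\<bar> * decay \<xi>"
        by (rule order_trans[OF C]) (intro mult_right_mono, auto simp: decay_pos less_imp_le)
      then show "norm (h $ j *\<^sub>R g j z \<xi>) \<le> norm h * (\<bar>C j\<bar> * decay \<xi>)"
        by (simp add: mult_mono component_le_norm_cart)
    qed
    then show "norm (f' z \<xi> h) \<le> (\<Sum>j\<in>UNIV. \<bar>C j\<bar>) * decay \<xi> * norm h"
      by (simp add: sum_distrib_left sum_distrib_right mult_ac)
  next
    show "integrable lborel (\<lambda>\<xi>. cis (z \<bullet> \<xi>) *\<^sub>C (a (z, \<xi>) * ?w \<phi> z \<xi>))" for z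
      by (rule wpdo_integrable[OF a \<phi>])
    show "(\<lambda>\<xi>. f' x \<xi> h) \<in> borel_measurable lborel" for h
      unfolding f'_def using borel_measurable_integrable[OF gi] by measurable
  qed (auto simp: integrable_decay decay_pos less_imp_le intro!: mult_nonneg_nonneg sum_nonneg)
  moreover have "(\<integral>\<xi>. f' x \<xi> h \<partial>lborel) = (\<Sum>j\<in>UNIV. h $ j *\<^sub>R (wpdo (\<lambda>_. 0) (dx j a) \<phi> x + wpdo (\<lambda>_. 0) a (?d j) x))" for h
    unfolding f'_def using gi wpdo_integrable[OF aj \<phi>] wpdo_integrable[OF a \<phi>j]
    by (simp add: g_def wpdo_def)
  ultimately show ?thesis unfolding wpdo_def[abs_def] by simp
qed

text \<open>Multiplication by \<open>x $ j\<close> is, up to \<open>\<i>\<close>, differentiation of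
  the phase in \<open>\<xi>\<close>; integrating by parts moves the derivative to the symbol and to
  the transform, where it becomes a factor \<open>y $ j\<close>.\<close>

lemma wpdo_coord_mult:
  fixes a :: "(real ^ 'n) \<times> (real ^ 'n) \<Rightarrow> 'a::separable_cstar_algebra"
  assumes a: "a \<in> CB_infty" and \<phi>: "\<phi> \<in> schwartz"
  shows "x $ j *\<^sub>R wpdo m a \<phi> x = \<i> *\<^sub>C wpdo m (dxi j a) \<phi> x + wpdo m a (\<lambda>y. y $ j *\<^sub>R \<phi> y) x"
proof -
  let ?w = "wft (rat_window m)"
  define \<phi>' where "\<phi>' = (\<lambda>y. y $ j *\<^sub>R \<phi> y)"
  have aj: "dxi j a \<in> CB_infty" by (rule CB_partial_deriv[OF a]) simp
  have \<phi>': "\<phi>' \<in> schwartz" unfolding \<phi>'_def by (rule schwartz_coord_mult[OF \<phi>])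
  define F where "F \<xi> = cis (x \<bullet> \<xi>) *\<^sub>C (a (x, \<xi>) * ?w \<phi> x \<xi>)" for \<xi>
  have D: "\<exists>D. (F has_derivative D) (at \<xi>) \<and> D (axis j 1) =
      (\<i> * x $ j) *\<^sub>C F \<xi> + cis (x \<bullet> \<xi>) *\<^sub>C (dxi j a (x, \<xi>) * ?w \<phi> x \<xi>) + (- \<i>) *\<^sub>C (cis (x \<bullet> \<xi>) *\<^sub>C (a (x, \<xi>) * ?w \<phi>' x \<xi>))" for \<xi>
  proof -
    have 1: "((\<lambda>\<xi>. cis (x \<bullet> \<xi>)) has_derivative (\<lambda>h. complex_of_real (x \<bullet> h) * (\<i> * cis (x \<bullet> \<xi>)))) (at \<xi>)"
      by (intro has_derivative_cis_mult derivative_intros)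
    note d = scaleC.FDERIV[OF 1 bounded_bilinear.FDERIV[OF bounded_bilinear_mult CB_has_derivative_xi[OF a, of x \<xi>] wft_has_derivative_xi[OF \<phi>, of m x \<xi>]]]
    have "cis (x \<bullet> \<xi>) *\<^sub>C (a (x, \<xi>) * (\<Sum>i\<in>UNIV. axis j 1 $ i *\<^sub>R ((- \<i>) *\<^sub>C ?w (\<lambda>y. y $ i *\<^sub>R \<phi> y) x \<xi>)) +
        (\<Sum>i\<in>UNIV. axis j 1 $ i *\<^sub>R dxi i a (x, \<xi>)) * ?w \<phi> x \<xi>) +
        (complex_of_real (x \<bullet> axis j 1) * (\<i> * cis (x \<bullet> \<xi>))) *\<^sub>C (a (x, \<xi>) * ?w \<phi> x \<xi>) =
        (\<i> * x $ j) *\<^sub>C F \<xi> + cis (x \<bullet> \<xi>) *\<^sub>C (dxi j a (x, \<xi>) * ?w \<phi> x \<xi>) + (- \<i>) *\<^sub>C (cis (x \<bullet> \<xi>) *\<^sub>C (a (x, \<xi>) * ?w \<phi>' x \<xi>))"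
      unfolding sum_axis_scaleR F_def \<phi>'_def[symmetric]
      by (simp add: scaleC_add_right mult_scaleC_right scaleC_scaleC inner_axis mult_ac)
    then show ?thesis unfolding F_def[abs_def] using d by blast
  qed
  have pd: "partial_deriv (axis j 1) F \<xi> =
      (\<i> * x $ j) *\<^sub>C F \<xi> + cis (x \<bullet> \<xi>) *\<^sub>C (dxi j a (x, \<xi>) * ?w \<phi> x \<xi>) + (- \<i>) *\<^sub>C (cis (x \<bullet> \<xi>) *\<^sub>C (a (x, \<xi>) * ?w \<phi>' x \<xi>))" for \<xi>
    using D[of \<xi>] partial_deriv_eq by metis
  have Fd: "F differentiable (at \<xi>)" for \<xi> using D[of \<xi>] differentiable_def by blast
  note i1 = wpdo_integrable[OF a \<phi>, of x m] and i2 = wpdo_integrable[OF aj \<phi>, of x m] and i3 = wpdo_integrable[OF a \<phi>', of x m]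
  have Fi: "integrable lborel F" unfolding F_def by (rule i1)
  have gF: "wpdo m a \<phi> x = integral\<^sup>L lborel F" by (simp add: wpdo_def F_def[abs_def])
  obtain C1 where C1: "\<And>\<xi>. norm (F \<xi>) \<le> C1 * decay \<xi>" unfolding F_def using wpdo_integrand_bound[OF a \<phi>] by metis
  obtain C2 where C2: "\<And>\<xi>. norm (cis (x \<bullet> \<xi>) *\<^sub>C (dxi j a (x, \<xi>) * ?w \<phi> x \<xi>)) \<le> C2 * decay \<xi>" using wpdo_integrand_bound[OF aj \<phi>] by metis
  obtain C3 where C3: "\<And>\<xi>. norm (cis (x \<bullet> \<xi>) *\<^sub>C (a (x, \<xi>) * ?w \<phi>' x \<xi>)) \<le> C3 * decay \<xi>" using wpdo_integrand_bound[OF a \<phi>'] by metis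
  have "norm (partial_deriv (axis j 1) F \<xi>) \<le> (\<bar>x $ j\<bar> * C1 + C2 + C3) * decay \<xi>" for \<xi>
  proof -
    have "norm (partial_deriv (axis j 1) F \<xi>) \<le> norm ((\<i> * x $ j) *\<^sub>C F \<xi>) + norm (cis (x \<bullet> \<xi>) *\<^sub>C (dxi j a (x, \<xi>) * ?w \<phi> x \<xi>))
      + norm ((- \<i>) *\<^sub>C (cis (x \<bullet> \<xi>) *\<^sub>C (a (x, \<xi>) * ?w \<phi>' x \<xi>)))"
      unfolding pd by (intro order_trans[OF norm_triangle_ineq] add_mono norm_triangle_ineq order_refl)
    also have "\<dots> = \<bar>x $ j\<bar> * norm (F \<xi>) + norm (cis (x \<bullet> \<xi>) *\<^sub>C (dxi j a (x, \<xi>) * ?w \<phi> x \<xi>))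
      + norm (cis (x \<bullet> \<xi>) *\<^sub>C (a (x, \<xi>) * ?w \<phi>' x \<xi>))"
      by (simp add: norm_scaleC norm_mult)
    also have "\<dots> \<le> \<bar>x $ j\<bar> * (C1 * decay \<xi>) + C2 * decay \<xi> + C3 * decay \<xi>"
      by (intro add_mono mult_left_mono C1 C2 C3) simp
    finally show ?thesis by (simp add: algebra_simps)
  qed
  from integral_partial_deriv_zero(2)[OF Fd Fi this]
  have "0 = (\<i> * x $ j) *\<^sub>C wpdo m a \<phi> x + wpdo m (dxi j a) \<phi> x + (- \<i>) *\<^sub>C wpdo m a \<phi>' x"
    unfolding pd gF unfolding wpdo_def using Fi i2 i3
    by (simp add: integrable_bounded_linear[OF scaleC.bounded_linear_right]
        integral_bounded_linear[OF scaleC.bounded_linear_right])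
  \<comment> \<open>The signs are arranged to match \<open>scaleC_solve\<close>.\<close>
  then have "0 = (- \<i> * complex_of_real (- (x $ j))) *\<^sub>C wpdo m a \<phi> x + (\<i> * complex_of_real (- 1)) *\<^sub>C wpdo m a \<phi>' x + wpdo m (dxi j a) \<phi> x"
    by (simp add: add_ac)
  from scaleC_solve[OF this] have "- (x $ j *\<^sub>R wpdo m a \<phi> x) = - wpdo m a \<phi>' x - \<i> *\<^sub>C wpdo m (dxi j a) \<phi> x" by simp
  then have "- (- (x $ j *\<^sub>R wpdo m a \<phi> x)) = - (- wpdo m a \<phi>' x - \<i> *\<^sub>C wpdo m (dxi j a) \<phi> x)" by (rule arg_cong)
  then show ?thesis unfolding \<phi>'_def by simp
qed

text \<open>The family to which \<open>schwartzI\<close> is applied: differentiation and coordinate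
  factors change only the symbol and the Schwartz function.\<close>

inductive_set wpdo_span :: "(real ^ 'n \<Rightarrow> 'a::separable_cstar_algebra) set" where
  base: "a \<in> CB_infty \<Longrightarrow> \<phi> \<in> schwartz \<Longrightarrow> wpdo (\<lambda>_. 0) a \<phi> \<in> wpdo_span"
| add: "f \<in> wpdo_span \<Longrightarrow> g \<in> wpdo_span \<Longrightarrow> (\<lambda>x. f x + g x) \<in> wpdo_span"
| scale: "f \<in> wpdo_span \<Longrightarrow> (\<lambda>x. c *\<^sub>C f x) \<in> wpdo_span"

lemma wpdo_span_differentiable: "f \<in> wpdo_span \<Longrightarrow> f differentiable (at x)"
proof (induction rule: wpdo_span.induct)
  case (base a \<phi>)
  then show ?case using wpdo_has_derivative differentiable_def by blast
next
  case (scale f c)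
  then show ?case by (intro differentiable_linear[OF scaleC.bounded_linear_right])
qed (rule differentiable_add)

lemma wpdo_span_partial_deriv: "f \<in> wpdo_span \<Longrightarrow> partial_deriv (axis j 1) f \<in> wpdo_span"
proof (induction rule: wpdo_span.induct)
  case (base a \<phi>)
  have "partial_deriv (axis j 1) (wpdo (\<lambda>_. 0) a \<phi>) = (\<lambda>x. wpdo (\<lambda>_. 0) (dx j a) \<phi> x + wpdo (\<lambda>_. 0) a (partial_deriv (axis j 1) \<phi>) x)"
    using partial_deriv_eq[OF wpdo_has_derivative[OF base], where v = "axis j 1"] by (auto simp: sum_axis_scaleR)
  also have "\<dots> \<in> wpdo_span"
    using base by (intro wpdo_span.add wpdo_span.base CB_partial_deriv schwartz_partial_deriv) auto
  finally show ?case .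
next
  case (add f g)
  have "partial_deriv (axis j 1) (\<lambda>x. f x + g x) = (\<lambda>x. partial_deriv (axis j 1) f x + partial_deriv (axis j 1) g x)"
    by (intro ext partial_deriv_add wpdo_span_differentiable add.hyps)
  then show ?case using wpdo_span.add[OF add.IH] by simp
next
  case (scale f c)
  have "partial_deriv (axis j 1) (\<lambda>x. c *\<^sub>C f x) = (\<lambda>x. c *\<^sub>C partial_deriv (axis j 1) f x)"
    by (intro ext partial_deriv_linear[OF scaleC.bounded_linear_right] wpdo_span_differentiable scale.hyps)
  then show ?case using wpdo_span.scale[OF scale.IH] by simp
qed

lemma wpdo_span_coord_mult: "f \<in> wpdo_span \<Longrightarrow> (\<lambda>x. x $ j *\<^sub>R f x) \<in> wpdo_span"
proof (induction rule: wpdo_span.induct)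
  case (base a \<phi>)
  have "(\<lambda>x. x $ j *\<^sub>R wpdo (\<lambda>_. 0) a \<phi> x) = (\<lambda>x. \<i> *\<^sub>C wpdo (\<lambda>_. 0) (dxi j a) \<phi> x + wpdo (\<lambda>_. 0) a (\<lambda>y. y $ j *\<^sub>R \<phi> y) x)"
    by (intro ext wpdo_coord_mult[OF base])
  also have "\<dots> \<in> wpdo_span"
    using base by (intro wpdo_span.add wpdo_span.scale wpdo_span.base CB_partial_deriv schwartz_coord_mult) auto
  finally show ?case .
next
  case (add f g)
  then show ?case using wpdo_span.add[OF add.IH] by (simp add: scaleR_add_right)
next
  case (scale f c)
  then show ?case using wpdo_span.scale[OF scale.IH] by (simp add: scaleR_scaleC)
qed

lemma wpdo_span_bounded: "f \<in> wpdo_span \<Longrightarrow> bounded (range f)"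
proof (induction rule: wpdo_span.induct)
  case (base a \<phi>)
  then show ?case by (rule wpdo_bounded)
next
  case (add f g)
  then show ?case by (intro bounded_plus_comp)
next
  case (scale f c)
  then show ?case using bounded_linear_image[OF scale.IH scaleC.bounded_linear_right, of c]
    by (simp add: image_image)
qed

lemma wpdo_schwartz:
  assumes "a \<in> CB_infty" "\<phi> \<in> schwartz" shows "wpdo (\<lambda>_. 0) a \<phi> \<in> schwartz"
  by (rule schwartzI[OF wpdo_span.base[OF assms]])
    (rule wpdo_span_differentiable wpdo_span_bounded wpdo_span_partial_deriv wpdo_span_coord_mult; assumption)+

lemma pdo_schwartz:
  fixes a :: "(real ^ 'n) \<times> (real ^ 'n) \<Rightarrow> 'a::separable_cstar_algebra"
  assumes "a \<in> CB_infty" "\<phi> \<in> schwartz" shows "pdo a \<phi> \<in> schwartz"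
proof -
  have "pdo a \<phi> = (\<lambda>x. (((2 * pi) powr (- real CARD('n) / 2))\<^sup>2) *\<^sub>R wpdo (\<lambda>_. 0) a \<phi> x)"
    by (intro ext pdo_eq_wpdo)
  then show ?thesis using schwartz_linear[OF bounded_linear_scaleR_right wpdo_schwartz[OF assms]] by simp
qed

section \<open>Integration by parts in the frequency variable\<close>

lemma wpdo_diff_symbol:
  assumes a: "a \<in> CB_infty" and b: "b \<in> CB_infty" and \<phi>: "\<phi> \<in> schwartz"
  shows "wpdo m (\<lambda>z. a z - b z) \<phi> x = wpdo m a \<phi> x - wpdo m b \<phi> x"
  unfolding wpdo_def using wpdo_integrable[OF a \<phi>] wpdo_integrable[OF b \<phi>]
  by (simp add: left_diff_distrib scaleC_diff_right)

text \<open>Splitting off one window factor yields a term with \<open>x $ j\<close>.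
  \<open>wpdo_coord_mult\<close> rewrites it; the part with \<open>y $ j\<close> cancels, and a
  derivative of the symbol remains.\<close>

lemma wpdo_Suc:
  assumes a: "a \<in> CB_infty" and \<phi>: "\<phi> \<in> schwartz"
  shows "wpdo m a \<phi> x = wpdo (m(j := Suc (m j))) (\<lambda>z. a z - dxi j a z) \<phi> x"
proof -
  let ?m' = "m(j := Suc (m j))"
  have aj: "dxi j a \<in> CB_infty" by (rule CB_partial_deriv[OF a]) simp
  note \<phi>' = schwartz_coord_mult[OF \<phi>, of j]
  have "cis (x \<bullet> \<xi>) *\<^sub>C (a (x, \<xi>) * wft (rat_window m) \<phi> x \<xi>) =
      (1 + \<i> * x $ j) *\<^sub>C (cis (x \<bullet> \<xi>) *\<^sub>C (a (x, \<xi>) * wft (rat_window ?m') \<phi> x \<xi>))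
      - \<i> *\<^sub>C (cis (x \<bullet> \<xi>) *\<^sub>C (a (x, \<xi>) * wft (rat_window ?m') (\<lambda>y. y $ j *\<^sub>R \<phi> y) x \<xi>))" for \<xi>
    by (subst wft_rat_window_Suc[OF \<phi>, of m x \<xi> j])
      (simp add: right_diff_distrib mult_scaleC_right scaleC_scaleC scaleC_diff_right mult.commute)
  then have "wpdo m a \<phi> x = (1 + \<i> * x $ j) *\<^sub>C wpdo ?m' a \<phi> x - \<i> *\<^sub>C wpdo ?m' a (\<lambda>y. y $ j *\<^sub>R \<phi> y) x"
    unfolding wpdo_def using wpdo_integrable[OF a \<phi>, of x ?m'] wpdo_integrable[OF a \<phi>', of x ?m']
    by (simp add: integrable_bounded_linear[OF scaleC.bounded_linear_right]
        integral_bounded_linear[OF scaleC.bounded_linear_right])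
  also have "\<dots> = wpdo ?m' a \<phi> x + \<i> *\<^sub>C (x $ j *\<^sub>R wpdo ?m' a \<phi> x) - \<i> *\<^sub>C wpdo ?m' a (\<lambda>y. y $ j *\<^sub>R \<phi> y) x"
    by (simp add: scaleC_add_left scaleC_scaleC[symmetric] scaleC_of_real)
  also have "\<dots> = wpdo ?m' a \<phi> x - wpdo ?m' (dxi j a) \<phi> x"
    unfolding wpdo_coord_mult[OF a \<phi>] by (simp add: scaleC_add_right)
  finally show ?thesis unfolding wpdo_diff_symbol[OF a aj \<phi>] .
qed

lemma CB_one_minus_derivs:
  assumes "a \<in> CB_infty" "set bs \<subseteq> Basis" shows "one_minus_derivs bs a \<in> CB_infty"
  using assms(2) by (induction bs) (auto intro!: CB_diff CB_partial_deriv assms(1))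

lemma wpdo_one_minus_derivs:
  assumes a: "a \<in> CB_infty" and \<phi>: "\<phi> \<in> schwartz"
  shows "wpdo m a \<phi> x = wpdo (\<lambda>i. m i + count_list js i) (one_minus_derivs (map (\<lambda>j. (0, axis j 1)) js) a) \<phi> x"
proof (induction js)
  case (Cons j js)
  let ?m = "\<lambda>i. m i + count_list js i"
  let ?K = "one_minus_derivs (map (\<lambda>j. (0, axis j 1)) js) a"
  have eq: "?m(j := Suc (?m j)) = (\<lambda>i. m i + count_list (j # js) i)" by auto
  have K: "?K \<in> CB_infty" by (rule CB_one_minus_derivs[OF a]) auto
  have "wpdo m a \<phi> x = wpdo ?m ?K \<phi> x" by (rule Cons.IH)
  also have "\<dots> = wpdo (?m(j := Suc (?m j))) (\<lambda>z. ?K z - dxi j ?K z) \<phi> x" by (rule wpdo_Suc[OF K \<phi>])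
  finally show ?case unfolding eq by simp
qed simp

text \<open>Each operator \<open>1 - \<partial>\<close> doubles the number of terms, and
  \<open>us\<close> records the directions in which a term was differentiated. The prefix
  \<open>vs\<close> is arbitrary since the induction moves directions into it.\<close>

lemma iter_partial_one_minus_derivs_bound:
  assumes a: "a \<in> CB_infty" and ws: "distinct ws" "set ws \<subseteq> Basis" and vs: "set vs \<subseteq> Basis"
    and B: "\<And>us z. distinct us \<Longrightarrow> set us \<subseteq> set ws \<Longrightarrow> norm (iter_partial (vs @ us) a z) \<le> B"
  shows "norm (iter_partial vs (one_minus_derivs ws a) z) \<le> 2 ^ length ws * B"
  using ws vs B
proof (induction ws arbitrary: vs z)
  case Nil
  show ?case using Nil.prems(4)[of "[]"] by simp
next
  case (Cons w ws)
  let ?K = "one_minus_derivs ws a"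
  have K: "?K \<in> CB_infty" using Cons.prems by (intro CB_one_minus_derivs a) auto
  have w: "w \<in> Basis" "w \<notin> set ws" using Cons.prems by auto
  have vl: "vs \<in> lists Basis" using Cons.prems by auto
  have "iter_partial vs (one_minus_derivs (w # ws) a) = (\<lambda>z. iter_partial vs ?K z + iter_partial vs (\<lambda>z. - partial_deriv w ?K z) z)"
    using smooth_add_iter[OF CB_smooth[OF K] smooth_linear[OF bounded_linear_minus[OF bounded_linear_ident] smooth_partial_deriv[OF CB_smooth[OF K] w(1)]] vl]
    by simp
  also have "iter_partial vs (\<lambda>z. - partial_deriv w ?K z) = (\<lambda>z. - iter_partial (vs @ [w]) ?K z)"
    using smooth_linear_iter[OF bounded_linear_minus[OF bounded_linear_ident] smooth_partial_deriv[OF CB_smooth[OF K] w(1)] vl]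
    by (simp add: iter_partial_append)
  finally have "norm (iter_partial vs (one_minus_derivs (w # ws) a) z) \<le> norm (iter_partial vs ?K z) + norm (iter_partial (vs @ [w]) ?K z)"
    using norm_triangle_ineq4[of "iter_partial vs ?K z" "iter_partial (vs @ [w]) ?K z"] by simp
  also have "\<dots> \<le> 2 ^ length ws * B + 2 ^ length ws * B"
  proof (rule add_mono)
    show "norm (iter_partial vs ?K z) \<le> 2 ^ length ws * B"
    proof (rule Cons.IH)
      fix us z assume "distinct us" "set us \<subseteq> set ws"
      then show "norm (iter_partial (vs @ us) a z) \<le> B"
        using Cons.prems(4)[of us z] by auto
    qed (use Cons.prems in auto)
    show "norm (iter_partial (vs @ [w]) ?K z) \<le> 2 ^ length ws * B"
    proof (rule Cons.IH)
      fix us z assume "distinct us" "set us \<subseteq> set ws"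
      then show "norm (iter_partial ((vs @ [w]) @ us) a z) \<le> B"
        using Cons.prems(4)[of "w # us" z] w by auto
    qed (use Cons.prems in auto)
  qed
  finally show ?case by (simp add: mult_ac)
qed

section \<open>Integration by parts in the space variable\<close>

inductive_set slice_span :: "(real ^ 'n \<Rightarrow> 'a) \<Rightarrow> real ^ 'n \<Rightarrow> (real ^ 'n \<Rightarrow> 'a::separable_cstar_algebra) set" for \<phi> \<xi> where
  base: "b \<in> CB_infty \<Longrightarrow> (\<lambda>x. b (x, \<xi>) * wft (rat_window m) \<phi> x \<xi>) \<in> slice_span \<phi> \<xi>"
| add: "f \<in> slice_span \<phi> \<xi> \<Longrightarrow> g \<in> slice_span \<phi> \<xi> \<Longrightarrow> (\<lambda>x. f x + g x) \<in> slice_span \<phi> \<xi>"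
| scale: "f \<in> slice_span \<phi> \<xi> \<Longrightarrow> (\<lambda>x. c *\<^sub>C f x) \<in> slice_span \<phi> \<xi>"

lemma slice_span_base_derivative:
  fixes b :: "(real ^ 'n) \<times> (real ^ 'n) \<Rightarrow> 'a::separable_cstar_algebra"
  assumes b: "b \<in> CB_infty" and \<phi>: "\<phi> \<in> schwartz"
  shows "(\<lambda>x. b (x, \<xi>) * wft (rat_window m) \<phi> x \<xi>) differentiable (at x)"
    and "partial_deriv (axis j 1) (\<lambda>x. b (x, \<xi>) * wft (rat_window m) \<phi> x \<xi>) x =
      dx j b (x, \<xi>) * wft (rat_window m) \<phi> x \<xi> + (- \<i> * m j) *\<^sub>C (b (x, \<xi>) * wft (rat_window (m(j := Suc (m j)))) \<phi> x \<xi>)"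
proof -
  note d = bounded_bilinear.FDERIV[OF bounded_bilinear_mult CB_has_derivative_x[OF b, of \<xi> x] wft_has_derivative_x[OF \<phi>, of m \<xi> x]]
  show "(\<lambda>x. b (x, \<xi>) * wft (rat_window m) \<phi> x \<xi>) differentiable (at x)" using d differentiable_def by blast
  show "partial_deriv (axis j 1) (\<lambda>x. b (x, \<xi>) * wft (rat_window m) \<phi> x \<xi>) x =
      dx j b (x, \<xi>) * wft (rat_window m) \<phi> x \<xi> + (- \<i> * m j) *\<^sub>C (b (x, \<xi>) * wft (rat_window (m(j := Suc (m j)))) \<phi> x \<xi>)"
    unfolding partial_deriv_eq[OF d] sum_axis_scaleR mult_scaleC_right by simp
qed

lemma slice_span_differentiable:
  assumes "f \<in> slice_span \<phi> \<xi>" "\<phi> \<in> schwartz" shows "f differentiable (at x)"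
  using assms(1)
proof (induction rule: slice_span.induct)
  case (base b m)
  then show ?case by (rule slice_span_base_derivative[OF _ assms(2)])
next
  case (scale f c)
  then show ?case by (intro differentiable_linear[OF scaleC.bounded_linear_right])
qed (rule differentiable_add)

lemma slice_span_bounded:
  assumes "f \<in> slice_span \<phi> \<xi>" "\<phi> \<in> schwartz" shows "bounded (range f)"
  using assms(1)
proof (induction rule: slice_span.induct)
  case (base b m)
  obtain C where "\<And>x \<xi>. norm (b (x, \<xi>) * wft (rat_window m) \<phi> x \<xi>) \<le> C * decay \<xi>"
    using wpdo_integrand_bound[OF base assms(2)] by metis
  then show ?case by (auto simp: bounded_iff)
next
  case (add f g)
  then show ?case by (intro bounded_plus_comp)
next
  case (scale f c)
  then show ?case using bounded_linear_image[OF scale.IH scaleC.bounded_linear_right, of c]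
    by (simp add: image_image)
qed

lemma slice_span_partial_deriv:
  fixes f :: "real ^ 'n \<Rightarrow> 'a::separable_cstar_algebra"
  assumes "f \<in> slice_span \<phi> \<xi>" "\<phi> \<in> schwartz" "v \<in> Basis" shows "partial_deriv v f \<in> slice_span \<phi> \<xi>"
proof -
  obtain j where v: "v = axis j 1" using assms(3) by (auto simp: Basis_vec_eq)
  show ?thesis using assms(1) unfolding v
  proof (induction rule: slice_span.induct)
    case (base b m)
    have "dx j b \<in> CB_infty" by (rule CB_partial_deriv[OF base]) simp
    then show ?case
      using slice_span.add[OF slice_span.base slice_span.scale[OF slice_span.base[OF base]], of "dx j b" \<xi> m \<phi> "- \<i> * m j" "m(j := Suc (m j))"]
      by (simp add: slice_span_base_derivative(2)[OF base assms(2), abs_def])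
  next
    case (add f g)
    have "partial_deriv (axis j 1) (\<lambda>x. f x + g x) = (\<lambda>x. partial_deriv (axis j 1) f x + partial_deriv (axis j 1) g x)"
      by (intro ext partial_deriv_add slice_span_differentiable[OF add.hyps(1) assms(2)] slice_span_differentiable[OF add.hyps(2) assms(2)])
    then show ?case using slice_span.add[OF add.IH] by simp
  next
    case (scale f c)
    have "partial_deriv (axis j 1) (\<lambda>x. c *\<^sub>C f x) = (\<lambda>x. c *\<^sub>C partial_deriv (axis j 1) f x)"
      by (intro ext partial_deriv_linear[OF scaleC.bounded_linear_right] slice_span_differentiable[OF scale.hyps assms(2)])
    then show ?case using slice_span.scale[OF scale.IH] by simp
  qed
qed

lemma slice_span_diff: "f \<in> slice_span \<phi> \<xi> \<Longrightarrow> g \<in> slice_span \<phi> \<xi> \<Longrightarrow> (\<lambda>x. f x - g x) \<in> slice_span \<phi> \<xi>"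
  using slice_span.add[OF _ slice_span.scale[of g \<phi> \<xi> "- 1"], of f] by (simp add: scaleC_minus_left)

lemma slice_span_one_minus_derivs:
  assumes "f \<in> slice_span \<phi> \<xi>" "\<phi> \<in> schwartz" "set bs \<subseteq> Basis" shows "one_minus_derivs bs f \<in> slice_span \<phi> \<xi>"
  using assms(3) by (induction bs) (auto intro!: slice_span_diff slice_span_partial_deriv assms(1,2))

lemma one_minus_derivs_lin:
  assumes "f \<in> slice_span \<phi> \<xi>" "g \<in> slice_span \<phi> \<xi>" "\<phi> \<in> schwartz" "set bs \<subseteq> Basis"
  shows "one_minus_derivs bs (\<lambda>x. f x + c *\<^sub>C g x) = (\<lambda>x. one_minus_derivs bs f x + c *\<^sub>C one_minus_derivs bs g x)"
  using assms(4)
proof (induction bs)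
  case (Cons v bs)
  let ?f = "one_minus_derivs bs f" and ?g = "one_minus_derivs bs g"
  have fg: "?f \<in> slice_span \<phi> \<xi>" "?g \<in> slice_span \<phi> \<xi>"
    using Cons.prems by (auto intro!: slice_span_one_minus_derivs assms)
  have "partial_deriv v (\<lambda>x. ?f x + c *\<^sub>C ?g x) x = partial_deriv v ?f x + c *\<^sub>C partial_deriv v ?g x" for x
    by (simp add: partial_deriv_add[OF slice_span_differentiable[OF fg(1) assms(3)] differentiable_linear[OF scaleC.bounded_linear_right slice_span_differentiable[OF fg(2) assms(3)]]]
        partial_deriv_linear[OF scaleC.bounded_linear_right slice_span_differentiable[OF fg(2) assms(3)]])
  then show ?case using Cons by (simp add: scaleC_diff_right algebra_simps)
qed simp

text \<open>Detaches the operator that acts first, which is the order in which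
  \<open>main_form_bound\<close> inducts.\<close>

lemma one_minus_derivs_snoc: "one_minus_derivs (bs @ [v]) H = one_minus_derivs bs (\<lambda>x. H x - partial_deriv v H x)"
  by (induction bs) auto

text \<open>\<open>H\<close> is replaced by its average against \<open>kern\<close>; after Fubini
  the inner integral over \<open>x\<close> is the adjoint of the windowed transform of
  \<open>\<psi>\<close>. Thus the derivatives fall on \<open>H\<close> and none on
  \<open>\<psi>\<close>.\<close>

lemma pairing_kern:
  fixes \<phi> \<psi> :: "real ^ 'n \<Rightarrow> 'a::separable_cstar_algebra"
  assumes \<phi>: "\<phi> \<in> schwartz" and \<psi>: "\<psi> \<in> schwartz" and H: "H \<in> slice_span \<phi> \<xi>"
    and bs: "distinct bs" "set bs = Basis"
  shows "(\<integral>x. star (\<psi> x) * (cis (x \<bullet> \<xi>) *\<^sub>C H x) \<partial>lborel) =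
    (\<integral>x. star (wftk \<psi> x \<xi>) * one_minus_derivs bs H x \<partial>lborel)"
proof -
  define K where "K = one_minus_derivs bs H"
  have K: "K \<in> slice_span \<phi> \<xi>" unfolding K_def using bs by (intro slice_span_one_minus_derivs H \<phi>) simp
  have [measurable]: "K \<in> borel_measurable borel" by (rule differentiable_measurable) (rule slice_span_differentiable[OF K \<phi>])
  have [measurable]: "\<psi> \<in> borel_measurable borel" by (rule schwartz_measurable[OF \<psi>])
  obtain B where B: "\<And>x. norm (K x) \<le> B" using slice_span_bounded[OF K \<phi>] by (auto simp: bounded_iff)
  have rep: "H x = (\<integral>z. kern (z - x) *\<^sub>R K z \<partial>lborel)" for x
  proof -
    have "H x = (\<integral>s. kern s *\<^sub>R K (x + s) \<partial>lborel)" unfolding K_def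
      by (rule kern_representation(2)[of "slice_span \<phi> \<xi>", symmetric])
        (auto intro: slice_span_differentiable slice_span_bounded slice_span_partial_deriv slice_span_diff \<phi> H simp: bs)
    also have "\<dots> = (\<integral>z. kern (z - x) *\<^sub>R K z \<partial>lborel)"
      using lborel_integral_translate(1)[of "\<lambda>z. kern (z - x) *\<^sub>R K z" x] by simp
    finally show ?thesis .
  qed
  let ?F = "\<lambda>x z. star (\<psi> x) * (cis (x \<bullet> \<xi>) *\<^sub>C (kern (z - x) *\<^sub>R K z))"
  have npsi: "integrable lborel (\<lambda>y. norm (\<psi> y) * B)" using schwartz_integrable[OF \<psi>] by simp
  have Fi: "integrable (lborel \<Otimes>\<^sub>M lborel) (\<lambda>(x, z). ?F x z)"
  proof (rule pair_integrable_bound[OF pair_integrable_conv[OF npsi integrable_kern]])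
    have [measurable]: "(\<lambda>w. cis (fst w \<bullet> \<xi>)) \<in> borel_measurable (lborel \<Otimes>\<^sub>M lborel)"
      by (rule measurable_compose[OF _ cis_measurable]) simp
    show "(\<lambda>(x, z). ?F x z) \<in> borel_measurable (lborel \<Otimes>\<^sub>M lborel)"
      unfolding case_prod_unfold by measurable
    fix x z
    have "norm (?F x z) \<le> norm (\<psi> x) * (kern (z - x) * norm (K z))"
      using norm_mult_ineq[of "star (\<psi> x)" "cis (x \<bullet> \<xi>) *\<^sub>C (kern (z - x) *\<^sub>R K z)"] kern_bounds(1)[of "z - x"]
      by (simp add: norm_scaleC)
    also have "\<dots> \<le> norm (\<psi> x) * (kern (z - x) * B)"
      by (intro mult_left_mono B kern_bounds norm_ge_zero)
    finally show "norm (case (x, z) of (x, z) \<Rightarrow> ?F x z) \<le> (case (x, z) of (x, y) \<Rightarrow> norm (\<psi> x) * B * kern (y - x))"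
      by (simp add: mult_ac)
  qed
  have kK: "integrable lborel (\<lambda>z. kern (z - x) *\<^sub>R K z)" for x
  proof (rule Bochner_Integration.integrable_bound)
    have "integrable lborel (\<lambda>z. kern (z - x))"
      using lborel_integral_translate(2)[of kern "- x"] by (simp add: integrable_kern)
    then show "integrable lborel (\<lambda>z. B * kern (z - x))" by simp
    show "AE z in lborel. norm (kern (z - x) *\<^sub>R K z) \<le> norm (B * kern (z - x))"
      using B order_trans[OF norm_ge_zero B] by (intro AE_I2) (auto simp: abs_mult mult.commute intro!: mult_right_mono)
  qed measurable
  have "(\<integral>x. star (\<psi> x) * (cis (x \<bullet> \<xi>) *\<^sub>C H x) \<partial>lborel) = (\<integral>x. \<integral>z. ?F x z \<partial>lborel \<partial>lborel)"
    unfolding rep using kK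
    by (simp add: integral_bounded_linear[OF scaleC.bounded_linear_right, symmetric]
        integrable_bounded_linear[OF scaleC.bounded_linear_right])
  also have "\<dots> = (\<integral>z. \<integral>x. ?F x z \<partial>lborel \<partial>lborel)"
    by (rule lborel_pair.Fubini_integral[OF Fi, symmetric])
  also have "\<dots> = (\<integral>z. star (wftk \<psi> z \<xi>) * K z \<partial>lborel)"
  proof (rule Bochner_Integration.integral_cong[OF refl])
    fix z
    let ?g = "\<lambda>x. (cis (- (x \<bullet> \<xi>)) * complex_of_real (kern (z - x))) *\<^sub>C \<psi> x"
    have gi: "integrable lborel ?g" by (rule wft_integrable[OF \<psi> kern_complex_measurable kern_cmod_le])
    have "?F x z = star (?g x) * K z" for x
      by (simp add: star_scaleC cis_cnj mult_scaleC_left mult_scaleC_right scaleC_scaleC[symmetric] scaleC_of_real scaleR_scaleC star_scaleR)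
    then have "(\<integral>x. ?F x z \<partial>lborel) = (\<integral>x. star (?g x) \<partial>lborel) * K z"
      using integrable_bounded_linear[OF bounded_linear_star gi] by simp
    also have "(\<integral>x. star (?g x) \<partial>lborel) = star (wftk \<psi> z \<xi>)"
      unfolding wft_def by (rule integral_bounded_linear[OF bounded_linear_star gi])
    finally show "(\<integral>x. ?F x z \<partial>lborel) = star (wftk \<psi> z \<xi>) * K z" .
  qed
  finally show ?thesis unfolding K_def .
qed

text \<open>Induction over the coordinates still to be differentiated. By the product rule,
  \<open>1 - \<partial>\<close> in the coordinate \<open>j\<close> leaves the symbol
  \<open>b - dx j b\<close> with the old window, which costs \<open>2 * B\<close>, and
  \<open>\<i>\<close> times the symbol \<open>b\<close> with a raised exponent, which costs
  \<open>B\<close>; hence the factor 3 per coordinate. The coefficient \<open>m j\<close> of the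
  second term is 1 because exponents of untreated coordinates are 1.\<close>

lemma main_form_bound:
  fixes \<phi> \<psi> :: "real ^ 'n \<Rightarrow> 'a::separable_cstar_algebra" and m :: "'n \<Rightarrow> nat"
  assumes \<phi>: "\<phi> \<in> schwartz" and \<psi>: "\<psi> \<in> schwartz" and "distinct L"
    and "b \<in> CB_infty" "\<And>j. m j \<ge> 1" "\<And>j. j \<in> set L \<Longrightarrow> m j = 1"
    and "\<And>us z. distinct us \<Longrightarrow> set us \<subseteq> set L \<Longrightarrow> norm (iter_partial (map (\<lambda>j. (axis j 1, 0)) us) b z) \<le> B"
  shows "integrable (lborel \<Otimes>\<^sub>M lborel) (\<lambda>z. star (wftk \<psi> (fst z) (snd z)) *
      one_minus_derivs (map (\<lambda>j. axis j 1) L) (\<lambda>x. b (x, snd z) * wft (rat_window m) \<phi> x (snd z)) (fst z)) \<and>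
    norm (\<integral>z. star (wftk \<psi> (fst z) (snd z)) *
      one_minus_derivs (map (\<lambda>j. axis j 1) L) (\<lambda>x. b (x, snd z) * wft (rat_window m) \<phi> x (snd z)) (fst z) \<partial>(lborel \<Otimes>\<^sub>M lborel))
    \<le> 3 ^ length L * (form_const TYPE('n) * B * L2_norm lborel \<psi> * L2_norm lborel \<phi>)"
  using assms(3-7)
proof (induction L arbitrary: b m B rule: rev_induct)
  case Nil
  have B: "norm (b z) \<le> B" for z using Nil.prems(5)[of "[]" z] by simp
  show ?case using form_bound[where m = m and B = B, OF \<phi> \<psi> Nil.prems(3) CB_measurable[OF Nil.prems(2)] B] by simp
next
  case (snoc j L)
  let ?M = "lborel \<Otimes>\<^sub>M lborel :: ((real^'n) \<times> (real^'n)) measure"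
  let ?bs = "map (\<lambda>j. axis j 1) L :: (real ^ 'n) list"
  let ?m' = "m(j := Suc (m j))"
  let ?I = "\<lambda>b m z. star (wftk \<psi> (fst z) (snd z)) * one_minus_derivs ?bs (\<lambda>x. b (x, snd z) * wft (rat_window m) \<phi> x (snd z)) (fst z)"
  let ?R = "form_const TYPE('n) * B * L2_norm lborel \<psi> * L2_norm lborel \<phi>"
  note b = snoc.prems(2)
  have mj: "m j = 1" using snoc.prems(4) by simp
  have bj: "dx j b \<in> CB_infty" by (rule CB_partial_deriv[OF b]) simp
  let ?b1 = "\<lambda>z. b z - dx j b z"
  have b1: "?b1 \<in> CB_infty" by (rule CB_diff[OF b bj])
  have sub: "distinct L" "j \<notin> set L" using snoc.prems(1) by auto
  \<comment> \<open>As \<open>j\<close> is not in \<open>L\<close>, a further derivative in the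
    coordinate \<open>j\<close> still leaves a list of distinct directions.\<close>
  have R1: "norm (iter_partial (map (\<lambda>j. (axis j 1, 0)) us) ?b1 z) \<le> 2 * B" if us: "distinct us" "set us \<subseteq> set L" for us z
  proof -
    have "norm (iter_partial (map (\<lambda>j. (axis j 1, 0)) us) (one_minus_derivs [(axis j 1, 0)] b) z) \<le> 2 ^ length [(axis j (1::real), 0 :: real ^ 'n)] * B"
    proof (rule iter_partial_one_minus_derivs_bound[OF b])
      fix ws :: "((real ^ 'n) \<times> (real ^ 'n)) list" and z
      assume ws: "distinct ws" "set ws \<subseteq> set [(axis j 1, 0)]"
      then have "length ws = card (set ws)" by (simp add: distinct_card)
      also have "\<dots> \<le> 1" using card_mono[OF _ ws(2)] by simp
      finally have "length ws \<le> 1" .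
      then have "ws = [] \<or> ws = [(axis j 1, 0)]" using ws(2) by (cases ws) auto
      then show "norm (iter_partial (map (\<lambda>j. (axis j 1, 0)) us @ ws) b z) \<le> B"
      proof
        assume "ws = []"
        then show ?thesis using snoc.prems(5)[of us z] us by auto
      next
        assume "ws = [(axis j 1, 0)]"
        then show ?thesis using snoc.prems(5)[of "us @ [j]" z] us sub(2) by auto
      qed
    qed auto
    then show ?thesis by simp
  qed
  have R2: "norm (iter_partial (map (\<lambda>j. (axis j 1, 0)) us) b z) \<le> B" if "distinct us" "set us \<subseteq> set L" for us z
    using snoc.prems(5)[of us z] that by auto
  have I1: "integrable ?M (?I ?b1 m)" "norm (\<integral>z. ?I ?b1 m z \<partial>?M) \<le> 3 ^ length L * (form_const TYPE('n) * (2 * B) * L2_norm lborel \<psi> * L2_norm lborel \<phi>)"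
    using snoc.IH[OF sub(1) b1 snoc.prems(3) _ R1] snoc.prems(4) by auto
  have m'1: "1 \<le> ?m' i" for i using snoc.prems(3)[of i] by auto
  have m'2: "?m' i = 1" if "i \<in> set L" for i using that sub(2) snoc.prems(4)[of i] by auto
  have I2: "integrable ?M (?I b ?m')" "norm (\<integral>z. ?I b ?m' z \<partial>?M) \<le> 3 ^ length L * ?R"
    by (rule conjunct1[OF snoc.IH[where m = ?m', OF sub(1) b m'1 m'2 R2]]
        conjunct2[OF snoc.IH[where m = ?m', OF sub(1) b m'1 m'2 R2]]; assumption)+
  have eq: "star (wftk \<psi> (fst z) (snd z)) * one_minus_derivs (map (\<lambda>j. axis j 1) (L @ [j])) (\<lambda>x. b (x, snd z) * wft (rat_window m) \<phi> x (snd z)) (fst z)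
      = ?I ?b1 m z + \<i> *\<^sub>C ?I b ?m' z" for z
  proof -
    let ?\<xi> = "snd z"
    have "(\<lambda>x. b (x, ?\<xi>) * wft (rat_window m) \<phi> x ?\<xi> - partial_deriv (axis j 1) (\<lambda>x. b (x, ?\<xi>) * wft (rat_window m) \<phi> x ?\<xi>) x) =
        (\<lambda>x. ?b1 (x, ?\<xi>) * wft (rat_window m) \<phi> x ?\<xi> + \<i> *\<^sub>C (b (x, ?\<xi>) * wft (rat_window ?m') \<phi> x ?\<xi>))"
      unfolding slice_span_base_derivative(2)[OF b \<phi>] mj by (auto simp: left_diff_distrib scaleC_minus_left)
    then have "one_minus_derivs (map (\<lambda>j. axis j 1) (L @ [j])) (\<lambda>x. b (x, ?\<xi>) * wft (rat_window m) \<phi> x ?\<xi>) =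
        one_minus_derivs ?bs (\<lambda>x. ?b1 (x, ?\<xi>) * wft (rat_window m) \<phi> x ?\<xi> + \<i> *\<^sub>C (b (x, ?\<xi>) * wft (rat_window ?m') \<phi> x ?\<xi>))"
      by (simp add: one_minus_derivs_snoc)
    also have "\<dots> = (\<lambda>x. one_minus_derivs ?bs (\<lambda>x. ?b1 (x, ?\<xi>) * wft (rat_window m) \<phi> x ?\<xi>) x + \<i> *\<^sub>C one_minus_derivs ?bs (\<lambda>x. b (x, ?\<xi>) * wft (rat_window ?m') \<phi> x ?\<xi>) x)"
      by (rule one_minus_derivs_lin[OF slice_span.base[OF b1] slice_span.base[OF b] \<phi>]) auto
    finally show ?thesis by (simp add: distrib_left mult_scaleC_right)
  qed
  have i2: "integrable ?M (\<lambda>z. \<i> *\<^sub>C ?I b ?m' z)"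
    by (rule integrable_bounded_linear[OF scaleC.bounded_linear_right I2(1)])
  have "norm (\<integral>z. ?I ?b1 m z + \<i> *\<^sub>C ?I b ?m' z \<partial>?M) = norm ((\<integral>z. ?I ?b1 m z \<partial>?M) + \<i> *\<^sub>C (\<integral>z. ?I b ?m' z \<partial>?M))"
    using I1(1) i2 integral_bounded_linear[OF scaleC.bounded_linear_right I2(1), of \<i>] by simp
  also have "\<dots> \<le> norm (\<integral>z. ?I ?b1 m z \<partial>?M) + norm (\<integral>z. ?I b ?m' z \<partial>?M)"
    by (rule order_trans[OF norm_triangle_ineq]) (simp add: norm_scaleC)
  also have "\<dots> \<le> 3 ^ length (L @ [j]) * ?R" using I1(2) I2(2) by (simp add: algebra_simps)
  finally show ?case unfolding eq using I1(1) i2 by simp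
qed

text \<open>The square is the normalisation \<open>(2 * pi) powr (- n)\<close> with
  \<open>n = CARD('n)\<close>; \<open>2 ^ n\<close> counts the terms of the operators
  \<open>1 - \<partial>\<close> in \<open>\<xi>\<close>, and \<open>3 ^ n\<close> comes from
  \<open>main_form_bound\<close> in \<open>x\<close>.\<close>

definition pdo_const :: "'n::finite itself \<Rightarrow> real" where
  "pdo_const t = ((2 * pi) powr (- real CARD('n) / 2))\<^sup>2 * (3 ^ CARD('n) * (2 ^ CARD('n) * form_const t))"

lemma pdo_const_nonneg: "pdo_const TYPE('n::finite) \<ge> 0"
  unfolding pdo_const_def by (simp add: form_const_nonneg)

text \<open>After the frequency step the window has exponent 1 in every coordinate, which makes it
  square-integrable. Every derivative of the symbol that occurs is taken at most once in each
  direction, in \<open>x\<close> and in \<open>\<xi>\<close> alike, so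
  \<open>symbol_norm_bound\<close> covers it.\<close>

lemma norm_ip_pdo_le:
  fixes a :: "(real ^ 'n) \<times> (real ^ 'n) \<Rightarrow> 'a::separable_cstar_algebra"
  assumes a: "a \<in> CB_infty" and \<phi>: "\<phi> \<in> schwartz" and \<psi>: "\<psi> \<in> schwartz"
  shows "norm (L2_ip lborel \<psi> (pdo a \<phi>)) \<le> pdo_const TYPE('n) * symbol_norm a * L2_norm lborel \<psi> * L2_norm lborel \<phi>"
proof -
  obtain L where L: "distinct L" "set L = (UNIV :: 'n set)" using finite_distinct_list[of "UNIV :: 'n set"] by auto
  have len: "length L = CARD('n)" using L distinct_card by metis
  define b where "b = one_minus_derivs (map (\<lambda>j. (0, axis j 1)) L) a"
  have bB: "set (map (\<lambda>j. (0 :: real ^ 'n, axis j (1::real))) L) \<subseteq> Basis" by auto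
  have b: "b \<in> CB_infty" unfolding b_def by (rule CB_one_minus_derivs[OF a bB])
  have injx: "inj (\<lambda>j. axis j (1::real) :: real ^ 'n)" by (auto simp: inj_on_def axis_eq_axis)
  define m :: "'n \<Rightarrow> nat" where "m i = 1" for i
  have "(\<lambda>i. 0 + count_list L i) = m"
    using L by (auto simp: m_def fun_eq_iff distinct_count_atmost_1 simp flip: count_mset)
  then have gpe: "wpdo (\<lambda>_. 0) a \<phi> x = wpdo m b \<phi> x" for x
    using wpdo_one_minus_derivs[OF a \<phi>, of "\<lambda>_. 0" x L] by (simp add: b_def)
  let ?bs = "map (\<lambda>j. axis j 1) L :: (real ^ 'n) list"
  have bs: "distinct ?bs" "set ?bs = Basis"
    using L injx by (auto simp: distinct_map Basis_vec_eq intro: inj_on_subset)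
  have bound: "norm (iter_partial (map (\<lambda>j. (axis j 1, 0)) us) b z) \<le> 2 ^ CARD('n) * symbol_norm a"
    if us: "distinct us" for us z
  proof -
    have "norm (iter_partial (map (\<lambda>j. (axis j 1, 0)) us) b z) \<le> 2 ^ length (map (\<lambda>j. (0 :: real ^ 'n, axis j (1::real))) L) * symbol_norm a"
      unfolding b_def
    proof (rule iter_partial_one_minus_derivs_bound[OF a])
      show "distinct (map (\<lambda>j. (0 :: real ^ 'n, axis j (1::real))) L)"
        using L by (auto simp: distinct_map inj_on_def axis_eq_axis)
      fix ws :: "((real ^ 'n) \<times> (real ^ 'n)) list" and z
      assume ws: "distinct ws" "set ws \<subseteq> set (map (\<lambda>j. (0, axis j 1)) L)"
      have "\<exists>ks. ws = map (\<lambda>j. (0, axis j 1)) ks"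
        using ws(2)
      proof (induction ws)
        case (Cons w ws)
        then obtain k ks where "w = (0, axis k 1)" "ws = map (\<lambda>j. (0, axis j 1)) ks" by auto
        then show ?case by (intro exI[of _ "k # ks"]) simp
      qed simp
      then obtain ks where ks: "ws = map (\<lambda>j. (0, axis j 1)) ks" by blast
      then have "distinct ks" using ws(1) by (simp add: distinct_map)
      then show "norm (iter_partial (map (\<lambda>j. (axis j 1, 0)) us @ ws) a z) \<le> symbol_norm a"
        unfolding ks by (rule symbol_norm_bound[OF a us])
    qed auto
    then show ?thesis by (simp add: len)
  qed
  define Hf where "Hf \<xi> = (\<lambda>x. b (x, \<xi>) * wft (rat_window m) \<phi> x \<xi>)" for \<xi>
  let ?M = "lborel \<Otimes>\<^sub>M lborel :: ((real^'n) \<times> (real^'n)) measure"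
  let ?J = "\<lambda>z. star (wftk \<psi> (fst z) (snd z)) * one_minus_derivs ?bs (Hf (snd z)) (fst z)"
  have main: "integrable ?M ?J"
    "norm (\<integral>z. ?J z \<partial>?M) \<le> 3 ^ length L * (form_const TYPE('n) * (2 ^ CARD('n) * symbol_norm a) * L2_norm lborel \<psi> * L2_norm lborel \<phi>)"
    using main_form_bound[OF \<phi> \<psi> L(1) b, of m "2 ^ CARD('n) * symbol_norm a"] bound
    by (auto simp: m_def Hf_def)
  let ?F = "\<lambda>x \<xi>. star (\<psi> x) * (cis (x \<bullet> \<xi>) *\<^sub>C Hf \<xi> x)"
  obtain C where C: "C > 0" "\<And>x \<xi>. norm (cis (x \<bullet> \<xi>) *\<^sub>C (b (x, \<xi>) * wft (rat_window m) \<phi> x \<xi>)) \<le> C * decay \<xi>"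
    using wpdo_integrand_bound[OF b \<phi>] by metis
  have Fi: "integrable ?M (\<lambda>(x, \<xi>). ?F x \<xi>)"
  proof (rule pair_integrable_bound)
    show "integrable ?M (\<lambda>(x, \<xi>). norm (\<psi> x) * (C * decay \<xi>))"
      by (rule pair_integrable_mult) (use schwartz_integrable[OF \<psi>] integrable_decay in auto)
    have [measurable]: "\<psi> \<in> borel_measurable borel" by (rule schwartz_measurable[OF \<psi>])
    have [measurable]: "b \<in> borel_measurable ?M" using CB_measurable[OF b] by (simp add: lborel_prod)
    have [measurable]: "(\<lambda>z. wft (rat_window m) \<phi> (fst z) (snd z)) \<in> borel_measurable ?M"
      using wft_measurable[OF \<phi> rat_window_measurable] by (simp add: borel_prod lborel_prod)
    have [measurable]: "(\<lambda>z. cis (fst z \<bullet> snd z)) \<in> borel_measurable ?M"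
      by (rule measurable_compose[OF _ cis_measurable]) simp
    show "(\<lambda>(x, \<xi>). ?F x \<xi>) \<in> borel_measurable ?M"
      unfolding case_prod_unfold Hf_def prod.collapse by measurable
    fix x \<xi>
    show "norm (case (x, \<xi>) of (x, \<xi>) \<Rightarrow> ?F x \<xi>) \<le> (case (x, \<xi>) of (x, \<xi>) \<Rightarrow> norm (\<psi> x) * (C * decay \<xi>))"
      using norm_mult_ineq[of "star (\<psi> x)" "cis (x \<bullet> \<xi>) *\<^sub>C Hf \<xi> x"] mult_left_mono[OF C(2)[of x \<xi>], of "norm (\<psi> x)"]
      by (simp add: Hf_def)
  qed
  \<comment> \<open>\<open>\<xi>\<close> is made the outer variable since
    \<open>pairing_kern\<close> works at fixed \<open>\<xi>\<close>; afterwards the iterated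
    integral is read as one on the product space, where \<open>main_form_bound\<close>
    applies.\<close>
  have "L2_ip lborel \<psi> (wpdo (\<lambda>_. 0) a \<phi>) = (\<integral>x. \<integral>\<xi>. ?F x \<xi> \<partial>lborel \<partial>lborel)"
    unfolding L2_ip_def gpe unfolding wpdo_def Hf_def using wpdo_integrable[OF b \<phi>] by simp
  also have "\<dots> = (\<integral>\<xi>. \<integral>x. ?F x \<xi> \<partial>lborel \<partial>lborel)"
    by (rule lborel_pair.Fubini_integral[OF Fi, symmetric])
  also have "\<dots> = (\<integral>\<xi>. \<integral>x. star (wftk \<psi> x \<xi>) * one_minus_derivs ?bs (Hf \<xi>) x \<partial>lborel \<partial>lborel)"
    by (intro Bochner_Integration.integral_cong refl pairing_kern[OF \<phi> \<psi> _ bs])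
      (simp add: Hf_def slice_span.base[OF b])
  also have "\<dots> = (\<integral>z. ?J z \<partial>?M)"
    using lborel_pair.integral_snd[of "\<lambda>x \<xi>. ?J (x, \<xi>)"] main(1) by (simp add: case_prod_unfold)
  finally have "norm (L2_ip lborel \<psi> (wpdo (\<lambda>_. 0) a \<phi>)) \<le> 3 ^ CARD('n) * (form_const TYPE('n) * (2 ^ CARD('n) * symbol_norm a) * L2_norm lborel \<psi> * L2_norm lborel \<phi>)"
    using main(2) by (simp add: len)
  moreover have "L2_ip lborel \<psi> (pdo a \<phi>) = (((2 * pi) powr (- real CARD('n) / 2))\<^sup>2) *\<^sub>R L2_ip lborel \<psi> (wpdo (\<lambda>_. 0) a \<phi>)"
    unfolding L2_ip_def pdo_eq_wpdo by simp
  ultimately show ?thesis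
    by (simp add: pdo_const_def mult_left_mono mult_ac)
qed

lemma L2_norm_pdo_le:
  fixes a :: "(real ^ 'n) \<times> (real ^ 'n) \<Rightarrow> 'a::separable_cstar_algebra"
  assumes a: "a \<in> CB_infty" and \<phi>: "\<phi> \<in> schwartz"
  shows "L2_norm lborel (pdo a \<phi>) \<le> pdo_const TYPE('n) * symbol_norm a * L2_norm lborel \<phi>"
proof (cases "L2_norm lborel (pdo a \<phi>) = 0")
  case True
  then show ?thesis by (simp add: pdo_const_nonneg symbol_norm_nonneg[OF a])
next
  case False
  have "L2_norm lborel (pdo a \<phi>) * L2_norm lborel (pdo a \<phi>) \<le> (pdo_const TYPE('n) * symbol_norm a * L2_norm lborel \<phi>) * L2_norm lborel (pdo a \<phi>)"
    using norm_ip_pdo_le[OF a \<phi> pdo_schwartz[OF a \<phi>]] L2_norm_power2[of lborel "pdo a \<phi>"]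
    by (simp add: power2_eq_square mult_ac)
  then show ?thesis using False L2_norm_nonneg[of lborel "pdo a \<phi>"] by (simp add: less_le)
qed

section \<open>Linearity\<close>

lemma wft_add:
  fixes \<phi> \<psi> :: "real ^ 'n \<Rightarrow> 'a::separable_cstar_algebra"
  assumes "\<phi> \<in> schwartz" "\<psi> \<in> schwartz"
  shows "wft (rat_window m) (\<lambda>x. \<phi> x + \<psi> x) x \<xi> = wft (rat_window m) \<phi> x \<xi> + wft (rat_window m) \<psi> x \<xi>"
  unfolding wft_def using wft_integrable[OF assms(1) rat_window_measurable cmod_rat_window_le, of \<xi> m x]
    wft_integrable[OF assms(2) rat_window_measurable cmod_rat_window_le, of \<xi> m x]
  by (simp add: scaleC_add_right)

lemma wft_scaleC:
  fixes \<phi> :: "real ^ 'n \<Rightarrow> 'a::separable_cstar_algebra"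
  assumes "\<phi> \<in> schwartz"
  shows "wft (rat_window m) (\<lambda>x. c *\<^sub>C \<phi> x) x \<xi> = c *\<^sub>C wft (rat_window m) \<phi> x \<xi>"
  unfolding wft_def
  using integral_bounded_linear[OF scaleC.bounded_linear_right wft_integrable[OF assms rat_window_measurable cmod_rat_window_le, of \<xi> m x], of c]
  by (simp add: scaleC_scaleC mult_ac)

lemma pdo_add:
  fixes a :: "(real ^ 'n) \<times> (real ^ 'n) \<Rightarrow> 'a::separable_cstar_algebra"
  assumes a: "a \<in> CB_infty" and \<phi>: "\<phi> \<in> schwartz" and \<psi>: "\<psi> \<in> schwartz"
  shows "pdo a (\<lambda>x. \<phi> x + \<psi> x) = (\<lambda>x. pdo a \<phi> x + pdo a \<psi> x)"
proof
  fix x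
  show "pdo a (\<lambda>x. \<phi> x + \<psi> x) x = pdo a \<phi> x + pdo a \<psi> x"
    unfolding pdo_eq_wpdo wpdo_def wft_add[OF \<phi> \<psi>]
    using wpdo_integrable[OF a \<phi>, of x "\<lambda>_. 0"] wpdo_integrable[OF a \<psi>, of x "\<lambda>_. 0"]
    by (simp add: distrib_left scaleC_add_right scaleR_add_right)
qed

lemma pdo_scaleC:
  fixes a :: "(real ^ 'n) \<times> (real ^ 'n) \<Rightarrow> 'a::separable_cstar_algebra"
  assumes a: "a \<in> CB_infty" and \<phi>: "\<phi> \<in> schwartz"
  shows "pdo a (\<lambda>x. c *\<^sub>C \<phi> x) = (\<lambda>x. c *\<^sub>C pdo a \<phi> x)"
proof
  fix x
  have "cis (x \<bullet> \<xi>) *\<^sub>C (a (x, \<xi>) * (c *\<^sub>C wft (rat_window (\<lambda>_. 0)) \<phi> x \<xi>)) =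
      c *\<^sub>C (cis (x \<bullet> \<xi>) *\<^sub>C (a (x, \<xi>) * wft (rat_window (\<lambda>_. 0)) \<phi> x \<xi>))" for \<xi>
    by (simp add: mult_scaleC_right scaleC_scaleC mult.commute)
  then show "pdo a (\<lambda>x. c *\<^sub>C \<phi> x) x = c *\<^sub>C pdo a \<phi> x"
    unfolding pdo_eq_wpdo wpdo_def wft_scaleC[OF \<phi>]
    using integral_bounded_linear[OF scaleC.bounded_linear_right wpdo_integrable[OF a \<phi>, of x "\<lambda>_. 0"], of c]
    by (simp add: scaleR_scaleC)
qed

lemma pdo_diff:
  fixes a :: "(real ^ 'n) \<times> (real ^ 'n) \<Rightarrow> 'a::separable_cstar_algebra"
  assumes a: "a \<in> CB_infty" and \<phi>: "\<phi> \<in> schwartz" and \<psi>: "\<psi> \<in> schwartz"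
  shows "pdo a (\<lambda>x. \<phi> x - \<psi> x) = (\<lambda>x. pdo a \<phi> x - pdo a \<psi> x)"
  using pdo_add[OF a \<phi> schwartz_scaleC[OF \<psi>, of "- 1"]] pdo_scaleC[OF a \<psi>, of "- 1"]
  by (simp add: scaleC_minus_left)

section \<open>The completion\<close>

lemma norm2_triangle: "f \<in> schwartz \<Longrightarrow> g \<in> schwartz \<Longrightarrow> norm2 (\<lambda>x. f x + g x) \<le> norm2 f + norm2 g"
  unfolding norm2_eq by (rule L2_norm_triangle[OF schwartz_L2 schwartz_L2])

lemma norm2_nonneg: "norm2 f \<ge> 0"
  by (simp add: norm2_eq)

lemma norm2_minus_commute: "norm2 (\<lambda>x. f x - g x) = norm2 (\<lambda>x. g x - f x)"
  unfolding norm2_eq by (rule L2_norm_minus_commute)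

lemma norm2_triangle3:
  assumes "f \<in> schwartz" "g \<in> schwartz" "h \<in> schwartz"
  shows "norm2 (\<lambda>x. f x - h x) \<le> norm2 (\<lambda>x. f x - g x) + norm2 (\<lambda>x. g x - h x)"
  using norm2_triangle[OF schwartz_diff[OF assms(1,2)] schwartz_diff[OF assms(2,3)]] by simp

lemma norm2_diff_le:
  assumes "f \<in> schwartz" "g \<in> schwartz"
  shows "\<bar>norm2 f - norm2 g\<bar> \<le> norm2 (\<lambda>x. f x - g x)"
  using norm2_triangle[OF schwartz_diff[OF assms] assms(2)]
    norm2_triangle[OF schwartz_diff[OF assms(2,1)] assms(1)] norm2_minus_commute[of f g] by simp

lemma cauchy_seqsD: "X \<in> cauchy_seqs \<Longrightarrow> X k \<in> schwartz"
  by (simp add: cauchy_seqs_def)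

lemma cauchy_seqs_add:
  assumes X: "X \<in> cauchy_seqs" and Y: "Y \<in> cauchy_seqs"
  shows "(\<lambda>k x. X k x + Y k x) \<in> cauchy_seqs"
proof -
  have "\<exists>N. \<forall>j\<ge>N. \<forall>k\<ge>N. norm2 (\<lambda>x. (X j x + Y j x) - (X k x + Y k x)) < e" if e: "e > 0" for e
  proof -
    obtain N1 where N1: "\<And>j k. j \<ge> N1 \<Longrightarrow> k \<ge> N1 \<Longrightarrow> norm2 (\<lambda>x. X j x - X k x) < e / 2"
      using X e unfolding cauchy_seqs_def by (fastforce dest: spec[of _ "e / 2"])
    obtain N2 where N2: "\<And>j k. j \<ge> N2 \<Longrightarrow> k \<ge> N2 \<Longrightarrow> norm2 (\<lambda>x. Y j x - Y k x) < e / 2"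
      using Y e unfolding cauchy_seqs_def by (fastforce dest: spec[of _ "e / 2"])
    have "norm2 (\<lambda>x. (X j x + Y j x) - (X k x + Y k x)) < e" if "j \<ge> max N1 N2" "k \<ge> max N1 N2" for j k
    proof -
      have "(\<lambda>x. (X j x + Y j x) - (X k x + Y k x)) = (\<lambda>x. (X j x - X k x) + (Y j x - Y k x))" by (simp add: algebra_simps)
      then have "norm2 (\<lambda>x. (X j x + Y j x) - (X k x + Y k x)) \<le> norm2 (\<lambda>x. X j x - X k x) + norm2 (\<lambda>x. Y j x - Y k x)"
        using norm2_triangle[OF schwartz_diff schwartz_diff, OF cauchy_seqsD[OF X] cauchy_seqsD[OF X] cauchy_seqsD[OF Y] cauchy_seqsD[OF Y]] by simp
      also have "\<dots> < e" using N1[of j k] N2[of j k] that by simp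
      finally show ?thesis .
    qed
    then show ?thesis by blast
  qed
  then show ?thesis using X Y unfolding cauchy_seqs_def by (auto intro: schwartz_add)
qed

text \<open>Lipschitz maps of Schwartz functions pass to the completion. A general \<open>P\<close>
  is allowed since this serves both scalar multiples and the operator itself.\<close>

lemma cauchy_seqs_image:
  assumes S: "\<And>\<phi>. \<phi> \<in> schwartz \<Longrightarrow> P \<phi> \<in> schwartz"
    and d: "\<And>\<phi> \<psi>. \<phi> \<in> schwartz \<Longrightarrow> \<psi> \<in> schwartz \<Longrightarrow> norm2 (\<lambda>x. P \<phi> x - P \<psi> x) \<le> C * norm2 (\<lambda>x. \<phi> x - \<psi> x)"
  shows "X \<in> cauchy_seqs \<Longrightarrow> (\<lambda>k. P (X k)) \<in> cauchy_seqs"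
    and "(X, Y) \<in> null_rel \<Longrightarrow> ((\<lambda>k. P (X k)), (\<lambda>k. P (Y k))) \<in> null_rel"
proof -
  show C: "(\<lambda>k. P (X k)) \<in> cauchy_seqs" if X: "X \<in> cauchy_seqs" for X
  proof -
    have "\<exists>N. \<forall>j\<ge>N. \<forall>k\<ge>N. norm2 (\<lambda>x. P (X j) x - P (X k) x) < e" if e: "e > 0" for e
    proof -
      \<comment> \<open>The denominator is positive whatever the sign of \<open>C\<close>.\<close>
      have "e / (\<bar>C\<bar> + 1) > 0" using e by (simp add: add_nonneg_pos)
      then obtain N where N: "\<And>j k. j \<ge> N \<Longrightarrow> k \<ge> N \<Longrightarrow> norm2 (\<lambda>x. X j x - X k x) < e / (\<bar>C\<bar> + 1)"
        using X unfolding cauchy_seqs_def by blast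
      have "norm2 (\<lambda>x. P (X j) x - P (X k) x) < e" if "j \<ge> N" "k \<ge> N" for j k
      proof -
        have "norm2 (\<lambda>x. P (X j) x - P (X k) x) \<le> C * norm2 (\<lambda>x. X j x - X k x)"
          by (rule d[OF cauchy_seqsD[OF X] cauchy_seqsD[OF X]])
        also have "\<dots> \<le> (\<bar>C\<bar> + 1) * norm2 (\<lambda>x. X j x - X k x)"
          by (intro mult_right_mono norm2_nonneg) simp
        also have "\<dots> < e" using N[OF that] by (simp add: pos_less_divide_eq add_nonneg_pos mult.commute)
        finally show ?thesis .
      qed
      then show ?thesis by blast
    qed
    then show ?thesis using X S unfolding cauchy_seqs_def by auto
  qed
  show "((\<lambda>k. P (X k)), (\<lambda>k. P (Y k))) \<in> null_rel" if "(X, Y) \<in> null_rel"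
  proof -
    have X: "X \<in> cauchy_seqs" and Y: "Y \<in> cauchy_seqs" and l: "(\<lambda>k. norm2 (\<lambda>x. X k x - Y k x)) \<longlonglongrightarrow> 0"
      using that by (auto simp: null_rel_def)
    have "(\<lambda>k. norm2 (\<lambda>x. P (X k) x - P (Y k) x)) \<longlonglongrightarrow> 0"
    proof (rule tendsto_sandwich[OF _ _ tendsto_const tendsto_mult_right_zero[OF l, of C]])
      show "\<forall>\<^sub>F k in sequentially. norm2 (\<lambda>x. P (X k) x - P (Y k) x) \<le> C * norm2 (\<lambda>x. X k x - Y k x)"
        using d[OF cauchy_seqsD[OF X] cauchy_seqsD[OF Y]] by simp
    qed (simp add: norm2_nonneg)
    then show ?thesis using C[OF X] C[OF Y] by (simp add: null_rel_def)
  qed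
qed

lemma equiv_null_rel: "equiv (cauchy_seqs :: (nat \<Rightarrow> real ^ 'n \<Rightarrow> 'a::separable_cstar_algebra) set) null_rel" (is "equiv _ ?r")
proof (rule equivI)
  show "?r \<subseteq> cauchy_seqs \<times> cauchy_seqs" by (auto simp: null_rel_def)
  show "refl_on cauchy_seqs ?r" by (auto simp: refl_on_def null_rel_def norm2_eq)
  show "sym ?r"
  proof (rule symI)
    fix X Y :: "nat \<Rightarrow> real ^ 'n \<Rightarrow> 'a"
    assume "(X, Y) \<in> null_rel"
    moreover have "norm2 (\<lambda>x. Y k x - X k x) = norm2 (\<lambda>x. X k x - Y k x)" for k
      by (rule norm2_minus_commute)
    ultimately show "(Y, X) \<in> null_rel" by (simp add: null_rel_def)
  qed
  show "trans ?r"
  proof (rule transI)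
    fix X Y Z :: "nat \<Rightarrow> real ^ 'n \<Rightarrow> 'a"
    assume XY: "(X, Y) \<in> null_rel" and YZ: "(Y, Z) \<in> null_rel"
    have c: "X \<in> cauchy_seqs" "Y \<in> cauchy_seqs" "Z \<in> cauchy_seqs" using XY YZ by (auto simp: null_rel_def)
    have l: "(\<lambda>k. norm2 (\<lambda>x. X k x - Y k x) + norm2 (\<lambda>x. Y k x - Z k x)) \<longlonglongrightarrow> 0"
      using tendsto_add[of "\<lambda>k. norm2 (\<lambda>x. X k x - Y k x)" 0 sequentially "\<lambda>k. norm2 (\<lambda>x. Y k x - Z k x)" 0] XY YZ
      by (auto simp: null_rel_def)
    have "(\<lambda>k. norm2 (\<lambda>x. X k x - Z k x)) \<longlonglongrightarrow> 0"
    proof (rule tendsto_sandwich[OF _ _ tendsto_const l])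
      show "\<forall>\<^sub>F k in sequentially. norm2 (\<lambda>x. X k x - Z k x) \<le> norm2 (\<lambda>x. X k x - Y k x) + norm2 (\<lambda>x. Y k x - Z k x)"
        using norm2_triangle3[OF cauchy_seqsD[OF c(1)] cauchy_seqsD[OF c(2)] cauchy_seqsD[OF c(3)]] by simp
    qed (simp add: norm2_nonneg)
    then show "(X, Z) \<in> null_rel" using c by (simp add: null_rel_def)
  qed
qed

lemma null_rel_add:
  assumes "(X, X') \<in> null_rel" "(Y, Y') \<in> null_rel"
  shows "((\<lambda>k x. X k x + Y k x), (\<lambda>k x. X' k x + Y' k x)) \<in> null_rel"
proof -
  have c: "X \<in> cauchy_seqs" "X' \<in> cauchy_seqs" "Y \<in> cauchy_seqs" "Y' \<in> cauchy_seqs"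
    using assms by (auto simp: null_rel_def)
  have l: "(\<lambda>k. norm2 (\<lambda>x. X k x - X' k x) + norm2 (\<lambda>x. Y k x - Y' k x)) \<longlonglongrightarrow> 0"
    using tendsto_add[of "\<lambda>k. norm2 (\<lambda>x. X k x - X' k x)" 0 sequentially "\<lambda>k. norm2 (\<lambda>x. Y k x - Y' k x)" 0] assms
    by (auto simp: null_rel_def)
  have "(\<lambda>k. norm2 (\<lambda>x. (X k x + Y k x) - (X' k x + Y' k x))) \<longlonglongrightarrow> 0"
  proof (rule tendsto_sandwich[OF _ _ tendsto_const l])
    have "(\<lambda>x. (X k x + Y k x) - (X' k x + Y' k x)) = (\<lambda>x. (X k x - X' k x) + (Y k x - Y' k x))" for k
      by (simp add: algebra_simps)
    then show "\<forall>\<^sub>F k in sequentially. norm2 (\<lambda>x. (X k x + Y k x) - (X' k x + Y' k x)) \<le> norm2 (\<lambda>x. X k x - X' k x) + norm2 (\<lambda>x. Y k x - Y' k x)"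
      using norm2_triangle[OF schwartz_diff schwartz_diff, OF cauchy_seqsD[OF c(1)] cauchy_seqsD[OF c(2)] cauchy_seqsD[OF c(3)] cauchy_seqsD[OF c(4)]]
      by simp
  qed (simp add: norm2_nonneg)
  then show ?thesis using c by (simp add: null_rel_def cauchy_seqs_add)
qed

abbreviation seq_cls :: "(nat \<Rightarrow> real ^ 'n \<Rightarrow> 'a) \<Rightarrow> ('a::separable_cstar_algebra, 'n::finite) seq_class" where
  "seq_cls X \<equiv> null_rel `` {X}"

lemma seq_cls_eq: "(X, Y) \<in> null_rel \<Longrightarrow> seq_cls X = seq_cls Y"
  by (rule equiv_class_eq[OF equiv_null_rel])

lemma E_space_seq_cls: "X \<in> cauchy_seqs \<Longrightarrow> seq_cls X \<in> E_space"
  unfolding E_space_def by (rule quotientI)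

lemma E_space_obtain:
  assumes "u \<in> E_space" obtains X where "X \<in> cauchy_seqs" "u = seq_cls X"
  using assms unfolding E_space_def by (rule quotientE) blast

lemma E_add_seq_cls:
  assumes "X \<in> cauchy_seqs" "Y \<in> cauchy_seqs"
  shows "E_add (seq_cls X) (seq_cls Y) = seq_cls (\<lambda>k x. X k x + Y k x)"
  unfolding E_add_def
  by (rule UN_equiv_class2[OF equiv_null_rel equiv_null_rel _ assms])
    (intro congruent2I' seq_cls_eq null_rel_add)

lemma norm2_scaleC: "norm2 (\<lambda>x. c *\<^sub>C f x) = cmod c * norm2 f"
  unfolding norm2_eq by (rule L2_norm_scaleC)

lemma scaleC_lipschitz: "norm2 (\<lambda>x. c *\<^sub>C \<phi> x - c *\<^sub>C \<psi> x) \<le> cmod c * norm2 (\<lambda>x. \<phi> x - \<psi> x)"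
  by (simp add: scaleC_diff_right[symmetric] norm2_scaleC)

lemma E_scale_seq_cls:
  assumes "X \<in> cauchy_seqs"
  shows "E_scale c (seq_cls X) = seq_cls (\<lambda>k x. c *\<^sub>C X k x)"
  unfolding E_scale_def
proof (rule UN_equiv_class[OF equiv_null_rel _ assms])
  show "(\<lambda>X. seq_cls (\<lambda>k x. c *\<^sub>C X k x)) respects null_rel"
    by (rule congruentI) (rule seq_cls_eq, rule cauchy_seqs_image(2)[OF schwartz_scaleC scaleC_lipschitz])
qed

lemma norm2_convergent:
  assumes X: "X \<in> cauchy_seqs" shows "convergent (\<lambda>k. norm2 (X k))"
proof (rule Cauchy_convergent, rule metric_CauchyI)
  fix e :: real assume "e > 0"
  then obtain N where N: "\<And>j k. j \<ge> N \<Longrightarrow> k \<ge> N \<Longrightarrow> norm2 (\<lambda>x. X j x - X k x) < e"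
    using X unfolding cauchy_seqs_def by blast
  have "dist (norm2 (X j)) (norm2 (X k)) < e" if "j \<ge> N" "k \<ge> N" for j k
    using norm2_diff_le[OF cauchy_seqsD[OF X, of j] cauchy_seqsD[OF X, of k]] N[OF that] by (simp add: dist_real_def)
  then show "\<exists>N. \<forall>j\<ge>N. \<forall>k\<ge>N. dist (norm2 (X j)) (norm2 (X k)) < e" by blast
qed

text \<open>\<open>E_norm\<close> is a definite description over all representatives, so it is
  meaningful only once the limit is known to exist and to be shared by the whole class.\<close>

lemma E_norm_seq_cls:
  assumes X: "X \<in> cauchy_seqs" shows "(\<lambda>k. norm2 (X k)) \<longlonglongrightarrow> E_norm (seq_cls X)"
proof -
  obtain r where r: "(\<lambda>k. norm2 (X k)) \<longlonglongrightarrow> r" using norm2_convergent[OF X] convergent_def by blast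
  have all: "(\<lambda>k. norm2 (Y k)) \<longlonglongrightarrow> r" if "Y \<in> seq_cls X" for Y
  proof -
    have Y: "Y \<in> cauchy_seqs" and l: "(\<lambda>k. norm2 (\<lambda>x. X k x - Y k x)) \<longlonglongrightarrow> 0" using that by (auto simp: null_rel_def)
    have "(\<lambda>k. norm2 (X k) - norm2 (Y k)) \<longlonglongrightarrow> 0"
    proof (rule Lim_null_comparison[OF _ l])
      show "\<forall>\<^sub>F k in sequentially. norm (norm2 (X k) - norm2 (Y k)) \<le> norm2 (\<lambda>x. X k x - Y k x)"
        using norm2_diff_le[OF cauchy_seqsD[OF X] cauchy_seqsD[OF Y]] by simp
    qed
    from tendsto_diff[OF r this] show ?thesis by simp
  qed
  have self: "X \<in> seq_cls X" using X by (rule equiv_class_self[OF equiv_null_rel])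
  have "E_norm (seq_cls X) = r"
    unfolding E_norm_def
  proof (rule the_equality)
    show "\<forall>Y\<in>seq_cls X. (\<lambda>k. norm2 (Y k)) \<longlonglongrightarrow> r" using all by blast
    fix s assume "\<forall>Y\<in>seq_cls X. (\<lambda>k. norm2 (Y k)) \<longlonglongrightarrow> s"
    then show "s = r" using self r LIMSEQ_unique by blast
  qed
  then show ?thesis using r by simp
qed

lemma cauchy_seqs_const: "\<phi> \<in> schwartz \<Longrightarrow> (\<lambda>k. \<phi>) \<in> cauchy_seqs"
  by (auto simp: cauchy_seqs_def norm2_eq)

text \<open>The norm of the inner product is at most the integral of the pointwise norms. The
  extended-real form matches the convergence used in \<open>E_of_fun\<close>.\<close>

lemma norm2_power2_le:
  assumes f: "L2 lborel f"
  shows "ennreal ((norm2 f)\<^sup>2) \<le> (\<integral>\<^sup>+x. ennreal ((norm (f x))\<^sup>2) \<partial>lborel)"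
proof -
  have "(norm2 f)\<^sup>2 = norm (L2_ip lborel f f)" by (simp add: norm2_eq L2_norm_power2)
  also have "\<dots> \<le> (\<integral>x. (norm (f x))\<^sup>2 \<partial>lborel)"
    unfolding L2_ip_def by (rule order_trans[OF integral_norm_bound]) (simp add: cstar_identity)
  finally show ?thesis
    using f by (subst nn_integral_eq_integral) (auto simp: L2_def intro!: ennreal_leI)
qed

text \<open>The constant sequence is among the approximating sequences, and any other one is Cauchy
  and equivalent to it because \<open>norm2\<close> is dominated by the norm in which they
  converge.\<close>

lemma E_of_fun_schwartz:
  fixes g :: "real ^ 'n \<Rightarrow> 'a::separable_cstar_algebra"
  assumes g: "g \<in> schwartz"
  shows "E_of_fun g = seq_cls (\<lambda>k. g)"
proof -
  let ?Z = "{Y. square_integrable g \<and> (\<forall>k. Y k \<in> schwartz) \<and>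
     (\<lambda>k. \<integral>\<^sup>+ x. ennreal ((norm (Y k x - g x))\<^sup>2) \<partial>lborel) \<longlonglongrightarrow> 0}"
  have sq: "square_integrable g" using schwartz_L2[OF g] by (simp add: square_integrable_def L2_def)
  have in_Z: "(\<lambda>k. g) \<in> ?Z" using sq g by simp
  have rel: "(Y, \<lambda>k. g) \<in> null_rel" if "Y \<in> ?Z" for Y
  proof -
    have Y: "\<And>k. Y k \<in> schwartz" and l: "(\<lambda>k. \<integral>\<^sup>+ x. ennreal ((norm (Y k x - g x))\<^sup>2) \<partial>lborel) \<longlonglongrightarrow> 0"
      using that by auto
    have "(\<lambda>k. ennreal ((norm2 (\<lambda>x. Y k x - g x))\<^sup>2)) \<longlonglongrightarrow> 0"
    proof (rule tendsto_sandwich[OF _ _ tendsto_const l])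
      show "\<forall>\<^sub>F k in sequentially. ennreal ((norm2 (\<lambda>x. Y k x - g x))\<^sup>2) \<le> (\<integral>\<^sup>+ x. ennreal ((norm (Y k x - g x))\<^sup>2) \<partial>lborel)"
        using norm2_power2_le[OF schwartz_L2[OF schwartz_diff[OF Y g]]] by simp
    qed simp
    then have "(\<lambda>k. (norm2 (\<lambda>x. Y k x - g x))\<^sup>2) \<longlonglongrightarrow> 0"
      using tendsto_ennrealD[of "\<lambda>k. (norm2 (\<lambda>x. Y k x - g x))\<^sup>2" 0 sequentially] by (simp add: ennreal_0)
    then have "(\<lambda>k. sqrt ((norm2 (\<lambda>x. Y k x - g x))\<^sup>2)) \<longlonglongrightarrow> sqrt 0" by (rule tendsto_real_sqrt)
    then have l2: "(\<lambda>k. norm2 (\<lambda>x. Y k x - g x)) \<longlonglongrightarrow> 0" by (simp add: norm2_nonneg)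
    have "\<exists>N. \<forall>j\<ge>N. \<forall>k\<ge>N. norm2 (\<lambda>x. Y j x - Y k x) < e" if e: "e > 0" for e
    proof -
      have "\<forall>\<^sub>F k in sequentially. norm2 (\<lambda>x. Y k x - g x) < e / 2" using order_tendstoD(2)[OF l2, of "e / 2"] e by simp
      then obtain N where N: "\<And>k. k \<ge> N \<Longrightarrow> norm2 (\<lambda>x. Y k x - g x) < e / 2" by (auto simp: eventually_sequentially)
      have "norm2 (\<lambda>x. Y j x - Y k x) < e" if "j \<ge> N" "k \<ge> N" for j k
        using norm2_triangle3[OF Y[of j] g Y[of k]] N[OF that(1)] N[OF that(2)] norm2_minus_commute[of g "Y k"] by simp
      then show ?thesis by blast
    qed
    then have "Y \<in> cauchy_seqs" using Y by (simp add: cauchy_seqs_def)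
    then show ?thesis using l2 cauchy_seqs_const[OF g] by (simp add: null_rel_def)
  qed
  have "null_rel `` ?Z = seq_cls (\<lambda>k. g)"
  proof
    show "null_rel `` ?Z \<subseteq> seq_cls (\<lambda>k. g)"
    proof
      fix W assume "W \<in> null_rel `` ?Z"
      then obtain Y where Y: "Y \<in> ?Z" "(Y, W) \<in> null_rel" by blast
      then show "W \<in> seq_cls (\<lambda>k. g)" using seq_cls_eq[OF rel[OF Y(1)]] by blast
    qed
    show "seq_cls (\<lambda>k. g) \<subseteq> null_rel `` ?Z" using in_Z by blast
  qed
  then show ?thesis by (simp add: E_of_fun_def)
qed

section \<open>Extension of the operator to the completion\<close>

definition pdo_ext :: "((real ^ 'n) \<times> (real ^ 'n) \<Rightarrow> 'a) \<Rightarrow> ('a::separable_cstar_algebra, 'n::finite) seq_class \<Rightarrow> ('a, 'n) seq_class" where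
  "pdo_ext a u = (\<Union>X\<in>u. seq_cls (\<lambda>k. pdo a (X k)))"

lemma norm2_pdo_le:
  fixes a :: "(real ^ 'n) \<times> (real ^ 'n) \<Rightarrow> 'a::separable_cstar_algebra"
  assumes "a \<in> CB_infty" "\<phi> \<in> schwartz"
  shows "norm2 (pdo a \<phi>) \<le> pdo_const TYPE('n) * symbol_norm a * norm2 \<phi>"
  unfolding norm2_eq by (rule L2_norm_pdo_le[OF assms])

lemma pdo_lipschitz:
  fixes a :: "(real ^ 'n) \<times> (real ^ 'n) \<Rightarrow> 'a::separable_cstar_algebra"
  assumes a: "a \<in> CB_infty" and "\<phi> \<in> schwartz" "\<psi> \<in> schwartz"
  shows "norm2 (\<lambda>x. pdo a \<phi> x - pdo a \<psi> x) \<le> (pdo_const TYPE('n) * symbol_norm a) * norm2 (\<lambda>x. \<phi> x - \<psi> x)"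
  using norm2_pdo_le[OF a schwartz_diff[OF assms(2,3)]] by (simp add: pdo_diff[OF assms])

lemma pdo_cauchy_seqs:
  assumes a: "a \<in> CB_infty" and X: "X \<in> cauchy_seqs"
  shows "(\<lambda>k. pdo a (X k)) \<in> cauchy_seqs"
  by (rule cauchy_seqs_image(1)[OF pdo_schwartz[OF a] pdo_lipschitz[OF a]]) (assumption+, rule X)

lemma pdo_ext_seq_cls:
  assumes a: "a \<in> CB_infty" and X: "X \<in> cauchy_seqs"
  shows "pdo_ext a (seq_cls X) = seq_cls (\<lambda>k. pdo a (X k))"
  unfolding pdo_ext_def
proof (rule UN_equiv_class[OF equiv_null_rel _ X])
  show "(\<lambda>X. seq_cls (\<lambda>k. pdo a (X k))) respects null_rel"
    by (rule congruentI) (rule seq_cls_eq, rule cauchy_seqs_image(2)[OF pdo_schwartz[OF a] pdo_lipschitz[OF a]])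
qed

lemma E_norm_pdo_ext_le:
  fixes a :: "(real ^ 'n) \<times> (real ^ 'n) \<Rightarrow> 'a::separable_cstar_algebra"
  assumes a: "a \<in> CB_infty" and u: "u \<in> E_space"
  shows "E_norm (pdo_ext a u) \<le> pdo_const TYPE('n) * symbol_norm a * E_norm u"
proof -
  obtain X where X: "X \<in> cauchy_seqs" "u = seq_cls X" using E_space_obtain[OF u] by blast
  have P: "(\<lambda>k. pdo a (X k)) \<in> cauchy_seqs"
    by (rule pdo_cauchy_seqs[OF a X(1)])
  show ?thesis unfolding X(2) pdo_ext_seq_cls[OF a X(1)]
  proof (rule LIMSEQ_le[OF E_norm_seq_cls[OF P] tendsto_mult_left[OF E_norm_seq_cls[OF X(1)]]])
    show "\<exists>N. \<forall>n\<ge>N. norm2 (pdo a (X n)) \<le> pdo_const TYPE('n) * symbol_norm a * norm2 (X n)"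
      using norm2_pdo_le[OF a cauchy_seqsD[OF X(1)]] by blast
  qed
qed

lemma E_bounded_op_pdo_ext:
  fixes a :: "(real ^ 'n) \<times> (real ^ 'n) \<Rightarrow> 'a::separable_cstar_algebra"
  assumes a: "a \<in> CB_infty"
  shows "E_bounded_op (pdo_ext a)"
proof -
  note img = pdo_cauchy_seqs[OF a]
  have 1: "pdo_ext a u \<in> E_space" if "u \<in> E_space" for u
  proof -
    obtain X where X: "X \<in> cauchy_seqs" "u = seq_cls X" using E_space_obtain[OF \<open>u \<in> E_space\<close>] by blast
    show ?thesis unfolding X(2) pdo_ext_seq_cls[OF a X(1)] by (rule E_space_seq_cls[OF img[OF X(1)]])
  qed
  have 2: "pdo_ext a (E_add u v) = E_add (pdo_ext a u) (pdo_ext a v)" if uv: "u \<in> E_space" "v \<in> E_space" for u v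
  proof -
    obtain X where X: "X \<in> cauchy_seqs" "u = seq_cls X" using E_space_obtain[OF uv(1)] by blast
    obtain Y where Y: "Y \<in> cauchy_seqs" "v = seq_cls Y" using E_space_obtain[OF uv(2)] by blast
    show ?thesis
      unfolding X(2) Y(2) E_add_seq_cls[OF X(1) Y(1)] pdo_ext_seq_cls[OF a X(1)] pdo_ext_seq_cls[OF a Y(1)]
        pdo_ext_seq_cls[OF a cauchy_seqs_add[OF X(1) Y(1)]] E_add_seq_cls[OF img[OF X(1)] img[OF Y(1)]]
        pdo_add[OF a cauchy_seqsD[OF X(1)] cauchy_seqsD[OF Y(1)]] ..
  qed
  have 3: "pdo_ext a (E_scale c u) = E_scale c (pdo_ext a u)" if u: "u \<in> E_space" for c u
  proof -
    obtain X where X: "X \<in> cauchy_seqs" "u = seq_cls X" using E_space_obtain[OF u] by blast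
    have cX: "(\<lambda>k x. c *\<^sub>C X k x) \<in> cauchy_seqs"
      by (rule cauchy_seqs_image(1)[OF schwartz_scaleC scaleC_lipschitz X(1)])
    show ?thesis
      unfolding X(2) E_scale_seq_cls[OF X(1)] pdo_ext_seq_cls[OF a X(1)] pdo_ext_seq_cls[OF a cX] E_scale_seq_cls[OF img[OF X(1)]]
        pdo_scaleC[OF a cauchy_seqsD[OF X(1)]] ..
  qed
  show ?thesis unfolding E_bounded_op_def using 1 2 3 E_norm_pdo_ext_le[OF a] by blast
qed

lemma E_opnorm_pdo_ext_le:
  fixes a :: "(real ^ 'n) \<times> (real ^ 'n) \<Rightarrow> 'a::separable_cstar_algebra"
  assumes a: "a \<in> CB_infty"
  shows "E_opnorm (pdo_ext a) \<le> pdo_const TYPE('n) * symbol_norm a"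
  unfolding E_opnorm_def
proof (rule cSup_least)
  \<comment> \<open>The zero class makes the set under the supremum nonempty, as
    \<open>cSup_least\<close> requires.\<close>
  have z: "(\<lambda>k x. 0) \<in> (cauchy_seqs :: (nat \<Rightarrow> real ^ 'n \<Rightarrow> 'a) set)"
    using cauchy_seqs_const[OF schwartz_zero] .
  have "E_norm (seq_cls (\<lambda>k x. 0 :: 'a) :: ('a, 'n) seq_class) = 0"
    using E_norm_seq_cls[OF z] by (simp add: norm2_eq LIMSEQ_const_iff)
  then show "{E_norm (pdo_ext a u) |u. u \<in> E_space \<and> E_norm u \<le> 1} \<noteq> {}"
    using E_space_seq_cls[OF z] by fastforce
  fix r assume "r \<in> {E_norm (pdo_ext a u) |u. u \<in> E_space \<and> E_norm u \<le> 1}"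
  then obtain u where u: "u \<in> E_space" "E_norm u \<le> 1" "r = E_norm (pdo_ext a u)" by blast
  have "r \<le> pdo_const TYPE('n) * symbol_norm a * E_norm u" unfolding u(3) by (rule E_norm_pdo_ext_le[OF a u(1)])
  also have "\<dots> \<le> pdo_const TYPE('n) * symbol_norm a * 1"
    using u(2) by (intro mult_left_mono mult_nonneg_nonneg pdo_const_nonneg symbol_norm_nonneg a)
  finally show "r \<le> pdo_const TYPE('n) * symbol_norm a" by simp
qed

theorem theorem2p1:
  shows "\<exists>l>0. \<forall>a \<in> (CB_infty :: ((real ^ 'n) \<times> (real ^ 'n) \<Rightarrow> 'a::separable_cstar_algebra) set).
    \<exists>T. E_bounded_op T \<and>
        (\<forall>\<phi>\<in>schwartz. T (E_embed \<phi>) = E_of_fun (pdo a \<phi>)) \<and>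
        E_opnorm T \<le> l * symbol_norm a"
\<comment> \<open>Adding 1 secures strict positivity of the constant, since
  \<open>pdo_const_nonneg\<close> only gives \<open>\<ge> 0\<close>.\<close>
proof (intro exI[of _ "pdo_const TYPE('n) + 1"] conjI ballI)
  show "pdo_const TYPE('n) + 1 > 0" using pdo_const_nonneg[where 'n = 'n] by linarith
  fix a :: "(real ^ 'n) \<times> (real ^ 'n) \<Rightarrow> 'a" assume a: "a \<in> CB_infty"
  have "pdo_ext a (E_embed \<phi>) = E_of_fun (pdo a \<phi>)" if \<phi>: "\<phi> \<in> schwartz" for \<phi>
    unfolding E_embed_def pdo_ext_seq_cls[OF a cauchy_seqs_const[OF \<phi>]]
    by (rule E_of_fun_schwartz[OF pdo_schwartz[OF a \<phi>], symmetric])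
  moreover have "E_opnorm (pdo_ext a) \<le> (pdo_const TYPE('n) + 1) * symbol_norm a"
    using E_opnorm_pdo_ext_le[OF a] symbol_norm_nonneg[OF a] by (simp add: distrib_right)
  ultimately show "\<exists>T. E_bounded_op T \<and> (\<forall>\<phi>\<in>schwartz. T (E_embed \<phi>) = E_of_fun (pdo a \<phi>)) \<and>
      E_opnorm T \<le> (pdo_const TYPE('n) + 1) * symbol_norm a"
    using E_bounded_op_pdo_ext[OF a] by blast
qed

end
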